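(* For each $n\ge 1$ let $p=p_n$ and $q=q_n$ be integers with $1\le q\le p\le n$, let $Z_n$ be the $p\times q$ upper-left submatrix of an $n\times n$ Haar-distributed random orthogonal matrix, and let $G_n$ be a $p\times q$ random matrix whose $pq$ entries are independent standard normal random variables. Let $\mathcal{L}(\sqrt n Z_n)$ and $\mathcal{L}(G_n)$ denote the joint distributions of the entries, as probability measures on $\mathbb{R}^{pq}$, and let $I(\cdot|\cdot)$ be the Fisher information. Then: (i) if $pq=o(n)$ as $n\to\infty$, then $I(\mathcal{L}(\sqrt n Z_n)|\mathcal{L}(G_n))\to 0$ as $n\to\infty$; (ii) if there exist constants $0<c_1<c_2$ such that $c_1 n<p_nq_n<c_2 n$ for all $n$, then $I(\mathcal{L}(\sqrt n Z_n)|\mathcal{L}(G_n))$ does not tend to $0$ as $n\to\infty$; (iii) if $p=o(n)$ as $n\to\infty$, then $$I(\mathcal{L}(\sqrt n Z_n)|\mathcal{L}(G_n))=\frac{p^2q(q+1)}{4n^2}\,(1+o(1))\qquad (n\to\infty).$$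
   Context: For probability measures $\mu,\nu$ on $\mathbb{R}^m$ (with Euclidean norm $\|\cdot\|$) having densities $f$ and $g$ with respect to Lebesgue measure, the Fisher information is $$I(\mu|\nu)=\int_{\mathbb{R}^m}\big\|\nabla\sqrt{f/g}\,(x)\big\|^2 g(x)\,dx\in[0,\infty].$$ (Note the normalization: this equals $\frac14\int\|\nabla\log (f/g)\|^2 f\,dx$.) When $\mu$ has no density with respect to Lebesgue measure, $I(\mu|\nu)$ is taken to be $+\infty$. A $p\times q$ matrix is identified with a vector in $\mathbb{R}^{pq}$. The law $\mathcal{L}(\sqrt n Z_n)$ has a density whenever $p+q\le n$.
   Formalization: Part (iii) additionally assumes p_n → ∞; without it the claim is false (for p=q=1, I ~ 3/(2n²), not 1/(2n²)), and under p=o(n) the asymptotics hold exactly when p_n → ∞. *)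

theory Defs
  imports "HOL-Probability.Probability"
begin

text \<open>
  The dimension pq varies with n, so a real vector is a function on a finite index set I,
  an element of the extensional product space; a p by q matrix is a vector over
  \<open>{..<p} \<times> {..<q}\<close> (row, column), counted from 0.
\<close>

abbreviation mat_idx :: "nat \<Rightarrow> nat \<Rightarrow> (nat \<times> nat) set"
  where "mat_idx p q \<equiv> {..<p} \<times> {..<q}"

abbreviation borel_on :: "'i set \<Rightarrow> ('i \<Rightarrow> real) measure"
  where "borel_on I \<equiv> PiM I (\<lambda>_. borel)"

abbreviation lborel_on :: "'i set \<Rightarrow> ('i \<Rightarrow> real) measure"
  where "lborel_on I \<equiv> PiM I (\<lambda>_. lborel)"

definition joint_law :: "'w measure \<Rightarrow> 'i set \<Rightarrow> ('w \<Rightarrow> 'i \<Rightarrow> real) \<Rightarrow> ('i \<Rightarrow> real) measure"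
  where "joint_law M I X = distr M (borel_on I) (\<lambda>\<omega>. restrict (X \<omega>) I)"

definition has_density_on :: "('i \<Rightarrow> real) measure \<Rightarrow> 'i set \<Rightarrow> (('i \<Rightarrow> real) \<Rightarrow> real) \<Rightarrow> bool"
  where "has_density_on \<mu> I f \<longleftrightarrow>
    f \<in> borel_measurable (lborel_on I) \<and> (\<forall>x \<in> space (lborel_on I). 0 \<le> f x) \<and>
    \<mu> = density (lborel_on I) (\<lambda>x. ennreal (f x))"

definition partial_differentiable :: "'i \<Rightarrow> (('i \<Rightarrow> real) \<Rightarrow> real) \<Rightarrow> ('i \<Rightarrow> real) \<Rightarrow> bool"
  where "partial_differentiable i u x \<longleftrightarrow> (\<lambda>t. u (x(i := t))) differentiable (at (x i))"

definition partial_deriv :: "'i \<Rightarrow> (('i \<Rightarrow> real) \<Rightarrow> real) \<Rightarrow> ('i \<Rightarrow> real) \<Rightarrow> real"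
  where "partial_deriv i u x = deriv (\<lambda>t. u (x(i := t))) (x i)"

definition grad_norm :: "'i set \<Rightarrow> (('i \<Rightarrow> real) \<Rightarrow> real) \<Rightarrow> ('i \<Rightarrow> real) \<Rightarrow> real"
  where "grad_norm I u x = L2_set (\<lambda>i. partial_deriv i u x) I"

text \<open>
  Densities are only determined up to null sets, whereas the pointwise gradient depends on the
  chosen versions. The infimum below runs over the versions for which the gradient exists
  almost everywhere. For positive g all of them give the same integral: by Fubini, if two
  versions of the square root agree almost everywhere, they agree almost everywhere on almost
  every line parallel to an axis, so their partial derivatives coincide wherever the functions
  agree on such a line and both derivatives exist. If there is no such version, in particular
  if one of the measures has no density, then the infimum is over the empty set, i.e.
  \<open>\<infinity>\<close>.
\<close>

definition fisher_information :: "'i set \<Rightarrow> ('i \<Rightarrow> real) measure \<Rightarrow> ('i \<Rightarrow> real) measure \<Rightarrow> ennreal"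
  where "fisher_information I \<mu> \<nu> =
    Inf {(\<integral>\<^sup>+x. ennreal ((grad_norm I (\<lambda>y. sqrt (f y / g y)) x)\<^sup>2 * g x) \<partial>lborel_on I) | f g.
           has_density_on \<mu> I f \<and> has_density_on \<nu> I g \<and>
           (AE x in lborel_on I. \<forall>i\<in>I. partial_differentiable i (\<lambda>y. sqrt (f y / g y)) x)}"

definition mat_mul :: "nat \<Rightarrow> (nat \<times> nat \<Rightarrow> real) \<Rightarrow> (nat \<times> nat \<Rightarrow> real) \<Rightarrow> nat \<times> nat \<Rightarrow> real"
  where "mat_mul n A B = (\<lambda>(i, j) \<in> mat_idx n n. \<Sum>k<n. A (i, k) * B (k, j))"

definition mat_transpose :: "nat \<Rightarrow> (nat \<times> nat \<Rightarrow> real) \<Rightarrow> nat \<times> nat \<Rightarrow> real"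
  where "mat_transpose n A = (\<lambda>(i, j) \<in> mat_idx n n. A (j, i))"

definition mat_one :: "nat \<Rightarrow> nat \<times> nat \<Rightarrow> real"
  where "mat_one n = (\<lambda>(i, j) \<in> mat_idx n n. if i = j then 1 else 0)"

definition orthogonal_mats :: "nat \<Rightarrow> (nat \<times> nat \<Rightarrow> real) set"
  where "orthogonal_mats n = {A \<in> extensional (mat_idx n n).
    mat_mul n (mat_transpose n A) A = mat_one n \<and> mat_mul n A (mat_transpose n A) = mat_one n}"

text \<open>
  The normalised Haar measure of the compact group O(n), viewed as a measure on matrix space
  concentrated on O(n); left invariance determines it.
\<close>

definition haar_orthogonal :: "nat \<Rightarrow> (nat \<times> nat \<Rightarrow> real) measure \<Rightarrow> bool"
  where "haar_orthogonal n \<mu> \<longleftrightarrow>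
    prob_space \<mu> \<and> sets \<mu> = sets (borel_on (mat_idx n n)) \<and>
    (AE A in \<mu>. A \<in> orthogonal_mats n) \<and>
    (\<forall>B \<in> orthogonal_mats n. distr \<mu> (borel_on (mat_idx n n)) (mat_mul n B) = \<mu>)"

definition haar_orthogonal_matrix :: "nat \<Rightarrow> 'w measure \<Rightarrow> ('w \<Rightarrow> nat \<times> nat \<Rightarrow> real) \<Rightarrow> bool"
  where "haar_orthogonal_matrix n M U \<longleftrightarrow>
    prob_space M \<and> (\<forall>ij \<in> mat_idx n n. (\<lambda>\<omega>. U \<omega> ij) \<in> borel_measurable M) \<and>
    haar_orthogonal n (joint_law M (mat_idx n n) U)"

definition std_gaussian_matrix ::
    "nat \<Rightarrow> nat \<Rightarrow> 'w measure \<Rightarrow> ('w \<Rightarrow> nat \<times> nat \<Rightarrow> real) \<Rightarrow> bool"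
  where "std_gaussian_matrix p q M G \<longleftrightarrow>
    prob_space M \<and>
    prob_space.indep_vars M (\<lambda>_. borel) (\<lambda>ij \<omega>. G \<omega> ij) (mat_idx p q) \<and>
    (\<forall>ij \<in> mat_idx p q. distributed M lborel (\<lambda>\<omega>. G \<omega> ij) std_normal_density)"

end

theory Submission
  imports Defs "Jordan_Normal_Form.Determinant"
begin

text \<open>
  Let X be the upper left p by q block of a Haar orthogonal matrix, \<open>V = 1 - X\<^sup>T X\<close>, \<open>K = V\<inverse>\<close> and
  \<open>m = n - p - q - 1\<close>. Differentiating the invariance under the rotations of one of the first p rows
  and one of the remaining rows gives integration by parts formulas on O(n). Summed over the remaining
  rows they are closed identities in X and K. Applied to traces of \<open>X K X\<^sup>T\<close> and \<open>X K\<^sup>2 X\<^sup>T\<close> they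
  yield \<open>m E tr(X K X\<^sup>T) = pq\<close> and \<open>m (m - 2) (m + 1) E tr(X K\<^sup>2 X\<^sup>T) = pq (m + p) (m + q)\<close>; to
  avoid integrability problems K is first replaced by \<open>(V + e)\<inverse>\<close>, and then e tends to 0. Applied
  to test functions of X they say that the law of X, divided by \<open>(det V)\<^bsup>m/2\<^esup>\<close>, has vanishing
  distributional gradient on the unit ball of the operator norm, so that this power of the determinant
  is the density up to a constant, as soon as X lies almost surely inside the ball. No normalising
  constant is needed: the logarithmic gradient of the density ratio gives the Fisher information
  \<open>n/4 E |X - (m/n) X K|\<^sup>2\<close>, which expands into the two moments above and \<open>E |X|\<^sup>2 = pq/n\<close>.

  For \<open>m > 2\<close> this is an explicit rational function of n, p, q, of which (i) and (iii) are the
  asymptotics; it is at least \<open>(pq/n)\<^sup>2/4\<close>. For \<open>0 < m \<le> 2\<close> the second moment identity cannot hold,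
  its two sides having different signs, so that \<open>E tr(X K\<^sup>2 X\<^sup>T)\<close> and the Fisher information are infinite. For \<open>m \<le> 0\<close> there is
  either no density or the integrand is at least \<open>n/4 |X|\<^sup>2\<close>, so that the Fisher information is at least
  \<open>pq/4\<close>. Together these lower bounds give (ii).
\<close>

subsection \<open>Determinants and inverses of matrices of functions\<close>

text \<open>A rotation of two block rows, or of two rows outside the block, leaves V unchanged; only
  a pair of a block row i and an outside (hidden) row k moves it. V is the Gram matrix of the hidden
  rows, so summing over k recreates V next to a factor K and cancels it. This is why the summed
  identities close, and why the exponent m / 2 of the density comes out of a count of rows and
  columns. The identity for the second moment contains the mixed moment of tr(X K X^T) and tr K. A
  further test function, with the extra factor tr K, gives a second relation for it; eliminating the
  mixed moment leaves the coefficient m (m - 1) - 2 = (m - 2) (m + 1). In (iii) the growth of p is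
  essential. For constant p and q the exact value divided by p^2 q (q + 1) / (4 n^2) tends to 1 +
  1/p + 2/(p (q + 1)), which is 3 for p = q = 1.\<close>

definition mdet :: "nat \<Rightarrow> (nat \<Rightarrow> nat \<Rightarrow> real) \<Rightarrow> real"
  where "mdet q F = Determinant.det (Matrix.mat q q (\<lambda>(a, b). F a b))"

text \<open>Adjugate divided by determinant, so that a matrix of determinant 0 gets the zero matrix.
  Being total, \<open>minv\<close> is measurable without case distinctions, and formulas with K keep
  a meaning where V is singular.\<close>

definition minv :: "nat \<Rightarrow> (nat \<Rightarrow> nat \<Rightarrow> real) \<Rightarrow> nat \<Rightarrow> nat \<Rightarrow> real"
  where "minv q F a b = adj_mat (Matrix.mat q q (\<lambda>(a, b). F a b)) $$ (a, b) / mdet q F"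

lemma sum_delta_mult:
  fixes f :: "nat \<Rightarrow> real"
  assumes "b < q"
  shows "(\<Sum>c<q. f c * (if c = b then 1 else 0)) = f b"
    and "(\<Sum>c<q. f c * (if b = c then 1 else 0)) = f b"
    and "(\<Sum>c<q. (if c = b then 1 else 0) * f c) = f b"
    and "(\<Sum>c<q. (if b = c then 1 else 0) * f c) = f b"
  using assms by (simp_all add: if_distrib[where f = "\<lambda>x. x * _"] if_distrib[where f = "(*) _"] cong: if_cong)

lemma mdet_perm:
  "mdet q F = (\<Sum>\<pi> | \<pi> permutes {0..<q}. signof \<pi> * (\<Prod>i = 0..<q. F i (\<pi> i)))"
proof -
  have "mdet q F = (\<Sum>\<pi> | \<pi> permutes {0..<q}.
      signof \<pi> * (\<Prod>i = 0..<q. Matrix.mat q q (\<lambda>(a, b). F a b) $$ (i, \<pi> i)))"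
    unfolding mdet_def by (rule det_def') simp
  also have "\<dots> = (\<Sum>\<pi> | \<pi> permutes {0..<q}. signof \<pi> * (\<Prod>i = 0..<q. F i (\<pi> i)))"
    by (intro sum.cong refl arg_cong2[where f="(*)"] prod.cong)
      (use permutes_in_image in fastforce)
  finally show ?thesis .
qed

text \<open>Expresses the entries of the inverse by determinants of entries of F, so that limits and
  measurability of \<open>minv\<close> reduce to those of \<open>mdet\<close>. The index shifts skip
  row b and column a.\<close>

lemma minv_cofactor:
  assumes "a < q" "b < q"
  shows "minv q F a b = (-1) ^ (b + a) *
    mdet (q - 1) (\<lambda>i j. F (if i < b then i else Suc i) (if j < a then j else Suc j)) / mdet q F"
proof -
  have "mat_delete (Matrix.mat q q (\<lambda>(a, b). F a b)) b a =
     Matrix.mat (q - 1) (q - 1) (\<lambda>(i, j). F (if i < b then i else Suc i) (if j < a then j else Suc j))"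
    unfolding mat_delete_def by (intro eq_matI) auto
  then show ?thesis
    using assms by (simp add: minv_def adj_mat_def cofactor_def mdet_def)
qed

lemma minv_right:
  assumes "mdet q F \<noteq> 0" "a < q" "b < q"
  shows "(\<Sum>c<q. F a c * minv q F c b) = (if a = b then 1 else 0)"
proof -
  let ?A = "Matrix.mat q q (\<lambda>(a, b). F a b)"
  have A: "?A \<in> carrier_mat q q" by simp
  have "(?A * adj_mat ?A) $$ (a, b) = (\<Sum>c<q. F a c * adj_mat ?A $$ (c, b))"
    using assms adj_mat(1)[OF A]
    by (auto simp: times_mat_def scalar_prod_def adj_mat_def atLeast0LessThan intro!: sum.cong)
  moreover have "(?A * adj_mat ?A) $$ (a, b) = (if a = b then mdet q F else 0)"
    using assms by (simp add: adj_mat(2)[OF A] mdet_def)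
  moreover have "(\<Sum>c<q. F a c * minv q F c b) = (\<Sum>c<q. F a c * adj_mat ?A $$ (c, b)) / mdet q F"
    by (simp add: minv_def sum_divide_distrib)
  ultimately have "(\<Sum>c<q. F a c * minv q F c b) = (if a = b then mdet q F else 0) / mdet q F"
    by (simp only:)
  then show ?thesis using assms(1) by simp
qed

lemma minv_left:
  assumes "mdet q F \<noteq> 0" "a < q" "b < q"
  shows "(\<Sum>c<q. minv q F a c * F c b) = (if a = b then 1 else 0)"
proof -
  let ?A = "Matrix.mat q q (\<lambda>(a, b). F a b)"
  have A: "?A \<in> carrier_mat q q" by simp
  have "(adj_mat ?A * ?A) $$ (a, b) = (\<Sum>c<q. adj_mat ?A $$ (a, c) * F c b)"
    using assms adj_mat(1)[OF A]
    by (auto simp: times_mat_def scalar_prod_def adj_mat_def atLeast0LessThan intro!: sum.cong)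
  moreover have "(adj_mat ?A * ?A) $$ (a, b) = (if a = b then mdet q F else 0)"
    using assms by (simp add: adj_mat(3)[OF A] mdet_def)
  moreover have "(\<Sum>c<q. minv q F a c * F c b) = (\<Sum>c<q. adj_mat ?A $$ (a, c) * F c b) / mdet q F"
    by (simp add: minv_def sum_divide_distrib)
  ultimately have "(\<Sum>c<q. minv q F a c * F c b) = (if a = b then mdet q F else 0) / mdet q F"
    by (simp only:)
  then show ?thesis using assms(1) by simp
qed

lemma minv_unique:
  assumes "mdet q F \<noteq> 0"
    and "\<And>a b. a < q \<Longrightarrow> b < q \<Longrightarrow> (\<Sum>c<q. G a c * F c b) = (if a = b then 1 else 0)"
    and "a < q" "b < q"
  shows "G a b = minv q F a b"
proof -
  have "G a b = (\<Sum>c<q. G a c * (if c = b then 1 else 0))"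
    using \<open>b < q\<close> by (simp add: sum_delta_mult)
  also have "\<dots> = (\<Sum>c<q. G a c * (\<Sum>d<q. F c d * minv q F d b))"
    using assms by (intro sum.cong refl arg_cong2[where f="(*)"]) (simp add: minv_right)
  also have "\<dots> = (\<Sum>d<q. (\<Sum>c<q. G a c * F c d) * minv q F d b)"
    unfolding sum_distrib_left sum_distrib_right by (subst sum.swap) (simp add: mult.assoc)
  also have "\<dots> = (\<Sum>d<q. (if a = d then 1 else 0) * minv q F d b)"
    using assms by (intro sum.cong refl arg_cong2[where f="(*)"]) simp
  also have "\<dots> = minv q F a b" using \<open>a < q\<close> by (simp add: sum_delta_mult)
  finally show ?thesis .
qed

text \<open>The transpose of the inverse of a symmetric matrix is again a left inverse, and left
  inverses are unique.\<close>

lemma minv_sym: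
  assumes "mdet q F \<noteq> 0" and "\<And>a b. a < q \<Longrightarrow> b < q \<Longrightarrow> F a b = F b a" and "a < q" "b < q"
  shows "minv q F b a = minv q F a b"
proof (rule minv_unique[OF assms(1) _ assms(3,4), where G = "\<lambda>a b. minv q F b a"])
  fix a b assume ab: "a < q" "b < q"
  have "(\<Sum>c<q. minv q F c a * F c b) = (\<Sum>c<q. F b c * minv q F c a)"
    using assms ab by (intro sum.cong refl) (simp add: mult.commute)
  then show "(\<Sum>c<q. minv q F c a * F c b) = (if a = b then 1 else 0)"
    using minv_right[OF assms(1) ab(2,1)] by auto
qed

lemma mdet_nonzeroI:
  assumes "\<And>v. (\<And>a. a < q \<Longrightarrow> (\<Sum>b<q. F a b * v b) = 0) \<Longrightarrow> (\<forall>b<q. v b = 0)"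
  shows "mdet q F \<noteq> 0"
proof
  let ?A = "Matrix.mat q q (\<lambda>(a, b). F a b)"
  assume "mdet q F = 0"
  then obtain v where v: "v \<in> carrier_vec q" "v \<noteq> 0\<^sub>v q" "?A *\<^sub>v v = 0\<^sub>v q"
    using det_0_iff_vec_prod_zero[of ?A q] by (auto simp: mdet_def)
  have "(\<Sum>b<q. F a b * v $ b) = 0" if "a < q" for a
  proof -
    have "(?A *\<^sub>v v) $ a = (\<Sum>b<q. F a b * v $ b)"
      using that v(1) by (auto simp: scalar_prod_def atLeast0LessThan intro!: sum.cong)
    then show ?thesis using v(3) that by simp
  qed
  from assms[OF this] have "\<forall>b<q. v $ b = 0" by blast
  then have "v = 0\<^sub>v q" using v(1) by auto
  with v(2) show False by simp
qed

lemma mdet_mult: "mdet q (\<lambda>a b. \<Sum>c<q. F a c * G c b) = mdet q F * mdet q G"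
proof -
  let ?M = "\<lambda>F. Matrix.mat q q (\<lambda>(a, b). F a b)"
  have "?M (\<lambda>a b. \<Sum>c<q. F a c * G c b) = ?M F * ?M G"
    by (intro eq_matI) (auto simp: times_mat_def scalar_prod_def atLeast0LessThan intro!: sum.cong)
  then show ?thesis unfolding mdet_def by (simp add: det_mult[of _ q])
qed

lemma tendsto_mdet:
  assumes "\<And>a b. a < q \<Longrightarrow> b < q \<Longrightarrow> ((\<lambda>t. F t a b) \<longlongrightarrow> L a b) net"
  shows "((\<lambda>t. mdet q (F t)) \<longlongrightarrow> mdet q L) net"
  unfolding mdet_perm
  by (intro tendsto_sum tendsto_mult tendsto_const tendsto_prod assms)
    (use permutes_in_image in fastforce)+

lemma tendsto_minv:
  assumes "\<And>a b. a < q \<Longrightarrow> b < q \<Longrightarrow> ((\<lambda>t. F t a b) \<longlongrightarrow> L a b) net" "mdet q L \<noteq> 0" "a < q" "b < q"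
  shows "((\<lambda>t. minv q (F t) a b) \<longlongrightarrow> minv q L a b) net"
  unfolding minv_cofactor[OF assms(3,4)]
  by (intro tendsto_divide tendsto_mult tendsto_const tendsto_mdet assms) auto

lemma borel_measurable_mdet:
  assumes "\<And>a b. a < q \<Longrightarrow> b < q \<Longrightarrow> (\<lambda>x. F x a b) \<in> borel_measurable M"
  shows "(\<lambda>x. mdet q (F x)) \<in> borel_measurable M"
  unfolding mdet_perm
  by (intro borel_measurable_sum borel_measurable_times borel_measurable_const
      borel_measurable_prod assms)
    (use permutes_in_image in fastforce)+

lemma borel_measurable_minv:
  assumes "\<And>a b. a < q \<Longrightarrow> b < q \<Longrightarrow> (\<lambda>x. F x a b) \<in> borel_measurable M" "a < q" "b < q"
  shows "(\<lambda>x. minv q (F x) a b) \<in> borel_measurable M"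
  unfolding minv_cofactor[OF assms(2,3)]
  by (intro borel_measurable_divide borel_measurable_times borel_measurable_const
      borel_measurable_mdet assms) auto

text \<open>The resolvent identity G^-1 - F^-1 = G^-1 (F - G) F^-1, obtained by inserting an
  identity matrix on either side. It yields the derivative of the inverse and the comparison of K at
  e with K at 0.\<close>

lemma minv_diff:
  assumes "mdet q F \<noteq> 0" "mdet q G \<noteq> 0" "a < q" "b < q"
  shows "minv q G a b - minv q F a b =
    (\<Sum>c<q. \<Sum>d<q. minv q G a c * (F c d - G c d) * minv q F d b)"
proof -
  have "(\<Sum>c<q. \<Sum>d<q. minv q G a c * F c d * minv q F d b)
      = (\<Sum>c<q. minv q G a c * (\<Sum>d<q. F c d * minv q F d b))"
    by (simp add: sum_distrib_left mult.assoc)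
  also have "\<dots> = (\<Sum>c<q. if c = b then minv q G a c else 0)"
    using assms by (intro sum.cong) (simp_all add: minv_right)
  finally have 1: "(\<Sum>c<q. \<Sum>d<q. minv q G a c * F c d * minv q F d b) = minv q G a b"
    using assms by simp
  have "(\<Sum>c<q. \<Sum>d<q. minv q G a c * G c d * minv q F d b)
      = (\<Sum>d<q. (\<Sum>c<q. minv q G a c * G c d) * minv q F d b)"
    by (subst sum.swap) (simp add: sum_distrib_right)
  also have "\<dots> = (\<Sum>d<q. if a = d then minv q F d b else 0)"
    using assms by (intro sum.cong) (simp_all add: minv_left)
  finally have 2: "(\<Sum>c<q. \<Sum>d<q. minv q G a c * G c d * minv q F d b) = minv q F a b"
    using assms by simp
  show ?thesis
    unfolding 1[symmetric] 2[symmetric] sum_subtractf[symmetric]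
    by (intro sum.cong refl) (simp add: algebra_simps)
qed

text \<open>Divide the resolvent identity by t - s. The factor at t converges by continuity of the
  inverse, and \<open>ev\<close> keeps F t invertible near s.\<close>

lemma DERIV_minv:
  assumes F: "\<And>a b. a < q \<Longrightarrow> b < q \<Longrightarrow> ((\<lambda>t. F t a b) has_real_derivative F' a b) (at s)"
    and "mdet q (F s) \<noteq> 0" "a < q" "b < q"
  shows "((\<lambda>t. minv q (F t) a b) has_real_derivative
    - (\<Sum>c<q. \<Sum>d<q. minv q (F s) a c * F' c d * minv q (F s) d b)) (at s)"
proof -
  have cont: "((\<lambda>t. F t a b) \<longlongrightarrow> F s a b) (at s)" if "a < q" "b < q" for a b
    using DERIV_isCont[OF F[OF that]] by (simp add: isCont_def)
  have ev: "\<forall>\<^sub>F t in at s. mdet q (F t) \<noteq> 0"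
    by (rule tendsto_imp_eventually_ne[OF tendsto_mdet[OF cont]]) (use assms in auto)
  have "((\<lambda>t. - (\<Sum>c<q. \<Sum>d<q. minv q (F t) a c * ((F t c d - F s c d) / (t - s)) * minv q (F s) d b))
     \<longlongrightarrow> - (\<Sum>c<q. \<Sum>d<q. minv q (F s) a c * F' c d * minv q (F s) d b)) (at s)"
    by (intro tendsto_minus tendsto_sum tendsto_mult tendsto_const tendsto_minv cont assms)
       (use F in \<open>auto simp: has_field_derivative_iff\<close>)
  moreover have "\<forall>\<^sub>F t in at s. - (\<Sum>c<q. \<Sum>d<q. minv q (F t) a c * ((F t c d - F s c d) / (t - s)) * minv q (F s) d b)
      = (minv q (F t) a b - minv q (F s) a b) / (t - s)"
    using ev
  proof eventually_elim
    case (elim t)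
    show ?case
      unfolding minv_diff[OF assms(2) elim assms(3,4)]
      by (simp add: sum_divide_distrib sum_negf[symmetric])
         (intro sum.cong refl, simp add: divide_simps algebra_simps)
  qed
  ultimately show ?thesis
    unfolding has_field_derivative_iff by (rule Lim_transform_eventually)
qed

text \<open>In the differentiated Leibniz sum only \<pi> = id survives: a permutation cannot move
  exactly one point, so for \<pi> \<noteq> id an off-diagonal factor, which is 0, remains after any
  single factor has been differentiated.\<close>

lemma DERIV_mdet_at_id:
  assumes F: "\<And>a b. a < q \<Longrightarrow> b < q \<Longrightarrow> ((\<lambda>t. F t a b) has_real_derivative F' a b) (at s)"
    and id: "\<And>a b. a < q \<Longrightarrow> b < q \<Longrightarrow> F s a b = (if a = b then 1 else 0)"
  shows "((\<lambda>t. mdet q (F t)) has_real_derivative (\<Sum>a<q. F' a a)) (at s)"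
proof -
  let ?P = "{\<pi>. \<pi> permutes {0..<q}}"
  have fin: "finite ?P" by (simp add: finite_permutations)
  have "((\<lambda>t. mdet q (F t)) has_real_derivative
     (\<Sum>\<pi>\<in>?P. signof \<pi> * (\<Sum>a\<in>{0..<q}. F' a (\<pi> a) * (\<Prod>b\<in>{0..<q} - {a}. F s b (\<pi> b))))) (at s)"
    unfolding mdet_perm
  proof (intro DERIV_sum DERIV_cmult)
    fix \<pi> assume "\<pi> \<in> ?P"
    then have "\<And>a. a < q \<Longrightarrow> \<pi> a < q" using permutes_in_image by fastforce
    then show "((\<lambda>t. \<Prod>i = 0..<q. F t i (\<pi> i)) has_real_derivative
       (\<Sum>a = 0..<q. F' a (\<pi> a) * (\<Prod>b\<in>{0..<q} - {a}. F s b (\<pi> b)))) (at s)"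
      by (intro has_field_derivative_prod F) auto
  qed
  moreover have "(\<Sum>\<pi>\<in>?P. signof \<pi> * (\<Sum>a\<in>{0..<q}. F' a (\<pi> a) * (\<Prod>b\<in>{0..<q} - {a}. F s b (\<pi> b))))
    = (\<Sum>\<pi>\<in>?P. if \<pi> = id then (\<Sum>a<q. F' a a) else 0)"
  proof (intro sum.cong refl)
    fix \<pi> assume \<pi>: "\<pi> \<in> ?P"
    then have lt: "\<And>a. a < q \<Longrightarrow> \<pi> a < q" using permutes_in_image by fastforce
    show "signof \<pi> * (\<Sum>a\<in>{0..<q}. F' a (\<pi> a) * (\<Prod>b\<in>{0..<q} - {a}. F s b (\<pi> b)))
      = (if \<pi> = id then (\<Sum>a<q. F' a a) else 0)"
    proof (cases "\<pi> = id")
      case True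
      then show ?thesis by (simp add: id atLeast0LessThan)
    next
      case False
      have "(\<Prod>b\<in>{0..<q} - {a}. F s b (\<pi> b)) = 0" if "a < q" for a
      proof -
        have "\<exists>b\<in>{0..<q} - {a}. \<pi> b \<noteq> b"
        proof (rule ccontr)
          assume *: "\<not> ?thesis"
          have inj: "inj \<pi>" using \<pi> permutes_inj by auto
          have "\<pi> b = b" for b
          proof (cases "b = a")
            case True
            show ?thesis
            proof (rule ccontr)
              assume "\<pi> b \<noteq> b"
              then have "\<pi> b \<in> {0..<q} - {a}" using True that lt by auto
              then have "\<pi> (\<pi> b) = \<pi> b" using * by blast
              with inj \<open>\<pi> b \<noteq> b\<close> show False by (auto dest: injD)
            qed
          next
            case False
            then show ?thesis
              using * \<pi> permutes_not_in[of \<pi> "{0..<q}" b] by (cases "b < q") auto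
          qed
          with \<open>\<pi> \<noteq> id\<close> show False by auto
        qed
        then obtain b where "b \<in> {0..<q} - {a}" "\<pi> b \<noteq> b" by blast
        then show ?thesis
          using lt by (intro prod_zero) (auto simp: id intro!: bexI[of _ b])
      qed
      then have "(\<Sum>a = 0..<q. F' a (\<pi> a) * (\<Prod>b\<in>{0..<q} - {a}. F s b (\<pi> b))) = 0"
        by (intro sum.neutral ballI) (metis atLeastLessThan_iff mult_zero_right)
      then show ?thesis using False by simp
    qed
  qed
  moreover have "\<dots> = (\<Sum>a<q. F' a a)"
    using fin permutes_id by (simp add: sum.delta)
  ultimately show ?thesis by simp
qed

lemma mdet_one: "mdet q (\<lambda>a b. if a = b then 1 else 0) = 1"
proof -
  have "Matrix.mat q q (\<lambda>(a, b). if a = b then 1 else (0::real)) = 1\<^sub>m q"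
    by (intro eq_matI) auto
  then show ?thesis by (simp add: mdet_def)
qed

lemma mdet_cong: "(\<And>a b. a < q \<Longrightarrow> b < q \<Longrightarrow> F a b = G a b) \<Longrightarrow> mdet q F = mdet q G"
  unfolding mdet_def by (intro arg_cong[where f = Determinant.det] cong_mat) auto

lemma minv_cong:
  "(\<And>a b. a < q \<Longrightarrow> b < q \<Longrightarrow> F a b = G a b) \<Longrightarrow> minv q F a b = minv q G a b"
proof -
  assume "\<And>a b. a < q \<Longrightarrow> b < q \<Longrightarrow> F a b = G a b"
  then have "Matrix.mat q q (\<lambda>(a, b). F a b) = Matrix.mat q q (\<lambda>(a, b). G a b)"
    by (intro cong_mat) auto
  then show ?thesis by (simp add: minv_def mdet_def)
qed

text \<open>Jacobi's formula, reduced to the identity matrix by multiplying with the inverse of \<open>F s\<close>.\<close>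

lemma DERIV_mdet:
  assumes F: "\<And>a b. a < q \<Longrightarrow> b < q \<Longrightarrow> ((\<lambda>t. F t a b) has_real_derivative F' a b) (at s)"
    and nz: "mdet q (F s) \<noteq> 0"
  shows "((\<lambda>t. mdet q (F t)) has_real_derivative
    mdet q (F s) * (\<Sum>a<q. \<Sum>b<q. minv q (F s) a b * F' b a)) (at s)"
proof -
  let ?K = "minv q (F s)"
  have "mdet q (\<lambda>a b. \<Sum>c<q. F s a c * ?K c b) = 1"
    by (subst mdet_one[symmetric, of q]) (intro mdet_cong minv_right nz)
  then have one: "mdet q (F s) * mdet q ?K = 1" by (simp add: mdet_mult)
  have "((\<lambda>t. mdet q (\<lambda>a b. \<Sum>c<q. ?K a c * F t c b)) has_real_derivative
     (\<Sum>a<q. \<Sum>b<q. ?K a b * F' b a)) (at s)"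
  proof (rule DERIV_mdet_at_id[where F' = "\<lambda>a b. \<Sum>c<q. ?K a c * F' c b"])
    fix a b assume "a < q" "b < q"
    then show "((\<lambda>t. \<Sum>c<q. ?K a c * F t c b) has_real_derivative (\<Sum>c<q. ?K a c * F' c b)) (at s)"
      by (intro DERIV_sum DERIV_cmult F) auto
    show "(\<Sum>c<q. ?K a c * F s c b) = (if a = b then 1 else 0)"
      using nz \<open>a < q\<close> \<open>b < q\<close> by (rule minv_left)
  qed
  then have "((\<lambda>t. mdet q (F s) * (mdet q ?K * mdet q (F t))) has_real_derivative
     mdet q (F s) * (\<Sum>a<q. \<Sum>b<q. ?K a b * F' b a)) (at s)"
    unfolding mdet_mult by (rule DERIV_cmult)
  then show ?thesis using one by (simp add: mult.assoc[symmetric])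
qed

subsection \<open>Rotations of two rows\<close>

lemma sum_two:
  fixes f :: "nat \<Rightarrow> real"
  assumes "i \<noteq> k" "i < n" "k < n"
  shows "(\<Sum>l<n. (if l = i then u else if l = k then v else 0) * f l) = u * f i + v * f k"
proof -
  have "(\<Sum>l<n. (if l = i then u else if l = k then v else 0) * f l)
      = (\<Sum>l<n. (if l = i then u * f l else 0) + (if l = k then v * f l else 0))"
    using assms by (intro sum.cong) auto
  also have "\<dots> = u * f i + v * f k"
    using assms by (simp add: sum.distrib)
  finally show ?thesis .
qed

lemma sum_split_two:
  fixes f :: "nat \<Rightarrow> real"
  assumes "i \<noteq> k" "i < n" "k < n"
  shows "(\<Sum>l<n. f l) = f i + f k + (\<Sum>l\<in>{..<n} - {i, k}. f l)"
proof -
  have "(\<Sum>l<n. f l) = (\<Sum>l\<in>{i, k}. f l) + (\<Sum>l\<in>{..<n} - {i, k}. f l)"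
    using assms sum.subset_diff[of "{i, k}" "{..<n}" f] by simp
  then show ?thesis using assms by simp
qed

lemma orthogonal_mats_iff:
  "A \<in> orthogonal_mats n \<longleftrightarrow> A \<in> extensional (mat_idx n n) \<and>
     (\<forall>a<n. \<forall>b<n. (\<Sum>c<n. A (a, c) * A (b, c)) = (if a = b then 1 else 0)) \<and>
     (\<forall>c<n. \<forall>d<n. (\<Sum>a<n. A (a, c) * A (a, d)) = (if c = d then 1 else 0))"
proof -
  have *: "restrict f (mat_idx n n) = mat_one n \<longleftrightarrow> (\<forall>a<n. \<forall>b<n. f (a, b) = (if a = b then 1 else 0))"
    for f :: "nat \<times> nat \<Rightarrow> real"
    unfolding mat_one_def restrict_def fun_eq_iff by auto
  have 1: "mat_mul n (mat_transpose n A) A =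
      restrict (\<lambda>(c, d). \<Sum>a<n. A (a, c) * A (a, d)) (mat_idx n n)"
    unfolding mat_mul_def mat_transpose_def restrict_def fun_eq_iff by auto
  have 2: "mat_mul n A (mat_transpose n A) =
      restrict (\<lambda>(a, b). \<Sum>c<n. A (a, c) * A (b, c)) (mat_idx n n)"
    unfolding mat_mul_def mat_transpose_def restrict_def fun_eq_iff by auto
  show ?thesis
    unfolding orthogonal_mats_def 1 2 mem_Collect_eq * by auto
qed

lemma orthogonal_mats_entry_le:
  assumes "A \<in> orthogonal_mats n" "a < n" "c < n"
  shows "\<bar>A (a, c)\<bar> \<le> 1"
proof -
  have "A (a, c) * A (a, c) \<le> (\<Sum>c<n. A (a, c) * A (a, c))"
    using assms by (intro member_le_sum) auto
  also have "\<dots> = 1"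
    using assms by (auto simp: orthogonal_mats_iff)
  finally have "(A (a, c))\<^sup>2 \<le> 1" by (simp add: power2_eq_square)
  then show ?thesis by (simp add: abs_square_le_1)
qed

definition plane_rot :: "nat \<Rightarrow> nat \<Rightarrow> nat \<Rightarrow> real \<Rightarrow> nat \<times> nat \<Rightarrow> real"
  where "plane_rot n i k \<theta> = (\<lambda>(a, b) \<in> mat_idx n n.
    if a = i then (if b = i then cos \<theta> else if b = k then sin \<theta> else 0)
    else if a = k then (if b = i then - sin \<theta> else if b = k then cos \<theta> else 0)
    else if b = a then 1 else 0)"

definition rot_rows :: "nat \<Rightarrow> nat \<Rightarrow> nat \<Rightarrow> real \<Rightarrow> (nat \<times> nat \<Rightarrow> real) \<Rightarrow> nat \<times> nat \<Rightarrow> real"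
  where "rot_rows n i k \<theta> A = mat_mul n (plane_rot n i k \<theta>) A"

lemma rot_rows_apply:
  assumes "i \<noteq> k" "i < n" "k < n" "a < n" "c < n"
  shows "rot_rows n i k \<theta> A (a, c) =
    (if a = i then cos \<theta> * A (i, c) + sin \<theta> * A (k, c)
     else if a = k then cos \<theta> * A (k, c) - sin \<theta> * A (i, c) else A (a, c))"
proof -
  have "rot_rows n i k \<theta> A (a, c) = (\<Sum>l<n. plane_rot n i k \<theta> (a, l) * A (l, c))"
    using assms by (simp add: rot_rows_def mat_mul_def)
  also have "\<dots> = (\<Sum>l<n. (if a = i then (if l = i then cos \<theta> else if l = k then sin \<theta> else 0)
    else if a = k then (if l = i then - sin \<theta> else if l = k then cos \<theta> else 0)
    else if l = a then 1 else 0) * A (l, c))"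
    using assms by (intro sum.cong refl) (simp add: plane_rot_def)
  also have "\<dots> = (if a = i then cos \<theta> * A (i, c) + sin \<theta> * A (k, c)
     else if a = k then cos \<theta> * A (k, c) - sin \<theta> * A (i, c) else A (a, c))"
    using assms by (simp add: sum_two sum_delta_mult)
  finally show ?thesis .
qed

lemma rot_rows_extensional: "rot_rows n i k \<theta> A \<in> extensional (mat_idx n n)"
  by (auto simp: rot_rows_def mat_mul_def)

lemma rot_rows_orthogonal:
  assumes "i \<noteq> k" "i < n" "k < n" "A \<in> orthogonal_mats n"
  shows "rot_rows n i k \<theta> A \<in> orthogonal_mats n"
proof -
  have row: "(\<Sum>c<n. A (a, c) * A (b, c)) = (if a = b then 1 else 0)" if "a < n" "b < n" for a b
    using assms(4) that by (auto simp: orthogonal_mats_iff)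
  have col: "(\<Sum>a<n. A (a, c) * A (a, d)) = (if c = d then 1 else 0)" if "c < n" "d < n" for c d
    using assms(4) that by (auto simp: orthogonal_mats_iff)
  have comb: "(\<Sum>c<n. (u * A (a, c) + v * A (b, c)) * (u' * A (a', c) + v' * A (b', c)))
     = u * u' * (\<Sum>c<n. A (a, c) * A (a', c)) + u * v' * (\<Sum>c<n. A (a, c) * A (b', c))
     + v * u' * (\<Sum>c<n. A (b, c) * A (a', c)) + v * v' * (\<Sum>c<n. A (b, c) * A (b', c))"
    for u v u' v' a b a' b'
    by (simp add: sum_distrib_left sum.distrib[symmetric] algebra_simps)
  have "(\<Sum>c<n. rot_rows n i k \<theta> A (a, c) * rot_rows n i k \<theta> A (b, c)) = (if a = b then 1 else 0)"
    if ab: "a < n" "b < n" for a b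
  proof -
    \<comment> \<open>A uniform description of the rotated rows: row a is \<open>u a\<close> times
      the old row \<open>a1 a\<close> plus \<open>v a\<close> times the old row k. Row k itself is
      built on row i with coefficient - sin.\<close>
    define u where "u a = (if a = i then cos \<theta> else if a = k then - sin \<theta> else 1)" for a
    define v where "v a = (if a = i then sin \<theta> else if a = k then cos \<theta> else 0)" for a
    define a1 where "a1 a = (if a = i then i else if a = k then i else a)" for a
    have e: "rot_rows n i k \<theta> A (a, c) = u a * A (a1 a, c) + v a * A (k, c)" if "a < n" "c < n" for a c
      using that assms by (simp add: rot_rows_apply u_def v_def a1_def)
    have "(\<Sum>c<n. rot_rows n i k \<theta> A (a, c) * rot_rows n i k \<theta> A (b, c))
      = (\<Sum>c<n. (u a * A (a1 a, c) + v a * A (k, c)) * (u b * A (a1 b, c) + v b * A (k, c)))"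
      using ab by (intro sum.cong refl) (simp add: e)
    also have "\<dots> = u a * u b * (if a1 a = a1 b then 1 else 0) + u a * v b * (if a1 a = k then 1 else 0)
        + v a * u b * (if k = a1 b then 1 else 0) + v a * v b"
      unfolding comb using ab assms by (subst (1 2 3 4) row) (auto simp: a1_def)
    also have "\<dots> = (if a = b then 1 else 0)"
      using sin_cos_squared_add[of \<theta>] assms(1)
      by (auto simp: u_def v_def a1_def power2_eq_square add.commute)
    finally show ?thesis .
  qed
  moreover have "(\<Sum>a<n. rot_rows n i k \<theta> A (a, c) * rot_rows n i k \<theta> A (a, d)) = (if c = d then 1 else 0)"
    if cd: "c < n" "d < n" for c d
  proof -
    have alg: "(s * x + t * y) * (s * x' + t * y') + (s * y - t * x) * (s * y' - t * x')
       = (s\<^sup>2 + t\<^sup>2) * (x * x' + y * y')" for s t x y x' y' :: real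
      by (simp add: power2_eq_square algebra_simps)
    have "(\<Sum>a\<in>{..<n} - {i, k}. rot_rows n i k \<theta> A (a, c) * rot_rows n i k \<theta> A (a, d))
      = (\<Sum>a\<in>{..<n} - {i, k}. A (a, c) * A (a, d))"
      using assms cd by (intro sum.cong refl) (auto simp: rot_rows_apply)
    then have "(\<Sum>a<n. rot_rows n i k \<theta> A (a, c) * rot_rows n i k \<theta> A (a, d))
       = (\<Sum>a<n. A (a, c) * A (a, d))"
      unfolding sum_split_two[OF assms(1-3)] using assms cd
      by (simp add: rot_rows_apply alg)
    then show ?thesis using col cd by simp
  qed
  ultimately show ?thesis
    by (auto simp: orthogonal_mats_iff rot_rows_extensional)
qed

text \<open>The rotation matrix is the rotated identity matrix, so
  \<open>rot_rows_orthogonal\<close> covers it.\<close>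

lemma plane_rot_orthogonal:
  assumes "i \<noteq> k" "i < n" "k < n"
  shows "plane_rot n i k \<theta> \<in> orthogonal_mats n"
proof -
  have one: "mat_one n \<in> orthogonal_mats n"
  proof -
    have "(\<Sum>c<n. mat_one n (a, c) * mat_one n (b, c)) = (if a = b then 1 else 0)"
      and "(\<Sum>c<n. mat_one n (c, a) * mat_one n (c, b)) = (if a = b then 1 else 0)"
      if ab: "a < n" "b < n" for a b
    proof -
      have "(\<Sum>c<n. mat_one n (a, c) * mat_one n (b, c))
          = (\<Sum>c<n. (if c = a then 1 else 0) * (if c = b then 1 else 0))"
        "(\<Sum>c<n. mat_one n (c, a) * mat_one n (c, b))
          = (\<Sum>c<n. (if c = a then 1 else 0) * (if c = b then 1 else 0))"
        using ab by (auto simp: mat_one_def intro!: sum.cong)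
      then show "(\<Sum>c<n. mat_one n (a, c) * mat_one n (b, c)) = (if a = b then 1 else 0)"
        "(\<Sum>c<n. mat_one n (c, a) * mat_one n (c, b)) = (if a = b then 1 else 0)"
        using ab by (simp_all add: sum_delta_mult)
    qed
    then show ?thesis by (auto simp: orthogonal_mats_iff mat_one_def)
  qed
  have "plane_rot n i k \<theta> = rot_rows n i k \<theta> (mat_one n)"
  proof
    fix x :: "nat \<times> nat"
    obtain a b where x: "x = (a, b)" by (cases x)
    show "plane_rot n i k \<theta> x = rot_rows n i k \<theta> (mat_one n) x"
    proof (cases "x \<in> mat_idx n n")
      case True
      then show ?thesis
        using assms by (auto simp: x rot_rows_apply plane_rot_def mat_one_def)
    next
      case False
      then show ?thesis
        by (simp add: extensional_arb[OF rot_rows_extensional] plane_rot_def)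
    qed
  qed
  then show ?thesis using rot_rows_orthogonal[OF assms one] by simp
qed

text \<open>The rotations form a one-parameter group. Hence a derivative formula at angle 0, valid
  at all orthogonal matrices, gives the derivative at every angle.\<close>

lemma rot_rows_add:
  assumes "i \<noteq> k" "i < n" "k < n"
  shows "rot_rows n i k s (rot_rows n i k t A) = rot_rows n i k (s + t) A"
proof
  fix x :: "nat \<times> nat"
  obtain a b where x: "x = (a, b)" by (cases x)
  show "rot_rows n i k s (rot_rows n i k t A) x = rot_rows n i k (s + t) A x"
  proof (cases "x \<in> mat_idx n n")
    case True
    then show ?thesis
      using assms by (simp add: x rot_rows_apply sin_add cos_add algebra_simps)
  next
    case False
    then show ?thesis
      by (simp add: extensional_arb[OF rot_rows_extensional])
  qed
qed

lemma rot_rows_0: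
  assumes "i \<noteq> k" "i < n" "k < n" "A \<in> orthogonal_mats n"
  shows "rot_rows n i k 0 A = A"
proof
  fix x :: "nat \<times> nat"
  obtain a b where x: "x = (a, b)" by (cases x)
  show "rot_rows n i k 0 A x = A x"
  proof (cases "x \<in> mat_idx n n")
    case True
    then show ?thesis using assms by (auto simp: x rot_rows_apply)
  next
    case False
    then show ?thesis
      using assms(4) extensional_arb[of A "mat_idx n n" x]
      by (simp add: extensional_arb[OF rot_rows_extensional] orthogonal_mats_def)
  qed
qed

lemma DERIV_rot_rows:
  assumes "i \<noteq> k" "i < n" "k < n" "A \<in> orthogonal_mats n" "a < n" "c < n"
  shows "((\<lambda>t. rot_rows n i k t A (a, c)) has_real_derivative
    (if a = i then A (k, c) else if a = k then - A (i, c) else 0)) (at 0)"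
  unfolding rot_rows_apply[OF assms(1-3,5,6)]
  by (auto intro!: derivative_eq_intros)

lemma measurable_mat_mul: "mat_mul n B \<in> measurable (borel_on (mat_idx n n)) (borel_on (mat_idx n n))"
proof -
  have "mat_mul n B = (\<lambda>A. \<lambda>x\<in>mat_idx n n. \<Sum>k<n. B (fst x, k) * A (k, snd x))"
    by (auto simp: mat_mul_def fun_eq_iff restrict_def)
  also have "\<dots> \<in> measurable (borel_on (mat_idx n n)) (borel_on (mat_idx n n))"
    by (intro measurable_restrict borel_measurable_sum borel_measurable_times borel_measurable_const
        measurable_component_singleton) auto
  finally show ?thesis .
qed

section \<open>Haar measure and its invariance under rotations\<close>

locale haar =
  fixes n :: nat and \<mu> :: "(nat \<times> nat \<Rightarrow> real) measure"
  assumes haar: "haar_orthogonal n \<mu>"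
begin

sublocale prob_space \<mu>
  using haar by (simp add: haar_orthogonal_def)

lemma sets_mu[measurable_cong]: "sets \<mu> = sets (borel_on (mat_idx n n))"
  using haar by (simp add: haar_orthogonal_def)

lemma AE_orthogonal: "AE A in \<mu>. A \<in> orthogonal_mats n"
  using haar by (simp add: haar_orthogonal_def)

lemma measurable_entry[measurable]:
  "a < n \<Longrightarrow> c < n \<Longrightarrow> (\<lambda>A. A (a, c)) \<in> borel_measurable \<mu>"
  by (subst measurable_cong_sets[OF sets_mu refl], rule measurable_component_singleton) auto

text \<open>Differentiates the invariance under the rotations of rows i and k at the angle 0.\<close>

lemma integral_rotation_derivative:
  assumes ik: "i \<noteq> k" "i < n" "k < n"
    and \<phi>[measurable]: "\<phi> \<in> borel_measurable \<mu>"
    and D[measurable]: "D \<in> borel_measurable \<mu>"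
    and deriv: "\<And>A. A \<in> orthogonal_mats n \<Longrightarrow>
      ((\<lambda>t. \<phi> (rot_rows n i k t A)) has_real_derivative D A) (at 0)"
    and \<phi>_bound: "\<And>A. A \<in> orthogonal_mats n \<Longrightarrow> \<bar>\<phi> A\<bar> \<le> C1"
    and D_bound: "\<And>A. A \<in> orthogonal_mats n \<Longrightarrow> \<bar>D A\<bar> \<le> C"
  shows "(\<integral>A. D A \<partial>\<mu>) = 0"
proof -
  have rot_meas[measurable]: "rot_rows n i k t \<in> measurable \<mu> \<mu>" for t
    unfolding rot_rows_def[abs_def]
    using measurable_mat_mul by (simp cong: measurable_cong_sets add: sets_mu)
  have distr: "distr \<mu> \<mu> (rot_rows n i k t) = \<mu>" for t
    using haar plane_rot_orthogonal[OF ik, of t] sets_mu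
    unfolding rot_rows_def[abs_def] haar_orthogonal_def
    by (metis distr_cong)
  have int\<phi>: "integrable \<mu> \<phi>"
    by (rule integrable_const_bound[where B = C1]) (use AE_orthogonal \<phi>_bound in \<open>auto elim: eventually_mono\<close>)
  have int_rot: "integrable \<mu> (\<lambda>A. \<phi> (rot_rows n i k t A))" for t
    by (rule integrable_const_bound[where B = C1])
      (use AE_orthogonal \<phi>_bound rot_rows_orthogonal[OF ik] in \<open>auto elim: eventually_mono\<close>)
  have inv: "(\<integral>A. \<phi> (rot_rows n i k t A) \<partial>\<mu>) = (\<integral>A. \<phi> A \<partial>\<mu>)" for t
  proof -
    have "(\<integral>A. \<phi> A \<partial>\<mu>) = (\<integral>A. \<phi> A \<partial>distr \<mu> \<mu> (rot_rows n i k t))" by (simp add: distr)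
    also have "\<dots> = (\<integral>A. \<phi> (rot_rows n i k t A) \<partial>\<mu>)" by (rule integral_distr) auto
    finally show ?thesis ..
  qed
  have deriv_at: "((\<lambda>t. \<phi> (rot_rows n i k t A)) has_real_derivative D (rot_rows n i k s A)) (at s)"
    if A: "A \<in> orthogonal_mats n" for A s
  proof -
    have "((\<lambda>t. \<phi> (rot_rows n i k (t + s) A)) has_real_derivative D (rot_rows n i k s A)) (at 0)"
      using deriv[OF rot_rows_orthogonal[OF ik A, of s]] by (simp add: rot_rows_add[OF ik])
    then show ?thesis using DERIV_shift[of "\<lambda>t. \<phi> (rot_rows n i k t A)" _ 0 s] by simp
  qed
  \<comment> \<open>Mean value theorem along the orbit. Its points are orthogonal again, so the
    bound on D dominates the difference quotients uniformly.\<close>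
  have lip: "\<bar>\<phi> (rot_rows n i k t A) - \<phi> A\<bar> \<le> C * t"
    if A: "A \<in> orthogonal_mats n" and t: "t > 0" for A t
  proof -
    obtain s where "0 < s" "s < t"
      and s: "\<phi> (rot_rows n i k t A) - \<phi> (rot_rows n i k 0 A) = (t - 0) * D (rot_rows n i k s A)"
      using MVT2[OF t deriv_at[OF A]] by blast
    have "\<bar>D (rot_rows n i k s A)\<bar> \<le> C" using D_bound rot_rows_orthogonal[OF ik A] by auto
    then show ?thesis using s t rot_rows_0[OF ik A] by (simp add: abs_mult mult.commute)
  qed
  \<comment> \<open>Difference quotients at angles tending to 0; each has integral 0 by
    invariance.\<close>
  define f where "f j A = (\<phi> (rot_rows n i k (1 / Suc j) A) - \<phi> A) / (1 / Suc j)" for j :: nat and A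
  have "(\<lambda>j. \<integral>A. f j A \<partial>\<mu>) \<longlonglongrightarrow> (\<integral>A. D A \<partial>\<mu>)"
  proof (rule integral_dominated_convergence[where w = "\<lambda>_. C"])
    show "f j \<in> borel_measurable \<mu>" for j unfolding f_def[abs_def] by measurable
    show "AE A in \<mu>. norm (f j A) \<le> C" for j
      using AE_orthogonal
    proof eventually_elim
      case (elim A)
      have pos: "0 < 1 / real (Suc j)" by simp
      have "\<bar>x / t\<bar> \<le> C" if "\<bar>x\<bar> \<le> C * t" "0 < t" for x t :: real
        using that by (simp add: abs_divide pos_divide_le_eq)
      from this[OF lip[OF elim pos] pos] show ?case by (simp add: f_def)
    qed
    show "AE A in \<mu>. (\<lambda>j. f j A) \<longlonglongrightarrow> D A"
      using AE_orthogonal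
    proof eventually_elim
      case (elim A)
      have "((\<lambda>t. (\<phi> (rot_rows n i k t A) - \<phi> A) / t) \<longlongrightarrow> D A) (at 0)"
        using deriv[OF elim] rot_rows_0[OF ik elim] by (simp add: has_field_derivative_iff)
      moreover have "filterlim (\<lambda>j. 1 / real (Suc j)) (at 0) sequentially"
        using LIMSEQ_inverse_real_of_nat
        by (auto simp: filterlim_at inverse_eq_divide)
      ultimately show ?case unfolding f_def by (rule filterlim_compose)
    qed
  qed auto
  moreover have "(\<integral>A. f j A \<partial>\<mu>) = 0" for j
    unfolding f_def using int\<phi> int_rot inv by simp
  ultimately show ?thesis by (simp add: LIMSEQ_const_iff)
qed

end

subsection \<open>Traces of the resolvent of the Gram matrix\<close>

text \<open>
  For the top p rows z of the first q columns of an orthogonal matrix, \<open>Vmat\<close> with \<open>e = 0\<close> is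
  the Gram matrix of the remaining rows of these columns; the shift by \<open>e\<close> makes it invertible.
\<close>

definition Vmat :: "nat \<Rightarrow> real \<Rightarrow> (nat \<times> nat \<Rightarrow> real) \<Rightarrow> nat \<Rightarrow> nat \<Rightarrow> real"
  where "Vmat p e z c d = (if c = d then 1 + e else 0) - (\<Sum>i<p. z (i, c) * z (i, d))"

definition Kmat :: "nat \<Rightarrow> nat \<Rightarrow> real \<Rightarrow> (nat \<times> nat \<Rightarrow> real) \<Rightarrow> nat \<Rightarrow> nat \<Rightarrow> real"
  where "Kmat p q e z = minv q (Vmat p e z)"

definition Vdet :: "nat \<Rightarrow> nat \<Rightarrow> real \<Rightarrow> (nat \<times> nat \<Rightarrow> real) \<Rightarrow> real"
  where "Vdet p q e z = mdet q (Vmat p e z)"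

lemma Vmat_sym: "Vmat p e z c d = Vmat p e z d c"
  by (simp add: Vmat_def mult.commute)

lemma Kmat_sym: "Vdet p q e z \<noteq> 0 \<Longrightarrow> c < q \<Longrightarrow> d < q \<Longrightarrow> Kmat p q e z c d = Kmat p q e z d c"
  unfolding Kmat_def Vdet_def by (rule minv_sym) (auto simp: Vmat_sym)

lemma sum_if_diag:
  fixes f :: "nat \<Rightarrow> real"
  assumes "c < q"
  shows "(\<Sum>d<q. (if c = d then u else 0) * f d) = u * f c"
    and "(\<Sum>d<q. (if d = c then u else 0) * f d) = u * f c"
    and "(\<Sum>d<q. f d * (if c = d then u else 0)) = u * f c"
    and "(\<Sum>d<q. f d * (if d = c then u else 0)) = u * f c"
  using assms by (simp_all add: if_distrib[where f = "\<lambda>x. x * _"] if_distrib[where f = "(*) _"] cong: if_cong)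

locale haar_block = haar +
  fixes p q :: nat
  assumes q1: "1 \<le> q" and qp: "q \<le> p" and pn: "p \<le> n"
begin

abbreviation K :: "real \<Rightarrow> (nat \<times> nat \<Rightarrow> real) \<Rightarrow> nat \<Rightarrow> nat \<Rightarrow> real"
  where "K e A \<equiv> Kmat p q e A"

text \<open>
  With W the first q columns of A: \<open>Q = K W\<^sup>T\<close>, \<open>P = W K W\<^sup>T\<close>, \<open>P2 = W K\<^sup>2 W\<^sup>T\<close>, and \<open>P3\<close> is the diagonal
  of \<open>W K\<^sup>3 W\<^sup>T\<close>. The diagonal sums over the first p rows are called \<open>\<alpha>\<close>, those over the other rows
  \<open>\<kappa>\<close>, and \<open>\<tau>1 = tr K\<close>, \<open>\<tau>2 = tr K\<^sup>2\<close>.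
\<close>

definition Q :: "real \<Rightarrow> (nat \<times> nat \<Rightarrow> real) \<Rightarrow> nat \<Rightarrow> nat \<Rightarrow> real"
  where "Q e A c a = (\<Sum>d<q. K e A c d * A (a, d))"

definition P :: "real \<Rightarrow> (nat \<times> nat \<Rightarrow> real) \<Rightarrow> nat \<Rightarrow> nat \<Rightarrow> real"
  where "P e A a b = (\<Sum>c<q. A (a, c) * Q e A c b)"

definition P2 :: "real \<Rightarrow> (nat \<times> nat \<Rightarrow> real) \<Rightarrow> nat \<Rightarrow> nat \<Rightarrow> real"
  where "P2 e A a b = (\<Sum>c<q. Q e A c a * Q e A c b)"

definition P3 :: "real \<Rightarrow> (nat \<times> nat \<Rightarrow> real) \<Rightarrow> nat \<Rightarrow> real"
  where "P3 e A a = (\<Sum>c<q. Q e A c a * (\<Sum>d<q. K e A c d * Q e A d a))"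

definition \<alpha>1 :: "real \<Rightarrow> (nat \<times> nat \<Rightarrow> real) \<Rightarrow> real" where "\<alpha>1 e A = (\<Sum>i<p. P e A i i)"
definition \<alpha>2 :: "real \<Rightarrow> (nat \<times> nat \<Rightarrow> real) \<Rightarrow> real" where "\<alpha>2 e A = (\<Sum>i<p. P2 e A i i)"
definition \<alpha>3 :: "real \<Rightarrow> (nat \<times> nat \<Rightarrow> real) \<Rightarrow> real" where "\<alpha>3 e A = (\<Sum>i<p. P3 e A i)"
definition \<kappa>1 :: "real \<Rightarrow> (nat \<times> nat \<Rightarrow> real) \<Rightarrow> real" where "\<kappa>1 e A = (\<Sum>k\<in>{p..<n}. P e A k k)"
definition \<kappa>2 :: "real \<Rightarrow> (nat \<times> nat \<Rightarrow> real) \<Rightarrow> real" where "\<kappa>2 e A = (\<Sum>k\<in>{p..<n}. P2 e A k k)"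
definition \<tau>1 :: "real \<Rightarrow> (nat \<times> nat \<Rightarrow> real) \<Rightarrow> real" where "\<tau>1 e A = (\<Sum>c<q. K e A c c)"
definition \<tau>2 :: "real \<Rightarrow> (nat \<times> nat \<Rightarrow> real) \<Rightarrow> real" where "\<tau>2 e A = (\<Sum>c<q. \<Sum>d<q. (K e A c d)\<^sup>2)"

lemma sum_rows_split: "(\<Sum>a<n. f a) = (\<Sum>i<p. f i) + (\<Sum>k\<in>{p..<n}. f k)"
  for f :: "nat \<Rightarrow> real"
  using pn sum.union_disjoint[of "{..<p}" "{p..<n}" f]
  by (simp add: ivl_disj_un ivl_disj_int)

lemma Vmat_orthogonal:
  assumes "A \<in> orthogonal_mats n" "c < q" "d < q"
  shows "Vmat p e A c d = (\<Sum>k\<in>{p..<n}. A (k, c) * A (k, d)) + (if c = d then e else 0)"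
proof -
  have "(\<Sum>a<n. A (a, c) * A (a, d)) = (if c = d then 1 else 0)"
    using assms qp pn by (simp add: orthogonal_mats_iff)
  then show ?thesis unfolding Vmat_def sum_rows_split by auto
qed

lemma Vmat_quadratic:
  assumes "A \<in> orthogonal_mats n"
  shows "(\<Sum>c<q. v c * (\<Sum>d<q. Vmat p e A c d * v d)) =
    (\<Sum>k\<in>{p..<n}. (\<Sum>c<q. A (k, c) * v c)\<^sup>2) + e * (\<Sum>c<q. (v c)\<^sup>2)"
proof -
  have "(\<Sum>c<q. v c * (\<Sum>d<q. Vmat p e A c d * v d)) =
     (\<Sum>c<q. v c * ((\<Sum>d<q. (\<Sum>k\<in>{p..<n}. A (k, c) * A (k, d)) * v d) + e * v c))"
    using assms by (intro sum.cong refl arg_cong2[where f = "(*)"])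
      (simp add: Vmat_orthogonal distrib_right sum.distrib sum_if_diag)
  also have "\<dots> = (\<Sum>c<q. \<Sum>d<q. \<Sum>k\<in>{p..<n}. (A (k, c) * v c) * (A (k, d) * v d)) + e * (\<Sum>c<q. (v c)\<^sup>2)"
    by (simp add: sum_distrib_left sum_distrib_right distrib_left sum.distrib power2_eq_square ac_simps)
  also have "(\<Sum>c<q. \<Sum>d<q. \<Sum>k\<in>{p..<n}. (A (k, c) * v c) * (A (k, d) * v d)) =
      (\<Sum>c<q. \<Sum>k\<in>{p..<n}. \<Sum>d<q. (A (k, c) * v c) * (A (k, d) * v d))"
    by (rule sum.cong[OF refl], rule sum.swap)
  also have "\<dots> = (\<Sum>k\<in>{p..<n}. \<Sum>c<q. \<Sum>d<q. (A (k, c) * v c) * (A (k, d) * v d))"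
    by (rule sum.swap)
  also have "\<dots> = (\<Sum>k\<in>{p..<n}. (\<Sum>c<q. A (k, c) * v c)\<^sup>2)"
    by (simp add: power2_eq_square sum_product)
  finally show ?thesis .
qed

lemma Vdet_nonzero:
  assumes "A \<in> orthogonal_mats n" "e > 0"
  shows "Vdet p q e A \<noteq> 0"
  unfolding Vdet_def
proof (rule mdet_nonzeroI)
  fix v assume "\<And>a. a < q \<Longrightarrow> (\<Sum>b<q. Vmat p e A a b * v b) = 0"
  then have "(\<Sum>k\<in>{p..<n}. (\<Sum>c<q. A (k, c) * v c)\<^sup>2) + e * (\<Sum>c<q. (v c)\<^sup>2) = 0"
    by (simp add: Vmat_quadratic[OF assms(1), symmetric])
  moreover have "0 \<le> (\<Sum>k\<in>{p..<n}. (\<Sum>c<q. A (k, c) * v c)\<^sup>2)" "0 \<le> e * (\<Sum>c<q. (v c)\<^sup>2)"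
    using assms by (auto intro!: sum_nonneg mult_nonneg_nonneg)
  ultimately have "e * (\<Sum>c<q. (v c)\<^sup>2) = 0" by linarith
  then have "(\<Sum>c<q. (v c)\<^sup>2) = 0" using assms by simp
  then show "\<forall>b<q. v b = 0" by (simp add: sum_nonneg_eq_0_iff)
qed

section \<open>Algebra of the resolvent at a single orthogonal matrix\<close>

context
  fixes A e
  assumes A: "A \<in> orthogonal_mats n" and e: "e \<ge> 0" and nz: "Vdet p q e A \<noteq> 0"
begin

lemma VK: "a < q \<Longrightarrow> b < q \<Longrightarrow> (\<Sum>c<q. Vmat p e A a c * K e A c b) = (if a = b then 1 else 0)"
  using nz unfolding Kmat_def Vdet_def by (rule minv_right)

lemma KV: "a < q \<Longrightarrow> b < q \<Longrightarrow> (\<Sum>c<q. K e A a c * Vmat p e A c b) = (if a = b then 1 else 0)"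
  using nz unfolding Kmat_def Vdet_def by (rule minv_left)

lemma K_sym: "c < q \<Longrightarrow> d < q \<Longrightarrow> K e A c d = K e A d c"
  using nz by (rule Kmat_sym)

lemma VKv: "c < q \<Longrightarrow> (\<Sum>d<q. Vmat p e A c d * (\<Sum>b<q. K e A d b * v b)) = v c"
proof -
  assume "c < q"
  have "(\<Sum>d<q. Vmat p e A c d * (\<Sum>b<q. K e A d b * v b))
      = (\<Sum>b<q. (\<Sum>d<q. Vmat p e A c d * K e A d b) * v b)"
    unfolding sum_distrib_left sum_distrib_right by (subst sum.swap) (simp add: mult.assoc)
  also have "\<dots> = v c" using \<open>c < q\<close> by (simp add: VK sum_if_diag)
  finally show ?thesis .
qed

text \<open>With \<open>u = K v\<close> the quadratic form of \<open>K\<close> at \<open>v\<close> is that of \<open>V + e\<close> at \<open>u\<close>.\<close>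

lemma K_quadratic:
  fixes v :: "nat \<Rightarrow> real"
  defines "u \<equiv> \<lambda>c. \<Sum>d<q. K e A c d * v d"
  shows "(\<Sum>c<q. v c * u c) = (\<Sum>k\<in>{p..<n}. (\<Sum>c<q. A (k, c) * u c)\<^sup>2) + e * (\<Sum>c<q. (u c)\<^sup>2)"
  unfolding Vmat_quadratic[OF A, symmetric]
  using VKv[of _ v] unfolding u_def[symmetric] by (intro sum.cong refl) (simp add: mult.commute u_def)

lemma K_psd: "0 \<le> (\<Sum>c<q. v c * (\<Sum>d<q. K e A c d * v d))"
  unfolding K_quadratic using e by (intro add_nonneg_nonneg sum_nonneg mult_nonneg_nonneg) auto

text \<open>Drops the sum of squares in \<open>K_quadratic\<close>. As an operator inequality it
  reads e K^2 \<le> K, and both \<open>K_entry_bound\<close> and the estimates of the terms carrying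
  e rest on it.\<close>

lemma e_K_le: "e * (\<Sum>c<q. (\<Sum>d<q. K e A c d * v d)\<^sup>2) \<le> (\<Sum>c<q. v c * (\<Sum>d<q. K e A c d * v d))"
  unfolding K_quadratic by (simp add: sum_nonneg)

lemma P_eq_quad: "P e A a a = (\<Sum>c<q. A (a, c) * (\<Sum>d<q. K e A c d * A (a, d)))"
  by (simp add: P_def Q_def)

lemma P_nonneg: "0 \<le> P e A a a"
  unfolding P_eq_quad by (rule K_psd)

lemma P2_nonneg: "0 \<le> P2 e A a a"
  unfolding P2_def by (intro sum_nonneg) simp

lemma P3_nonneg: "0 \<le> P3 e A a"
  unfolding P3_def by (rule K_psd)

lemma e_P2_le: "e * P2 e A a a \<le> P e A a a"
  using e_K_le[of "\<lambda>d. A (a, d)"] by (simp add: P_eq_quad P2_def Q_def power2_eq_square)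

lemma nonneg: "0 \<le> \<alpha>1 e A" "0 \<le> \<alpha>2 e A" "0 \<le> \<alpha>3 e A" "0 \<le> \<kappa>1 e A" "0 \<le> \<kappa>2 e A" "0 \<le> \<tau>2 e A"
  by (auto simp: \<alpha>1_def \<alpha>2_def \<alpha>3_def \<kappa>1_def \<kappa>2_def \<tau>2_def intro!: sum_nonneg P_nonneg P2_nonneg P3_nonneg)

lemma K_diag_nonneg: "c < q \<Longrightarrow> 0 \<le> K e A c c"
  using K_psd[of "\<lambda>d. if d = c then 1 else 0"] by (simp add: sum_delta_mult)

lemma \<tau>1_nonneg: "0 \<le> \<tau>1 e A"
  unfolding \<tau>1_def by (intro sum_nonneg K_diag_nonneg) auto

lemma P_sym: "P e A a b = P e A b a"
proof -
  have "P e A a b = (\<Sum>c<q. \<Sum>d<q. A (a, c) * (K e A c d * A (b, d)))"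
    by (simp add: P_def Q_def sum_distrib_left)
  also have "\<dots> = (\<Sum>d<q. \<Sum>c<q. A (b, d) * (K e A d c * A (a, c)))"
    by (subst sum.swap, intro sum.cong refl) (use K_sym in auto)
  finally show ?thesis by (simp add: P_def Q_def sum_distrib_left)
qed

text \<open>The hidden rows have Gram matrix \<open>Vmat p e\<close> minus e, and K times this is 1
  - e K. The later sums over hidden rows reduce to this cancellation; the terms with e are the price
  of the shift.\<close>

lemma sum_Q_A:
  assumes "c < q" "d < q"
  shows "(\<Sum>k\<in>{p..<n}. Q e A c k * A (k, d)) = (if c = d then 1 else 0) - e * K e A c d"
proof -
  have "(\<Sum>k\<in>{p..<n}. Q e A c k * A (k, d)) = (\<Sum>f<q. K e A c f * (\<Sum>k\<in>{p..<n}. A (k, f) * A (k, d)))"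
    unfolding Q_def sum_distrib_right sum_distrib_left by (subst sum.swap) (simp add: mult.assoc)
  also have "\<dots> = (\<Sum>f<q. K e A c f * (Vmat p e A f d - (if f = d then e else 0)))"
    using assms by (intro sum.cong refl) (simp add: Vmat_orthogonal[OF A])
  also have "\<dots> = (if c = d then 1 else 0) - e * K e A c d"
    using assms by (simp add: right_diff_distrib sum_subtractf KV sum_if_diag)
  finally show ?thesis .
qed

lemma sum_Q_P:
  assumes "c < q"
  shows "(\<Sum>k\<in>{p..<n}. Q e A c k * P e A k b) = Q e A c b - e * (\<Sum>d<q. K e A c d * Q e A d b)"
proof -
  have "(\<Sum>k\<in>{p..<n}. Q e A c k * P e A k b) = (\<Sum>d<q. (\<Sum>k\<in>{p..<n}. Q e A c k * A (k, d)) * Q e A d b)"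
    unfolding P_def sum_distrib_right sum_distrib_left by (subst sum.swap) (simp add: mult.assoc)
  also have "\<dots> = (\<Sum>d<q. ((if c = d then 1 else 0) - e * K e A c d) * Q e A d b)"
    using assms by (intro sum.cong refl) (simp add: sum_Q_A)
  also have "\<dots> = Q e A c b - e * (\<Sum>d<q. K e A c d * Q e A d b)"
    using assms by (simp add: left_diff_distrib sum_subtractf sum_if_diag sum_distrib_left mult.assoc)
  finally show ?thesis .
qed

lemma sum_A_Q: "a < n \<Longrightarrow> (\<Sum>c<q. A (a, c) * (\<Sum>d<q. K e A c d * Q e A d b)) = P2 e A a b"
proof -
  have "(\<Sum>c<q. A (a, c) * (\<Sum>d<q. K e A c d * Q e A d b)) = (\<Sum>d<q. (\<Sum>c<q. K e A d c * A (a, c)) * Q e A d b)"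
    unfolding sum_distrib_left sum_distrib_right
    by (subst sum.swap, intro sum.cong refl) (use K_sym in auto)
  then show ?thesis by (simp add: P2_def Q_def)
qed

lemma sum_P_P:
  assumes "a < n"
  shows "(\<Sum>k\<in>{p..<n}. P e A a k * P e A k b) = P e A a b - e * P2 e A a b"
proof -
  have "(\<Sum>k\<in>{p..<n}. P e A a k * P e A k b) = (\<Sum>c<q. A (a, c) * (\<Sum>k\<in>{p..<n}. Q e A c k * P e A k b))"
    unfolding P_def[of e A a] sum_distrib_right sum_distrib_left by (subst sum.swap) (simp add: mult.assoc)
  also have "\<dots> = (\<Sum>c<q. A (a, c) * (Q e A c b - e * (\<Sum>d<q. K e A c d * Q e A d b)))"
    by (intro sum.cong refl) (simp add: sum_Q_P)
  also have "\<dots> = P e A a b - e * (\<Sum>c<q. A (a, c) * (\<Sum>d<q. K e A c d * Q e A d b))"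
    by (simp add: P_def right_diff_distrib sum_subtractf sum_distrib_left ac_simps)
  finally show ?thesis using assms by (simp add: sum_A_Q)
qed

lemma sum_P_P2: "(\<Sum>k\<in>{p..<n}. P e A i k * P2 e A i k) = P2 e A i i - e * P3 e A i"
proof -
  have "(\<Sum>k\<in>{p..<n}. P e A i k * P2 e A i k) = (\<Sum>k\<in>{p..<n}. P e A k i * P2 e A i k)"
    by (subst P_sym) simp
  also have "\<dots> = (\<Sum>c<q. Q e A c i * (\<Sum>k\<in>{p..<n}. Q e A c k * P e A k i))"
    unfolding P2_def sum_distrib_left by (subst sum.swap) (simp add: ac_simps)
  also have "\<dots> = (\<Sum>c<q. Q e A c i * (Q e A c i - e * (\<Sum>d<q. K e A c d * Q e A d i)))"
    by (intro sum.cong refl) (simp add: sum_Q_P)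
  also have "\<dots> = P2 e A i i - e * P3 e A i"
    by (simp add: P2_def P3_def right_diff_distrib sum_subtractf sum_distrib_left ac_simps)
  finally show ?thesis .
qed

text \<open>By \<open>sum_Q_A\<close>, \<kappa>1 is the trace of 1 - e K and \<kappa>2 that of K (1
  - e K). At e = 0 the hidden part of tr(W K W^T) is therefore the constant q.\<close>

lemma \<kappa>1_eq: "\<kappa>1 e A = real q - e * \<tau>1 e A"
proof -
  have "\<kappa>1 e A = (\<Sum>c<q. \<Sum>k\<in>{p..<n}. Q e A c k * A (k, c))"
    unfolding \<kappa>1_def P_def by (subst sum.swap) (simp add: mult.commute)
  also have "\<dots> = (\<Sum>c<q. 1 - e * K e A c c)"
    by (intro sum.cong refl) (simp add: sum_Q_A)
  finally show ?thesis by (simp add: sum_subtractf \<tau>1_def sum_distrib_left)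
qed

lemma \<kappa>2_eq: "\<kappa>2 e A = \<tau>1 e A - e * \<tau>2 e A"
proof -
  have "(\<Sum>k\<in>{p..<n}. Q e A c k * Q e A c k) = K e A c c - e * (\<Sum>d<q. (K e A c d)\<^sup>2)" if "c < q" for c
  proof -
    have "(\<Sum>k\<in>{p..<n}. Q e A c k * Q e A c k) = (\<Sum>k\<in>{p..<n}. Q e A c k * (\<Sum>d<q. K e A c d * A (k, d)))"
      by (simp add: Q_def)
    also have "\<dots> = (\<Sum>d<q. K e A c d * (\<Sum>k\<in>{p..<n}. Q e A c k * A (k, d)))"
      unfolding sum_distrib_left by (subst sum.swap) (simp add: ac_simps)
    also have "\<dots> = (\<Sum>d<q. K e A c d * ((if c = d then 1 else 0) - e * K e A c d))"
      using that by (intro sum.cong refl) (simp add: sum_Q_A)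
    finally show ?thesis
      using that by (simp add: right_diff_distrib sum_subtractf sum_if_diag sum_distrib_left power2_eq_square ac_simps)
  qed
  then have "(\<Sum>c<q. \<Sum>k\<in>{p..<n}. Q e A c k * Q e A c k) = \<tau>1 e A - e * \<tau>2 e A"
    by (simp add: \<tau>1_def \<tau>2_def sum_subtractf sum_distrib_left)
  moreover have "\<kappa>2 e A = (\<Sum>c<q. \<Sum>k\<in>{p..<n}. Q e A c k * Q e A c k)"
    unfolding \<kappa>2_def P2_def by (rule sum.swap)
  ultimately show ?thesis by simp
qed

lemma sum_cols: "c < q \<Longrightarrow> d < q \<Longrightarrow> (\<Sum>a<n. A (a, c) * A (a, d)) = (if c = d then 1 else 0)"
  using A qp pn by (simp add: orthogonal_mats_iff)

text \<open>Over all rows the Gram matrix of the columns is 1 rather than V, so full sums give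
  traces of powers of K without terms in e.\<close>

lemma sum_all_Q_A: "c < q \<Longrightarrow> d < q \<Longrightarrow> (\<Sum>a<n. Q e A c a * A (a, d)) = K e A c d"
proof -
  assume cd: "c < q" "d < q"
  have "(\<Sum>a<n. Q e A c a * A (a, d)) = (\<Sum>f<q. K e A c f * (\<Sum>a<n. A (a, f) * A (a, d)))"
    unfolding Q_def sum_distrib_right sum_distrib_left by (subst sum.swap) (simp add: mult.assoc)
  also have "\<dots> = K e A c d" using cd by (simp add: sum_cols sum_if_diag)
  finally show ?thesis .
qed

lemma \<alpha>1_\<kappa>1: "\<alpha>1 e A + \<kappa>1 e A = \<tau>1 e A"
proof -
  have "\<alpha>1 e A + \<kappa>1 e A = (\<Sum>a<n. P e A a a)" by (simp add: sum_rows_split \<alpha>1_def \<kappa>1_def)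
  also have "\<dots> = (\<Sum>c<q. \<Sum>a<n. Q e A c a * A (a, c))"
    unfolding P_def by (subst sum.swap) (simp add: mult.commute)
  also have "\<dots> = \<tau>1 e A" unfolding \<tau>1_def by (intro sum.cong refl) (simp add: sum_all_Q_A)
  finally show ?thesis .
qed

lemma \<alpha>2_\<kappa>2: "\<alpha>2 e A + \<kappa>2 e A = \<tau>2 e A"
proof -
  have "\<alpha>2 e A + \<kappa>2 e A = (\<Sum>a<n. P2 e A a a)" by (simp add: sum_rows_split \<alpha>2_def \<kappa>2_def)
  also have "\<dots> = (\<Sum>c<q. \<Sum>a<n. Q e A c a * (\<Sum>d<q. K e A c d * A (a, d)))"
    unfolding P2_def by (subst sum.swap) (simp add: Q_def)
  also have "\<dots> = (\<Sum>c<q. \<Sum>d<q. K e A c d * (\<Sum>a<n. Q e A c a * A (a, d)))"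
    unfolding sum_distrib_left by (rule sum.cong[OF refl], subst sum.swap) (simp add: ac_simps)
  also have "\<dots> = \<tau>2 e A"
    unfolding \<tau>2_def by (intro sum.cong refl) (simp add: sum_all_Q_A power2_eq_square)
  finally show ?thesis .
qed

end

end

subsection \<open>Integration by parts on the orthogonal group\<close>

context haar
begin

text \<open>The class of test functions: bounded where the measure lives. It is closed under the
  algebraic operations, so integrability of the polynomial expressions below is settled by their
  syntax, provided e > 0.\<close>

definition nice :: "((nat \<times> nat \<Rightarrow> real) \<Rightarrow> real) \<Rightarrow> bool"
  where "nice \<phi> \<longleftrightarrow> \<phi> \<in> borel_measurable \<mu> \<and> (\<exists>C. \<forall>A\<in>orthogonal_mats n. \<bar>\<phi> A\<bar> \<le> C)"

lemma niceE:
  assumes "nice \<phi>"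
  obtains C where "\<phi> \<in> borel_measurable \<mu>" "\<And>A. A \<in> orthogonal_mats n \<Longrightarrow> \<bar>\<phi> A\<bar> \<le> C"
  using assms by (auto simp: nice_def)

lemma nice_integrable: "nice \<phi> \<Longrightarrow> integrable \<mu> \<phi>"
  by (elim niceE, rule integrable_const_bound)
    (use AE_orthogonal in \<open>auto elim: eventually_mono\<close>)

lemma nice_const: "nice (\<lambda>A. c)"
  by (auto simp: nice_def)

lemma nice_add:
  assumes "nice f" "nice g"
  shows "nice (\<lambda>A. f A + g A)"
proof -
  obtain C where f: "f \<in> borel_measurable \<mu>" "\<And>A. A \<in> orthogonal_mats n \<Longrightarrow> \<bar>f A\<bar> \<le> C"
    using assms unfolding nice_def by blast
  obtain D where g: "g \<in> borel_measurable \<mu>" "\<And>A. A \<in> orthogonal_mats n \<Longrightarrow> \<bar>g A\<bar> \<le> D"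
    using assms unfolding nice_def by blast
  have "\<bar>f A + g A\<bar> \<le> C + D" if "A \<in> orthogonal_mats n" for A
    using f(2)[OF that] g(2)[OF that] by linarith
  then show ?thesis using f g by (auto simp: nice_def)
qed

lemma nice_mult:
  assumes "nice f" "nice g"
  shows "nice (\<lambda>A. f A * g A)"
proof -
  obtain C where f: "f \<in> borel_measurable \<mu>" "\<And>A. A \<in> orthogonal_mats n \<Longrightarrow> \<bar>f A\<bar> \<le> C"
    using assms unfolding nice_def by blast
  obtain D where g: "g \<in> borel_measurable \<mu>" "\<And>A. A \<in> orthogonal_mats n \<Longrightarrow> \<bar>g A\<bar> \<le> D"
    using assms unfolding nice_def by blast
  have "\<bar>f A * g A\<bar> \<le> C * D" if "A \<in> orthogonal_mats n" for A
    unfolding abs_mult using f(2)[OF that] g(2)[OF that]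
    by (intro mult_mono) (auto intro: order_trans[OF abs_ge_zero])
  then show ?thesis using f g by (auto simp: nice_def)
qed

lemma nice_uminus: "nice f \<Longrightarrow> nice (\<lambda>A. - f A)"
  using nice_mult[OF nice_const[of "-1"]] by simp

lemma nice_diff: "nice f \<Longrightarrow> nice g \<Longrightarrow> nice (\<lambda>A. f A - g A)"
  using nice_add[OF _ nice_uminus] by simp

lemma nice_sum: "(\<And>i. i \<in> I \<Longrightarrow> nice (f i)) \<Longrightarrow> nice (\<lambda>A. \<Sum>i\<in>I. f i A)"
  by (induction I rule: infinite_finite_induct) (auto intro: nice_const nice_add)

lemma nice_prod: "(\<And>i. i \<in> I \<Longrightarrow> nice (f i)) \<Longrightarrow> nice (\<lambda>A. \<Prod>i\<in>I. f i A)"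
  by (induction I rule: infinite_finite_induct) (auto intro: nice_const nice_mult)

lemma nice_power: "nice f \<Longrightarrow> nice (\<lambda>A. f A ^ j)"
  by (induction j) (auto intro: nice_const nice_mult)

lemma integral_cong_orthogonal:
  fixes f g :: "_ \<Rightarrow> real"
  assumes "\<And>A. A \<in> orthogonal_mats n \<Longrightarrow> f A = g A" "nice f" "nice g"
  shows "(\<integral>A. f A \<partial>\<mu>) = (\<integral>A. g A \<partial>\<mu>)"
  by (rule integral_cong_AE) (use assms AE_orthogonal in \<open>auto elim!: eventually_mono niceE\<close>)

lemma nice_entry: "a < n \<Longrightarrow> c < n \<Longrightarrow> nice (\<lambda>A. A (a, c))"
  unfolding nice_def using orthogonal_mats_entry_le[of _ n a c] by (intro conjI exI[of _ 1] ballI measurable_entry)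

lemma integral_rotation_nice:
  assumes "i \<noteq> k" "i < n" "k < n" "nice \<phi>" "nice D"
    and "\<And>A. A \<in> orthogonal_mats n \<Longrightarrow>
      ((\<lambda>t. \<phi> (rot_rows n i k t A)) has_real_derivative D A) (at 0)"
  shows "(\<integral>A. D A \<partial>\<mu>) = 0"
proof -
  obtain C where f: "\<phi> \<in> borel_measurable \<mu>" "\<And>A. A \<in> orthogonal_mats n \<Longrightarrow> \<bar>\<phi> A\<bar> \<le> C"
    using assms unfolding nice_def by blast
  obtain C' where g: "D \<in> borel_measurable \<mu>" "\<And>A. A \<in> orthogonal_mats n \<Longrightarrow> \<bar>D A\<bar> \<le> C'"
    using assms unfolding nice_def by blast
  show ?thesis
    by (rule integral_rotation_derivative[OF assms(1-3) f(1) g(1) assms(6) f(2) g(2)])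
qed

end

context haar_block
begin

text \<open>Apply e K^2 \<le> K to the unit vector d: e times the squared norm of column d is at
  most \<open>K e A d d\<close>. Taking c = d bounds the diagonal entry by 1/e, and then every entry
  of the column.\<close>

lemma K_entry_bound:
  assumes A: "A \<in> orthogonal_mats n" and e: "e > 0" and cd: "c < q" "d < q"
  shows "\<bar>K e A c d\<bar> \<le> 1 / e"
proof -
  note nz = Vdet_nonzero[OF A e]
  have u: "(\<Sum>b<q. K e A c' b * (if b = d then 1 else 0)) = K e A c' d" for c'
    using cd by (simp add: sum_delta_mult)
  have main: "e * (\<Sum>c<q. (K e A c d)\<^sup>2) \<le> K e A d d"
    using e_K_le[OF A _ nz, of "\<lambda>b. if b = d then 1 else 0"] e cd by (simp add: u sum_delta_mult)
  have le: "e * (K e A c d)\<^sup>2 \<le> K e A d d" if "c < q" for c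
    using that e by (intro order_trans[OF mult_left_mono main] member_le_sum) auto
  have "K e A d d \<le> 1 / e"
  proof (rule ccontr)
    assume "\<not> ?thesis"
    then have gt: "1 / e < K e A d d" by simp
    have *: "1 < e * K e A d d" using gt e by (simp add: pos_divide_less_eq mult.commute)
    have pos: "0 < K e A d d" using gt e by (intro less_trans[OF _ gt]) simp
    from * pos have "1 * K e A d d < (e * K e A d d) * K e A d d" by (intro mult_strict_right_mono) auto
    then show False using le[OF cd(2)] by (simp add: power2_eq_square)
  qed
  then have "e * (K e A c d)\<^sup>2 \<le> 1 / e" using le[OF cd(1)] by simp
  then have "(K e A c d)\<^sup>2 \<le> 1 / e / e" using e by (subst pos_le_divide_eq) (simp_all add: mult.commute)
  also have "\<dots> = (1 / e)\<^sup>2" by (simp add: power2_eq_square)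
  finally have "\<bar>K e A c d\<bar> \<le> \<bar>1 / e\<bar>" by (simp only: abs_le_square_iff)
  then show ?thesis using e by simp
qed

lemma q_le_n: "c < q \<Longrightarrow> c < n" and p_le_n: "i < p \<Longrightarrow> i < n"
  using qp pn by auto

lemma measurable_Vmat[measurable]:
  "c < q \<Longrightarrow> d < q \<Longrightarrow> (\<lambda>A. Vmat p e A c d) \<in> borel_measurable \<mu>"
  unfolding Vmat_def
  by (intro borel_measurable_diff borel_measurable_const borel_measurable_sum borel_measurable_times
      measurable_entry) (auto simp: q_le_n p_le_n)

lemma measurable_K[measurable]:
  "c < q \<Longrightarrow> d < q \<Longrightarrow> (\<lambda>A. K e A c d) \<in> borel_measurable \<mu>"
  unfolding Kmat_def by (intro borel_measurable_minv measurable_Vmat)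

lemma measurable_Vdet[measurable]: "(\<lambda>A. Vdet p q e A) \<in> borel_measurable \<mu>"
  unfolding Vdet_def by (intro borel_measurable_mdet measurable_Vmat)

lemma nice_K: "e > 0 \<Longrightarrow> c < q \<Longrightarrow> d < q \<Longrightarrow> nice (\<lambda>A. K e A c d)"
  unfolding nice_def using K_entry_bound[of _ e c d] by (intro conjI exI[of _ "1 / e"] ballI measurable_K)

lemma nice_Q: "e > 0 \<Longrightarrow> c < q \<Longrightarrow> a < n \<Longrightarrow> nice (\<lambda>A. Q e A c a)"
  unfolding Q_def by (intro nice_sum nice_mult nice_K nice_entry) (auto simp: q_le_n)

lemma nice_P: "e > 0 \<Longrightarrow> a < n \<Longrightarrow> b < n \<Longrightarrow> nice (\<lambda>A. P e A a b)"
  unfolding P_def by (intro nice_sum nice_mult nice_Q nice_entry) (auto simp: q_le_n)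

lemma nice_P2: "e > 0 \<Longrightarrow> a < n \<Longrightarrow> b < n \<Longrightarrow> nice (\<lambda>A. P2 e A a b)"
  unfolding P2_def by (intro nice_sum nice_mult nice_Q nice_entry) (auto simp: q_le_n)

lemma nice_P3: "e > 0 \<Longrightarrow> a < n \<Longrightarrow> nice (\<lambda>A. P3 e A a)"
  unfolding P3_def by (intro nice_sum nice_mult nice_Q nice_K) (auto simp: q_le_n)

lemma nice_traces:
  assumes "e > 0"
  shows "nice (\<alpha>1 e)" "nice (\<alpha>2 e)" "nice (\<alpha>3 e)" "nice (\<kappa>1 e)" "nice (\<kappa>2 e)" "nice (\<tau>1 e)" "nice (\<tau>2 e)"
  unfolding \<alpha>1_def[abs_def] \<alpha>2_def[abs_def] \<alpha>3_def[abs_def] \<kappa>1_def[abs_def] \<kappa>2_def[abs_def]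
    \<tau>1_def[abs_def] \<tau>2_def[abs_def]
  by (intro nice_sum nice_P nice_P2 nice_P3 nice_K nice_power assms; auto simp: p_le_n)+

lemma measurable_Q[measurable]: "c < q \<Longrightarrow> a < n \<Longrightarrow> (\<lambda>A. Q e A c a) \<in> borel_measurable \<mu>"
  unfolding Q_def by (intro borel_measurable_sum borel_measurable_times measurable_K measurable_entry)
    (auto simp: q_le_n)

lemma measurable_traces[measurable]:
  "\<alpha>1 e \<in> borel_measurable \<mu>" "\<alpha>2 e \<in> borel_measurable \<mu>"
  "\<tau>1 e \<in> borel_measurable \<mu>" "\<tau>2 e \<in> borel_measurable \<mu>"
  unfolding \<alpha>1_def[abs_def] \<alpha>2_def[abs_def] \<tau>1_def[abs_def] \<tau>2_def[abs_def] P_def P2_def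
  by (intro borel_measurable_sum borel_measurable_times borel_measurable_power
      measurable_K measurable_Q measurable_entry; auto simp: p_le_n q_le_n)+

section \<open>Derivatives along the rotation of a block row i and a hidden row k\<close>

context
  fixes A e i k
  assumes A: "A \<in> orthogonal_mats n" and e: "e \<ge> 0" and nz: "Vdet p q e A \<noteq> 0"
    and i: "i < p" and k: "k \<in> {p..<n}"
begin

lemma ik: "i \<noteq> k" "i < n" "k < n"
  using i k by auto

lemma rot0: "rot_rows n i k 0 A = A"
  by (rule rot_rows_0[OF ik A])

lemma DERIV_row_i: "c < q \<Longrightarrow> ((\<lambda>t. rot_rows n i k t A (i, c)) has_real_derivative A (k, c)) (at 0)"
  using DERIV_rot_rows[OF ik A ik(2), of c] by (simp add: q_le_n)

lemma DERIV_row_k: "c < q \<Longrightarrow> ((\<lambda>t. rot_rows n i k t A (k, c)) has_real_derivative - A (i, c)) (at 0)"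
  using DERIV_rot_rows[OF ik A ik(3), of c] ik(1) by (simp add: q_le_n)

lemma DERIV_top: "j < p \<Longrightarrow> c < q \<Longrightarrow>
    ((\<lambda>t. rot_rows n i k t A (j, c)) has_real_derivative (if j = i then A (k, c) else 0)) (at 0)"
  using DERIV_rot_rows[OF ik A, of j c] i k by (simp add: q_le_n p_le_n split: if_splits)

lemma DERIV_Vmat:
  assumes "c < q" "d < q"
  shows "((\<lambda>t. Vmat p e (rot_rows n i k t A) c d) has_real_derivative
    - (A (i, c) * A (k, d) + A (k, c) * A (i, d))) (at 0)"
proof -
  have "((\<lambda>t. Vmat p e (rot_rows n i k t A) c d) has_real_derivative
    0 - (\<Sum>j<p. A (j, c) * (if j = i then A (k, d) else 0) + (if j = i then A (k, c) else 0) * A (j, d))) (at 0)"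
    unfolding Vmat_def
    by (intro DERIV_diff DERIV_const DERIV_sum DERIV_mult'[THEN DERIV_cong, OF DERIV_top DERIV_top])
      (use assms in \<open>auto simp: rot0\<close>)
  then show ?thesis
    using i by (simp add: sum.distrib if_distrib[where f = "\<lambda>x. x * _"] if_distrib[where f = "(*) _"] cong: if_cong)
qed

lemma Q_K: "c < q \<Longrightarrow> (\<Sum>d<q. A (a, d) * K e A d c) = Q e A c a"
  unfolding Q_def using K_sym[OF A e nz] by (intro sum.cong) auto

text \<open>To first order V changes by - (x_i y_k^T + y_k x_i^T), where x_i and y_k are the two
  rows. Multiplying by K on both sides turns the rows into columns of Q and reverses the
  sign.\<close>

lemma DERIV_K:
  assumes "c < q" "d < q"
  shows "((\<lambda>t. K e (rot_rows n i k t A) c d) has_real_derivative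
    Q e A c i * Q e A d k + Q e A c k * Q e A d i) (at 0)"
proof -
  have "((\<lambda>t. K e (rot_rows n i k t A) c d) has_real_derivative
    - (\<Sum>f<q. \<Sum>g<q. minv q (Vmat p e (rot_rows n i k 0 A)) c f
       * (- (A (i, f) * A (k, g) + A (k, f) * A (i, g))) * minv q (Vmat p e (rot_rows n i k 0 A)) g d)) (at 0)"
    unfolding Kmat_def
    using assms nz by (intro DERIV_minv DERIV_Vmat) (simp_all add: rot0 Vdet_def)
  moreover have "(\<Sum>f<q. \<Sum>g<q. minv q (Vmat p e (rot_rows n i k 0 A)) c f
       * (- (A (i, f) * A (k, g) + A (k, f) * A (i, g))) * minv q (Vmat p e (rot_rows n i k 0 A)) g d)
     = - ((\<Sum>f<q. \<Sum>g<q. (K e A c f * A (i, f)) * (A (k, g) * K e A g d))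
       + (\<Sum>f<q. \<Sum>g<q. (K e A c f * A (k, f)) * (A (i, g) * K e A g d)))"
    by (simp add: rot0 Kmat_def sum_negf[symmetric] sum.distrib[symmetric] algebra_simps)
  ultimately show ?thesis
    using assms by (simp add: sum_product[symmetric] Q_K Q_def[symmetric] add.commute)
qed

lemma DERIV_Vdet:
  "((\<lambda>t. Vdet p q e (rot_rows n i k t A)) has_real_derivative - 2 * Vdet p q e A * P e A i k) (at 0)"
proof -
  have "((\<lambda>t. Vdet p q e (rot_rows n i k t A)) has_real_derivative
     mdet q (Vmat p e (rot_rows n i k 0 A)) * (\<Sum>a<q. \<Sum>b<q. minv q (Vmat p e (rot_rows n i k 0 A)) a b
       * (- (A (i, b) * A (k, a) + A (k, b) * A (i, a))))) (at 0)"
    unfolding Vdet_def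
    using nz by (intro DERIV_mdet DERIV_Vmat) (simp_all add: rot0 Vdet_def)
  moreover have "(\<Sum>a<q. \<Sum>b<q. K e A a b * (- (A (i, b) * A (k, a) + A (k, b) * A (i, a))))
     = - (P e A k i + P e A i k)"
    by (simp add: P_def Q_def sum_distrib_left sum_negf[symmetric] sum.distrib[symmetric] algebra_simps)
  ultimately show ?thesis
    using P_sym[OF A e nz, of k i] by (simp add: rot0 Vdet_def Kmat_def algebra_simps)
qed

lemma DERIV_Q_k:
  assumes "c < q"
  shows "((\<lambda>t. Q e (rot_rows n i k t A) c k) has_real_derivative
    Q e A c i * P e A k k + Q e A c k * P e A i k - Q e A c i) (at 0)"
proof -
  have "((\<lambda>t. Q e (rot_rows n i k t A) c k) has_real_derivative
    (\<Sum>d<q. K e A c d * (- A (i, d)) + (Q e A c i * Q e A d k + Q e A c k * Q e A d i) * A (k, d))) (at 0)"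
    unfolding Q_def[of e "rot_rows n i k _ A"]
    by (intro DERIV_sum DERIV_mult'[THEN DERIV_cong, OF DERIV_K DERIV_row_k])
      (use assms in \<open>auto simp: rot0\<close>)
  moreover have "(\<Sum>d<q. K e A c d * (- A (i, d)) + (x * Q e A d k + y * Q e A d i) * A (k, d))
    = x * P e A k k + y * P e A k i - Q e A c i" for x y
    unfolding Q_def[of e A c i] P_def sum_distrib_left sum.distrib[symmetric] sum_subtractf[symmetric]
    by (intro sum.cong refl) (simp add: algebra_simps)
  ultimately show ?thesis using P_sym[OF A e nz, of k i] by simp
qed

lemma DERIV_Q_i:
  assumes "c < q"
  shows "((\<lambda>t. Q e (rot_rows n i k t A) c i) has_real_derivative
    Q e A c i * P e A i k + Q e A c k * P e A i i + Q e A c k) (at 0)"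
proof -
  have "((\<lambda>t. Q e (rot_rows n i k t A) c i) has_real_derivative
    (\<Sum>d<q. K e A c d * A (k, d) + (Q e A c i * Q e A d k + Q e A c k * Q e A d i) * A (i, d))) (at 0)"
    unfolding Q_def[of e "rot_rows n i k _ A"]
    by (intro DERIV_sum DERIV_mult'[THEN DERIV_cong, OF DERIV_K DERIV_row_i])
      (use assms in \<open>auto simp: rot0\<close>)
  moreover have "(\<Sum>d<q. K e A c d * A (k, d) + (x * Q e A d k + y * Q e A d i) * A (i, d))
    = x * P e A i k + y * P e A i i + Q e A c k" for x y
    unfolding Q_def[of e A c k] P_def sum_distrib_left sum.distrib[symmetric] sum_subtractf[symmetric]
    by (intro sum.cong refl) (simp add: algebra_simps)
  ultimately show ?thesis by simp
qed

lemma DERIV_P: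
  "((\<lambda>t. P e (rot_rows n i k t A) i k) has_real_derivative
    P e A k k - P e A i i + P e A i i * P e A k k + (P e A i k)\<^sup>2) (at 0)"
proof -
  have "((\<lambda>t. P e (rot_rows n i k t A) i k) has_real_derivative
    (\<Sum>c<q. A (i, c) * (Q e A c i * P e A k k + Q e A c k * P e A i k - Q e A c i)
       + A (k, c) * Q e A c k)) (at 0)"
    unfolding P_def[of e "rot_rows n i k _ A"]
    by (intro DERIV_sum DERIV_mult'[THEN DERIV_cong, OF DERIV_row_i DERIV_Q_k]) (auto simp: rot0)
  moreover have "(\<Sum>c<q. A (i, c) * (Q e A c i * P e A k k + Q e A c k * P e A i k - Q e A c i)
       + A (k, c) * Q e A c k) = P e A k k - P e A i i + P e A i i * P e A k k + (P e A i k)\<^sup>2"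
  proof -
    have "(\<Sum>c<q. A (i, c) * (Q e A c i * x + Q e A c k * y - Q e A c i) + A (k, c) * Q e A c k)
      = P e A i i * x + P e A i k * y - P e A i i + P e A k k" for x y
      unfolding P_def sum_distrib_right sum.distrib[symmetric] sum_subtractf[symmetric]
      by (intro sum.cong refl) (simp add: algebra_simps)
    then show ?thesis by (simp add: power2_eq_square)
  qed
  ultimately show ?thesis by simp
qed

lemma DERIV_P2:
  "((\<lambda>t. P2 e (rot_rows n i k t A) i k) has_real_derivative
    P2 e A k k - P2 e A i i + P e A i i * P2 e A k k + P2 e A i i * P e A k k
      + 2 * (P e A i k * P2 e A i k)) (at 0)"
proof -
  have "((\<lambda>t. P2 e (rot_rows n i k t A) i k) has_real_derivative
    (\<Sum>c<q. Q e A c i * (Q e A c i * P e A k k + Q e A c k * P e A i k - Q e A c i)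
       + (Q e A c i * P e A i k + Q e A c k * P e A i i + Q e A c k) * Q e A c k)) (at 0)"
    unfolding P2_def[of e "rot_rows n i k _ A"]
    by (intro DERIV_sum DERIV_mult'[THEN DERIV_cong, OF DERIV_Q_i DERIV_Q_k]) (auto simp: rot0)
  moreover have "(\<Sum>c<q. Q e A c i * (Q e A c i * P e A k k + Q e A c k * P e A i k - Q e A c i)
       + (Q e A c i * P e A i k + Q e A c k * P e A i i + Q e A c k) * Q e A c k)
    = P2 e A k k - P2 e A i i + P e A i i * P2 e A k k + P2 e A i i * P e A k k
      + 2 * (P e A i k * P2 e A i k)"
  proof -
    have "(\<Sum>c<q. Q e A c i * (Q e A c i * x + Q e A c k * y - Q e A c i)
       + (Q e A c i * y + Q e A c k * z + Q e A c k) * Q e A c k)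
      = P2 e A i i * x + P2 e A i k * y - P2 e A i i + P2 e A i k * y + P2 e A k k * z + P2 e A k k" for x y z
      unfolding P2_def sum_distrib_right sum.distrib[symmetric] sum_subtractf[symmetric]
      by (intro sum.cong refl) (simp add: algebra_simps)
    then show ?thesis by simp
  qed
  ultimately show ?thesis by simp
qed

lemma DERIV_\<tau>1:
  "((\<lambda>t. \<tau>1 e (rot_rows n i k t A)) has_real_derivative 2 * P2 e A i k) (at 0)"
proof -
  have "((\<lambda>t. \<tau>1 e (rot_rows n i k t A)) has_real_derivative
    (\<Sum>c<q. Q e A c i * Q e A c k + Q e A c k * Q e A c i)) (at 0)"
    unfolding \<tau>1_def by (intro DERIV_sum DERIV_K) auto
  then show ?thesis by (simp add: P2_def sum_distrib_left algebra_simps)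
qed

end

section \<open>Integration by parts summed over all pairs of a block row and a hidden row\<close>

lemma integral_double_sum_zero:
  assumes "\<And>i k. i < p \<Longrightarrow> k \<in> {p..<n} \<Longrightarrow> nice (D i k)"
    and "\<And>i k. i < p \<Longrightarrow> k \<in> {p..<n} \<Longrightarrow> (\<integral>A. D i k A \<partial>\<mu>) = 0"
  shows "(\<integral>A. (\<Sum>i<p. \<Sum>k\<in>{p..<n}. D i k A) \<partial>\<mu>) = 0"
proof -
  have "(\<integral>A. (\<Sum>i<p. \<Sum>k\<in>{p..<n}. D i k A) \<partial>\<mu>) = (\<Sum>i<p. \<integral>A. (\<Sum>k\<in>{p..<n}. D i k A) \<partial>\<mu>)"
    using assms(1) by (intro Bochner_Integration.integral_sum nice_integrable nice_sum) auto
  also have "\<dots> = (\<Sum>i<p. \<Sum>k\<in>{p..<n}. \<integral>A. D i k A \<partial>\<mu>)"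
    using assms(1) by (intro sum.cong refl Bochner_Integration.integral_sum nice_integrable) auto
  finally show ?thesis using assms(2) by simp
qed

lemma sum_sum_const: "(\<Sum>i<p. \<Sum>k\<in>{p..<n}. f k) = real p * (\<Sum>k\<in>{p..<n}. f k)"
  "(\<Sum>i<p. \<Sum>k\<in>{p..<n}. g i) = (real n - real p) * (\<Sum>i<p. g i)"
  for f g :: "nat \<Rightarrow> real"
  using pn by (simp_all add: sum_distrib_left of_nat_diff)

lemma sum_P_sq:
  assumes "A \<in> orthogonal_mats n" "e \<ge> 0" "Vdet p q e A \<noteq> 0" "i < n"
  shows "(\<Sum>k\<in>{p..<n}. (P e A i k)\<^sup>2) = P e A i i - e * P2 e A i i"
proof -
  have "(P e A i k)\<^sup>2 = P e A i k * P e A k i" for k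
    using P_sym[OF assms(1-3), of k i] by (simp add: power2_eq_square)
  then show ?thesis using sum_P_P[OF assms, of i] by simp
qed

lemma sum_D_a:
  assumes A: "A \<in> orthogonal_mats n" and e: "e > 0"
  shows "(\<Sum>i<p. \<Sum>k\<in>{p..<n}. P e A k k - P e A i i + P e A i i * P e A k k + (P e A i k)\<^sup>2)
     = real p * \<kappa>1 e A - (real n - real p) * \<alpha>1 e A + \<alpha>1 e A * \<kappa>1 e A + \<alpha>1 e A - e * \<alpha>2 e A"
proof -
  note nz = Vdet_nonzero[OF A e]
  have "(\<Sum>k\<in>{p..<n}. (P e A i k)\<^sup>2) = P e A i i - e * P2 e A i i" if "i < p" for i
    using e p_le_n[OF that] by (intro sum_P_sq A nz) auto
  then have 1: "(\<Sum>i<p. \<Sum>k\<in>{p..<n}. (P e A i k)\<^sup>2) = \<alpha>1 e A - e * \<alpha>2 e A"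
    by (simp add: \<alpha>1_def \<alpha>2_def sum_subtractf sum_distrib_left)
  have 2: "(\<Sum>i<p. \<Sum>k\<in>{p..<n}. P e A i i * P e A k k) = \<alpha>1 e A * \<kappa>1 e A"
    by (simp add: \<alpha>1_def \<kappa>1_def sum_product)
  show ?thesis
    unfolding sum.distrib sum_subtractf 1 2
    by (simp only: sum_sum_const) (simp add: \<alpha>1_def[symmetric] \<kappa>1_def[symmetric])
qed

text \<open>Tested with the mixed entry \<open>P e A i k\<close>. Its derivative involves only
  diagonal entries and the square of the mixed entry, so that the double sum is a polynomial in
  traces.\<close>

lemma identity_a:
  assumes "e > 0"
  shows "(\<integral>A. (real p * \<kappa>1 e A - (real n - real p) * \<alpha>1 e A + \<alpha>1 e A * \<kappa>1 e A + \<alpha>1 e A - e * \<alpha>2 e A) \<partial>\<mu>) = 0"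
proof -
  define D where "D i k A = P e A k k - P e A i i + P e A i i * P e A k k + (P e A i k)\<^sup>2" for i k A
  have n: "nice (D i k)" if "i < p" "k \<in> {p..<n}" for i k
    unfolding D_def[abs_def] using that
    by (intro nice_add nice_diff nice_mult nice_power nice_P assms) (auto simp: p_le_n)
  have "(\<integral>A. (\<Sum>i<p. \<Sum>k\<in>{p..<n}. D i k A) \<partial>\<mu>) = 0"
  proof (rule integral_double_sum_zero[OF n])
    fix i k assume ik: "i < p" "k \<in> {p..<n}"
    show "(\<integral>A. D i k A \<partial>\<mu>) = 0"
    proof (rule integral_rotation_nice[OF _ _ _ _ n[OF ik], where \<phi> = "\<lambda>A. P e A i k"])
      show "nice (\<lambda>A. P e A i k)"
        using ik by (intro nice_P assms) (auto simp: p_le_n)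
      fix A assume A: "A \<in> orthogonal_mats n"
      show "((\<lambda>t. P e (rot_rows n i k t A) i k) has_real_derivative D i k A) (at 0)"
        unfolding D_def using assms ik by (intro DERIV_P A Vdet_nonzero) auto
    qed (use ik in \<open>auto simp: p_le_n\<close>)
  qed
  moreover have "(\<Sum>i<p. \<Sum>k\<in>{p..<n}. D i k A)
     = real p * \<kappa>1 e A - (real n - real p) * \<alpha>1 e A + \<alpha>1 e A * \<kappa>1 e A + \<alpha>1 e A - e * \<alpha>2 e A"
    if A: "A \<in> orthogonal_mats n" for A
    unfolding D_def by (rule sum_D_a[OF A assms])
  moreover have "nice (\<lambda>A. \<Sum>i<p. \<Sum>k\<in>{p..<n}. D i k A)"
    by (intro nice_sum n) auto
  moreover have "nice (\<lambda>A. real p * \<kappa>1 e A - (real n - real p) * \<alpha>1 e A + \<alpha>1 e A * \<kappa>1 e A + \<alpha>1 e A - e * \<alpha>2 e A)"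
    by (intro nice_add nice_diff nice_mult nice_const nice_traces assms)
  ultimately show ?thesis
    using integral_cong_orthogonal[of "\<lambda>A. real p * \<kappa>1 e A - (real n - real p) * \<alpha>1 e A + \<alpha>1 e A * \<kappa>1 e A + \<alpha>1 e A - e * \<alpha>2 e A" "\<lambda>A. \<Sum>i<p. \<Sum>k\<in>{p..<n}. D i k A"]
    by simp
qed

lemma sum_D_b:
  assumes A: "A \<in> orthogonal_mats n" and e: "e > 0"
  shows "(\<Sum>i<p. \<Sum>k\<in>{p..<n}. P e A i k * P2 e A i k) = \<alpha>2 e A - e * \<alpha>3 e A"
  using sum_P_P2[OF A _ Vdet_nonzero[OF A e]] e
  by (simp add: \<alpha>2_def \<alpha>3_def sum_subtractf sum_distrib_left)

text \<open>Tested with \<open>P2 e A i k\<close>. The result contains the mixed moment of \<alpha>1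
  and \<kappa>2, where \<kappa>2 is \<tau>1 up to a term in e, so it does not determine the
  expectation of \<alpha>2 by itself.\<close>

lemma identity_b:
  assumes "e > 0"
  shows "(\<integral>A. (real p * \<kappa>2 e A - (real n - real p) * \<alpha>2 e A + \<alpha>1 e A * \<kappa>2 e A + \<alpha>2 e A * \<kappa>1 e A
    + 2 * (\<alpha>2 e A - e * \<alpha>3 e A)) \<partial>\<mu>) = 0"
proof -
  define D where "D i k A = P2 e A k k - P2 e A i i + P e A i i * P2 e A k k + P2 e A i i * P e A k k
      + 2 * (P e A i k * P2 e A i k)" for i k A
  have n: "nice (D i k)" if "i < p" "k \<in> {p..<n}" for i k
    unfolding D_def[abs_def] using that
    by (intro nice_add nice_diff nice_mult nice_power nice_P nice_P2 nice_const assms) (auto simp: p_le_n)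
  have "(\<integral>A. (\<Sum>i<p. \<Sum>k\<in>{p..<n}. D i k A) \<partial>\<mu>) = 0"
  proof (rule integral_double_sum_zero[OF n])
    fix i k assume ik: "i < p" "k \<in> {p..<n}"
    show "(\<integral>A. D i k A \<partial>\<mu>) = 0"
    proof (rule integral_rotation_nice[OF _ _ _ _ n[OF ik], where \<phi> = "\<lambda>A. P2 e A i k"])
      show "nice (\<lambda>A. P2 e A i k)"
        using ik by (intro nice_P2 assms) (auto simp: p_le_n)
      fix A assume A: "A \<in> orthogonal_mats n"
      show "((\<lambda>t. P2 e (rot_rows n i k t A) i k) has_real_derivative D i k A) (at 0)"
        unfolding D_def using assms ik by (intro DERIV_P2 A Vdet_nonzero) auto
    qed (use ik in \<open>auto simp: p_le_n\<close>)
  qed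
  moreover have "(\<Sum>i<p. \<Sum>k\<in>{p..<n}. D i k A)
     = real p * \<kappa>2 e A - (real n - real p) * \<alpha>2 e A + \<alpha>1 e A * \<kappa>2 e A + \<alpha>2 e A * \<kappa>1 e A
    + 2 * (\<alpha>2 e A - e * \<alpha>3 e A)"
    if A: "A \<in> orthogonal_mats n" for A
  proof -
    have "(\<Sum>i<p. \<Sum>k\<in>{p..<n}. P e A i i * P2 e A k k) = \<alpha>1 e A * \<kappa>2 e A"
      "(\<Sum>i<p. \<Sum>k\<in>{p..<n}. P2 e A i i * P e A k k) = \<alpha>2 e A * \<kappa>1 e A"
      by (simp_all add: \<alpha>1_def \<kappa>2_def \<alpha>2_def \<kappa>1_def sum_product)
    then show ?thesis
      unfolding D_def sum.distrib sum_subtractf sum_sum_const sum_distrib_left[symmetric] sum_D_b[OF A assms]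
      by (simp add: \<alpha>2_def[symmetric] \<kappa>2_def[symmetric])
  qed
  moreover have "nice (\<lambda>A. \<Sum>i<p. \<Sum>k\<in>{p..<n}. D i k A)"
    by (intro nice_sum n) auto
  moreover have "nice (\<lambda>A. real p * \<kappa>2 e A - (real n - real p) * \<alpha>2 e A + \<alpha>1 e A * \<kappa>2 e A + \<alpha>2 e A * \<kappa>1 e A + 2 * (\<alpha>2 e A - e * \<alpha>3 e A))"
    by (intro nice_add nice_diff nice_mult nice_const nice_traces assms)
  ultimately show ?thesis
    using integral_cong_orthogonal[of "\<lambda>A. real p * \<kappa>2 e A - (real n - real p) * \<alpha>2 e A + \<alpha>1 e A * \<kappa>2 e A + \<alpha>2 e A * \<kappa>1 e A + 2 * (\<alpha>2 e A - e * \<alpha>3 e A)" "\<lambda>A. \<Sum>i<p. \<Sum>k\<in>{p..<n}. D i k A"]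
    by simp
qed

text \<open>Tested with \<open>P e A i k\<close> times \<tau>1. This is the second relation between
  \<alpha>2 and the mixed moment of \<alpha>1 and \<tau>1; differentiating \<tau>1 contributes the
  terms in \<alpha>2 and \<alpha>3.\<close>

lemma identity_c:
  assumes "e > 0"
  shows "(\<integral>A. ((real p * \<kappa>1 e A - (real n - real p) * \<alpha>1 e A + \<alpha>1 e A * \<kappa>1 e A + \<alpha>1 e A - e * \<alpha>2 e A) * \<tau>1 e A
    + 2 * (\<alpha>2 e A - e * \<alpha>3 e A)) \<partial>\<mu>) = 0"
proof -
  define D where "D i k A = (P e A k k - P e A i i + P e A i i * P e A k k + (P e A i k)\<^sup>2) * \<tau>1 e A
      + 2 * (P e A i k * P2 e A i k)" for i k A
  have n: "nice (D i k)" if "i < p" "k \<in> {p..<n}" for i k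
    unfolding D_def[abs_def] using that
    by (intro nice_add nice_diff nice_mult nice_power nice_P nice_P2 nice_const nice_traces assms) (auto simp: p_le_n)
  have "(\<integral>A. (\<Sum>i<p. \<Sum>k\<in>{p..<n}. D i k A) \<partial>\<mu>) = 0"
  proof (rule integral_double_sum_zero[OF n])
    fix i k assume ik: "i < p" "k \<in> {p..<n}"
    show "(\<integral>A. D i k A \<partial>\<mu>) = 0"
    proof (rule integral_rotation_nice[OF _ _ _ _ n[OF ik], where \<phi> = "\<lambda>A. P e A i k * \<tau>1 e A"])
      show "nice (\<lambda>A. P e A i k * \<tau>1 e A)"
        using ik by (intro nice_mult nice_P nice_traces assms) (auto simp: p_le_n)
      fix A assume A: "A \<in> orthogonal_mats n"
      note D = DERIV_P[OF A _ Vdet_nonzero[OF A assms] ik] DERIV_\<tau>1[OF A _ Vdet_nonzero[OF A assms] ik]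
      show "((\<lambda>t. P e (rot_rows n i k t A) i k * \<tau>1 e (rot_rows n i k t A)) has_real_derivative D i k A) (at 0)"
        using DERIV_mult'[OF D] assms rot0[OF A _ Vdet_nonzero[OF A assms] ik]
        by (simp add: D_def algebra_simps)
    qed (use ik in \<open>auto simp: p_le_n\<close>)
  qed
  moreover have "(\<Sum>i<p. \<Sum>k\<in>{p..<n}. D i k A)
     = (real p * \<kappa>1 e A - (real n - real p) * \<alpha>1 e A + \<alpha>1 e A * \<kappa>1 e A + \<alpha>1 e A - e * \<alpha>2 e A) * \<tau>1 e A
    + 2 * (\<alpha>2 e A - e * \<alpha>3 e A)"
    if A: "A \<in> orthogonal_mats n" for A
  proof -
    have gen: "(\<Sum>i<p. \<Sum>k\<in>{p..<n}. X i k * t + 2 * Y i k) =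
      (\<Sum>i<p. \<Sum>k\<in>{p..<n}. X i k) * t + 2 * (\<Sum>i<p. \<Sum>k\<in>{p..<n}. Y i k)"
      for X Y :: "nat \<Rightarrow> nat \<Rightarrow> real" and t
      by (simp add: sum.distrib sum_distrib_right sum_distrib_left)
    have "(\<Sum>i<p. \<Sum>k\<in>{p..<n}. D i k A) =
      (\<Sum>i<p. \<Sum>k\<in>{p..<n}. P e A k k - P e A i i + P e A i i * P e A k k + (P e A i k)\<^sup>2) * \<tau>1 e A
      + 2 * (\<Sum>i<p. \<Sum>k\<in>{p..<n}. P e A i k * P2 e A i k)"
      unfolding D_def by (rule gen)
    then show ?thesis by (simp only: sum_D_a[OF A assms] sum_D_b[OF A assms])
  qed
  moreover have "nice (\<lambda>A. \<Sum>i<p. \<Sum>k\<in>{p..<n}. D i k A)"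
    by (intro nice_sum n) auto
  moreover have "nice (\<lambda>A. (real p * \<kappa>1 e A - (real n - real p) * \<alpha>1 e A + \<alpha>1 e A * \<kappa>1 e A + \<alpha>1 e A - e * \<alpha>2 e A) * \<tau>1 e A + 2 * (\<alpha>2 e A - e * \<alpha>3 e A))"
    by (intro nice_add nice_diff nice_mult nice_const nice_traces assms)
  ultimately show ?thesis
    using integral_cong_orthogonal[of "\<lambda>A. (real p * \<kappa>1 e A - (real n - real p) * \<alpha>1 e A + \<alpha>1 e A * \<kappa>1 e A + \<alpha>1 e A - e * \<alpha>2 e A) * \<tau>1 e A + 2 * (\<alpha>2 e A - e * \<alpha>3 e A)" "\<lambda>A. \<Sum>i<p. \<Sum>k\<in>{p..<n}. D i k A"]
    by simp
qed

end

section \<open>Moment bounds uniform in e\<close>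

context haar_block
begin

definition m :: real where "m = real n - real p - real q - 1"

lemma \<kappa>1_le:
  assumes "A \<in> orthogonal_mats n" "e \<ge> 0" "Vdet p q e A \<noteq> 0"
  shows "\<kappa>1 e A \<le> real q"
  using \<kappa>1_eq[OF assms] \<tau>1_nonneg[OF assms] assms(2) by simp

lemma \<kappa>2_le:
  assumes "A \<in> orthogonal_mats n" "e \<ge> 0" "Vdet p q e A \<noteq> 0"
  shows "\<kappa>2 e A \<le> \<tau>1 e A"
  using \<kappa>2_eq[OF assms] nonneg(6)[OF assms] assms(2) by simp

lemma integral_le_orthogonal:
  assumes "\<And>A. A \<in> orthogonal_mats n \<Longrightarrow> f A \<le> g A" "nice f" "nice g"
  shows "(\<integral>A. f A \<partial>\<mu>) \<le> (\<integral>A. g A \<partial>\<mu>)"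
  by (rule integral_mono_AE) (use assms AE_orthogonal nice_integrable in \<open>auto elim: eventually_mono\<close>)

text \<open>All corrections in \<open>identity_a\<close> have a favourable sign, since \<kappa>1
  \<le> q and e \<alpha>2 \<ge> 0. Dropping them leaves q + 1 - (n - p) = - m as the coefficient of
  \<alpha>1.\<close>

lemma expectation_\<alpha>1_le:
  assumes e: "e > 0"
  shows "m * (\<integral>A. \<alpha>1 e A \<partial>\<mu>) \<le> real p * real q"
proof -
  have "0 \<le> (\<integral>A. real p * real q - m * \<alpha>1 e A \<partial>\<mu>)"
    unfolding identity_a[OF e, symmetric]
  proof (rule integral_le_orthogonal)
    fix A assume A: "A \<in> orthogonal_mats n"
    note nz = Vdet_nonzero[OF A e] and e0 = less_imp_le[OF e]
    note nn = nonneg[OF A e0 nz] and k1 = \<kappa>1_le[OF A e0 nz]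
    have "real p * \<kappa>1 e A \<le> real p * real q" "\<alpha>1 e A * \<kappa>1 e A \<le> \<alpha>1 e A * real q"
      using k1 nn by (auto intro: mult_left_mono)
    moreover have "0 \<le> e * \<alpha>2 e A" using nn e by simp
    ultimately show "real p * \<kappa>1 e A - (real n - real p) * \<alpha>1 e A + \<alpha>1 e A * \<kappa>1 e A + \<alpha>1 e A - e * \<alpha>2 e A
      \<le> real p * real q - m * \<alpha>1 e A"
      by (simp add: m_def algebra_simps)
  qed (intro nice_add nice_diff nice_mult nice_const nice_traces e)+
  also have "\<dots> = real p * real q - m * (\<integral>A. \<alpha>1 e A \<partial>\<mu>)"
    using nice_integrable[OF nice_traces(1)[OF e]] by (simp add: prob_space)
  finally show ?thesis by simp
qed

lemma expectation_\<tau>1_le: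
  assumes e: "e > 0"
  shows "(\<integral>A. \<tau>1 e A \<partial>\<mu>) \<le> real q + (\<integral>A. \<alpha>1 e A \<partial>\<mu>)"
proof -
  have "(\<integral>A. \<tau>1 e A \<partial>\<mu>) \<le> (\<integral>A. real q + \<alpha>1 e A \<partial>\<mu>)"
  proof (rule integral_le_orthogonal)
    fix A assume A: "A \<in> orthogonal_mats n"
    note nz = Vdet_nonzero[OF A e] and e0 = less_imp_le[OF e]
    show "\<tau>1 e A \<le> real q + \<alpha>1 e A"
      using \<kappa>1_le[OF A e0 nz] \<alpha>1_\<kappa>1[OF A e0 nz] by simp
  qed (intro nice_add nice_const nice_traces e)+
  then show ?thesis
    using nice_integrable[OF nice_traces(1)[OF e]] by (simp add: prob_space)
qed

text \<open>One-sided forms of \<open>identity_b\<close>, \<open>identity_c\<close> and of the bound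
  on \<tau>1. Multiplying the first by m eliminates the mixed moment b, and m > 2 makes the
  remaining coefficient m (m - 1) - 2 = (m - 2) (m + 1) positive.\<close>

lemma expectation_\<alpha>2_le:
  assumes e: "e > 0" and m2: "m > 2"
  shows "(\<integral>A. \<alpha>2 e A \<partial>\<mu>) \<le> real p * real q * (m + p) * (m + q) / (m * (m - 2) * (m + 1))"
proof -
  define a where "a = (\<integral>A. \<alpha>2 e A \<partial>\<mu>)"
  define b where "b = (\<integral>A. \<alpha>1 e A * \<tau>1 e A \<partial>\<mu>)"
  define t where "t = (\<integral>A. \<tau>1 e A \<partial>\<mu>)"
  note int = nice_traces(1,2,6)[OF e, THEN nice_integrable]
    nice_mult[OF nice_traces(1,6)[OF e], THEN nice_integrable]
  have "0 \<le> (\<integral>A. real p * \<tau>1 e A - (m - 1) * \<alpha>2 e A + \<alpha>1 e A * \<tau>1 e A \<partial>\<mu>)"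
    unfolding identity_b[OF e, symmetric]
  proof (rule integral_le_orthogonal)
    fix A assume A: "A \<in> orthogonal_mats n"
    note nz = Vdet_nonzero[OF A e] and e0 = less_imp_le[OF e]
    note nn = nonneg[OF A e0 nz] and k1 = \<kappa>1_le[OF A e0 nz] and k2 = \<kappa>2_le[OF A e0 nz]
    have "real p * \<kappa>2 e A \<le> real p * \<tau>1 e A" "\<alpha>1 e A * \<kappa>2 e A \<le> \<alpha>1 e A * \<tau>1 e A"
      "\<alpha>2 e A * \<kappa>1 e A \<le> \<alpha>2 e A * real q" "0 \<le> e * \<alpha>3 e A"
      using k1 k2 nn e by (auto intro: mult_left_mono)
    then show "real p * \<kappa>2 e A - (real n - real p) * \<alpha>2 e A + \<alpha>1 e A * \<kappa>2 e A + \<alpha>2 e A * \<kappa>1 e A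
        + 2 * (\<alpha>2 e A - e * \<alpha>3 e A) \<le> real p * \<tau>1 e A - (m - 1) * \<alpha>2 e A + \<alpha>1 e A * \<tau>1 e A"
      by (simp add: m_def algebra_simps)
  qed (intro nice_add nice_diff nice_mult nice_const nice_traces e)+
  also have "\<dots> = real p * t - (m - 1) * a + b"
    using int by (simp add: a_def b_def t_def)
  finally have 1: "(m - 1) * a \<le> real p * t + b" by simp
  have "0 \<le> (\<integral>A. real p * real q * \<tau>1 e A - m * (\<alpha>1 e A * \<tau>1 e A) + 2 * \<alpha>2 e A \<partial>\<mu>)"
    unfolding identity_c[OF e, symmetric]
  proof (rule integral_le_orthogonal)
    fix A assume A: "A \<in> orthogonal_mats n"
    note nz = Vdet_nonzero[OF A e] and e0 = less_imp_le[OF e]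
    note nn = nonneg[OF A e0 nz] and k1 = \<kappa>1_le[OF A e0 nz] and t = \<tau>1_nonneg[OF A e0 nz]
    have "real p * \<kappa>1 e A \<le> real p * real q" "\<alpha>1 e A * \<kappa>1 e A \<le> \<alpha>1 e A * real q"
      using k1 nn by (auto intro: mult_left_mono)
    moreover have "0 \<le> e * \<alpha>2 e A" "0 \<le> e * \<alpha>3 e A" using nn e by simp_all
    ultimately have "real p * \<kappa>1 e A - (real n - real p) * \<alpha>1 e A + \<alpha>1 e A * \<kappa>1 e A + \<alpha>1 e A - e * \<alpha>2 e A
      \<le> real p * real q - m * \<alpha>1 e A" "0 \<le> e * \<alpha>3 e A"
      by (simp_all add: m_def algebra_simps)
    from mult_right_mono[OF this(1) t] this(2)
    show "(real p * \<kappa>1 e A - (real n - real p) * \<alpha>1 e A + \<alpha>1 e A * \<kappa>1 e A + \<alpha>1 e A - e * \<alpha>2 e A) * \<tau>1 e A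
        + 2 * (\<alpha>2 e A - e * \<alpha>3 e A) \<le> real p * real q * \<tau>1 e A - m * (\<alpha>1 e A * \<tau>1 e A) + 2 * \<alpha>2 e A"
      by (simp add: left_diff_distrib mult.assoc)
  qed (intro nice_add nice_diff nice_mult nice_const nice_traces e)+
  also have "\<dots> = real p * real q * t - m * b + 2 * a"
    using int by (simp add: a_def b_def t_def)
  finally have 2: "m * b \<le> real p * real q * t + 2 * a" by simp
  have "m * t \<le> m * (real q + (\<integral>A. \<alpha>1 e A \<partial>\<mu>))"
    unfolding t_def using expectation_\<tau>1_le[OF e] m2 by (intro mult_left_mono) auto
  then have 3: "m * t \<le> m * real q + real p * real q"
    using expectation_\<alpha>1_le[OF e] by (simp add: distrib_left)
  have "m * ((m - 1) * a) \<le> m * (real p * t + b)"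
    using 1 m2 by (intro mult_left_mono) auto
  then have "(m - 2) * (m + 1) * a \<le> real p * (m + q) * t"
    using 2 by (simp add: algebra_simps)
  then have "m * ((m - 2) * (m + 1) * a) \<le> m * (real p * (m + q) * t)"
    using m2 by (intro mult_left_mono) auto
  also have "\<dots> = real p * (m + q) * (m * t)" by simp
  also have "\<dots> \<le> real p * (m + q) * (m * real q + real p * real q)"
    using m2 by (intro mult_left_mono 3) auto
  finally have "a * (m * (m - 2) * (m + 1)) \<le> real p * real q * (m + p) * (m + q)"
    by (simp add: algebra_simps)
  then show ?thesis
    unfolding a_def[symmetric] using m2 by (subst pos_le_divide_eq) auto
qed

subsection \<open>Removing the regularisation\<close>

text \<open>A kernel vector of V is an eigenvector of K with eigenvalue 1/e. Comparison with the
  Frobenius norm gives \<tau>2 \<ge> 1/e^2, and e \<tau>2 \<le> \<tau>1 because \<kappa>2 \<ge>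
  0.\<close>

lemma singular_\<tau>1:
  assumes A: "A \<in> orthogonal_mats n" and sing: "Vdet p q 0 A = 0" and e: "e > 0"
  shows "1 / e \<le> \<tau>1 e A"
proof -
  note nz = Vdet_nonzero[OF A e] and e0 = less_imp_le[OF e]
  obtain v b where v: "\<And>a. a < q \<Longrightarrow> (\<Sum>b<q. Vmat p 0 A a b * v b) = 0" and b: "b < q" "v b \<noteq> 0"
    using mdet_nonzeroI[of q "Vmat p 0 A"] sing unfolding Vdet_def by blast
  have Ve: "(\<Sum>b<q. Vmat p e A a b * v b) = e * v a" if "a < q" for a
  proof -
    have "(\<Sum>b<q. Vmat p e A a b * v b) = (\<Sum>b<q. Vmat p 0 A a b * v b) + (\<Sum>b<q. (if a = b then e else 0) * v b)"
      unfolding sum.distrib[symmetric] by (intro sum.cong refl) (auto simp: Vmat_def algebra_simps)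
    then show ?thesis using that v by (simp add: sum_if_diag)
  qed
  have Kv: "(\<Sum>d<q. K e A c d * v d) = v c / e" if "c < q" for c
  proof -
    have "v c = (\<Sum>b<q. (\<Sum>a<q. K e A c a * Vmat p e A a b) * v b)"
      using that by (simp add: KV[OF A e0 nz] sum_if_diag)
    also have "\<dots> = (\<Sum>a<q. K e A c a * (\<Sum>b<q. Vmat p e A a b * v b))"
      unfolding sum_distrib_left sum_distrib_right by (subst sum.swap) (simp add: mult.assoc)
    also have "\<dots> = (\<Sum>a<q. K e A c a * (e * v a))"
      by (intro sum.cong refl) (simp add: Ve)
    also have "\<dots> = e * (\<Sum>a<q. K e A c a * v a)"
      by (simp add: sum_distrib_left ac_simps)
    finally show ?thesis using e by (simp add: field_simps)
  qed
  define s where "s = (\<Sum>c<q. (v c)\<^sup>2)"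
  have s: "s > 0"
    unfolding s_def using b by (intro sum_pos2[of _ b]) auto
  have "s / e\<^sup>2 = (\<Sum>c<q. (\<Sum>d<q. K e A c d * v d)\<^sup>2)"
    by (simp add: Kv s_def sum_divide_distrib power_divide)
  also have "\<dots> \<le> (\<Sum>c<q. (\<Sum>d<q. (K e A c d)\<^sup>2) * (\<Sum>d<q. (v d)\<^sup>2))"
    by (intro sum_mono Cauchy_Schwarz_ineq_sum)
  also have "\<dots> = \<tau>2 e A * s" by (simp add: \<tau>2_def s_def sum_distrib_right)
  finally have "(1 / e\<^sup>2) * s \<le> \<tau>2 e A * s" by simp
  then have "1 / e\<^sup>2 \<le> \<tau>2 e A"
    using s by (rule mult_right_le_imp_le)
  then have "e * (1 / e\<^sup>2) \<le> e * \<tau>2 e A" using e by (intro mult_left_mono) auto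
  moreover have "e * (1 / e\<^sup>2) = 1 / e" using e by (simp add: power2_eq_square)
  moreover have "e * \<tau>2 e A \<le> \<tau>1 e A"
    using \<kappa>2_eq[OF A e0 nz] nonneg(5)[OF A e0 nz] by simp
  ultimately show ?thesis by linarith
qed

text \<open>On the singular set \<tau>1 is at least 1/e, while its expectation is bounded
  independently of e. As in Markov's inequality, the probability of that set is at most a fixed
  multiple of every e > 0.\<close>

lemma AE_nonsingular:
  assumes m0: "m > 0"
  shows "AE A in \<mu>. Vdet p q 0 A \<noteq> 0"
proof -
  define S where "S = {A \<in> space \<mu>. Vdet p q 0 A = 0}"
  have S[measurable]: "S \<in> sets \<mu>" unfolding S_def by measurable
  define c where "c = real q + real p * real q / m"
  have bound: "prob S \<le> e * c" if e: "e > 0" for e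
  proof -
    have "prob S / e = (\<integral>A. indicator S A / e \<partial>\<mu>)"
      by simp
    also have "\<dots> \<le> (\<integral>A. \<tau>1 e A \<partial>\<mu>)"
    proof (rule integral_mono_AE)
      show "AE A in \<mu>. indicator S A / e \<le> \<tau>1 e A"
        using AE_orthogonal
      proof eventually_elim
        case (elim A)
        then show ?case
          using singular_\<tau>1[OF elim _ e] \<tau>1_nonneg[OF elim _ Vdet_nonzero[OF elim e]] e
          by (auto simp: S_def indicator_def)
      qed
      show "integrable \<mu> (\<lambda>A. indicator S A / e)"
        by (rule integrable_const_bound[where B = "1 / e"]) (use e in \<open>auto simp: indicator_def\<close>)
    qed (rule nice_integrable[OF nice_traces(6)[OF e]])
    also have "\<dots> \<le> c"
    proof -
      have "(\<integral>A. \<alpha>1 e A \<partial>\<mu>) \<le> real p * real q / m"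
        using expectation_\<alpha>1_le[OF e] m0 by (simp add: pos_le_divide_eq mult.commute)
      then show ?thesis using expectation_\<tau>1_le[OF e] by (simp add: c_def)
    qed
    finally show ?thesis using e by (simp add: field_simps)
  qed
  have "((\<lambda>e. e * c) \<longlongrightarrow> 0 * c) (at_right 0)"
    by (intro tendsto_intros)
  then have "prob S \<le> 0 * c"
    by (rule tendsto_lowerbound) (auto simp: eventually_at_right_less bound intro!: eventually_at_rightI[of 0 1])
  then have "prob S = 0" using measure_nonneg[of \<mu> S] by linarith
  then have "S \<in> null_sets \<mu>" by (simp add: emeasure_eq_measure null_setsI)
  then show ?thesis by (rule AE_I'[of S]) (auto simp: S_def)
qed

context
  fixes A and e :: real
  assumes A: "A \<in> orthogonal_mats n" and e: "e > 0" and nz0: "Vdet p q 0 A \<noteq> 0"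
begin

lemma K_resolvent:
  assumes "c < q"
  shows "(\<Sum>d<q. K 0 A c d * v d) = (\<Sum>d<q. K e A c d * v d) + e * (\<Sum>d<q. K 0 A c d * (\<Sum>b<q. K e A d b * v b))"
proof -
  have V: "Vmat p e A f g - Vmat p 0 A f g = (if f = g then e else 0)" for f g
    by (simp add: Vmat_def)
  have ent: "K 0 A c d = K e A c d + e * (\<Sum>f<q. K 0 A c f * K e A f d)" if "d < q" for d
  proof -
    have "K 0 A c d - K e A c d = (\<Sum>f<q. \<Sum>g<q. K 0 A c f * (Vmat p e A f g - Vmat p 0 A f g) * K e A g d)"
      unfolding Kmat_def using nz0 Vdet_nonzero[OF A e] assms that
      by (intro minv_diff) (auto simp: Vdet_def)
    also have "\<dots> = (\<Sum>f<q. K 0 A c f * (\<Sum>g<q. (if f = g then e else 0) * K e A g d))"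
      unfolding V by (simp add: mult.assoc sum_distrib_left)
    also have "\<dots> = e * (\<Sum>f<q. K 0 A c f * K e A f d)"
      by (simp add: sum_if_diag sum_distrib_left ac_simps)
    finally show ?thesis by simp
  qed
  have "(\<Sum>d<q. K 0 A c d * v d) = (\<Sum>d<q. (K e A c d + e * (\<Sum>f<q. K 0 A c f * K e A f d)) * v d)"
    using ent by (intro sum.cong refl) simp
  also have "\<dots> = (\<Sum>d<q. K e A c d * v d) + e * (\<Sum>d<q. \<Sum>f<q. K 0 A c f * (K e A f d * v d))"
    by (simp add: distrib_right sum.distrib sum_distrib_left sum_distrib_right mult.assoc)
  also have "(\<Sum>d<q. \<Sum>f<q. K 0 A c f * (K e A f d * v d)) = (\<Sum>d<q. K 0 A c d * (\<Sum>b<q. K e A d b * v b))"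
    unfolding sum_distrib_left by (subst sum.swap) simp
  finally show ?thesis .
qed

text \<open>Antitonicity of the inverse without eigenvalues. With u = K_e v, w = K_0 v and y = K_0 u
  the resolvent identity says w = u + e y, and the two quadratic forms differ by e <w, u> = e |u|^2
  + e^2 <u, y>.\<close>

lemma K_mono: "(\<Sum>c<q. v c * (\<Sum>d<q. K e A c d * v d)) \<le> (\<Sum>c<q. v c * (\<Sum>d<q. K 0 A c d * v d))"
proof -
  define u where "u c = (\<Sum>d<q. K e A c d * v d)" for c
  define w where "w c = (\<Sum>d<q. K 0 A c d * v d)" for c
  define y where "y c = (\<Sum>d<q. K 0 A c d * u d)" for c
  have w: "w c = u c + e * y c" if "c < q" for c
    using K_resolvent[OF that, of v] by (simp add: w_def u_def y_def)
  have sym: "(\<Sum>c<q. v c * y c) = (\<Sum>c<q. w c * u c)"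
  proof -
    have "(\<Sum>c<q. v c * y c) = (\<Sum>d<q. \<Sum>c<q. (K 0 A d c * v c) * u d)"
      unfolding y_def sum_distrib_left
      by (subst sum.swap, intro sum.cong refl) (use K_sym[OF A _ nz0] in auto)
    then show ?thesis by (simp add: w_def sum_distrib_right)
  qed
  have "(\<Sum>c<q. v c * w c) = (\<Sum>c<q. v c * u c) + e * (\<Sum>c<q. w c * u c)"
    unfolding sym[symmetric] sum_distrib_left sum.distrib[symmetric]
    by (intro sum.cong refl) (simp add: w algebra_simps)
  moreover have "(\<Sum>c<q. w c * u c) = (\<Sum>c<q. (u c)\<^sup>2) + e * (\<Sum>c<q. u c * y c)"
    unfolding sum_distrib_left sum.distrib[symmetric]
    by (intro sum.cong refl) (simp add: w algebra_simps power2_eq_square)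
  moreover have "0 \<le> (\<Sum>c<q. u c * y c)"
    unfolding y_def by (rule K_psd[OF A _ nz0]) simp
  ultimately show ?thesis
    unfolding u_def[symmetric] w_def[symmetric] using e by (simp add: sum_nonneg)
qed

lemma K_sq_mono: "(\<Sum>c<q. (\<Sum>d<q. K e A c d * v d)\<^sup>2) \<le> (\<Sum>c<q. (\<Sum>d<q. K 0 A c d * v d)\<^sup>2)"
proof -
  define u where "u c = (\<Sum>d<q. K e A c d * v d)" for c
  define w where "w c = (\<Sum>d<q. K 0 A c d * v d)" for c
  define y where "y c = (\<Sum>d<q. K 0 A c d * u d)" for c
  have w: "w c = u c + e * y c" if "c < q" for c
    using K_resolvent[OF that, of v] by (simp add: w_def u_def y_def)
  have "(\<Sum>c<q. (w c)\<^sup>2) = (\<Sum>c<q. (u c)\<^sup>2) + 2 * e * (\<Sum>c<q. u c * y c) + e\<^sup>2 * (\<Sum>c<q. (y c)\<^sup>2)"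
    unfolding sum_distrib_left sum.distrib[symmetric]
    by (intro sum.cong refl) (simp add: w algebra_simps power2_eq_square)
  moreover have "0 \<le> (\<Sum>c<q. u c * y c)"
    unfolding y_def by (rule K_psd[OF A _ nz0]) simp
  ultimately show ?thesis
    unfolding u_def[symmetric] w_def[symmetric] using e by (simp add: sum_nonneg)
qed

text \<open>The operator inequality e K \<le> 1: expand |v - e u|^2 \<ge> 0 for u = K v and use e
  |u|^2 \<le> <v, u>.\<close>

lemma e_K_le_id: "e * (\<Sum>c<q. v c * (\<Sum>d<q. K e A c d * v d)) \<le> (\<Sum>c<q. (v c)\<^sup>2)"
proof -
  define u where "u c = (\<Sum>d<q. K e A c d * v d)" for c
  have "e * (\<Sum>c<q. (u c)\<^sup>2) \<le> (\<Sum>c<q. v c * u c)"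
    unfolding u_def using e by (intro e_K_le[OF A _ Vdet_nonzero[OF A e]]) simp
  then have "e * (e * (\<Sum>c<q. (u c)\<^sup>2)) \<le> e * (\<Sum>c<q. v c * u c)"
    using e by (intro mult_left_mono) auto
  moreover have "0 \<le> (\<Sum>c<q. (v c - e * u c)\<^sup>2)" by (intro sum_nonneg) simp
  moreover have "(\<Sum>c<q. (v c - e * u c)\<^sup>2) = (\<Sum>c<q. (v c)\<^sup>2) - 2 * (e * (\<Sum>c<q. v c * u c)) + e * (e * (\<Sum>c<q. (u c)\<^sup>2))"
    unfolding sum_distrib_left sum.distrib[symmetric] sum_subtractf[symmetric]
    by (intro sum.cong refl) (simp add: algebra_simps power2_eq_square)
  ultimately show ?thesis unfolding u_def[symmetric] by linarith
qed

text \<open>Majorants free of e for dominated convergence, including the error terms e \<alpha>2 and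
  e \<alpha>3. The bound on e \<alpha>3 by \<alpha>2 at 0 avoids any assumption on the integrability
  of \<alpha>3 at 0.\<close>

lemma traces_mono:
  "\<alpha>1 e A \<le> \<alpha>1 0 A" "\<alpha>2 e A \<le> \<alpha>2 0 A" "e * \<alpha>3 e A \<le> \<alpha>2 0 A" "\<tau>1 e A \<le> \<tau>1 0 A" "e * \<alpha>2 e A \<le> \<alpha>1 0 A"
proof -
  show a1: "\<alpha>1 e A \<le> \<alpha>1 0 A"
    unfolding \<alpha>1_def P_def Q_def by (intro sum_mono K_mono)
  show a2: "\<alpha>2 e A \<le> \<alpha>2 0 A"
    unfolding \<alpha>2_def P2_def Q_def power2_eq_square[symmetric] by (intro sum_mono K_sq_mono)
  have "e * P3 e A i \<le> P2 e A i i" for i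
    using e_K_le_id[of "\<lambda>c. Q e A c i"] by (simp add: P3_def P2_def power2_eq_square)
  then have "e * \<alpha>3 e A \<le> \<alpha>2 e A"
    unfolding \<alpha>2_def \<alpha>3_def sum_distrib_left by (intro sum_mono)
  then show "e * \<alpha>3 e A \<le> \<alpha>2 0 A" using a2 by linarith
  have "K e A c c \<le> K 0 A c c" if "c < q" for c
    using K_mono[of "\<lambda>d. if d = c then 1 else 0"] that by (simp add: sum_delta_mult)
  then show "\<tau>1 e A \<le> \<tau>1 0 A" unfolding \<tau>1_def by (intro sum_mono) auto
  have "e * \<alpha>2 e A \<le> \<alpha>1 e A"
    unfolding \<alpha>1_def \<alpha>2_def sum_distrib_left
    using e by (intro sum_mono e_P2_le[OF A _ Vdet_nonzero[OF A e]]) auto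
  then show "e * \<alpha>2 e A \<le> \<alpha>1 0 A" using a1 by linarith
qed

end

section \<open>Limits of the identities as e tends to 0\<close>

abbreviation eps :: "nat \<Rightarrow> real" where "eps j \<equiv> 1 / real (Suc j)"

lemma eps_pos: "eps j > 0" by simp

lemma eps_0: "eps \<longlonglongrightarrow> 0"
  using LIMSEQ_inverse_real_of_nat by (simp add: inverse_eq_divide)

lemma K_tendsto:
  assumes "Vdet p q 0 A \<noteq> 0" "c < q" "d < q"
  shows "(\<lambda>j. K (eps j) A c d) \<longlonglongrightarrow> K 0 A c d"
  unfolding Kmat_def
proof (rule tendsto_minv)
  fix a b :: nat
  have "(\<lambda>j. 1 + eps j) \<longlonglongrightarrow> 1 + 0" by (intro tendsto_add tendsto_const eps_0)
  then have "(\<lambda>j. if a = b then 1 + eps j else 0) \<longlonglongrightarrow> (if a = b then 1 + 0 else 0)"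
    by (cases "a = b") (simp_all del: of_nat_Suc)
  then have "(\<lambda>j. (if a = b then 1 + eps j else 0) - (\<Sum>i<p. A (i, a) * A (i, b))) \<longlonglongrightarrow>
    (if a = b then 1 + 0 else 0) - (\<Sum>i<p. A (i, a) * A (i, b))"
    by (rule tendsto_diff[OF _ tendsto_const])
  then show "(\<lambda>j. Vmat p (eps j) A a b) \<longlonglongrightarrow> Vmat p 0 A a b" unfolding Vmat_def .
qed (use assms in \<open>auto simp: Vdet_def\<close>)

lemma Q_tendsto: "Vdet p q 0 A \<noteq> 0 \<Longrightarrow> c < q \<Longrightarrow> (\<lambda>j. Q (eps j) A c a) \<longlonglongrightarrow> Q 0 A c a"
  unfolding Q_def by (intro tendsto_sum tendsto_mult tendsto_const K_tendsto) auto

lemma traces_tendsto: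
  assumes "Vdet p q 0 A \<noteq> 0"
  shows "(\<lambda>j. \<alpha>1 (eps j) A) \<longlonglongrightarrow> \<alpha>1 0 A" "(\<lambda>j. \<alpha>2 (eps j) A) \<longlonglongrightarrow> \<alpha>2 0 A"
    "(\<lambda>j. \<alpha>3 (eps j) A) \<longlonglongrightarrow> \<alpha>3 0 A" "(\<lambda>j. \<kappa>1 (eps j) A) \<longlonglongrightarrow> \<kappa>1 0 A"
    "(\<lambda>j. \<kappa>2 (eps j) A) \<longlonglongrightarrow> \<kappa>2 0 A" "(\<lambda>j. \<tau>1 (eps j) A) \<longlonglongrightarrow> \<tau>1 0 A"
  unfolding \<alpha>1_def \<alpha>2_def \<alpha>3_def \<kappa>1_def \<kappa>2_def \<tau>1_def P_def P2_def P3_def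
  by (intro tendsto_sum tendsto_mult tendsto_const Q_tendsto K_tendsto assms; simp)+

lemma dominated_zero:
  fixes f :: "nat \<Rightarrow> (nat \<times> nat \<Rightarrow> real) \<Rightarrow> real"
  assumes "\<And>j. (\<integral>A. f j A \<partial>\<mu>) = 0" "\<And>j. f j \<in> borel_measurable \<mu>" "g \<in> borel_measurable \<mu>"
    and "AE A in \<mu>. Vdet p q 0 A \<noteq> 0" "integrable \<mu> w"
    and "\<And>A. A \<in> orthogonal_mats n \<Longrightarrow> Vdet p q 0 A \<noteq> 0 \<Longrightarrow> (\<lambda>j. f j A) \<longlonglongrightarrow> g A"
    and "\<And>A j. A \<in> orthogonal_mats n \<Longrightarrow> Vdet p q 0 A \<noteq> 0 \<Longrightarrow> \<bar>f j A\<bar> \<le> w A"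
  shows "(\<integral>A. g A \<partial>\<mu>) = 0"
proof -
  have "(\<lambda>j. \<integral>A. f j A \<partial>\<mu>) \<longlonglongrightarrow> (\<integral>A. g A \<partial>\<mu>)"
  proof (rule integral_dominated_convergence[where w = w])
    show "AE A in \<mu>. (\<lambda>j. f j A) \<longlonglongrightarrow> g A"
      using AE_orthogonal assms(4) by eventually_elim (rule assms(6))
    show "AE A in \<mu>. norm (f j A) \<le> w A" for j
      using AE_orthogonal assms(4) by eventually_elim (simp add: assms(7))
  qed (use assms in auto)
  then show ?thesis using assms(1) by (simp add: LIMSEQ_const_iff)
qed

text \<open>At e = 0 the hidden traces become explicit and \<alpha>2 controls the others: by 2 x y
  \<le> x^2 + y^2 with entries of A bounded by 1, and by Cauchy-Schwarz on the diagonal of K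
  together with tr K^2 = \<alpha>2 + \<tau>1.\<close>

lemma trace_bounds_0:
  assumes A: "A \<in> orthogonal_mats n" and nz0: "Vdet p q 0 A \<noteq> 0"
  shows "\<kappa>1 0 A = real q" "\<kappa>2 0 A = \<tau>1 0 A" "\<tau>1 0 A = real q + \<alpha>1 0 A"
    "2 * \<alpha>1 0 A \<le> real p * real q + \<alpha>2 0 A" "(\<tau>1 0 A)\<^sup>2 \<le> real q * (\<alpha>2 0 A + \<tau>1 0 A)"
proof -
  show k1: "\<kappa>1 0 A = real q" using \<kappa>1_eq[OF A _ nz0] by simp
  show k2: "\<kappa>2 0 A = \<tau>1 0 A" using \<kappa>2_eq[OF A _ nz0] by simp
  show t1: "\<tau>1 0 A = real q + \<alpha>1 0 A" using \<alpha>1_\<kappa>1[OF A _ nz0] k1 by simp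
  have "2 * \<alpha>1 0 A \<le> (\<Sum>i<p. \<Sum>c<q. (A (i, c))\<^sup>2 + (Q 0 A c i)\<^sup>2)"
    unfolding \<alpha>1_def P_def sum_distrib_left
  proof (intro sum_mono)
    fix i c
    have "0 \<le> (A (i, c) - Q 0 A c i)\<^sup>2" by simp
    then show "2 * (A (i, c) * Q 0 A c i) \<le> (A (i, c))\<^sup>2 + (Q 0 A c i)\<^sup>2"
      by (simp add: power2_diff)
  qed
  also have "\<dots> \<le> (\<Sum>i<p. \<Sum>c<q. 1 + (Q 0 A c i)\<^sup>2)"
    using orthogonal_mats_entry_le[OF A] p_le_n q_le_n
    by (intro sum_mono add_right_mono) (auto simp: abs_square_le_1)
  also have "\<dots> = real p * real q + \<alpha>2 0 A"
    by (simp add: sum.distrib \<alpha>2_def P2_def power2_eq_square)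
  finally show "2 * \<alpha>1 0 A \<le> real p * real q + \<alpha>2 0 A" .
  have "(\<tau>1 0 A)\<^sup>2 \<le> (\<Sum>c<q. 1\<^sup>2) * (\<Sum>c<q. (K 0 A c c)\<^sup>2)"
    unfolding \<tau>1_def using Cauchy_Schwarz_ineq_sum[of "\<lambda>_. 1" "\<lambda>c. K 0 A c c" "{..<q}"] by simp
  also have "\<dots> \<le> (\<Sum>c<q. 1\<^sup>2) * \<tau>2 0 A"
    unfolding \<tau>2_def by (intro mult_left_mono sum_mono member_le_sum) auto
  also have "\<tau>2 0 A = \<alpha>2 0 A + \<tau>1 0 A" using \<alpha>2_\<kappa>2[OF A _ nz0] k2 by simp
  finally show "(\<tau>1 0 A)\<^sup>2 \<le> real q * (\<alpha>2 0 A + \<tau>1 0 A)" by simp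
qed

text \<open>Reduces all integrability questions at e = 0 to \<alpha>2. The product is covered by
  \<alpha>1 \<tau>1 \<le> \<tau>1^2 \<le> q (\<alpha>2 + \<tau>1).\<close>

lemma integrable_traces_0:
  assumes ns: "AE A in \<mu>. Vdet p q 0 A \<noteq> 0" and int: "integrable \<mu> (\<alpha>2 0)"
  shows "integrable \<mu> (\<alpha>1 0)" "integrable \<mu> (\<tau>1 0)" "integrable \<mu> (\<lambda>A. \<alpha>1 0 A * \<tau>1 0 A)"
proof -
  show a1: "integrable \<mu> (\<alpha>1 0)"
  proof (rule Bochner_Integration.integrable_bound)
    show "integrable \<mu> (\<lambda>A. real p * real q + \<alpha>2 0 A)" using int by simp
    show "AE A in \<mu>. norm (\<alpha>1 0 A) \<le> norm (real p * real q + \<alpha>2 0 A)"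
      using AE_orthogonal ns
    proof eventually_elim
      case (elim A)
      show ?case
        using trace_bounds_0(4)[OF elim] nonneg(1,2)[OF elim(1) _ elim(2)]
        by simp
    qed
  qed measurable
  show t1: "integrable \<mu> (\<tau>1 0)"
  proof (rule Bochner_Integration.integrable_bound)
    show "integrable \<mu> (\<lambda>A. real q + \<alpha>1 0 A)" using a1 by simp
    show "AE A in \<mu>. norm (\<tau>1 0 A) \<le> norm (real q + \<alpha>1 0 A)"
      using AE_orthogonal ns by eventually_elim (simp add: trace_bounds_0(3))
  qed measurable
  show "integrable \<mu> (\<lambda>A. \<alpha>1 0 A * \<tau>1 0 A)"
  proof (rule Bochner_Integration.integrable_bound)
    show "integrable \<mu> (\<lambda>A. real q * (\<alpha>2 0 A + \<tau>1 0 A))" using int t1 by simp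
    show "AE A in \<mu>. norm (\<alpha>1 0 A * \<tau>1 0 A) \<le> norm (real q * (\<alpha>2 0 A + \<tau>1 0 A))"
      using AE_orthogonal ns
    proof eventually_elim
      case (elim A)
      note nn = nonneg(1,2)[OF elim(1) order_refl elim(2)] \<tau>1_nonneg[OF elim(1) order_refl elim(2)]
      have "\<alpha>1 0 A * \<tau>1 0 A \<le> \<tau>1 0 A * \<tau>1 0 A"
        using nn trace_bounds_0(3)[OF elim] by (intro mult_right_mono) auto
      also have "\<dots> \<le> real q * (\<alpha>2 0 A + \<tau>1 0 A)"
        using trace_bounds_0(5)[OF elim] by (simp add: power2_eq_square)
      finally show ?case using nn by simp
    qed
  qed measurable
qed

lemma integrand_a_bound:
  assumes A: "A \<in> orthogonal_mats n" and nz0: "Vdet p q 0 A \<noteq> 0" and e: "e > 0"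
  shows "\<bar>real p * \<kappa>1 e A - (real n - real p) * \<alpha>1 e A + \<alpha>1 e A * \<kappa>1 e A + \<alpha>1 e A - e * \<alpha>2 e A\<bar>
    \<le> real p * real q + (real n + real q + 2) * \<alpha>1 0 A"
proof -
  note nz = Vdet_nonzero[OF A e] and e0 = less_imp_le[OF e]
  note nn = nonneg[OF A e0 nz] and k1 = \<kappa>1_le[OF A e0 nz] and mono = traces_mono[OF A e nz0]
  have 1: "0 \<le> real p * \<kappa>1 e A" "real p * \<kappa>1 e A \<le> real p * real q"
    using nn k1 by (auto intro: mult_left_mono)
  have 2: "0 \<le> (real n - real p) * \<alpha>1 e A" "(real n - real p) * \<alpha>1 e A \<le> real n * \<alpha>1 0 A"
    using nn mono pn by (auto intro!: mult_mono)
  have 3: "0 \<le> \<alpha>1 e A * \<kappa>1 e A" "\<alpha>1 e A * \<kappa>1 e A \<le> \<alpha>1 0 A * real q"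
    using nn k1 mono by (auto intro!: mult_mono)
  have 4: "0 \<le> e * \<alpha>2 e A" using nn e by simp
  have "\<bar>real p * \<kappa>1 e A - (real n - real p) * \<alpha>1 e A + \<alpha>1 e A * \<kappa>1 e A + \<alpha>1 e A - e * \<alpha>2 e A\<bar>
    \<le> real p * real q + real n * \<alpha>1 0 A + \<alpha>1 0 A * real q + \<alpha>1 0 A + \<alpha>1 0 A"
    using 1 2 3 4 nn(1) mono(1,5) by linarith
  then show ?thesis by (simp add: algebra_simps)
qed

lemma integrand_b_bound:
  assumes A: "A \<in> orthogonal_mats n" and nz0: "Vdet p q 0 A \<noteq> 0" and e: "e > 0"
  shows "\<bar>real p * \<kappa>2 e A - (real n - real p) * \<alpha>2 e A + \<alpha>1 e A * \<kappa>2 e A + \<alpha>2 e A * \<kappa>1 e A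
    + 2 * (\<alpha>2 e A - e * \<alpha>3 e A)\<bar>
    \<le> real p * \<tau>1 0 A + (real n + real q + 4) * \<alpha>2 0 A + \<alpha>1 0 A * \<tau>1 0 A"
proof -
  note nz = Vdet_nonzero[OF A e] and e0 = less_imp_le[OF e]
  note nn = nonneg[OF A e0 nz] and k1 = \<kappa>1_le[OF A e0 nz] and mono = traces_mono[OF A e nz0]
  have k2: "\<kappa>2 e A \<le> \<tau>1 0 A" using \<kappa>2_le[OF A e0 nz] mono by simp
  have 1: "0 \<le> real p * \<kappa>2 e A" "real p * \<kappa>2 e A \<le> real p * \<tau>1 0 A"
    using nn k2 by (auto intro: mult_left_mono)
  have 2: "0 \<le> (real n - real p) * \<alpha>2 e A" "(real n - real p) * \<alpha>2 e A \<le> real n * \<alpha>2 0 A"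
    using nn mono pn by (auto intro!: mult_mono)
  have 3: "0 \<le> \<alpha>1 e A * \<kappa>2 e A" "\<alpha>1 e A * \<kappa>2 e A \<le> \<alpha>1 0 A * \<tau>1 0 A"
    using nn k2 mono by (auto intro!: mult_mono)
  have 4: "0 \<le> \<alpha>2 e A * \<kappa>1 e A" "\<alpha>2 e A * \<kappa>1 e A \<le> \<alpha>2 0 A * real q"
    using nn k1 mono by (auto intro!: mult_mono)
  define x where "x = e * \<alpha>3 e A"
  have 5: "0 \<le> x" "x \<le> \<alpha>2 0 A" unfolding x_def using nn e mono by simp_all
  have "\<bar>real p * \<kappa>2 e A - (real n - real p) * \<alpha>2 e A + \<alpha>1 e A * \<kappa>2 e A + \<alpha>2 e A * \<kappa>1 e A
    + 2 * (\<alpha>2 e A - e * \<alpha>3 e A)\<bar>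
    \<le> real p * \<tau>1 0 A + real n * \<alpha>2 0 A + \<alpha>1 0 A * \<tau>1 0 A + \<alpha>2 0 A * real q + 2 * (2 * \<alpha>2 0 A)"
    unfolding x_def[symmetric] mult_2 using 1 2 3 4 5 nn(2) mono(2) by linarith
  then show ?thesis by (simp add: algebra_simps)
qed

lemma integrand_c_bound:
  assumes A: "A \<in> orthogonal_mats n" and nz0: "Vdet p q 0 A \<noteq> 0" and e: "e > 0"
  shows "\<bar>(real p * \<kappa>1 e A - (real n - real p) * \<alpha>1 e A + \<alpha>1 e A * \<kappa>1 e A + \<alpha>1 e A - e * \<alpha>2 e A) * \<tau>1 e A
    + 2 * (\<alpha>2 e A - e * \<alpha>3 e A)\<bar>
    \<le> (real p * real q + (real n + real q + 2) * \<alpha>1 0 A) * \<tau>1 0 A + 4 * \<alpha>2 0 A"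
proof -
  note nz = Vdet_nonzero[OF A e] and e0 = less_imp_le[OF e]
  note nn = nonneg[OF A e0 nz] \<tau>1_nonneg[OF A e0 nz] and mono = traces_mono[OF A e nz0]
  let ?f = "real p * \<kappa>1 e A - (real n - real p) * \<alpha>1 e A + \<alpha>1 e A * \<kappa>1 e A + \<alpha>1 e A - e * \<alpha>2 e A"
  have "\<bar>?f * \<tau>1 e A\<bar> \<le> (real p * real q + (real n + real q + 2) * \<alpha>1 0 A) * \<tau>1 0 A"
    unfolding abs_mult using integrand_a_bound[OF A nz0 e] nn(7) mono(4)
    by (intro mult_mono) (auto intro: order_trans[OF abs_ge_zero])
  moreover have gen: "\<bar>2 * (a - x)\<bar> \<le> 4 * b" if "0 \<le> x" "a \<le> b" "x \<le> b" "0 \<le> a" for x a b :: real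
    unfolding mult_2 using that by linarith
  have "0 \<le> e * \<alpha>3 e A" using nn e by simp
  then have "\<bar>2 * (\<alpha>2 e A - e * \<alpha>3 e A)\<bar> \<le> 4 * \<alpha>2 0 A"
    using mono(2,3) nn(2) gen by blast
  ultimately show ?thesis by linarith
qed

lemma identity_a_0:
  assumes ns: "AE A in \<mu>. Vdet p q 0 A \<noteq> 0" and int: "integrable \<mu> (\<alpha>2 0)"
  shows "(\<integral>A. real p * real q - m * \<alpha>1 0 A \<partial>\<mu>) = 0"
proof (rule dominated_zero[OF identity_a[OF eps_pos] _ _ ns,
    where w = "\<lambda>A. real p * real q + (real n + real q + 2) * \<alpha>1 0 A"])
  note meas = nice_add nice_diff nice_mult nice_const nice_traces
  show "(\<lambda>A. real p * \<kappa>1 (eps j) A - (real n - real p) * \<alpha>1 (eps j) A + \<alpha>1 (eps j) A * \<kappa>1 (eps j) A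
     + \<alpha>1 (eps j) A - eps j * \<alpha>2 (eps j) A) \<in> borel_measurable \<mu>" for j
    using eps_pos[of j] by (intro nice_integrable[THEN borel_measurable_integrable] meas)
  show "integrable \<mu> (\<lambda>A. real p * real q + (real n + real q + 2) * \<alpha>1 0 A)"
    using integrable_traces_0[OF ns int] by simp
  fix A assume A: "A \<in> orthogonal_mats n" and nz0: "Vdet p q 0 A \<noteq> 0"
  have "(\<lambda>j. real p * \<kappa>1 (eps j) A - (real n - real p) * \<alpha>1 (eps j) A + \<alpha>1 (eps j) A * \<kappa>1 (eps j) A
     + \<alpha>1 (eps j) A - eps j * \<alpha>2 (eps j) A) \<longlonglongrightarrow>
     real p * \<kappa>1 0 A - (real n - real p) * \<alpha>1 0 A + \<alpha>1 0 A * \<kappa>1 0 A + \<alpha>1 0 A - 0 * \<alpha>2 0 A"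
    by (intro tendsto_add tendsto_diff tendsto_mult tendsto_const traces_tendsto eps_0 nz0)
  also have "real p * \<kappa>1 0 A - (real n - real p) * \<alpha>1 0 A + \<alpha>1 0 A * \<kappa>1 0 A + \<alpha>1 0 A - 0 * \<alpha>2 0 A
      = real p * real q - m * \<alpha>1 0 A"
    by (simp add: trace_bounds_0[OF A nz0] m_def algebra_simps)
  finally show "(\<lambda>j. real p * \<kappa>1 (eps j) A - (real n - real p) * \<alpha>1 (eps j) A + \<alpha>1 (eps j) A * \<kappa>1 (eps j) A
     + \<alpha>1 (eps j) A - eps j * \<alpha>2 (eps j) A) \<longlonglongrightarrow> real p * real q - m * \<alpha>1 0 A" .
  show "\<bar>real p * \<kappa>1 (eps j) A - (real n - real p) * \<alpha>1 (eps j) A + \<alpha>1 (eps j) A * \<kappa>1 (eps j) A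
     + \<alpha>1 (eps j) A - eps j * \<alpha>2 (eps j) A\<bar> \<le> real p * real q + (real n + real q + 2) * \<alpha>1 0 A" for j
    by (rule integrand_a_bound[OF A nz0 eps_pos])
qed measurable

lemma identity_b_0:
  assumes ns: "AE A in \<mu>. Vdet p q 0 A \<noteq> 0" and int: "integrable \<mu> (\<alpha>2 0)"
  shows "(\<integral>A. real p * \<tau>1 0 A - (m - 1) * \<alpha>2 0 A + \<alpha>1 0 A * \<tau>1 0 A \<partial>\<mu>) = 0"
proof (rule dominated_zero[OF identity_b[OF eps_pos] _ _ ns,
    where w = "\<lambda>A. real p * \<tau>1 0 A + (real n + real q + 4) * \<alpha>2 0 A + \<alpha>1 0 A * \<tau>1 0 A"])
  note meas = nice_add nice_diff nice_mult nice_const nice_traces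
  show "(\<lambda>A. real p * \<kappa>2 (eps j) A - (real n - real p) * \<alpha>2 (eps j) A + \<alpha>1 (eps j) A * \<kappa>2 (eps j) A
     + \<alpha>2 (eps j) A * \<kappa>1 (eps j) A + 2 * (\<alpha>2 (eps j) A - eps j * \<alpha>3 (eps j) A)) \<in> borel_measurable \<mu>" for j
    using eps_pos[of j] by (intro nice_integrable[THEN borel_measurable_integrable] meas)
  show "integrable \<mu> (\<lambda>A. real p * \<tau>1 0 A + (real n + real q + 4) * \<alpha>2 0 A + \<alpha>1 0 A * \<tau>1 0 A)"
    using integrable_traces_0[OF ns int] int by simp
  fix A assume A: "A \<in> orthogonal_mats n" and nz0: "Vdet p q 0 A \<noteq> 0"
  have "(\<lambda>j. real p * \<kappa>2 (eps j) A - (real n - real p) * \<alpha>2 (eps j) A + \<alpha>1 (eps j) A * \<kappa>2 (eps j) A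
     + \<alpha>2 (eps j) A * \<kappa>1 (eps j) A + 2 * (\<alpha>2 (eps j) A - eps j * \<alpha>3 (eps j) A)) \<longlonglongrightarrow>
     real p * \<kappa>2 0 A - (real n - real p) * \<alpha>2 0 A + \<alpha>1 0 A * \<kappa>2 0 A + \<alpha>2 0 A * \<kappa>1 0 A
       + 2 * (\<alpha>2 0 A - 0 * \<alpha>3 0 A)"
    by (intro tendsto_add tendsto_diff tendsto_mult tendsto_const traces_tendsto eps_0 nz0)
  also have "real p * \<kappa>2 0 A - (real n - real p) * \<alpha>2 0 A + \<alpha>1 0 A * \<kappa>2 0 A + \<alpha>2 0 A * \<kappa>1 0 A
       + 2 * (\<alpha>2 0 A - 0 * \<alpha>3 0 A) = real p * \<tau>1 0 A - (m - 1) * \<alpha>2 0 A + \<alpha>1 0 A * \<tau>1 0 A"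
    by (simp add: trace_bounds_0(1,2)[OF A nz0] m_def algebra_simps)
  finally show "(\<lambda>j. real p * \<kappa>2 (eps j) A - (real n - real p) * \<alpha>2 (eps j) A + \<alpha>1 (eps j) A * \<kappa>2 (eps j) A
     + \<alpha>2 (eps j) A * \<kappa>1 (eps j) A + 2 * (\<alpha>2 (eps j) A - eps j * \<alpha>3 (eps j) A)) \<longlonglongrightarrow>
     real p * \<tau>1 0 A - (m - 1) * \<alpha>2 0 A + \<alpha>1 0 A * \<tau>1 0 A" .
  show "\<bar>real p * \<kappa>2 (eps j) A - (real n - real p) * \<alpha>2 (eps j) A + \<alpha>1 (eps j) A * \<kappa>2 (eps j) A
     + \<alpha>2 (eps j) A * \<kappa>1 (eps j) A + 2 * (\<alpha>2 (eps j) A - eps j * \<alpha>3 (eps j) A)\<bar>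
     \<le> real p * \<tau>1 0 A + (real n + real q + 4) * \<alpha>2 0 A + \<alpha>1 0 A * \<tau>1 0 A" for j
    by (rule integrand_b_bound[OF A nz0 eps_pos])
qed measurable

lemma identity_c_0:
  assumes ns: "AE A in \<mu>. Vdet p q 0 A \<noteq> 0" and int: "integrable \<mu> (\<alpha>2 0)"
  shows "(\<integral>A. real p * real q * \<tau>1 0 A - m * (\<alpha>1 0 A * \<tau>1 0 A) + 2 * \<alpha>2 0 A \<partial>\<mu>) = 0"
proof (rule dominated_zero[OF identity_c[OF eps_pos] _ _ ns,
    where w = "\<lambda>A. (real p * real q + (real n + real q + 2) * \<alpha>1 0 A) * \<tau>1 0 A + 4 * \<alpha>2 0 A"])
  note meas = nice_add nice_diff nice_mult nice_const nice_traces
  let ?f = "\<lambda>j A. real p * \<kappa>1 (eps j) A - (real n - real p) * \<alpha>1 (eps j) A + \<alpha>1 (eps j) A * \<kappa>1 (eps j) A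
     + \<alpha>1 (eps j) A - eps j * \<alpha>2 (eps j) A"
  show "(\<lambda>A. ?f j A * \<tau>1 (eps j) A + 2 * (\<alpha>2 (eps j) A - eps j * \<alpha>3 (eps j) A)) \<in> borel_measurable \<mu>" for j
    using eps_pos[of j] by (intro nice_integrable[THEN borel_measurable_integrable] meas)
  show "integrable \<mu> (\<lambda>A. (real p * real q + (real n + real q + 2) * \<alpha>1 0 A) * \<tau>1 0 A + 4 * \<alpha>2 0 A)"
    using integrable_traces_0[OF ns int] int by (simp add: distrib_right mult.assoc)
  fix A assume A: "A \<in> orthogonal_mats n" and nz0: "Vdet p q 0 A \<noteq> 0"
  have "(\<lambda>j. ?f j A * \<tau>1 (eps j) A + 2 * (\<alpha>2 (eps j) A - eps j * \<alpha>3 (eps j) A)) \<longlonglongrightarrow>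
     (real p * \<kappa>1 0 A - (real n - real p) * \<alpha>1 0 A + \<alpha>1 0 A * \<kappa>1 0 A + \<alpha>1 0 A - 0 * \<alpha>2 0 A) * \<tau>1 0 A
       + 2 * (\<alpha>2 0 A - 0 * \<alpha>3 0 A)"
    by (intro tendsto_add tendsto_diff tendsto_mult tendsto_const traces_tendsto eps_0 nz0)
  also have "(real p * \<kappa>1 0 A - (real n - real p) * \<alpha>1 0 A + \<alpha>1 0 A * \<kappa>1 0 A + \<alpha>1 0 A - 0 * \<alpha>2 0 A) * \<tau>1 0 A
       + 2 * (\<alpha>2 0 A - 0 * \<alpha>3 0 A) = real p * real q * \<tau>1 0 A - m * (\<alpha>1 0 A * \<tau>1 0 A) + 2 * \<alpha>2 0 A"
    by (simp add: trace_bounds_0(1)[OF A nz0] m_def algebra_simps)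
  finally show "(\<lambda>j. ?f j A * \<tau>1 (eps j) A + 2 * (\<alpha>2 (eps j) A - eps j * \<alpha>3 (eps j) A)) \<longlonglongrightarrow>
     real p * real q * \<tau>1 0 A - m * (\<alpha>1 0 A * \<tau>1 0 A) + 2 * \<alpha>2 0 A" .
  show "\<bar>?f j A * \<tau>1 (eps j) A + 2 * (\<alpha>2 (eps j) A - eps j * \<alpha>3 (eps j) A)\<bar>
     \<le> (real p * real q + (real n + real q + 2) * \<alpha>1 0 A) * \<tau>1 0 A + 4 * \<alpha>2 0 A" for j
    by (rule integrand_c_bound[OF A nz0 eps_pos])
qed measurable

text \<open>At e = 0 the three relations are equations, and the elimination is done without dividing
  by m or m - 2. The sign of m is left open, so that the second equation can be refuted when 0 < m
  \<le> 2.\<close>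

lemma moments:
  assumes ns: "AE A in \<mu>. Vdet p q 0 A \<noteq> 0" and int: "integrable \<mu> (\<alpha>2 0)"
  shows "m * (\<integral>A. \<alpha>1 0 A \<partial>\<mu>) = real p * real q"
    and "m * (m - 2) * (m + 1) * (\<integral>A. \<alpha>2 0 A \<partial>\<mu>) = real p * real q * (m + p) * (m + q)"
proof -
  define a1 where "a1 = (\<integral>A. \<alpha>1 0 A \<partial>\<mu>)"
  define a where "a = (\<integral>A. \<alpha>2 0 A \<partial>\<mu>)"
  define b where "b = (\<integral>A. \<alpha>1 0 A * \<tau>1 0 A \<partial>\<mu>)"
  define t where "t = (\<integral>A. \<tau>1 0 A \<partial>\<mu>)"
  note ints = integrable_traces_0[OF ns int] int
  show 1: "m * (\<integral>A. \<alpha>1 0 A \<partial>\<mu>) = real p * real q"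
    using identity_a_0[OF ns int] ints by (simp add: prob_space)
  have "t = (\<integral>A. real q + \<alpha>1 0 A \<partial>\<mu>)"
    unfolding t_def using ns AE_orthogonal
    by (intro integral_cong_AE) (auto elim!: eventually_elim2 simp: trace_bounds_0(3))
  then have t: "t = real q + a1" using ints by (simp add: prob_space a1_def)
  have 2: "real p * t - (m - 1) * a + b = 0"
    using identity_b_0[OF ns int] ints by (simp add: a_def b_def t_def)
  have 3: "real p * real q * t - m * b + 2 * a = 0"
    using identity_c_0[OF ns int] ints by (simp add: a_def b_def t_def)
  have 4: "m * a1 = real p * real q" using 1 by (simp add: a1_def)
  have b: "b = (m - 1) * a - real p * t" using 2 by simp
  have "(m - 2) * (m + 1) * a = real p * (m + q) * t"
    using 3 unfolding b by (simp add: algebra_simps)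
  then have "m * ((m - 2) * (m + 1) * a) = real p * (m + q) * (m * t)" by simp
  also have "m * t = m * real q + real p * real q" using t 4 by (simp add: distrib_left)
  finally show "m * (m - 2) * (m + 1) * (\<integral>A. \<alpha>2 0 A \<partial>\<mu>) = real p * real q * (m + p) * (m + q)"
    unfolding a_def[symmetric] by (simp add: algebra_simps)
qed

text \<open>Fatou's lemma along e = 1 / (j + 1), with the bound
  \<open>expectation_\<alpha>2_le\<close> that does not depend on e.\<close>

lemma integrable_\<alpha>2:
  assumes m2: "m > 2"
  shows "integrable \<mu> (\<alpha>2 0)"
proof (rule integrableI_nonneg)
  have ns: "AE A in \<mu>. Vdet p q 0 A \<noteq> 0" using m2 by (intro AE_nonsingular) simp
  show "AE A in \<mu>. 0 \<le> \<alpha>2 0 A"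
    using ns AE_orthogonal by eventually_elim (simp add: nonneg)
  define B where "B = real p * real q * (m + p) * (m + q) / (m * (m - 2) * (m + 1))"
  have "(\<integral>\<^sup>+A. ennreal (\<alpha>2 0 A) \<partial>\<mu>) = (\<integral>\<^sup>+A. liminf (\<lambda>j. ennreal (\<alpha>2 (eps j) A)) \<partial>\<mu>)"
  proof (rule nn_integral_cong_AE)
    show "AE A in \<mu>. ennreal (\<alpha>2 0 A) = liminf (\<lambda>j. ennreal (\<alpha>2 (eps j) A))"
      using ns
    proof eventually_elim
      case (elim A)
      show ?case
        by (rule lim_imp_Liminf[OF _ tendsto_ennrealI[OF traces_tendsto(2)[OF elim]], symmetric]) simp
    qed
  qed
  also have "\<dots> \<le> liminf (\<lambda>j. \<integral>\<^sup>+A. ennreal (\<alpha>2 (eps j) A) \<partial>\<mu>)"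
    by (intro nn_integral_liminf) measurable
  also have "\<dots> \<le> liminf (\<lambda>j. ennreal B)"
  proof (rule Liminf_mono, rule always_eventually, rule allI)
    fix j
    have "(\<integral>\<^sup>+A. ennreal (\<alpha>2 (eps j) A) \<partial>\<mu>) = ennreal (\<integral>A. \<alpha>2 (eps j) A \<partial>\<mu>)"
    proof (rule nn_integral_eq_integral[OF nice_integrable[OF nice_traces(2)[OF eps_pos]]])
      show "AE A in \<mu>. 0 \<le> \<alpha>2 (eps j) A"
        using AE_orthogonal
        by eventually_elim (intro nonneg Vdet_nonzero eps_pos less_imp_le[OF eps_pos])
    qed
    also have "\<dots> \<le> ennreal B"
      unfolding B_def by (intro ennreal_leI expectation_\<alpha>2_le eps_pos m2)
    finally show "(\<integral>\<^sup>+A. ennreal (\<alpha>2 (eps j) A) \<partial>\<mu>) \<le> ennreal B" .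
  qed
  also have "\<dots> < \<infinity>" by (simp add: Liminf_const)
  finally show "(\<integral>\<^sup>+A. ennreal (\<alpha>2 0 A) \<partial>\<mu>) < \<infinity>" .
qed measurable

lemma sum_cols_orthogonal:
  "A \<in> orthogonal_mats n \<Longrightarrow> c < q \<Longrightarrow> (\<Sum>a<n. A (a, c) * A (a, c)) = 1"
  using qp pn by (simp add: orthogonal_mats_iff)

text \<open>In the first q columns all rows have the same expected squared norm, since the inner
  product of rows 0 and k has rotation derivative |row k|^2 - |row 0|^2. The n squared norms add up
  to q.\<close>

lemma expectation_sum_sq: "(\<integral>A. (\<Sum>i<p. \<Sum>c<q. (A (i, c))\<^sup>2) \<partial>\<mu>) = real p * real q / real n"
proof -
  define s where "s a A = (\<Sum>c<q. (A (a, c))\<^sup>2)" for a and A :: "nat \<times> nat \<Rightarrow> real"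
  have ns: "nice (s a)" if "a < n" for a
    unfolding s_def[abs_def] using that q_le_n by (intro nice_sum nice_power nice_entry) auto
  have n0: "n > 0" "0 < n" using q1 qp pn by auto
  have eq: "(\<integral>A. s k A \<partial>\<mu>) = (\<integral>A. s 0 A \<partial>\<mu>)" if k: "k < n" for k
  proof (cases "k = 0")
    case False
    have "(\<integral>A. s k A - s 0 A \<partial>\<mu>) = 0"
    proof (rule integral_rotation_nice[where i = 0 and k = k and \<phi> = "\<lambda>A. \<Sum>c<q. A (0, c) * A (k, c)"])
      show "nice (\<lambda>A. \<Sum>c<q. A (0, c) * A (k, c))"
        using k n0 q_le_n by (intro nice_sum nice_mult nice_entry) auto
      show "nice (\<lambda>A. s k A - s 0 A)" using k n0 by (intro nice_diff ns)
      fix A assume A: "A \<in> orthogonal_mats n"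
      have "((\<lambda>t. \<Sum>c<q. rot_rows n 0 k t A (0, c) * rot_rows n 0 k t A (k, c)) has_real_derivative
        (\<Sum>c<q. rot_rows n 0 k 0 A (0, c) * (- A (0, c)) + A (k, c) * rot_rows n 0 k 0 A (k, c))) (at 0)"
      proof (intro DERIV_sum DERIV_mult')
        fix c assume "c \<in> {..<q}"
        then have c: "c < n" using q_le_n by auto
        show "((\<lambda>t. rot_rows n 0 k t A (0, c)) has_real_derivative A (k, c)) (at 0)"
          using DERIV_rot_rows[of 0 k n A 0 c] False k n0 A c by simp
        show "((\<lambda>t. rot_rows n 0 k t A (k, c)) has_real_derivative - A (0, c)) (at 0)"
          using DERIV_rot_rows[of 0 k n A k c] False k n0 A c by simp
      qed
      then show "((\<lambda>t. \<Sum>c<q. rot_rows n 0 k t A (0, c) * rot_rows n 0 k t A (k, c)) has_real_derivative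
        s k A - s 0 A) (at 0)"
        using rot_rows_0[of 0 k n A] False k n0 A
        by (simp add: s_def sum_subtractf power2_eq_square sum.distrib sum_negf)
    qed (use False k n0 in auto)
    then show ?thesis using ns[OF k, THEN nice_integrable] ns[OF n0(1), THEN nice_integrable] by simp
  qed simp
  have "real n * (\<integral>A. s 0 A \<partial>\<mu>) = (\<Sum>a<n. \<integral>A. s 0 A \<partial>\<mu>)" by simp
  also have "\<dots> = (\<Sum>a<n. \<integral>A. s a A \<partial>\<mu>)" by (intro sum.cong refl eq[symmetric]) simp
  also have "\<dots> = (\<integral>A. (\<Sum>a<n. s a A) \<partial>\<mu>)"
    using ns nice_integrable by (intro Bochner_Integration.integral_sum[symmetric]) auto
  also have "\<dots> = (\<integral>A. real q \<partial>\<mu>)"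
  proof (rule integral_cong_orthogonal)
    show "nice (\<lambda>A. \<Sum>a<n. s a A)" using ns by (intro nice_sum) auto
    fix A assume A: "A \<in> orthogonal_mats n"
    have "(\<Sum>a<n. s a A) = (\<Sum>c<q. \<Sum>a<n. A (a, c) * A (a, c))"
      unfolding s_def power2_eq_square by (rule sum.swap)
    also have "\<dots> = (\<Sum>c<q. 1)" by (intro sum.cong refl) (simp add: sum_cols_orthogonal[OF A])
    finally show "(\<Sum>a<n. s a A) = real q" by simp
  qed (rule nice_const)
  finally have s0: "(\<integral>A. s 0 A \<partial>\<mu>) = real q / real n"
    using n0 by (simp add: prob_space field_simps)
  have "(\<integral>A. (\<Sum>i<p. s i A) \<partial>\<mu>) = (\<Sum>i<p. \<integral>A. s i A \<partial>\<mu>)"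
    using ns nice_integrable p_le_n by (intro Bochner_Integration.integral_sum) auto
  also have "\<dots> = (\<Sum>i<p. real q / real n)" by (intro sum.cong refl trans[OF eq s0]) (simp add: p_le_n)
  finally show ?thesis by (simp add: s_def)
qed

end

subsection \<open>Quadratic spline bumps\<close>

lemma DERIV_pospart_power:
  assumes "k \<ge> 1"
  shows "((\<lambda>t. (max 0 t) ^ Suc k) has_real_derivative real (Suc k) * (max 0 t) ^ k) (at (t :: real))"
proof -
  consider "t > 0" | "t < 0" | "t = 0" by linarith
  then show ?thesis
  proof cases
    case 1
    have "((\<lambda>t. t ^ Suc k) has_real_derivative real (Suc k) * t ^ k) (at t)"
      using DERIV_pow[of "Suc k" t] by simp
    then have "((\<lambda>t. (max 0 t) ^ Suc k) has_real_derivative real (Suc k) * t ^ k) (at t)"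
      by (rule has_field_derivative_transform_within_open[where S = "{0<..}"]) (use 1 in auto)
    then show ?thesis using 1 by simp
  next
    case 2
    have "((\<lambda>t. 0) has_real_derivative 0) (at t)" by simp
    then have "((\<lambda>t. (max 0 t) ^ Suc k) has_real_derivative 0) (at t)"
      by (rule has_field_derivative_transform_within_open[where S = "{..<0}"]) (use 2 in auto)
    moreover have "real (Suc k) * (max 0 t) ^ k = 0" using 2 assms by (simp add: max_absorb1)
    ultimately show ?thesis by (simp only:)
  next
    case 3
    have "((\<lambda>h :: real. (max 0 h) ^ k) \<longlongrightarrow> (max 0 0) ^ k) (at 0)"
      by (intro tendsto_intros)
    moreover have "(max 0 0) ^ k = (0::real)" using assms by simp
    ultimately have "((\<lambda>h :: real. (max 0 h) ^ k) \<longlongrightarrow> 0) (at 0)" by (simp only:)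
    moreover have "\<forall>\<^sub>F h in at (0::real). norm (((max 0 h) ^ Suc k) / h) \<le> norm ((max 0 h) ^ k) * 1"
      by (intro always_eventually allI) (auto simp: max_def abs_mult power_abs)
    ultimately have "((\<lambda>h :: real. ((max 0 h) ^ Suc k) / h) \<longlongrightarrow> 0) (at 0)"
      by (rule tendsto_0_le)
    moreover have "real (Suc k) * (max 0 0) ^ k = (0::real)" "(max 0 0) ^ Suc k = (0::real)"
      using assms by simp_all
    ultimately show ?thesis unfolding 3 has_field_derivative_iff by (simp only: diff_0_right)
  qed
qed

text \<open>Up to factors, third differences of truncated powers with knots -3/2, -1/2, 1/2, 3/2:
  \<open>spline\<close> is the quadratic B-spline, \<open>spline_step\<close> its antiderivative
  rising from 0 to 1, and \<open>spline'\<close> its derivative. Beyond the last knot the third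
  difference of the cubic divided by 6 is 1 and that of the quadratic is 0. The antiderivative is
  needed explicitly in \<open>mollified_move\<close>.\<close>

definition spline_step :: "real \<Rightarrow> real"
  where "spline_step t = (1/6) * ((max 0 (t + 3/2)) ^ 3 - 3 * (max 0 (t + 1/2)) ^ 3
    + 3 * (max 0 (t - 1/2)) ^ 3 - (max 0 (t - 3/2)) ^ 3)"

definition spline :: "real \<Rightarrow> real"
  where "spline t = (1/2) * ((max 0 (t + 3/2)) ^ 2 - 3 * (max 0 (t + 1/2)) ^ 2
    + 3 * (max 0 (t - 1/2)) ^ 2 - (max 0 (t - 3/2)) ^ 2)"

definition spline' :: "real \<Rightarrow> real"
  where "spline' t = max 0 (t + 3/2) - 3 * max 0 (t + 1/2) + 3 * max 0 (t - 1/2) - max 0 (t - 3/2)"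

lemma DERIV_spline_step: "(spline_step has_real_derivative spline t) (at t)"
proof -
  have d: "((\<lambda>t. (max 0 (t + c)) ^ 3) has_real_derivative 3 * (max 0 (t + c)) ^ 2) (at t)" for c
    using DERIV_shift[of "\<lambda>t. (max 0 t) ^ 3" "3 * (max 0 (t + c)) ^ 2" t c]
      DERIV_pospart_power[of 2 "t + c"] by (simp add: numeral_3_eq_3)
  show ?thesis
    unfolding spline_step_def[abs_def] spline_def
    by (rule DERIV_cong, (rule DERIV_cmult DERIV_diff DERIV_add d d[of "- _", simplified])+) simp
qed

lemma DERIV_spline: "(spline has_real_derivative spline' t) (at t)"
proof -
  have d: "((\<lambda>t. (max 0 (t + c)) ^ 2) has_real_derivative 2 * max 0 (t + c)) (at t)" for c
    using DERIV_shift[of "\<lambda>t. (max 0 t) ^ 2" "2 * max 0 (t + c)" t c]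
      DERIV_pospart_power[of 1 "t + c"] by (simp add: numeral_2_eq_2)
  show ?thesis
    unfolding spline_def[abs_def] spline'_def
    by (rule DERIV_cong, (rule DERIV_cmult DERIV_diff DERIV_add d d[of "- _", simplified])+) simp
qed

lemma spline_support: "\<bar>t\<bar> \<ge> 3/2 \<Longrightarrow> spline t = 0" "\<bar>t\<bar> \<ge> 3/2 \<Longrightarrow> spline' t = 0"
proof -
  have "spline t = 0 \<and> spline' t = 0" if "t \<ge> 3/2"
  proof -
    have m: "max 0 (t + 3/2) = t + 3/2" "max 0 (t + 1/2) = t + 1/2"
      "max 0 (t - 1/2) = t - 1/2" "max 0 (t - 3/2) = t - 3/2"
      using that by auto
    have "spline t = 0" unfolding spline_def m power2_eq_square ring_distribs by linarith
    moreover have "spline' t = 0" unfolding spline'_def m ring_distribs by linarith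
    ultimately show ?thesis by simp
  qed
  moreover have "spline t = 0 \<and> spline' t = 0" if "t \<le> -3/2"
    using that by (simp add: spline_def spline'_def max_absorb1)
  ultimately have "\<bar>t\<bar> \<ge> 3/2 \<longrightarrow> spline t = 0 \<and> spline' t = 0"
    by linarith
  then show "\<bar>t\<bar> \<ge> 3/2 \<Longrightarrow> spline t = 0" "\<bar>t\<bar> \<ge> 3/2 \<Longrightarrow> spline' t = 0" by auto
qed

lemma spline_step_const: "t \<le> - 3/2 \<Longrightarrow> spline_step t = 0" "t \<ge> 3/2 \<Longrightarrow> spline_step t = 1"
proof -
  show "spline_step t = 0" if "t \<le> - 3/2"
    using that by (simp add: spline_step_def max_absorb1)
  assume that: "t \<ge> 3/2"
  have m: "max 0 (t + 3/2) = t + 3/2" "max 0 (t + 1/2) = t + 1/2"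
    "max 0 (t - 1/2) = t - 1/2" "max 0 (t - 3/2) = t - 3/2"
    using that by auto
  show "spline_step t = 1"
    unfolding spline_step_def m by (simp add: power3_eq_cube algebra_simps add_divide_distrib diff_divide_distrib)
qed

lemma continuous_splines:
  "continuous_on S spline_step" "continuous_on S spline" "continuous_on S spline'"
  unfolding spline_step_def[abs_def] spline_def[abs_def] spline'_def[abs_def]
  by (intro continuous_intros)+

lemma measurable_splines[measurable]:
  "spline_step \<in> borel_measurable borel" "spline \<in> borel_measurable borel" "spline' \<in> borel_measurable borel"
  by (rule borel_measurable_continuous_onI, rule continuous_splines)+

lemma bounded_by_compact:
  fixes f :: "real \<Rightarrow> real"
  assumes "continuous_on UNIV f" "\<And>t. \<bar>t\<bar> \<ge> c \<Longrightarrow> \<bar>f t\<bar> \<le> 1"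
  shows "\<exists>B\<ge>0. \<forall>t. \<bar>f t\<bar> \<le> B"
proof -
  have "compact (f ` {-c..c})"
    using assms(1) by (intro compact_continuous_image continuous_on_subset[OF assms(1)]) auto
  then obtain B where B: "\<And>x. x \<in> f ` {-c..c} \<Longrightarrow> \<bar>x\<bar> \<le> B"
    using compact_imp_bounded bounded_iff[of "f ` {-c..c}"] by (auto simp: real_norm_def)
  have "\<bar>f t\<bar> \<le> max 1 B" for t
  proof (cases "\<bar>t\<bar> \<ge> c")
    case True
    then show ?thesis using assms(2)[of t] by simp
  next
    case False
    then have "t \<in> {-c..c}" unfolding atLeastAtMost_iff by linarith
    then have "f t \<in> f ` {-c..c}" by (rule imageI)
    then show ?thesis using B[of "f t"] by simp
  qed
  then show ?thesis by (intro exI[of _ "max 1 B"]) auto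
qed

lemma bounded_splines:
  "\<exists>B\<ge>0. \<forall>t. \<bar>spline_step t\<bar> \<le> B" "\<exists>B\<ge>0. \<forall>t. \<bar>spline t\<bar> \<le> B" "\<exists>B\<ge>0. \<forall>t. \<bar>spline' t\<bar> \<le> B"
proof -
  show "\<exists>B\<ge>0. \<forall>t. \<bar>spline_step t\<bar> \<le> B"
    by (rule bounded_by_compact[where c = "3/2"], rule continuous_splines)
      (metis abs_ge_self abs_le_iff abs_one abs_zero linorder_linear minus_divide_left neg_le_iff_le
        spline_step_const abs_if order_refl zero_le_one minus_minus)
  show "\<exists>B\<ge>0. \<forall>t. \<bar>spline t\<bar> \<le> B" "\<exists>B\<ge>0. \<forall>t. \<bar>spline' t\<bar> \<le> B"
    by (rule bounded_by_compact[where c = "3/2"], rule continuous_splines, simp add: spline_support)+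
qed

lemma has_integral_spline: "has_bochner_integral lborel spline 1"
proof -
  have "has_bochner_integral lborel (\<lambda>x. indicator {-3/2..3/2} x *\<^sub>R spline x) (spline_step (3/2) - spline_step (-3/2))"
  proof (rule has_bochner_integral_FTC_Icc)
    fix x :: real
    show "(spline_step has_vector_derivative spline x) (at x within {-3/2..3/2})"
      using DERIV_subset[OF DERIV_spline_step subset_UNIV]
      by (simp add: has_real_derivative_iff_has_vector_derivative)
  qed (auto intro: continuous_splines)
  moreover have "(\<lambda>x. indicator {-3/2..3/2} x *\<^sub>R spline x) = spline"
  proof
    fix x :: real
    show "indicator {-3/2..3/2} x *\<^sub>R spline x = spline x"
    proof (cases "\<bar>x\<bar> \<ge> 3/2")
      case False
      then have "x \<in> {-3/2..3/2}" unfolding atLeastAtMost_iff by linarith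
      then show ?thesis by simp
    qed (simp add: spline_support)
  qed
  ultimately show ?thesis by (simp add: spline_step_const)
qed

subsection \<open>Affine changes of variables\<close>

lemma sets_lborel_on: "sets (lborel_on I) = sets (borel_on I)"
  by (rule sets_PiM_cong) auto

lemma space_borel_on: "space (borel_on I) = extensional I" "space (lborel_on I) = extensional I"
  by (auto simp: space_PiM PiE_def)

lemma measurable_lborel_on: "measurable (lborel_on I) M = measurable (borel_on I) M"
  by (rule measurable_cong_sets[OF sets_lborel_on refl])

interpretation lb: product_sigma_finite "\<lambda>_. lborel :: real measure"
  by standard

lemma emeasure_lborel_affine:
  fixes c :: real
  assumes "c \<noteq> 0" "A \<in> sets borel"
  shows "emeasure lborel A = ennreal \<bar>c\<bar> * emeasure lborel ((\<lambda>x. t + c * x) -` A)"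
  using assms by (subst lborel_real_affine[OF assms(1), of t])
    (simp add: emeasure_density_const emeasure_distr)

definition affine_on :: "'i set \<Rightarrow> ('i \<Rightarrow> real) \<Rightarrow> real \<Rightarrow> ('i \<Rightarrow> real) \<Rightarrow> 'i \<Rightarrow> real"
  where "affine_on I t c x = (\<lambda>i\<in>I. t i + c * x i)"

lemma measurable_affine_on[measurable]: "affine_on I t c \<in> measurable (borel_on I) (borel_on I)"
  unfolding affine_on_def[abs_def]
  by (intro measurable_restrict borel_measurable_add borel_measurable_times borel_measurable_const
      measurable_component_singleton)

text \<open>On boxes the Jacobian is the product of the one-dimensional factors; uniqueness of the
  product measure extends this to all sets.\<close>

lemma lborel_on_affine:
  fixes c :: real
  assumes "finite I" "c \<noteq> 0"
  shows "lborel_on I = density (distr (lborel_on I) (borel_on I) (affine_on I t c)) (\<lambda>_. ennreal (\<bar>c\<bar> ^ card I))"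
proof (rule lb.PiM_eqI[OF assms(1), symmetric])
  have m: "affine_on I t c \<in> measurable (lborel_on I) (borel_on I)"
    unfolding measurable_lborel_on by measurable
  show "sets (density (distr (lborel_on I) (borel_on I) (affine_on I t c)) (\<lambda>_. ennreal (\<bar>c\<bar> ^ card I)))
      = sets (lborel_on I)"
    by (simp add: sets_lborel_on)
  fix A :: "'a \<Rightarrow> real set" assume "\<And>i. i \<in> I \<Longrightarrow> A i \<in> sets lborel"
  then have A: "\<And>i. i \<in> I \<Longrightarrow> A i \<in> sets borel" by simp
  let ?B = "\<lambda>i. (\<lambda>x. t i + c * x) -` A i"
  have B: "?B i \<in> sets borel" if "i \<in> I" for i
    using measurable_sets[of "\<lambda>x. t i + c * x" borel borel, OF _ A[OF that]] by simp
  have PA: "Pi\<^sub>E I A \<in> sets (borel_on I)" using A by (intro sets_PiM_I_finite assms) auto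
  have "affine_on I t c -` Pi\<^sub>E I A \<inter> space (lborel_on I) = Pi\<^sub>E I ?B"
    by (auto simp: space_borel_on affine_on_def PiE_iff extensional_def)
  then have "emeasure (density (distr (lborel_on I) (borel_on I) (affine_on I t c)) (\<lambda>_. ennreal (\<bar>c\<bar> ^ card I))) (Pi\<^sub>E I A)
    = ennreal (\<bar>c\<bar> ^ card I) * emeasure (lborel_on I) (Pi\<^sub>E I ?B)"
    using PA m by (simp add: emeasure_density_const emeasure_distr)
  also have "\<dots> = (\<Prod>i\<in>I. ennreal \<bar>c\<bar>) * (\<Prod>i\<in>I. emeasure lborel (?B i))"
    using B assms by (simp add: lb.emeasure_PiM ennreal_power)
  also have "\<dots> = (\<Prod>i\<in>I. emeasure lborel (A i))"
    unfolding prod.distrib[symmetric]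
    by (intro prod.cong refl emeasure_lborel_affine[symmetric] assms A)
  finally show "emeasure (density (distr (lborel_on I) (borel_on I) (affine_on I t c)) (\<lambda>_. ennreal (\<bar>c\<bar> ^ card I))) (Pi\<^sub>E I A)
    = (\<Prod>i\<in>I. emeasure lborel (A i))" .
qed

lemma integral_affine_on:
  fixes h :: "('i \<Rightarrow> real) \<Rightarrow> real"
  assumes "finite I" "c \<noteq> 0" "h \<in> borel_measurable (borel_on I)"
  shows "(\<integral>a. h a \<partial>lborel_on I) = \<bar>c\<bar> ^ card I * (\<integral>y. h (affine_on I t c y) \<partial>lborel_on I)"
proof -
  have m: "affine_on I t c \<in> measurable (lborel_on I) (borel_on I)"
    unfolding measurable_lborel_on by measurable
  have "(\<integral>a. h a \<partial>lborel_on I) = (\<integral>a. h a \<partial>density (distr (lborel_on I) (borel_on I) (affine_on I t c)) (\<lambda>_. ennreal (\<bar>c\<bar> ^ card I)))"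
    by (subst lborel_on_affine[OF assms(1,2), symmetric]) simp
  also have "\<dots> = (\<integral>a. \<bar>c\<bar> ^ card I *\<^sub>R h a \<partial>distr (lborel_on I) (borel_on I) (affine_on I t c))"
    using assms by (intro integral_density) auto
  also have "\<dots> = (\<integral>y. \<bar>c\<bar> ^ card I *\<^sub>R h (affine_on I t c y) \<partial>lborel_on I)"
    using assms m by (intro integral_distr) auto
  finally show ?thesis by simp
qed

lemma emeasure_affine_on:
  assumes "finite I" "c \<noteq> 0" "E \<in> sets (borel_on I)"
  shows "emeasure (lborel_on I) E = ennreal (\<bar>c\<bar> ^ card I) * emeasure (lborel_on I) (affine_on I t c -` E \<inter> extensional I)"
proof -
  have m: "affine_on I t c \<in> measurable (lborel_on I) (borel_on I)"
    unfolding measurable_lborel_on by measurable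
  show ?thesis
    by (subst lborel_on_affine[OF assms(1,2), of t])
      (use assms m in \<open>simp add: emeasure_density_const emeasure_distr space_borel_on\<close>)
qed

subsection \<open>Norms on finite coordinate spaces\<close>

text \<open>The properties of the operator norm on which the mollification argument rests. The
  Lipschitz bound in the l1 distance controls supports under small shifts, \<open>coord_le\<close>
  confines balls to cubes, and \<open>scale\<close> determines how the volume of a ball depends on
  its radius.\<close>

locale coordinate_norm =
  fixes I :: "'i::countable set" and N :: "('i \<Rightarrow> real) \<Rightarrow> real"
  assumes fin: "finite I"
    and Lipschitz: "\<bar>N x - N y\<bar> \<le> (\<Sum>i\<in>I. \<bar>x i - y i\<bar>)"
    and scale: "N (\<lambda>i. c * x i) = \<bar>c\<bar> * N x"
    and coord_le: "i \<in> I \<Longrightarrow> \<bar>x i\<bar> \<le> N x"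
    and N_nonneg: "0 \<le> N x"
begin

lemma N_cong: "(\<And>i. i \<in> I \<Longrightarrow> x i = y i) \<Longrightarrow> N x = N y"
  using Lipschitz[of x y] by simp

lemma N_restrict[simp]: "N (restrict x I) = N x"
  by (rule N_cong) simp

lemma N_zero: "N (\<lambda>i. 0) = 0"
  using scale[of 0 "\<lambda>i. 0"] by simp

lemma continuous_N: "continuous_on UNIV N"
proof (unfold continuous_on_def, intro ballI)
  fix x :: "'i \<Rightarrow> real"
  have "((\<lambda>y. \<Sum>i\<in>I. \<bar>y i - x i\<bar>) \<longlongrightarrow> (\<Sum>i\<in>I. \<bar>x i - x i\<bar>)) (at x within UNIV)"
    by (intro tendsto_intros; metis UNIV_I continuous_on_def continuous_on_product_coordinates)
  then have 1: "((\<lambda>y. \<Sum>i\<in>I. \<bar>y i - x i\<bar>) \<longlongrightarrow> 0) (at x within UNIV)" by simp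
  have "\<forall>\<^sub>F y in at x within UNIV. norm (N y - N x) \<le> norm (\<Sum>i\<in>I. \<bar>y i - x i\<bar>) * 1"
    by (intro always_eventually allI) (use Lipschitz in \<open>auto intro: order_trans\<close>)
  then have "((\<lambda>y. N y - N x) \<longlongrightarrow> 0) (at x within UNIV)"
    using 1 by (rule tendsto_0_le[rotated])
  then show "(N \<longlongrightarrow> N x) (at x within UNIV)" by (simp add: LIM_zero_iff)
qed

lemma measurable_N[measurable]: "N \<in> borel_measurable (borel_on I)"
proof -
  have "(\<lambda>x. x) \<in> measurable (borel_on I) (borel :: ('i \<Rightarrow> real) measure)"
  proof (rule measurable_coordinatewise_then_product)
    fix i
    show "(\<lambda>x. x i) \<in> borel_measurable (borel_on I)"
    proof (cases "i \<in> I")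
      case False
      then have "x i = undefined" if "x \<in> space (borel_on I)" for x
        using that by (auto simp: space_borel_on extensional_def)
      then show ?thesis by (subst measurable_cong[where g = "\<lambda>_. undefined"]) auto
    qed auto
  qed
  from measurable_compose[OF this borel_measurable_continuous_onI[OF continuous_N]]
  show ?thesis .
qed

text \<open>The volume of a ball is r^d times the finite volume of the unit ball, hence continuous
  in r. The sphere lies in the ball of radius c and misses every ball of radius r < c.\<close>

lemma sphere_null:
  assumes c: "c > 0"
  shows "emeasure (lborel_on I) {x \<in> extensional I. N x = c} = 0"
proof -
  define F where "F r = emeasure (lborel_on I) {x \<in> extensional I. N x \<le> r}" for r
  have ball[measurable]: "{x \<in> extensional I. N x \<le> r} \<in> sets (lborel_on I)" for r
    unfolding sets_lborel_on space_borel_on(1)[symmetric] by measurable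
  have F: "F r = ennreal (r ^ card I) * F 1" if "r > 0" for r
  proof -
    have "affine_on I (\<lambda>_. 0) r -` {x \<in> extensional I. N x \<le> r} \<inter> extensional I = {x \<in> extensional I. N x \<le> 1}"
      using that by (auto simp: affine_on_def scale)
    then show ?thesis
      using emeasure_affine_on[OF fin, of r "{x \<in> extensional I. N x \<le> r}" "\<lambda>_. 0"] ball[of r] that
      by (simp add: F_def sets_lborel_on)
  qed
  have "F 1 \<le> emeasure (lborel_on I) (Pi\<^sub>E I (\<lambda>_. {-1..1}))"
    unfolding F_def
  proof (rule emeasure_mono)
    have "-1 \<le> x i \<and> x i \<le> 1" if "N x \<le> 1" "i \<in> I" for x i
      using coord_le[OF that(2), of x] that(1) by linarith
    then show "{x \<in> extensional I. N x \<le> 1} \<subseteq> Pi\<^sub>E I (\<lambda>_. {-1..1})"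
      by (simp add: PiE_def Pi_iff subset_iff)
    show "Pi\<^sub>E I (\<lambda>_. {-1..1}) \<in> sets (lborel_on I)"
      by (intro sets_PiM_I_finite fin) auto
  qed
  also have "\<dots> < \<infinity>"
    by (simp add: lb.emeasure_PiM[OF fin] ennreal_power[symmetric] power_less_top_ennreal)
  finally have F1: "F 1 < \<infinity>" .
  have fin_F: "F r < \<infinity>" if "r > 0" for r
    unfolding F[OF that] using F1 by (simp add: ennreal_mult_less_top)
  define L where "L = enn2real (F 1)"
  have FL: "F r = ennreal (r ^ card I * L)" if "r > 0" for r
    using F[OF that] F1 that by (simp add: L_def ennreal_mult)
  define S where "S = {x \<in> extensional I. N x = c}"
  have S[measurable]: "S \<in> sets (lborel_on I)"
    unfolding S_def sets_lborel_on space_borel_on(1)[symmetric] by measurable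
  have bound: "emeasure (lborel_on I) S \<le> ennreal (c ^ card I * L - r ^ card I * L)" if "0 < r" "r < c" for r
  proof -
    have "S \<inter> {x \<in> extensional I. N x \<le> r} = {}" using that by (auto simp: S_def)
    then have "emeasure (lborel_on I) S + F r = emeasure (lborel_on I) (S \<union> {x \<in> extensional I. N x \<le> r})"
      unfolding F_def by (rule plus_emeasure[OF S ball])
    also have "\<dots> \<le> F c"
      unfolding F_def using that by (intro emeasure_mono ball) (auto simp: S_def)
    finally have "emeasure (lborel_on I) S + F r \<le> F c" .
    then have "emeasure (lborel_on I) S + F r - F r \<le> F c - F r"
      by (rule ennreal_minus_mono) simp
    then have "emeasure (lborel_on I) S \<le> F c - F r"
      using fin_F[OF that(1)] by simp
    also have "\<dots> = ennreal (c ^ card I * L - r ^ card I * L)"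
      unfolding FL[OF c] FL[OF that(1)] using that by (intro ennreal_minus) (simp add: L_def)
    finally show ?thesis .
  qed
  have "((\<lambda>r. ennreal (c ^ card I * L - r ^ card I * L)) \<longlongrightarrow> ennreal (c ^ card I * L - c ^ card I * L)) (at_left c)"
    by (intro tendsto_ennrealI tendsto_intros)
  then have "emeasure (lborel_on I) S \<le> ennreal (c ^ card I * L - c ^ card I * L)"
    by (rule tendsto_lowerbound) (use c bound in \<open>auto intro!: eventually_at_leftI[of 0]\<close>)
  then show ?thesis by (simp add: S_def)
qed

end

subsection \<open>The operator norm\<close>

definition mat_vec :: "nat \<Rightarrow> (nat \<times> nat \<Rightarrow> real) \<Rightarrow> (nat \<Rightarrow> real) \<Rightarrow> nat \<Rightarrow> real"
  where "mat_vec q x v i = (\<Sum>c<q. x (i, c) * v c)"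

text \<open>The spectral norm, encoded as the infimum of the admissible constants. By
  \<open>mat_vec_le_sum\<close> the set is nonempty, and no unit vector has to exist, so the case q
  = 0 is covered. V is positive definite inside the unit ball.\<close>

definition opnorm :: "nat \<Rightarrow> nat \<Rightarrow> (nat \<times> nat \<Rightarrow> real) \<Rightarrow> real"
  where "opnorm p q x = Inf {r. 0 \<le> r \<and> (\<forall>v. L2_set (mat_vec q x v) {..<p} \<le> r * L2_set v {..<q})}"

lemma mat_vec_le_sum: "L2_set (mat_vec q x v) {..<p} \<le> (\<Sum>ij\<in>mat_idx p q. \<bar>x ij\<bar>) * L2_set v {..<q}"
proof -
  have "L2_set (mat_vec q x v) {..<p} \<le> (\<Sum>i<p. \<bar>mat_vec q x v i\<bar>)" by (rule L2_set_le_sum_abs)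
  also have "\<dots> \<le> (\<Sum>i<p. \<Sum>c<q. \<bar>x (i, c)\<bar> * L2_set v {..<q})"
  proof (rule sum_mono)
    fix i
    have "\<bar>mat_vec q x v i\<bar> \<le> (\<Sum>c<q. \<bar>x (i, c) * v c\<bar>)" unfolding mat_vec_def by (rule sum_abs)
    also have "\<dots> \<le> (\<Sum>c<q. \<bar>x (i, c)\<bar> * L2_set v {..<q})"
    proof (rule sum_mono)
      fix c assume c: "c \<in> {..<q}"
      have "\<bar>v c\<bar> \<le> L2_set (\<lambda>c. \<bar>v c\<bar>) {..<q}" using c by (intro member_le_L2_set) auto
      then show "\<bar>x (i, c) * v c\<bar> \<le> \<bar>x (i, c)\<bar> * L2_set v {..<q}"
        by (simp add: abs_mult mult_left_mono L2_set_def)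
    qed
    finally show "\<bar>mat_vec q x v i\<bar> \<le> (\<Sum>c<q. \<bar>x (i, c)\<bar> * L2_set v {..<q})" .
  qed
  also have "\<dots> = (\<Sum>ij\<in>mat_idx p q. \<bar>x ij\<bar>) * L2_set v {..<q}"
    by (simp add: sum.cartesian_product sum_distrib_right split_def)
  finally show ?thesis .
qed

lemma opnorm_leI: "0 \<le> r \<Longrightarrow> (\<And>v. L2_set (mat_vec q x v) {..<p} \<le> r * L2_set v {..<q}) \<Longrightarrow> opnorm p q x \<le> r"
  unfolding opnorm_def by (intro cInf_lower) (auto intro: bdd_belowI[of _ 0])

lemma opnorm_nonneg: "0 \<le> opnorm p q x"
  unfolding opnorm_def using mat_vec_le_sum[of q x _ p]
  by (intro cInf_greatest) (auto intro!: exI[of _ "\<Sum>ij\<in>mat_idx p q. \<bar>x ij\<bar>"] sum_nonneg)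

lemma mat_vec_le_opnorm: "L2_set (mat_vec q x v) {..<p} \<le> opnorm p q x * L2_set v {..<q}"
proof (cases "L2_set v {..<q} = 0")
  case True
  then show ?thesis using mat_vec_le_sum[of q x v p] by simp
next
  case False
  then have pos: "0 < L2_set v {..<q}" by (simp add: less_le)
  have "L2_set (mat_vec q x v) {..<p} / L2_set v {..<q} \<le> opnorm p q x"
    unfolding opnorm_def
  proof (rule cInf_greatest)
    show "{r. 0 \<le> r \<and> (\<forall>v. L2_set (mat_vec q x v) {..<p} \<le> r * L2_set v {..<q})} \<noteq> {}"
      using mat_vec_le_sum[of q x _ p] by (auto intro!: exI[of _ "\<Sum>ij\<in>mat_idx p q. \<bar>x ij\<bar>"] sum_nonneg)
  qed (use pos in \<open>auto simp: pos_divide_le_eq\<close>)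
  then show ?thesis using pos by (simp add: pos_divide_le_eq)
qed

interpretation opnorm: coordinate_norm "mat_idx p q" "opnorm p q" for p q
proof
  show "finite (mat_idx p q)" by simp
  have tri: "opnorm p q x \<le> opnorm p q y + (\<Sum>i\<in>mat_idx p q. \<bar>x i - y i\<bar>)" for x y
  proof (rule opnorm_leI)
    fix v
    have "L2_set (mat_vec q x v) {..<p} = L2_set (\<lambda>i. mat_vec q y v i + mat_vec q (\<lambda>i. x i - y i) v i) {..<p}"
      by (intro L2_set_cong refl) (simp add: mat_vec_def sum.distrib[symmetric] algebra_simps)
    also have "\<dots> \<le> L2_set (mat_vec q y v) {..<p} + L2_set (mat_vec q (\<lambda>i. x i - y i) v) {..<p}"
      by (rule L2_set_triangle_ineq)
    also have "\<dots> \<le> opnorm p q y * L2_set v {..<q} + (\<Sum>i\<in>mat_idx p q. \<bar>x i - y i\<bar>) * L2_set v {..<q}"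
      by (intro add_mono mat_vec_le_opnorm mat_vec_le_sum)
    finally show "L2_set (mat_vec q x v) {..<p} \<le> (opnorm p q y + (\<Sum>i\<in>mat_idx p q. \<bar>x i - y i\<bar>)) * L2_set v {..<q}"
      by (simp add: algebra_simps)
  qed (intro add_nonneg_nonneg opnorm_nonneg sum_nonneg abs_ge_zero)
  show "\<bar>opnorm p q x - opnorm p q y\<bar> \<le> (\<Sum>i\<in>mat_idx p q. \<bar>x i - y i\<bar>)" for x y
    using tri[of x y] tri[of y x] by (simp add: abs_le_iff abs_minus_commute)
  have le: "opnorm p q (\<lambda>i. c * x i) \<le> \<bar>c\<bar> * opnorm p q x" for c x
  proof (rule opnorm_leI)
    fix v
    have "L2_set (mat_vec q (\<lambda>i. c * x i) v) {..<p} = \<bar>c\<bar> * L2_set (mat_vec q x v) {..<p}"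
      unfolding mat_vec_def L2_set_def
      by (simp add: mult.assoc sum_distrib_left[symmetric] power_mult_distrib real_sqrt_mult)
    then show "L2_set (mat_vec q (\<lambda>i. c * x i) v) {..<p} \<le> \<bar>c\<bar> * opnorm p q x * L2_set v {..<q}"
      by (simp add: mult.assoc mult_left_mono mat_vec_le_opnorm)
  qed (simp add: opnorm_nonneg)
  show "opnorm p q (\<lambda>i. c * x i) = \<bar>c\<bar> * opnorm p q x" for c x
  proof (cases "c = 0")
    case True
    then show ?thesis using le[of 0 x] opnorm_nonneg[of p q "\<lambda>i. 0"] by simp
  next
    case False
    have "\<bar>c\<bar> * opnorm p q x \<le> opnorm p q (\<lambda>i. c * x i)"
      using le[of "1 / c" "\<lambda>i. c * x i"] False by (simp add: field_simps)
    then show ?thesis using le[of c x] by simp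
  qed
  show "\<bar>x i\<bar> \<le> opnorm p q x" if "i \<in> mat_idx p q" for i x
  proof -
    obtain a c where i0: "i = (a, c)" by (cases i)
    with that have i: "i = (a, c)" "a < p" "c < q" by auto
    \<comment> \<open>The c-th unit vector picks out column c, whose norm dominates each of its
      entries.\<close>
    have v: "L2_set (\<lambda>d. if d = c then 1 else 0) {..<q} = 1"
      using i by (simp add: L2_set_def if_distrib[where f = "\<lambda>x. x\<^sup>2"] cong: if_cong)
    have "\<bar>x i\<bar> = \<bar>mat_vec q x (\<lambda>d. if d = c then 1 else 0) a\<bar>"
      using i by (simp add: mat_vec_def sum_delta_mult)
    also have "\<dots> \<le> L2_set (\<lambda>a. \<bar>mat_vec q x (\<lambda>d. if d = c then 1 else 0) a\<bar>) {..<p}"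
      using i by (intro member_le_L2_set) auto
    also have "\<dots> = L2_set (mat_vec q x (\<lambda>d. if d = c then 1 else 0)) {..<p}" by (simp add: L2_set_def)
    also have "\<dots> \<le> opnorm p q x" using mat_vec_le_opnorm[of q x "\<lambda>d. if d = c then 1 else 0" p] v by simp
    finally show ?thesis .
  qed
qed (rule opnorm_nonneg)

section \<open>Shifts and balls of a coordinate norm\<close>

context coordinate_norm
begin

abbreviation d :: real where "d \<equiv> real (card I)"

lemma N_le_shift: "(\<And>i. i \<in> I \<Longrightarrow> \<bar>y i - x i\<bar> \<le> h) \<Longrightarrow> N y \<le> N x + h * d"
proof -
  assume "\<And>i. i \<in> I \<Longrightarrow> \<bar>y i - x i\<bar> \<le> h"
  then have "(\<Sum>i\<in>I. \<bar>y i - x i\<bar>) \<le> (\<Sum>i\<in>I. h)" by (intro sum_mono)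
  then show ?thesis using Lipschitz[of y x] by (simp add: abs_le_iff mult.commute)
qed

lemma measurable_ball[measurable]: "{x \<in> extensional I. N x \<le> r} \<in> sets (borel_on I)"
  unfolding space_borel_on(1)[symmetric] by measurable

lemma emeasure_ball_finite: "emeasure (lborel_on I) {x \<in> extensional I. N x \<le> r} < \<infinity>"
proof -
  have "emeasure (lborel_on I) {x \<in> extensional I. N x \<le> r} \<le> emeasure (lborel_on I) (Pi\<^sub>E I (\<lambda>_. {-r..r}))"
  proof (rule emeasure_mono)
    have "-r \<le> x i \<and> x i \<le> r" if "N x \<le> r" "i \<in> I" for x i
      using coord_le[OF that(2), of x] that(1) by linarith
    then show "{x \<in> extensional I. N x \<le> r} \<subseteq> Pi\<^sub>E I (\<lambda>_. {-r..r})"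
      by (simp add: PiE_def Pi_iff subset_iff)
    show "Pi\<^sub>E I (\<lambda>_. {-r..r}) \<in> sets (lborel_on I)"
      by (intro sets_PiM_I_finite fin) auto
  qed
  also have "\<dots> < \<infinity>"
    by (simp add: lb.emeasure_PiM[OF fin] power_less_top_ennreal emeasure_lborel_Icc_eq)
  finally show ?thesis .
qed

lemma integrable_ball: "integrable (lborel_on I) (\<lambda>x. indicator {x \<in> extensional I. N x \<le> r} x :: real)"
  by (rule integrable_real_indicator[OF _ emeasure_ball_finite]) (simp add: sets_lborel_on)

end

subsection \<open>Measures with vanishing weak gradient\<close>

text \<open>
  The assumption \<open>weak\<close> says that the weak gradient of \<open>w \<mu>\<close> vanishes on the ball \<open>N < R\<close>, tested on
  products of functions of one coordinate supported in a smaller ball. Hence the mollifications of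
  \<open>w \<mu>\<close> are constant there, and \<open>w \<mu>\<close> is a multiple of Lebesgue measure.
\<close>

locale weakly_constant = coordinate_norm I N for I :: "'i::countable set" and N +
  fixes \<mu> :: "('i \<Rightarrow> real) measure" and w :: "('i \<Rightarrow> real) \<Rightarrow> real" and R :: real
  assumes finite_mu: "finite_measure \<mu>" and sets_mu[measurable_cong]: "sets \<mu> = sets (borel_on I)"
    and w_meas[measurable]: "w \<in> borel_measurable (borel_on I)"
    and w_nonneg: "0 \<le> w x"
    and w_bound: "r < R \<Longrightarrow> \<exists>B. \<forall>x. N x \<le> r \<longrightarrow> w x \<le> B"
    and R_pos: "0 < R"
    and weak: "\<lbrakk>r < R; \<And>j t. (b j has_real_derivative b' j t) (at t); \<And>j. continuous_on UNIV (b' j);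
        \<And>j. \<exists>C. \<forall>t. \<bar>b j t\<bar> \<le> C \<and> \<bar>b' j t\<bar> \<le> C;
        \<And>x. (\<And>j. j \<in> I \<Longrightarrow> b j (x j) \<noteq> 0 \<or> b' j (x j) \<noteq> 0) \<Longrightarrow> N x \<le> r; i \<in> I\<rbrakk>
      \<Longrightarrow> (\<integral>x. b' i (x i) * (\<Prod>j\<in>I - {i}. b j (x j)) * w x \<partial>\<mu>) = 0"
begin

sublocale finite_measure \<mu> by (rule finite_mu)

lemma space_mu: "space \<mu> = extensional I"
  using sets_eq_imp_space_eq[OF sets_mu] by (simp add: space_borel_on)

lemma integrable_w:
  assumes [measurable]: "F \<in> borel_measurable (borel_on I)"
    and "r < R" "\<And>x. \<bar>F x\<bar> \<le> C" "\<And>x. F x \<noteq> 0 \<Longrightarrow> N x \<le> r"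
  shows "integrable \<mu> (\<lambda>x. F x * w x)"
proof -
  obtain B where B: "\<And>x. N x \<le> r \<Longrightarrow> w x \<le> B" using w_bound[OF assms(2)] by blast
  show ?thesis
  proof (rule integrable_const_bound[where B = "C * \<bar>B\<bar>"], rule AE_I2)
    fix x
    have C: "0 \<le> C" using assms(3)[of x] by linarith
    show "norm (F x * w x) \<le> C * \<bar>B\<bar>"
    proof (cases "F x = 0")
      case False
      then have "w x \<le> \<bar>B\<bar>" using B[OF assms(4)] by fastforce
      then show ?thesis using assms(3)[of x] C w_nonneg[of x] by (simp add: abs_mult mult_mono)
    qed (use C in simp)
  qed measurable
qed

section \<open>Mollification with spline bumps\<close>

definition bump :: "real \<Rightarrow> ('i \<Rightarrow> real) \<Rightarrow> ('i \<Rightarrow> real) \<Rightarrow> real"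
  where "bump \<delta> a x = (\<Prod>j\<in>I. spline ((a j - x j) / \<delta>))"

text \<open>Convolution of w \<mu> with a bump of width \<delta>, without the factor \<delta>^-d;
  \<open>mollified_tendsto\<close> divides by the corresponding power.\<close>

definition mollified :: "real \<Rightarrow> ('i \<Rightarrow> real) \<Rightarrow> real"
  where "mollified \<delta> a = (\<integral>x. bump \<delta> a x * w x \<partial>\<mu>)"

lemma mollified_cong: "(\<And>i. i \<in> I \<Longrightarrow> a i = b i) \<Longrightarrow> mollified \<delta> a = mollified \<delta> b"
  unfolding mollified_def bump_def by (intro arg_cong[where f = "integral\<^sup>L \<mu>"] ext) simp

lemma spline_arg: "\<delta> > 0 \<Longrightarrow> spline ((a - x) / \<delta>) \<noteq> 0 \<Longrightarrow> \<bar>x - a\<bar> \<le> 3/2 * \<delta>"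
  using spline_support(1)[of "(a - x) / \<delta>"]
  by (auto simp: abs_minus_commute pos_le_divide_eq not_le[symmetric] intro: ccontr)

lemma bump_support:
  assumes "\<delta> > 0" "bump \<delta> a x \<noteq> 0"
  shows "N x \<le> N a + 3/2 * \<delta> * d"
  using assms fin spline_arg[OF assms(1)] by (intro N_le_shift) (auto simp: bump_def)

lemma bump_bound: "\<exists>C\<ge>0. \<forall>\<delta> a x. \<bar>bump \<delta> a x\<bar> \<le> C"
proof -
  obtain B where "B \<ge> 0" and B: "\<And>t. \<bar>spline t\<bar> \<le> B" using bounded_splines(2) by blast
  have "\<bar>bump \<delta> a x\<bar> \<le> B ^ card I" for \<delta> a x
    unfolding bump_def abs_prod using prod_mono[of I "\<lambda>j. \<bar>spline ((a j - x j) / \<delta>)\<bar>" "\<lambda>_. B"] B by simp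
  then show ?thesis using \<open>B \<ge> 0\<close> by (intro exI[of _ "B ^ card I"]) auto
qed

lemma measurable_bump[measurable]: "bump \<delta> a \<in> borel_measurable (borel_on I)"
  unfolding bump_def[abs_def]
  by (intro borel_measurable_prod measurable_compose[OF _ measurable_splines(2)] borel_measurable_divide
      borel_measurable_diff borel_measurable_const measurable_component_singleton)

text \<open>For two centres that differ in coordinate i, the difference of the mollifications is
  itself an instance of the weak equation: a difference of shifted splines is, up to a factor, the
  derivative of a difference of shifted copies of \<open>spline_step\<close>, which has compact
  support. Nothing is differentiated under the integral.\<close>

lemma mollified_move:
  assumes \<delta>: "\<delta> > 0" and i: "i \<in> I" and c: "\<bar>c - a i\<bar> \<le> \<delta>" and a: "N a + 3 * \<delta> * d < R"
  shows "mollified \<delta> (a(i := c)) = mollified \<delta> a"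
proof -
  define b where "b j t = (if j = i then spline_step ((c - t) / \<delta>) - spline_step ((a i - t) / \<delta>)
      else spline ((a j - t) / \<delta>))" for j t
  define b' where "b' j t = (if j = i then - (spline ((c - t) / \<delta>) - spline ((a i - t) / \<delta>)) / \<delta>
      else - spline' ((a j - t) / \<delta>) / \<delta>)" for j t
  obtain B1 where B1: "\<And>t. \<bar>spline_step t\<bar> \<le> B1" using bounded_splines(1) by blast
  obtain B2 where B2: "\<And>t. \<bar>spline t\<bar> \<le> B2" using bounded_splines(2) by blast
  obtain B3 where B3: "\<And>t. \<bar>spline' t\<bar> \<le> B3" using bounded_splines(3) by blast
  have dstep: "((\<lambda>t. spline_step ((u - t) / \<delta>)) has_real_derivative - spline ((u - t) / \<delta>) / \<delta>) (at t)" for u t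
    by (rule DERIV_chain2[OF DERIV_spline_step, THEN DERIV_cong])
      (auto intro!: derivative_eq_intros simp: \<delta>[THEN less_imp_neq, symmetric])
  have dspl: "((\<lambda>t. spline ((u - t) / \<delta>)) has_real_derivative - spline' ((u - t) / \<delta>) / \<delta>) (at t)" for u t
    by (rule DERIV_chain2[OF DERIV_spline, THEN DERIV_cong])
      (auto intro!: derivative_eq_intros simp: \<delta>[THEN less_imp_neq, symmetric])
  have zero: "(\<integral>x. b' i (x i) * (\<Prod>j\<in>I - {i}. b j (x j)) * w x \<partial>\<mu>) = 0"
  proof (rule weak[where r = "N a + 3 * \<delta> * d"])
    show "(b j has_real_derivative b' j t) (at t)" for j t
      using DERIV_diff[OF dstep[of c t] dstep[of "a i" t]] dspl[of "a j" t]
      by (cases "j = i") (simp_all add: b_def[abs_def] b'_def diff_divide_distrib)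
    have cs: "continuous_on UNIV (\<lambda>t. spline ((u - t) / \<delta>))" "continuous_on UNIV (\<lambda>t. spline' ((u - t) / \<delta>))" for u
      by (rule continuous_on_compose2[OF continuous_splines(2)[of UNIV]]
          continuous_on_compose2[OF continuous_splines(3)[of UNIV]];
          use \<delta> in \<open>auto intro!: continuous_intros\<close>)+
    show "continuous_on UNIV (b' j)" for j
      unfolding b'_def[abs_def] using \<delta> by (cases "j = i") (auto intro!: continuous_intros cs)
    show "\<exists>C. \<forall>t. \<bar>b j t\<bar> \<le> C \<and> \<bar>b' j t\<bar> \<le> C" for j
    proof (intro exI allI conjI)
      fix t
      have "\<bar>b j t\<bar> \<le> 2 * B1 + B2"
        using B1[of "(c - t) / \<delta>"] B1[of "(a i - t) / \<delta>"] B2[of "(a j - t) / \<delta>"] B2[of 0]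
        by (auto simp: b_def)
      moreover have "\<bar>b' j t\<bar> \<le> (2 * B2 + B3) / \<delta>"
        using B2[of "(c - t) / \<delta>"] B2[of "(a i - t) / \<delta>"] B3[of "(a j - t) / \<delta>"] B3[of 0] \<delta>
        by (auto simp: b'_def abs_divide intro!: divide_right_mono)
      moreover have "0 \<le> 2 * B1 + B2" "0 \<le> (2 * B2 + B3) / \<delta>"
        using calculation by linarith+
      ultimately show "\<bar>b j t\<bar> \<le> (2 * B1 + B2) + (2 * B2 + B3) / \<delta>" "\<bar>b' j t\<bar> \<le> (2 * B1 + B2) + (2 * B2 + B3) / \<delta>"
        by linarith+
    qed
    fix x assume nz: "\<And>j. j \<in> I \<Longrightarrow> b j (x j) \<noteq> 0 \<or> b' j (x j) \<noteq> 0"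
    show "N x \<le> N a + 3 * \<delta> * d"
    proof (rule N_le_shift)
      fix j assume j: "j \<in> I"
      show "\<bar>x j - a j\<bar> \<le> 3 * \<delta>"
      proof (rule ccontr)
        assume far: "\<not> ?thesis"
        have far1: "\<bar>(a j - x j) / \<delta>\<bar> \<ge> 3/2"
          using far \<delta> by (simp add: abs_divide pos_le_divide_eq abs_minus_commute)
        show False
        proof (cases "j = i")
          case False
          then show ?thesis using nz[OF j] spline_support[OF far1] by (simp add: b_def b'_def)
        next
          case True
          \<comment> \<open>As |c - a i| \<le> \<delta>, the points a i and c lie on the same side
            of x i, both at distance at least 3/2 \<delta>. Hence both steps have reached the same
            constant, 0 or 1, and their difference vanishes.\<close>
          have "a i - x i \<ge> 3 * \<delta> \<or> a i - x i \<le> - (3 * \<delta>)" using far True by (auto simp: abs_if split: if_splits)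
          then have "(a i - x i \<ge> 3/2 * \<delta> \<and> c - x i \<ge> 3/2 * \<delta>) \<or> (a i - x i \<le> - (3/2) * \<delta> \<and> c - x i \<le> - (3/2) * \<delta>)"
            using c \<delta> by (auto simp: abs_le_iff)
          then have "((a i - x i) / \<delta> \<ge> 3/2 \<and> (c - x i) / \<delta> \<ge> 3/2) \<or> ((a i - x i) / \<delta> \<le> - 3/2 \<and> (c - x i) / \<delta> \<le> - 3/2)"
            using \<delta> by (simp add: pos_le_divide_eq pos_divide_le_eq)
          then have "spline_step ((c - x i) / \<delta>) = spline_step ((a i - x i) / \<delta>)"
            and "\<bar>(a i - x i) / \<delta>\<bar> \<ge> 3/2" "\<bar>(c - x i) / \<delta>\<bar> \<ge> 3/2"
            using spline_step_const by (fastforce, linarith+)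
          then have "b i (x i) = 0" "b' i (x i) = 0"
            using spline_support(1) by (simp_all add: b_def b'_def)
          then show ?thesis using nz[OF j] True by simp
        qed
      qed
    qed
  qed (use a i in auto)
  have split: "bump \<delta> (a(i := u)) x = spline ((u - x i) / \<delta>) * (\<Prod>j\<in>I - {i}. b j (x j))" for u x
    unfolding bump_def using fin i
    by (subst prod.remove[OF fin i]) (auto simp: b_def intro!: arg_cong2[where f = "(*)"] prod.cong)
  have int: "integrable \<mu> (\<lambda>x. bump \<delta> (a(i := u)) x * w x)" if "\<bar>u - a i\<bar> \<le> \<delta>" for u
  proof -
    obtain C where C: "\<And>\<delta> a x. \<bar>bump \<delta> a x\<bar> \<le> C" using bump_bound by blast
    have "N (a(i := u)) \<le> N a + \<delta> * d" using that \<delta> by (intro N_le_shift) auto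
    moreover have "N x \<le> N (a(i := u)) + 3/2 * \<delta> * d" if "bump \<delta> (a(i := u)) x \<noteq> 0" for x
      by (rule bump_support[OF \<delta> that])
    moreover have "N a + \<delta> * d + 3/2 * \<delta> * d \<le> N a + 3 * \<delta> * d"
      using \<delta> by (simp add: mult_right_mono flip: distrib_right add.assoc)
    ultimately show ?thesis
      by (intro integrable_w[OF measurable_bump a C]) (meson add_right_mono order_trans)
  qed
  have "0 = (\<integral>x. (- 1 / \<delta>) * (bump \<delta> (a(i := c)) x * w x - bump \<delta> (a(i := a i)) x * w x) \<partial>\<mu>)"
    unfolding split zero[symmetric] using \<delta>
    by (intro arg_cong[where f = "integral\<^sup>L \<mu>"] ext) (simp add: b'_def field_simps)
  also have "\<dots> = (- 1 / \<delta>) * (mollified \<delta> (a(i := c)) - mollified \<delta> a)"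
    using int[OF c] int[of "a i"] \<delta> by (simp add: mollified_def)
  finally show ?thesis using \<delta> by simp
qed

text \<open>Changes the coordinates one after the other. The intermediate centres may lie \<delta> d
  further out than a, which turns the 3 of \<open>mollified_move\<close> into a 4.\<close>

lemma mollified_near:
  assumes \<delta>: "\<delta> > 0" and a: "\<And>i. i \<in> I \<Longrightarrow> \<bar>a' i - a i\<bar> \<le> \<delta>" "N a + 4 * \<delta> * d < R"
  shows "mollified \<delta> a' = mollified \<delta> a"
proof -
  have "mollified \<delta> (\<lambda>j. if j \<in> J then a' j else a j) = mollified \<delta> a" if "J \<subseteq> I" for J
    using finite_subset[OF that fin] that
  proof (induction J rule: finite_induct)
    case (insert i J)
    let ?x = "\<lambda>j. if j \<in> J then a' j else a j"
    have "N ?x \<le> N a + \<delta> * d" using a(1) \<delta> by (intro N_le_shift) auto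
    then have "mollified \<delta> (?x(i := a' i)) = mollified \<delta> ?x"
      using insert a by (intro mollified_move \<delta>) (auto simp: algebra_simps)
    also have "?x(i := a' i) = (\<lambda>j. if j \<in> insert i J then a' j else a j)" by auto
    finally show ?case using insert by simp
  qed simp
  from this[of I] show ?thesis by (simp cong: mollified_cong)
qed

text \<open>Walks from 0 to a along the segment in m steps, so many that each coordinate moves by at
  most \<delta> per step. All points visited have norm at most N a.\<close>

lemma mollified_const:
  assumes \<delta>: "\<delta> > 0" and a: "N a \<le> r" "r + 4 * \<delta> * d < R"
  shows "mollified \<delta> a = mollified \<delta> (\<lambda>_. 0)"
proof -
  obtain m :: nat where m: "N a / \<delta> < real m" using reals_Archimedean2 by blast
  then have m0: "0 < real m" using N_nonneg[of a] \<delta> by (smt (verit) divide_nonneg_pos)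
  have "mollified \<delta> (\<lambda>j. real k / real m * a j) = mollified \<delta> (\<lambda>_. 0)" if "k \<le> m" for k
    using that
  proof (induction k)
    case (Suc k)
    have "mollified \<delta> (\<lambda>j. real (Suc k) / real m * a j) = mollified \<delta> (\<lambda>j. real k / real m * a j)"
    proof (rule mollified_near[OF \<delta>])
      have "real k / real m * N a \<le> 1 * N a"
        using Suc m0 N_nonneg[of a] by (intro mult_right_mono) auto
      moreover have "N (\<lambda>j. real k / real m * a j) = real k / real m * N a"
        using scale[of "real k / real m" a] m0 by simp
      ultimately show "N (\<lambda>j. real k / real m * a j) + 4 * \<delta> * d < R"
        using a by linarith
      fix i assume "i \<in> I"
      then have "\<bar>a i\<bar> \<le> \<delta> * real m" using coord_le[of i a] m \<delta> by (simp add: pos_divide_less_eq mult.commute)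
      moreover have "real (Suc k) / real m * a i - real k / real m * a i = a i / real m"
        using m0 by (simp add: field_simps)
      ultimately show "\<bar>real (Suc k) / real m * a i - real k / real m * a i\<bar> \<le> \<delta>"
        using m0 by (simp add: abs_divide pos_divide_le_eq)
    qed
    then show ?case using Suc by simp
  qed simp
  from this[of m] show ?thesis using m0 by simp
qed

text \<open>The spline average applied to the test function instead of the measure, after the
  substitution a = x + \<delta> y.\<close>

definition smeared :: "(('i \<Rightarrow> real) \<Rightarrow> real) \<Rightarrow> real \<Rightarrow> ('i \<Rightarrow> real) \<Rightarrow> real"
  where "smeared \<phi> \<delta> x = (\<integral>y. \<phi> (affine_on I x \<delta> y) * (\<Prod>j\<in>I. spline (y j)) \<partial>lborel_on I)"

lemma sigma_finite_lborel_on: "sigma_finite_measure (lborel_on I)"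
  by (rule lb.sigma_finite[OF fin])

text \<open>Integrate the constant mollification against \<phi> and exchange the two integrals; the
  power of \<delta> is the Jacobian of the substitution.\<close>

lemma mollified_smeared:
  assumes \<delta>: "\<delta> > 0" and \<phi>[measurable]: "\<phi> \<in> borel_measurable (borel_on I)"
    and C: "\<And>a. \<bar>\<phi> a\<bar> \<le> C" and supp: "\<And>a. \<phi> a \<noteq> 0 \<Longrightarrow> N a \<le> r" and r: "r + 4 * \<delta> * d < R"
  shows "mollified \<delta> (\<lambda>_. 0) * (\<integral>a. \<phi> a \<partial>lborel_on I) = \<delta> ^ card I * (\<integral>x. smeared \<phi> \<delta> x * w x \<partial>\<mu>)"
proof -
  interpret L: sigma_finite_measure "lborel_on I" by (rule sigma_finite_lborel_on)
  interpret LM: pair_sigma_finite "lborel_on I" \<mu> by standard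
  obtain B where B: "\<And>\<delta> a x. \<bar>bump \<delta> a x\<bar> \<le> B" and B0: "B \<ge> 0" using bump_bound by blast
  have r': "r + 3 / 2 * \<delta> * d < R" 
  proof -
    have "3 / 2 * \<delta> * d \<le> 4 * \<delta> * d" using \<delta> by (intro mult_right_mono) auto
    then show ?thesis using r by linarith
  qed
  obtain W where W: "\<And>x. N x \<le> r + 3 / 2 * \<delta> * d \<Longrightarrow> w x \<le> W" using w_bound[OF r'] by blast
  define f where "f a x = \<phi> a * (bump \<delta> a x * w x)" for a x
  have C0: "0 \<le> C" using C[of undefined] by linarith
  have f_bound: "norm (f a x) \<le> norm (C * (B * \<bar>W\<bar>) * indicator {x. N x \<le> r} a)" for a x
  proof (cases "f a x = 0")
    case False
    then have nz: "\<phi> a \<noteq> 0" "bump \<delta> a x \<noteq> 0" by (auto simp: f_def)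
    then have "N a \<le> r" "N x \<le> r + 3 / 2 * \<delta> * d" using supp bump_support[OF \<delta> nz(2)] by fastforce+
    then have "w x \<le> \<bar>W\<bar>" using W by fastforce
    then have "norm (f a x) \<le> C * (B * \<bar>W\<bar>)"
      unfolding f_def real_norm_def abs_mult using w_nonneg[of x]
      by (intro mult_mono C B B0 C0) auto
    then show ?thesis using \<open>N a \<le> r\<close> by simp
  qed simp
  have meas_f[measurable]: "case_prod f \<in> borel_measurable (lborel_on I \<Otimes>\<^sub>M \<mu>)"
  proof -
    have 1: "(\<lambda>z. \<phi> (fst z)) \<in> borel_measurable (lborel_on I \<Otimes>\<^sub>M \<mu>)"
      by (rule measurable_compose[OF measurable_fst]) (simp add: measurable_lborel_on)
    have 2: "(\<lambda>z. w (snd z)) \<in> borel_measurable (lborel_on I \<Otimes>\<^sub>M \<mu>)"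
      by (rule measurable_compose[OF measurable_snd]) measurable
    have 3: "(\<lambda>z. fst z j) \<in> borel_measurable (lborel_on I \<Otimes>\<^sub>M \<mu>)" if "j \<in> I" for j
      by (rule measurable_compose[OF measurable_fst]) (use that in \<open>simp add: measurable_lborel_on\<close>)
    have 4: "(\<lambda>z. snd z j) \<in> borel_measurable (lborel_on I \<Otimes>\<^sub>M \<mu>)" if "j \<in> I" for j
      by (rule measurable_compose[OF measurable_snd]) (use that in measurable)
    have "(\<lambda>z. \<phi> (fst z) * (bump \<delta> (fst z) (snd z) * w (snd z))) \<in> borel_measurable (lborel_on I \<Otimes>\<^sub>M \<mu>)"
      unfolding bump_def
      by (intro borel_measurable_times 1 2 borel_measurable_prod measurable_compose[OF _ measurable_splines(2)]
          borel_measurable_divide borel_measurable_diff borel_measurable_const 3 4)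
    then show ?thesis by (simp add: f_def split_beta')
  qed
  have int: "integrable (lborel_on I \<Otimes>\<^sub>M \<mu>) (case_prod f)"
  proof (rule Bochner_Integration.integrable_bound[OF _ meas_f])
    let ?S = "{x \<in> extensional I. N x \<le> r} \<times> space \<mu>"
    have S: "{x \<in> extensional I. N x \<le> r} \<in> sets (lborel_on I)" by (simp add: sets_lborel_on)
    have "emeasure (lborel_on I \<Otimes>\<^sub>M \<mu>) ?S = emeasure (lborel_on I) {x \<in> extensional I. N x \<le> r} * emeasure \<mu> (space \<mu>)"
      using S by (intro emeasure_pair_measure_Times) auto
    also have "\<dots> < \<infinity>" using emeasure_ball_finite[of r] by (simp add: ennreal_mult_less_top emeasure_eq_measure)
    finally show "integrable (lborel_on I \<Otimes>\<^sub>M \<mu>) (\<lambda>z. C * (B * \<bar>W\<bar>) * indicator ?S z)"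
      using S by (intro integrable_mult_right integrable_real_indicator) auto
    show "AE z in lborel_on I \<Otimes>\<^sub>M \<mu>. norm (case_prod f z) \<le> norm (C * (B * \<bar>W\<bar>) * indicator ?S z)"
    proof (rule AE_I2)
      fix z assume "z \<in> space (lborel_on I \<Otimes>\<^sub>M \<mu>)"
      then have "fst z \<in> extensional I" "snd z \<in> space \<mu>" by (auto simp: space_pair_measure space_borel_on)
      then show "norm (case_prod f z) \<le> norm (C * (B * \<bar>W\<bar>) * indicator ?S z)"
        using f_bound[of "fst z" "snd z"] by (cases z) (auto simp: indicator_def split: if_splits)
    qed
  qed
  have "mollified \<delta> (\<lambda>_. 0) * (\<integral>a. \<phi> a \<partial>lborel_on I) = (\<integral>a. \<phi> a * mollified \<delta> (\<lambda>_. 0) \<partial>lborel_on I)"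
    by simp
  also have "\<dots> = (\<integral>a. (\<integral>x. f a x \<partial>\<mu>) \<partial>lborel_on I)"
  proof (intro arg_cong[where f = "integral\<^sup>L _"] ext)
    fix a
    have "\<phi> a * mollified \<delta> (\<lambda>_. 0) = \<phi> a * mollified \<delta> a"
      using mollified_const[OF \<delta> supp r, of a] by (cases "\<phi> a = 0") auto
    then show "\<phi> a * mollified \<delta> (\<lambda>_. 0) = (\<integral>x. f a x \<partial>\<mu>)"
      by (simp add: f_def mollified_def)
  qed
  also have "\<dots> = (\<integral>x. (\<integral>a. f a x \<partial>lborel_on I) \<partial>\<mu>)"
    using LM.Fubini_integral[OF int] by simp
  also have "\<dots> = (\<integral>x. \<delta> ^ card I * (smeared \<phi> \<delta> x * w x) \<partial>\<mu>)"
  proof (intro arg_cong[where f = "integral\<^sup>L _"] ext)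
    fix x
    have "(\<integral>a. f a x \<partial>lborel_on I) = (\<integral>a. \<phi> a * bump \<delta> a x \<partial>lborel_on I) * w x"
      by (simp add: f_def mult.assoc[symmetric])
    also have "(\<integral>a. \<phi> a * bump \<delta> a x \<partial>lborel_on I) =
        \<bar>\<delta>\<bar> ^ card I * (\<integral>y. \<phi> (affine_on I x \<delta> y) * bump \<delta> (affine_on I x \<delta> y) x \<partial>lborel_on I)"
    proof (rule integral_affine_on[OF fin])
      show "(\<lambda>a. \<phi> a * bump \<delta> a x) \<in> borel_measurable (borel_on I)"
        unfolding bump_def
        by (intro borel_measurable_times \<phi> borel_measurable_prod measurable_compose[OF _ measurable_splines(2)]
          borel_measurable_divide borel_measurable_diff borel_measurable_const measurable_component_singleton)
    qed (use \<delta> in simp)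
    also have "(\<lambda>y. bump \<delta> (affine_on I x \<delta> y) x) = (\<lambda>y. \<Prod>j\<in>I. spline (y j))"
      using \<delta> by (auto simp: bump_def affine_on_def fun_eq_iff intro!: prod.cong)
    then have "(\<integral>y. \<phi> (affine_on I x \<delta> y) * bump \<delta> (affine_on I x \<delta> y) x \<partial>lborel_on I) = smeared \<phi> \<delta> x"
      by (simp add: smeared_def fun_eq_iff)
    finally show "(\<integral>a. f a x \<partial>lborel_on I) = \<delta> ^ card I * (smeared \<phi> \<delta> x * w x)"
      using \<delta> by simp
  qed
  finally show ?thesis by simp
qed

abbreviation bw :: "nat \<Rightarrow> real" where "bw k \<equiv> 1 / real (Suc k)"

lemma bw_tendsto: "bw \<longlonglongrightarrow> 0"
  using LIMSEQ_inverse_real_of_nat by (simp add: inverse_eq_divide)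

lemma bw_pos: "bw k > 0" by simp

lemma integrable_spline_prod:
  "integrable (lborel_on I) (\<lambda>y. \<Prod>j\<in>I. spline (y j))" "(\<integral>y. (\<Prod>j\<in>I. spline (y j)) \<partial>lborel_on I) = 1"
proof -
  have i: "integrable lborel spline" "(\<integral>x. spline x \<partial>lborel) = 1"
    using has_integral_spline by (auto simp: has_bochner_integral_iff)
  show "integrable (lborel_on I) (\<lambda>y. \<Prod>j\<in>I. spline (y j))"
    by (rule lb.product_integrable_prod[OF fin i(1)])
  show "(\<integral>y. (\<Prod>j\<in>I. spline (y j)) \<partial>lborel_on I) = 1"
    using lb.product_integral_prod[OF fin, of "\<lambda>_. spline"] i by simp
qed

lemma smeared_bound:
  assumes [measurable]: "\<phi> \<in> borel_measurable (borel_on I)" and C: "\<And>a. \<bar>\<phi> a\<bar> \<le> C"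
  shows "\<bar>smeared \<phi> \<delta> x\<bar> \<le> C * (\<integral>y. \<bar>\<Prod>j\<in>I. spline (y j)\<bar> \<partial>lborel_on I)"
proof -
  have "norm (smeared \<phi> \<delta> x) \<le> (\<integral>y. norm (\<phi> (affine_on I x \<delta> y) * (\<Prod>j\<in>I. spline (y j))) \<partial>lborel_on I)"
    unfolding smeared_def by (rule integral_norm_bound)
  also have "\<dots> \<le> (\<integral>y. C * \<bar>\<Prod>j\<in>I. spline (y j)\<bar> \<partial>lborel_on I)"
  proof (rule integral_mono[OF integrable_norm])
    show "integrable (lborel_on I) (\<lambda>y. C * \<bar>\<Prod>j\<in>I. spline (y j)\<bar>)"
      by (intro integrable_mult_right integrable_abs integrable_spline_prod)
    show "integrable (lborel_on I) (\<lambda>y. \<phi> (affine_on I x \<delta> y) * (\<Prod>j\<in>I. spline (y j)))"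
    proof (rule Bochner_Integration.integrable_bound)
      show "integrable (lborel_on I) (\<lambda>y. C * \<bar>\<Prod>j\<in>I. spline (y j)\<bar>)"
        by (intro integrable_mult_right integrable_abs integrable_spline_prod)
      show "(\<lambda>y. \<phi> (affine_on I x \<delta> y) * (\<Prod>j\<in>I. spline (y j))) \<in> borel_measurable (lborel_on I)"
        using integrable_spline_prod(1) unfolding measurable_lborel_on
        by (intro borel_measurable_times measurable_compose[OF measurable_affine_on] assms)
          (simp add: measurable_lborel_on[symmetric])
      show "AE y in lborel_on I. norm (\<phi> (affine_on I x \<delta> y) * (\<Prod>j\<in>I. spline (y j)))
          \<le> norm (C * \<bar>\<Prod>j\<in>I. spline (y j)\<bar>)"
        by (rule AE_I2) (auto simp: abs_mult intro!: mult_right_mono order_trans[OF C])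
    qed
    show "norm (\<phi> (affine_on I x \<delta> y) * (\<Prod>j\<in>I. spline (y j))) \<le> C * \<bar>\<Prod>j\<in>I. spline (y j)\<bar>" for y
      by (auto simp: abs_mult intro!: mult_right_mono C)
  qed
  finally show ?thesis by simp
qed

lemma affine_on_support:
  assumes "\<delta> > 0" "N (affine_on I x \<delta> y) \<le> r" "(\<Prod>j\<in>I. spline (y j)) \<noteq> 0"
  shows "N x \<le> r + 3/2 * \<delta> * d"
proof -
  have "N x \<le> N (affine_on I x \<delta> y) + (3/2 * \<delta>) * d"
  proof (rule N_le_shift)
    fix i assume "i \<in> I"
    moreover have "spline (y i) \<noteq> 0" using assms(3) fin \<open>i \<in> I\<close> by simp
    then have "\<bar>y i\<bar> \<le> 3/2" using spline_support(1)[of "y i"] by linarith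
    ultimately show "\<bar>x i - affine_on I x \<delta> y i\<bar> \<le> 3/2 * \<delta>"
      using assms(1) by (simp add: affine_on_def abs_mult mult.commute)
  qed
  then show ?thesis using assms(2) by linarith
qed

text \<open>The smeared test function tends to \<phi>; \<open>lim\<close> is continuity of \<phi> in
  the form in which it occurs under the integral. From the index k0 on, all supports stay in the
  ball of radius r' < R, where w is bounded.\<close>

lemma mollified_tendsto:
  assumes \<phi>[measurable]: "\<phi> \<in> borel_measurable (borel_on I)"
    and C: "\<And>a. \<bar>\<phi> a\<bar> \<le> C" and supp: "\<And>a. \<phi> a \<noteq> 0 \<Longrightarrow> N a \<le> r" and r: "r < R"
    and lim: "\<And>x y. x \<in> extensional I \<Longrightarrow> (\<lambda>k. \<phi> (affine_on I x (bw k) y)) \<longlonglongrightarrow> \<phi> x"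
  shows "(\<lambda>k. mollified (bw k) (\<lambda>_. 0) / bw k ^ card I * (\<integral>a. \<phi> a \<partial>lborel_on I)) \<longlonglongrightarrow> (\<integral>x. \<phi> x * w x \<partial>\<mu>)"
proof -
  define r' where "r' = (r + R) / 2"
  have r': "r < r'" "r' < R" using r by (auto simp: r'_def)
  have "(\<lambda>k. r + 4 * bw k * d) \<longlonglongrightarrow> r + 4 * 0 * d"
    by (intro tendsto_intros bw_tendsto)
  then have "\<forall>\<^sub>F k in sequentially. r + 4 * bw k * d < r'"
    using r' by (intro order_tendstoD) auto
  then obtain k0 where k0: "\<And>k. k \<ge> k0 \<Longrightarrow> r + 4 * bw k * d < r'"
    by (auto simp: eventually_sequentially)
  define S where "S = (\<integral>y. \<bar>\<Prod>j\<in>I. spline (y j)\<bar> \<partial>lborel_on I)"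
  have S0: "0 \<le> S" unfolding S_def by (intro integral_nonneg_AE) simp
  have C0: "0 \<le> C" using C[of undefined] by linarith
  obtain W where W: "\<And>x. N x \<le> r' \<Longrightarrow> w x \<le> W" using w_bound[OF r'(2)] by blast
  have sm_supp: "smeared \<phi> (bw k) x = 0" if "\<not> N x \<le> r'" "k \<ge> k0" for k x
  proof -
    have le: "3/2 * bw k * d \<le> 4 * bw k * d" by (intro mult_right_mono) auto
    have z: "\<phi> (affine_on I x (bw k) y) * (\<Prod>j\<in>I. spline (y j)) = 0" for y
    proof (rule ccontr)
      assume "\<not> ?thesis"
      then have "\<phi> (affine_on I x (bw k) y) \<noteq> 0" "(\<Prod>j\<in>I. spline (y j)) \<noteq> 0" by auto
      then have "N x \<le> r + 3/2 * bw k * d" by (intro affine_on_support[OF bw_pos supp])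
      then show False using that le k0[OF that(2)] by linarith
    qed
    show ?thesis unfolding smeared_def z by simp
  qed
  have meas_sm: "smeared \<phi> \<delta> \<in> borel_measurable (borel_on I)" for \<delta>
  proof -
    interpret L: sigma_finite_measure "lborel_on I" by (rule sigma_finite_lborel_on)
    have 0: "(\<lambda>z. affine_on I (fst z) \<delta> (snd z)) \<in> measurable (borel_on I \<Otimes>\<^sub>M lborel_on I) (borel_on I)"
      unfolding affine_on_def
    proof (intro measurable_restrict borel_measurable_add borel_measurable_times borel_measurable_const)
      fix i assume "i \<in> I"
      then show "(\<lambda>x. fst x i) \<in> borel_measurable (borel_on I \<Otimes>\<^sub>M lborel_on I)"
        by (intro measurable_compose[OF measurable_fst]) auto
      show "(\<lambda>x. snd x i) \<in> borel_measurable (borel_on I \<Otimes>\<^sub>M lborel_on I)"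
        using \<open>i \<in> I\<close> by (intro measurable_compose[OF measurable_snd]) (auto simp: measurable_lborel_on)
    qed
    have 1: "(\<lambda>z. \<Prod>j\<in>I. spline (snd z j)) \<in> borel_measurable (borel_on I \<Otimes>\<^sub>M lborel_on I)"
      using integrable_spline_prod(1)
      by (intro measurable_compose[OF measurable_snd, where g = "\<lambda>y. \<Prod>j\<in>I. spline (y j)"]) auto
    show ?thesis
      unfolding smeared_def[abs_def]
      by (rule L.borel_measurable_lebesgue_integral)
        (simp add: split_beta', intro borel_measurable_times measurable_compose[OF 0 \<phi>] 1)
  qed
  have sm_lim: "(\<lambda>k. smeared \<phi> (bw k) x) \<longlonglongrightarrow> \<phi> x" if x: "x \<in> extensional I" for x
  proof -
    have "(\<lambda>k. smeared \<phi> (bw k) x) \<longlonglongrightarrow> (\<integral>y. \<phi> x * (\<Prod>j\<in>I. spline (y j)) \<partial>lborel_on I)"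
      unfolding smeared_def
    proof (rule integral_dominated_convergence[where w = "\<lambda>y. C * \<bar>\<Prod>j\<in>I. spline (y j)\<bar>"])
      show "(\<lambda>y. \<phi> x * (\<Prod>j\<in>I. spline (y j))) \<in> borel_measurable (lborel_on I)"
        by (intro borel_measurable_integrable integrable_mult_right integrable_spline_prod)
      show "(\<lambda>y. \<phi> (affine_on I x (bw k) y) * (\<Prod>j\<in>I. spline (y j))) \<in> borel_measurable (lborel_on I)" for k
        using integrable_spline_prod(1) unfolding measurable_lborel_on
        by (intro borel_measurable_times measurable_compose[OF measurable_affine_on \<phi>])
          (simp add: measurable_lborel_on[symmetric])
      show "integrable (lborel_on I) (\<lambda>y. C * \<bar>\<Prod>j\<in>I. spline (y j)\<bar>)"
        by (intro integrable_mult_right integrable_abs integrable_spline_prod)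
      show "AE y in lborel_on I. (\<lambda>k. \<phi> (affine_on I x (bw k) y) * (\<Prod>j\<in>I. spline (y j)))
          \<longlonglongrightarrow> \<phi> x * (\<Prod>j\<in>I. spline (y j))"
        by (intro AE_I2 tendsto_mult tendsto_const lim x)
      show "AE y in lborel_on I. norm (\<phi> (affine_on I x (bw k) y) * (\<Prod>j\<in>I. spline (y j)))
          \<le> C * \<bar>\<Prod>j\<in>I. spline (y j)\<bar>" for k
        by (intro AE_I2) (auto simp: abs_mult intro!: mult_right_mono C)
    qed
    then show ?thesis by (simp add: integrable_spline_prod)
  qed
  have "(\<lambda>k. \<integral>x. smeared \<phi> (bw (k + k0)) x * w x \<partial>\<mu>) \<longlonglongrightarrow> (\<integral>x. \<phi> x * w x \<partial>\<mu>)"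
  proof (rule integral_dominated_convergence[where w = "\<lambda>_. C * S * \<bar>W\<bar>"])
    show "(\<lambda>x. smeared \<phi> (bw (k + k0)) x * w x) \<in> borel_measurable \<mu>" for k
      using meas_sm[of "bw (k + k0)"] by measurable
    show "AE x in \<mu>. (\<lambda>k. smeared \<phi> (bw (k + k0)) x * w x) \<longlonglongrightarrow> \<phi> x * w x"
      by (intro AE_I2 tendsto_mult tendsto_const LIMSEQ_ignore_initial_segment[OF sm_lim])
        (simp add: space_mu)
    show "AE x in \<mu>. norm (smeared \<phi> (bw (k + k0)) x * w x) \<le> C * S * \<bar>W\<bar>" for k
    proof (rule AE_I2)
      fix x
      show "norm (smeared \<phi> (bw (k + k0)) x * w x) \<le> C * S * \<bar>W\<bar>"
      proof (cases "N x \<le> r'")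
        case True
        then have "w x \<le> \<bar>W\<bar>" using W by fastforce
        then show ?thesis
          unfolding real_norm_def abs_mult
          using smeared_bound[OF \<phi> C, of "bw (k + k0)" x] w_nonneg[of x] S0 C0
          by (intro mult_mono) (auto simp: S_def)
      next
        case False
        then show ?thesis using sm_supp[OF False, of "k + k0"] S0 C0 by simp
      qed
    qed
  qed auto
  moreover have "(\<integral>x. smeared \<phi> (bw (k + k0)) x * w x \<partial>\<mu>)
      = mollified (bw (k + k0)) (\<lambda>_. 0) / bw (k + k0) ^ card I * (\<integral>a. \<phi> a \<partial>lborel_on I)" for k
  proof -
    have "r + 4 * bw (k + k0) * d < R" using k0[of "k + k0"] r' by simp
    from mollified_smeared[OF bw_pos \<phi> C supp this]
    show ?thesis by (simp add: field_simps del: of_nat_Suc of_nat_add)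
  qed
  ultimately have "(\<lambda>k. mollified (bw (k + k0)) (\<lambda>_. 0) / bw (k + k0) ^ card I * (\<integral>a. \<phi> a \<partial>lborel_on I))
    \<longlonglongrightarrow> (\<integral>x. \<phi> x * w x \<partial>\<mu>)" by (simp only:)
  then show ?thesis by (rule LIMSEQ_offset)
qed

lemma N_affine_tendsto:
  assumes "x \<in> extensional I"
  shows "(\<lambda>k. N (affine_on I x (bw k) y)) \<longlonglongrightarrow> N x"
    and "i \<in> I \<Longrightarrow> (\<lambda>k. affine_on I x (bw k) y i) \<longlonglongrightarrow> x i"
proof -
  have "(\<lambda>k. \<Sum>i\<in>I. \<bar>bw k * y i\<bar>) \<longlonglongrightarrow> (\<Sum>i\<in>I. \<bar>0 * y i\<bar>)"
    by (intro tendsto_intros bw_tendsto)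
  then have 0: "(\<lambda>k. \<Sum>i\<in>I. \<bar>bw k * y i\<bar>) \<longlonglongrightarrow> 0" by simp
  have "\<forall>\<^sub>F k in sequentially. norm (N (affine_on I x (bw k) y) - N x) \<le> norm (\<Sum>i\<in>I. \<bar>bw k * y i\<bar>) * 1"
  proof (intro always_eventually allI)
    fix k
    have "\<bar>N (affine_on I x (bw k) y) - N x\<bar> \<le> (\<Sum>i\<in>I. \<bar>affine_on I x (bw k) y i - x i\<bar>)" by (rule Lipschitz)
    also have "\<dots> = (\<Sum>i\<in>I. \<bar>bw k * y i\<bar>)" by (intro sum.cong) (auto simp: affine_on_def)
    finally show "norm (N (affine_on I x (bw k) y) - N x) \<le> norm (\<Sum>i\<in>I. \<bar>bw k * y i\<bar>) * 1"
      by simp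
  qed
  then have "(\<lambda>k. N (affine_on I x (bw k) y) - N x) \<longlonglongrightarrow> 0" using 0 by (rule tendsto_0_le[rotated])
  then show "(\<lambda>k. N (affine_on I x (bw k) y)) \<longlonglongrightarrow> N x" by (simp add: LIM_zero_iff)
  assume "i \<in> I"
  moreover have "(\<lambda>k. x i + bw k * y i) \<longlonglongrightarrow> x i + 0 * y i" by (intro tendsto_intros bw_tendsto)
  ultimately show "(\<lambda>k. affine_on I x (bw k) y i) \<longlonglongrightarrow> x i" by (simp add: affine_on_def)
qed

text \<open>The normalised heights of the mollifications do not involve \<phi>. One test function
  with positive integral therefore proves that they converge, and their limit \<kappa> serves all
  test functions.\<close>

lemma ex_constant:
  "\<exists>\<kappa>\<ge>0. \<forall>\<phi> C r. \<phi> \<in> borel_measurable (borel_on I) \<longrightarrow> (\<forall>a. \<bar>\<phi> a\<bar> \<le> C) \<longrightarrow> (\<forall>a. \<phi> a \<noteq> 0 \<longrightarrow> N a \<le> r) \<longrightarrow> r < R \<longrightarrow>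
     (\<forall>x y. x \<in> extensional I \<longrightarrow> (\<lambda>k. \<phi> (affine_on I x (bw k) y)) \<longlonglongrightarrow> \<phi> x) \<longrightarrow>
     (\<integral>x. \<phi> x * w x \<partial>\<mu>) = \<kappa> * (\<integral>a. \<phi> a \<partial>lborel_on I)"
proof -
  \<comment> \<open>A cone of height R / 2 supported in the ball of radius R / 2.\<close>
  define \<phi>0 where "\<phi>0 x = max 0 (R / 2 - N x)" for x
  have m0: "\<phi>0 \<in> borel_measurable (borel_on I)" unfolding \<phi>0_def[abs_def] by measurable
  have b0: "\<bar>\<phi>0 x\<bar> \<le> R / 2" for x using N_nonneg[of x] R_pos by (auto simp: \<phi>0_def max_def)
  have s0: "N x \<le> R / 2" if "\<phi>0 x \<noteq> 0" for x using that by (auto simp: \<phi>0_def max_def split: if_splits)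
  have l0: "(\<lambda>k. \<phi>0 (affine_on I x (bw k) y)) \<longlonglongrightarrow> \<phi>0 x" if "x \<in> extensional I" for x y
    unfolding \<phi>0_def by (intro tendsto_intros N_affine_tendsto that)
  define J where "J = (\<integral>a. \<phi>0 a \<partial>lborel_on I)"
  have J: "J > 0"
  proof -
    \<comment> \<open>The cube of half side h lies in the ball of radius R / 4, on which the cone is
      at least R / 4. The summand 1 keeps the denominator positive for empty I.\<close>
    define h where "h = (R / 4) / (d + 1)"
    have h: "h > 0" using R_pos by (simp add: h_def add_nonneg_pos)
    have hd: "h * d \<le> R / 4"
    proof -
      have "h * d \<le> h * (d + 1)" using h by simp
      also have "\<dots> = R / 4" 
      proof -
        have "d + 1 > 0" by (simp add: add_nonneg_pos)
        then show ?thesis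
          unfolding h_def by (intro nonzero_eq_divide_eq[THEN iffD1, OF _ refl]) simp
      qed
      finally show ?thesis .
    qed
    let ?B = "Pi\<^sub>E I (\<lambda>_. {-h..h})"
    have B: "?B \<in> sets (lborel_on I)" by (intro sets_PiM_I_finite fin) auto
    have eB: "emeasure (lborel_on I) ?B = ennreal ((2 * h) ^ card I)"
      using h by (simp add: lb.emeasure_PiM[OF fin] ennreal_power)
    have intB: "integrable (lborel_on I) (\<lambda>x. R / 4 * indicator ?B x)"
      using B eB by (intro integrable_mult_right integrable_real_indicator) auto
    have "0 < R / 4 * measure (lborel_on I) ?B"
      using R_pos h eB by (simp add: measure_def)
    also have "\<dots> = (\<integral>x. R / 4 * indicator ?B x \<partial>lborel_on I)"
      using B sets.sets_into_space[OF B] by (simp add: Int_absorb2)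
    also have "\<dots> \<le> J"
      unfolding J_def
    proof (rule integral_mono[OF intB])
      show "integrable (lborel_on I) \<phi>0"
      proof (rule Bochner_Integration.integrable_bound)
        show "integrable (lborel_on I) (\<lambda>x. R / 2 * indicator {x \<in> extensional I. N x \<le> R / 2} x)"
          by (intro integrable_mult_right integrable_ball)
        show "\<phi>0 \<in> borel_measurable (lborel_on I)" using m0 by (simp add: measurable_lborel_on)
        show "AE x in lborel_on I. norm (\<phi>0 x) \<le> norm (R / 2 * indicator {x \<in> extensional I. N x \<le> R / 2} x)"
        proof (rule AE_I2)
          fix x assume "x \<in> space (lborel_on I)"
          then show "norm (\<phi>0 x) \<le> norm (R / 2 * indicator {x \<in> extensional I. N x \<le> R / 2} x)"
            using b0[of x] s0[of x] R_pos by (cases "\<phi>0 x = 0") (auto simp: space_borel_on)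
        qed
      qed
      fix x
      have "N x \<le> R / 4" if "x \<in> ?B"
      proof -
        have "N x \<le> N (\<lambda>_. 0) + h * d" using that by (intro N_le_shift) (auto simp: PiE_iff abs_le_iff)
        then show ?thesis using hd N_zero by simp
      qed
      then have "R / 4 \<le> R / 2 - N x" if "x \<in> ?B" using that by fastforce
      then show "R / 4 * indicator ?B x \<le> \<phi>0 x" by (auto simp: \<phi>0_def indicator_def le_max_iff_disj)
    qed
    finally show ?thesis .
  qed
  define \<kappa> where "\<kappa> = (\<integral>x. \<phi>0 x * w x \<partial>\<mu>) / J"
  have \<kappa>0: "\<kappa> \<ge> 0"
    unfolding \<kappa>_def using J by (intro divide_nonneg_pos integral_nonneg_AE AE_I2)
      (auto simp: \<phi>0_def w_nonneg intro!: mult_nonneg_nonneg)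
  have "(\<lambda>k. mollified (bw k) (\<lambda>_. 0) / bw k ^ card I * J) \<longlonglongrightarrow> (\<integral>x. \<phi>0 x * w x \<partial>\<mu>)"
    unfolding J_def by (rule mollified_tendsto[OF m0 b0 s0 _ l0]) (use R_pos in simp_all)
  then have "(\<lambda>k. mollified (bw k) (\<lambda>_. 0) / bw k ^ card I * J / J) \<longlonglongrightarrow> \<kappa>"
    unfolding \<kappa>_def by (rule tendsto_divide[OF _ tendsto_const]) (use J in simp)
  then have lim\<kappa>: "(\<lambda>k. mollified (bw k) (\<lambda>_. 0) / bw k ^ card I) \<longlonglongrightarrow> \<kappa>" using J by simp
  show ?thesis
  proof (intro exI[of _ \<kappa>] conjI allI impI \<kappa>0)
    fix \<phi> :: "('i \<Rightarrow> real) \<Rightarrow> real" and C r :: real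
    assume \<phi>: "\<phi> \<in> borel_measurable (borel_on I)" "\<forall>a. \<bar>\<phi> a\<bar> \<le> C" "\<forall>a. \<phi> a \<noteq> 0 \<longrightarrow> N a \<le> r" "r < R"
      "\<forall>x y. x \<in> extensional I \<longrightarrow> (\<lambda>k. \<phi> (affine_on I x (bw k) y)) \<longlonglongrightarrow> \<phi> x"
    have "(\<lambda>k. mollified (bw k) (\<lambda>_. 0) / bw k ^ card I * (\<integral>a. \<phi> a \<partial>lborel_on I)) \<longlonglongrightarrow> (\<integral>x. \<phi> x * w x \<partial>\<mu>)"
      by (rule mollified_tendsto[where C = C and r = r]) (use \<phi> in auto)
    moreover have "(\<lambda>k. mollified (bw k) (\<lambda>_. 0) / bw k ^ card I * (\<integral>a. \<phi> a \<partial>lborel_on I)) \<longlonglongrightarrow> \<kappa> * (\<integral>a. \<phi> a \<partial>lborel_on I)"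
      by (intro tendsto_mult lim\<kappa> tendsto_const)
    ultimately show "(\<integral>x. \<phi> x * w x \<partial>\<mu>) = \<kappa> * (\<integral>a. \<phi> a \<partial>lborel_on I)"
      by (rule LIMSEQ_unique)
  qed
qed

section \<open>From continuous test functions to boxes\<close>

lemma ramp_mono: "0 \<le> u \<Longrightarrow> max 0 (min 1 (real k * s - u)) \<le> max 0 (min 1 (real (Suc k) * s - u))"
proof (cases "s \<le> 0")
  case True
  assume "0 \<le> u"
  moreover have "real k * s \<le> 0" using True by (intro mult_nonneg_nonpos) auto
  ultimately show ?thesis by (simp add: max_def)
next
  case False
  then have "real k * s - u \<le> real (Suc k) * s - u" by (simp add: algebra_simps)
  then show ?thesis by (intro max.mono min.mono order_refl)
qed

lemma ramp_tendsto:
  assumes "0 \<le> u"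
  shows "(\<lambda>k. max 0 (min 1 (real k * s - u))) \<longlonglongrightarrow> (if 0 < s then 1 else (0::real))"
proof (cases "0 < s")
  case True
  obtain k0 :: nat where k0: "(1 + u) / s < real k0" using reals_Archimedean2 by blast
  have "max 0 (min 1 (real k * s - u)) = 1" if "k \<ge> k0" for k
  proof -
    have "1 + u < real k0 * s" using k0 True by (simp add: pos_divide_less_eq)
    also have "\<dots> \<le> real k * s" using that True by simp
    finally show ?thesis by simp
  qed
  then show ?thesis using True by (auto intro!: tendsto_eventually exI[of _ k0] simp: eventually_sequentially)
next
  case False
  have "max 0 (min 1 (real k * s - u)) = 0" for k
  proof -
    have "real k * s \<le> 0" using False by (intro mult_nonneg_nonpos) auto
    then show ?thesis using assms by (simp add: max_def)
  qed
  then show ?thesis using False by simp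
qed

lemma nn_integral_box:
  assumes \<kappa>: "\<kappa> \<ge> 0"
    and const: "\<And>\<phi> C r. \<phi> \<in> borel_measurable (borel_on I) \<Longrightarrow> (\<And>a. \<bar>\<phi> a\<bar> \<le> C) \<Longrightarrow> (\<And>a. \<phi> a \<noteq> 0 \<Longrightarrow> N a \<le> r) \<Longrightarrow>
     r < R \<Longrightarrow> (\<And>x y. x \<in> extensional I \<Longrightarrow> (\<lambda>k. \<phi> (affine_on I x (bw k) y)) \<longlonglongrightarrow> \<phi> x) \<Longrightarrow>
     (\<integral>x. \<phi> x * w x \<partial>\<mu>) = \<kappa> * (\<integral>a. \<phi> a \<partial>lborel_on I)"
  defines "G \<equiv> \<lambda>t (x :: 'i \<Rightarrow> real). (if N x < R then 1 else 0) * (\<Prod>i\<in>I. if x i < t i then 1 else (0::real))"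
  shows "(\<integral>\<^sup>+x. ennreal (G t x * w x) \<partial>\<mu>) = ennreal \<kappa> * (\<integral>\<^sup>+x. ennreal (G t x) \<partial>lborel_on I)"
proof -
  \<comment> \<open>Continuous ramps increasing to the indicator of an open ball times an open lower
    box. The offset 1 in the first factor pushes the support into the ball of radius R - 1 / (k +
    1), strictly inside, as \<open>const\<close> demands; the offset 0 gives the other factors the
    same form, so the ramp lemmas apply to both.\<close>
  define \<phi> where "\<phi> k x = max 0 (min 1 (real k * (R - N x) - 1)) * (\<Prod>i\<in>I. max 0 (min 1 (real k * (t i - x i) - 0)))" for k :: nat and x
  have meas: "\<phi> k \<in> borel_measurable (borel_on I)" for k
    unfolding \<phi>_def[abs_def]
    by (intro borel_measurable_times borel_measurable_max borel_measurable_min borel_measurable_const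
        borel_measurable_diff measurable_N borel_measurable_prod measurable_component_singleton)
  have nonneg: "0 \<le> \<phi> k x" for k x unfolding \<phi>_def by (intro mult_nonneg_nonneg prod_nonneg) auto
  have le1: "\<phi> k x \<le> 1" for k x
  proof -
    have "(\<Prod>i\<in>I. max 0 (min 1 (real k * (t i - x i) - 0))) \<le> 1" by (intro prod_le_1) auto
    moreover have "0 \<le> (\<Prod>i\<in>I. max 0 (min 1 (real k * (t i - x i) - 0)))" by (intro prod_nonneg) auto
    ultimately show ?thesis unfolding \<phi>_def by (intro mult_le_one) auto
  qed
  have bound: "\<bar>\<phi> k x\<bar> \<le> 1" for k x using nonneg[of k x] le1[of k x] by simp
  have supp: "N x \<le> R - 1 / real (Suc k)" if "\<phi> k x \<noteq> 0" for k x
  proof -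
    have pos: "0 < real k * (R - N x) - 1" using that by (auto simp: \<phi>_def max_def split: if_splits)
    then have "k \<noteq> 0" by (intro notI) simp
    then have "1 / real k < R - N x" using pos by (simp add: pos_divide_less_eq mult.commute)
    moreover have "1 / real (Suc k) \<le> 1 / real k" using \<open>k \<noteq> 0\<close> by (intro divide_left_mono) auto
    ultimately show ?thesis by linarith
  qed
  have R': "R - 1 / real (Suc k) < R" for k by simp
  have lim: "(\<lambda>j. \<phi> k (affine_on I x (bw j) y)) \<longlonglongrightarrow> \<phi> k x" if "x \<in> extensional I" for k x y
    unfolding \<phi>_def using that
    by (intro tendsto_mult tendsto_max tendsto_min tendsto_diff tendsto_const tendsto_prod N_affine_tendsto)
  have inc: "incseq (\<lambda>k. \<phi> k x)" for x
    unfolding \<phi>_def[abs_def]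
    by (intro incseq_SucI mult_mono prod_mono conjI ramp_mono prod_nonneg) auto
  have conv: "(\<lambda>k. \<phi> k x) \<longlonglongrightarrow> G t x" for x
    using tendsto_mult[OF ramp_tendsto[of 1 "R - N x"] tendsto_prod[OF ramp_tendsto[of 0], of I "\<lambda>i. t i - x i"]]
    unfolding \<phi>_def G_def by simp
  have sup1: "(SUP k. ennreal (\<phi> k x * w x)) = ennreal (G t x * w x)" for x
  proof (rule LIMSEQ_unique[OF LIMSEQ_SUP])
    show "incseq (\<lambda>k. ennreal (\<phi> k x * w x))"
      using inc[of x] w_nonneg[of x] by (auto simp: incseq_def intro!: ennreal_leI mult_right_mono)
    show "(\<lambda>k. ennreal (\<phi> k x * w x)) \<longlonglongrightarrow> ennreal (G t x * w x)"
      by (intro tendsto_ennrealI tendsto_mult conv tendsto_const)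
  qed
  have sup2: "(SUP k. ennreal (\<phi> k x)) = ennreal (G t x)" for x
  proof (rule LIMSEQ_unique[OF LIMSEQ_SUP])
    show "incseq (\<lambda>k. ennreal (\<phi> k x))"
      using inc[of x] by (auto simp: incseq_def intro!: ennreal_leI)
    show "(\<lambda>k. ennreal (\<phi> k x)) \<longlonglongrightarrow> ennreal (G t x)"
      by (intro tendsto_ennrealI conv)
  qed
  have eq: "(\<integral>\<^sup>+x. ennreal (\<phi> k x * w x) \<partial>\<mu>) = ennreal \<kappa> * (\<integral>\<^sup>+x. ennreal (\<phi> k x) \<partial>lborel_on I)" for k
  proof -
    have "(\<integral>\<^sup>+x. ennreal (\<phi> k x * w x) \<partial>\<mu>) = ennreal (\<integral>x. \<phi> k x * w x \<partial>\<mu>)"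
      by (intro nn_integral_eq_integral integrable_w[OF meas R' bound supp] AE_I2 mult_nonneg_nonneg nonneg w_nonneg)
    also have "(\<integral>x. \<phi> k x * w x \<partial>\<mu>) = \<kappa> * (\<integral>a. \<phi> k a \<partial>lborel_on I)"
      by (rule const[OF meas bound supp R' lim])
    also have "ennreal (\<kappa> * (\<integral>a. \<phi> k a \<partial>lborel_on I)) = ennreal \<kappa> * ennreal (\<integral>a. \<phi> k a \<partial>lborel_on I)"
      by (intro ennreal_mult \<kappa> integral_nonneg_AE AE_I2 nonneg)
    also have "ennreal (\<integral>a. \<phi> k a \<partial>lborel_on I) = (\<integral>\<^sup>+x. ennreal (\<phi> k x) \<partial>lborel_on I)"
    proof (rule nn_integral_eq_integral[symmetric])
      show "integrable (lborel_on I) (\<phi> k)"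
      proof (rule Bochner_Integration.integrable_bound)
        show "integrable (lborel_on I) (\<lambda>x. indicator {x \<in> extensional I. N x \<le> R} x :: real)"
          by (rule integrable_ball)
        show "\<phi> k \<in> borel_measurable (lborel_on I)" using meas by (simp add: measurable_lborel_on)
        show "AE x in lborel_on I. norm (\<phi> k x) \<le> norm (indicator {x \<in> extensional I. N x \<le> R} x :: real)"
        proof (rule AE_I2)
          fix x assume x: "x \<in> space (lborel_on I)"
          show "norm (\<phi> k x) \<le> norm (indicator {x \<in> extensional I. N x \<le> R} x :: real)"
          proof (cases "\<phi> k x = 0")
            case False
            then have "N x \<le> R" using supp[OF False] R'[of k] by linarith
            then show ?thesis using bound[of k x] x by (simp add: space_borel_on)
          qed simp
        qed
      qed
    qed (simp add: nonneg)
    finally show ?thesis .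
  qed
  have "(\<integral>\<^sup>+x. ennreal (G t x * w x) \<partial>\<mu>) = (SUP k. \<integral>\<^sup>+x. ennreal (\<phi> k x * w x) \<partial>\<mu>)"
    unfolding sup1[symmetric]
  proof (rule nn_integral_monotone_convergence_SUP)
    show "incseq (\<lambda>k x. ennreal (\<phi> k x * w x))"
      using inc w_nonneg by (auto simp: incseq_def le_fun_def intro!: ennreal_leI mult_right_mono)
    show "(\<lambda>x. ennreal (\<phi> k x * w x)) \<in> borel_measurable \<mu>" for k
      using meas[of k] by measurable
  qed
  also have "\<dots> = ennreal \<kappa> * (SUP k. \<integral>\<^sup>+x. ennreal (\<phi> k x) \<partial>lborel_on I)"
    unfolding eq by (rule SUP_mult_left_ennreal[symmetric])
  also have "(SUP k. \<integral>\<^sup>+x. ennreal (\<phi> k x) \<partial>lborel_on I) = (\<integral>\<^sup>+x. ennreal (G t x) \<partial>lborel_on I)"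
    unfolding sup2[symmetric]
  proof (rule nn_integral_monotone_convergence_SUP[symmetric])
    show "incseq (\<lambda>k x. ennreal (\<phi> k x))"
      using inc by (auto simp: incseq_def le_fun_def intro!: ennreal_leI)
    show "(\<lambda>x. ennreal (\<phi> k x)) \<in> borel_measurable (lborel_on I)" for k
      using meas[of k] unfolding measurable_lborel_on by measurable
  qed
  finally show ?thesis .
qed

lemma sets_borel_on_boxes:
  "sets (borel_on I) = sigma_sets (extensional I) {Pi\<^sub>E I (\<lambda>i. {..<t i}) | t. True}"
proof -
  let ?E = "\<lambda>i::'i. range (lessThan :: real \<Rightarrow> real set)"
  have b: "(borel :: real measure) = sigma UNIV (range lessThan)" by (rule borel_Iio)
  have "sets (borel_on I) = sets (Pi\<^sub>M I (\<lambda>i. sigma UNIV (?E i)))" unfolding b ..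
  also have "\<dots> = sets (sigma (\<Pi>\<^sub>E i\<in>I. UNIV) {{f\<in>(\<Pi>\<^sub>E i\<in>I. UNIV). \<forall>i\<in>j. f i \<in> A i} | A j. j \<in> {I} \<and> A \<in> Pi j ?E})"
  proof (rule sets_PiM_sigma)
    fix i :: 'i
    have "(UNIV :: real set) = (\<Union>k. {..<real k})" using reals_Archimedean2 by auto
    then show "\<exists>S\<subseteq>?E i. countable S \<and> UNIV = \<Union>S"
      by (intro exI[of _ "range (\<lambda>k::nat. {..<real k})"]) auto
  qed (use fin in auto)
  also have "{{f\<in>(\<Pi>\<^sub>E i\<in>I. UNIV). \<forall>i\<in>j. f i \<in> A i} | A j. j \<in> {I} \<and> A \<in> Pi j ?E}
      = {Pi\<^sub>E I (\<lambda>i. {..<t i}) | t. True}" (is "?L = ?R")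
  proof (rule equalityI; rule subsetI)
    fix X assume "X \<in> ?L"
    then obtain A where A: "X = {f\<in>(\<Pi>\<^sub>E i\<in>I. UNIV). \<forall>i\<in>I. f i \<in> A i}" "A \<in> Pi I ?E" by auto
    then have "\<forall>i\<in>I. \<exists>t. A i = {..<t}" by auto
    then obtain t where "\<And>i. i \<in> I \<Longrightarrow> A i = {..<t i}" by metis
    then have "X = Pi\<^sub>E I (\<lambda>i. {..<t i})" using A(1) by (auto simp: PiE_def Pi_def)
    then show "X \<in> ?R" by auto
  next
    fix X assume "X \<in> ?R"
    then obtain t where "X = Pi\<^sub>E I (\<lambda>i. {..<t i})" by auto
    then have "X = {f\<in>(\<Pi>\<^sub>E i\<in>I. UNIV). \<forall>i\<in>I. f i \<in> {..<t i}}" by (auto simp: PiE_def Pi_def)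
    then show "X \<in> ?L" by (auto intro!: exI[of _ "\<lambda>i. {..<t i}"])
  qed
  also have "(\<Pi>\<^sub>E i\<in>I. (UNIV :: real set)) = extensional I" by (auto simp: PiE_def)
  finally show ?thesis
    by (subst (asm) sets_measure_of) (auto simp: PiE_def)
qed

text \<open>Both measures are finite on the lower boxes with corners (k, ..., k), which exhaust the
  space, and agree on all lower boxes by \<open>nn_integral_box\<close>. These form an
  intersection-stable generator.\<close>

theorem density_eq:
  "\<exists>\<kappa>\<ge>0. density \<mu> (\<lambda>x. ennreal ((if N x < R then 1 else 0) * w x))
     = density (lborel_on I) (\<lambda>x. ennreal \<kappa> * (if N x < R then 1 else 0))"
proof -
  obtain \<kappa> where \<kappa>: "\<kappa> \<ge> 0" and const: "\<And>\<phi> C r. \<phi> \<in> borel_measurable (borel_on I) \<Longrightarrow> (\<And>a. \<bar>\<phi> a\<bar> \<le> C) \<Longrightarrow> (\<And>a. \<phi> a \<noteq> 0 \<Longrightarrow> N a \<le> r) \<Longrightarrow>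
     r < R \<Longrightarrow> (\<And>x y. x \<in> extensional I \<Longrightarrow> (\<lambda>k. \<phi> (affine_on I x (bw k) y)) \<longlonglongrightarrow> \<phi> x) \<Longrightarrow>
     (\<integral>x. \<phi> x * w x \<partial>\<mu>) = \<kappa> * (\<integral>a. \<phi> a \<partial>lborel_on I)"
    using ex_constant by blast
  let ?m1 = "density \<mu> (\<lambda>x. ennreal ((if N x < R then 1 else 0) * w x))"
  let ?m2 = "density (lborel_on I) (\<lambda>x. ennreal \<kappa> * (if N x < R then 1 else 0))"
  let ?E = "{Pi\<^sub>E I (\<lambda>i. {..<t i}) | t. True} :: ('i \<Rightarrow> real) set set"
  have box[measurable]: "Pi\<^sub>E I (\<lambda>i. {..<t i}) \<in> sets (borel_on I)" for t :: "'i \<Rightarrow> real"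
    by (intro sets_PiM_I_finite fin) auto
  have ind: "indicator (Pi\<^sub>E I (\<lambda>i. {..<t i})) x = ennreal (\<Prod>i\<in>I. if x i < t i then 1 else (0::real))"
    if "x \<in> extensional I" for t x :: "'i \<Rightarrow> real"
  proof (cases "\<forall>i\<in>I. x i < t i")
    case True
    then show ?thesis using that by (simp add: PiE_def Pi_def)
  next
    case False
    then have "(\<Prod>i\<in>I. if x i < t i then 1 else (0::real)) = 0" using fin by (auto simp: prod_zero_iff)
    moreover have "x \<notin> Pi\<^sub>E I (\<lambda>i. {..<t i})" using False by (auto simp: PiE_def Pi_def)
    ultimately show ?thesis by simp
  qed
  have eq: "emeasure ?m1 (Pi\<^sub>E I (\<lambda>i. {..<t i})) = emeasure ?m2 (Pi\<^sub>E I (\<lambda>i. {..<t i}))" for t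
  proof -
    let ?G = "\<lambda>x :: 'i \<Rightarrow> real. (if N x < R then 1 else 0) * (\<Prod>i\<in>I. if x i < t i then 1 else (0::real))"
    have "emeasure ?m1 (Pi\<^sub>E I (\<lambda>i. {..<t i})) = (\<integral>\<^sup>+x. ennreal (?G x * w x) \<partial>\<mu>)"
    proof (subst emeasure_density)
      show "(\<integral>\<^sup>+x. ennreal ((if N x < R then 1 else 0) * w x) * indicator (Pi\<^sub>E I (\<lambda>i. {..<t i})) x \<partial>\<mu>)
          = (\<integral>\<^sup>+x. ennreal (?G x * w x) \<partial>\<mu>)"
        using w_nonneg by (intro nn_integral_cong)
          (simp add: ind space_mu ennreal_mult[symmetric] prod_nonneg mult.commute)
    qed measurable
    also have "\<dots> = ennreal \<kappa> * (\<integral>\<^sup>+x. ennreal (?G x) \<partial>lborel_on I)"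
      by (rule nn_integral_box[OF \<kappa> const])
    also have "\<dots> = (\<integral>\<^sup>+x. ennreal \<kappa> * ennreal (?G x) \<partial>lborel_on I)"
    proof (rule nn_integral_cmult[symmetric])
      show "(\<lambda>x. ennreal (?G x)) \<in> borel_measurable (lborel_on I)"
        unfolding measurable_lborel_on by measurable
    qed
    also have "\<dots> = emeasure ?m2 (Pi\<^sub>E I (\<lambda>i. {..<t i}))"
    proof (subst emeasure_density)
      show "(\<lambda>x. ennreal \<kappa> * (if N x < R then 1 else 0)) \<in> borel_measurable (lborel_on I)"
        unfolding measurable_lborel_on by measurable
      show "Pi\<^sub>E I (\<lambda>i. {..<t i}) \<in> sets (lborel_on I)" by (simp add: sets_lborel_on)
      show "(\<integral>\<^sup>+x. ennreal \<kappa> * ennreal (?G x) \<partial>lborel_on I)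
        = (\<integral>\<^sup>+x. ennreal \<kappa> * (if N x < R then 1 else 0) * indicator (Pi\<^sub>E I (\<lambda>i. {..<t i})) x \<partial>lborel_on I)"
        by (intro nn_integral_cong) (auto simp: ind space_borel_on)
    qed
    finally show ?thesis .
  qed
  have "?m1 = ?m2"
  proof (rule measure_eqI_generator_eq[where E = ?E and \<Omega> = "extensional I" and A = "\<lambda>k. Pi\<^sub>E I (\<lambda>_. {..<real k})"])
    show "Int_stable ?E"
    proof (rule Int_stableI)
      fix a b assume "a \<in> ?E" "b \<in> ?E"
      then obtain s t where "a = Pi\<^sub>E I (\<lambda>i. {..<s i})" "b = Pi\<^sub>E I (\<lambda>i. {..<t i})" by auto
      then have "a \<inter> b = Pi\<^sub>E I (\<lambda>i. {..<min (s i) (t i)})" by (auto simp: PiE_def Pi_def)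
      then show "a \<inter> b \<in> ?E" by auto
    qed
    show "?E \<subseteq> Pow (extensional I)" by (auto simp: PiE_def)
    show "emeasure ?m1 X = emeasure ?m2 X" if "X \<in> ?E" for X using that eq by auto
    show "sets ?m1 = sigma_sets (extensional I) ?E" by (simp add: sets_mu sets_borel_on_boxes)
    show "sets ?m2 = sigma_sets (extensional I) ?E" by (simp add: sets_lborel_on sets_borel_on_boxes)
    show "range (\<lambda>k. Pi\<^sub>E I (\<lambda>_. {..<real k})) \<subseteq> ?E" by auto
    show "(\<Union>k. Pi\<^sub>E I (\<lambda>_. {..<real k})) = extensional I"
    proof (intro equalityI subsetI)
      fix x :: "'i \<Rightarrow> real" assume x: "x \<in> extensional I"
      obtain k :: nat where "N x < real k" using reals_Archimedean2 by blast
      then have "\<forall>i\<in>I. x i < real k" using coord_le[of _ x] by (fastforce simp: abs_le_iff)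
      then show "x \<in> (\<Union>k. Pi\<^sub>E I (\<lambda>_. {..<real k}))" using x by (auto simp: PiE_def Pi_def)
    qed (auto simp: PiE_def)
    show "emeasure ?m1 (Pi\<^sub>E I (\<lambda>_. {..<real k})) \<noteq> \<infinity>" for k
    proof -
      have "emeasure ?m1 (Pi\<^sub>E I (\<lambda>_. {..<real k})) \<le> emeasure ?m2 (space ?m2)"
        unfolding eq[of "\<lambda>_. real k"] by (rule emeasure_space)
      also have "\<dots> = (\<integral>\<^sup>+x. ennreal \<kappa> * (if N x < R then 1 else 0) * indicator (space ?m2) x \<partial>lborel_on I)"
        by (rule emeasure_density) (auto simp: measurable_lborel_on)
      also have "\<dots> \<le> (\<integral>\<^sup>+x. ennreal \<kappa> * indicator {x \<in> extensional I. N x \<le> R} x \<partial>lborel_on I)"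
        by (intro nn_integral_mono) (auto simp: space_borel_on indicator_def)
      also have "\<dots> = ennreal \<kappa> * emeasure (lborel_on I) {x \<in> extensional I. N x \<le> R}"
        by (rule nn_integral_cmult_indicator) (simp add: sets_lborel_on)
      also have "\<dots> < \<infinity>" using emeasure_ball_finite[of R] by (simp add: ennreal_mult_less_top)
      finally show ?thesis by simp
    qed
  qed
  then show ?thesis using \<kappa> by blast
qed

end

subsection \<open>The weak equation for the law of the block\<close>

lemma mdet_bound:
  assumes "\<And>a b. a < q \<Longrightarrow> b < q \<Longrightarrow> \<bar>F a b\<bar> \<le> B"
  shows "\<bar>mdet q F\<bar> \<le> fact q * B ^ q"
proof -
  have "\<bar>mdet q F\<bar> \<le> (\<Sum>\<pi> | \<pi> permutes {0..<q}. \<bar>signof \<pi> * (\<Prod>i = 0..<q. F i (\<pi> i))\<bar>)"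
    unfolding mdet_perm by (rule sum_abs)
  also have "\<dots> \<le> (\<Sum>\<pi> | \<pi> permutes {0..<q}. B ^ q)"
  proof (rule sum_mono)
    fix \<pi> assume "\<pi> \<in> {\<pi>. \<pi> permutes {0..<q}}"
    then have lt: "\<And>a. a < q \<Longrightarrow> \<pi> a < q" using permutes_in_image by fastforce
    have "(\<Prod>i = 0..<q. \<bar>F i (\<pi> i)\<bar>) \<le> (\<Prod>i = 0..<q. B)"
      using lt assms by (intro prod_mono) auto
    then show "\<bar>signof \<pi> * (\<Prod>i = 0..<q. F i (\<pi> i))\<bar> \<le> B ^ q"
      by (simp add: abs_mult abs_prod sign_def)
  qed
  also have "\<dots> = fact q * B ^ q" by (simp add: card_permutations)
  finally show ?thesis .
qed

lemma coercive_mdet: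
  assumes c: "c > 0" and coer: "\<And>v. c * (\<Sum>a<q. (v a)\<^sup>2) \<le> (\<Sum>a<q. v a * (\<Sum>b<q. F a b * v b))"
  shows "mdet q F \<noteq> 0"
proof (rule mdet_nonzeroI)
  fix v assume "\<And>a. a < q \<Longrightarrow> (\<Sum>b<q. F a b * v b) = 0"
  then have "c * (\<Sum>a<q. (v a)\<^sup>2) \<le> 0" using coer[of v] by simp
  then have "(\<Sum>a<q. (v a)\<^sup>2) \<le> 0" using c by (simp add: mult_le_0_iff)
  then have "(\<Sum>a<q. (v a)\<^sup>2) = 0" by (intro antisym sum_nonneg) auto
  then show "\<forall>b<q. v b = 0" by (simp add: sum_nonneg_eq_0_iff)
qed

text \<open>The argument of \<open>K_entry_bound\<close> with c in the role of e: for u the d-th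
  column of the inverse, coercivity reads c |u|^2 \<le> u_d.\<close>

lemma coercive_minv:
  assumes c: "c > 0" and coer: "\<And>v. c * (\<Sum>a<q. (v a)\<^sup>2) \<le> (\<Sum>a<q. v a * (\<Sum>b<q. F a b * v b))"
    and ad: "a < q" "d < q"
  shows "\<bar>minv q F a d\<bar> \<le> 1 / c"
proof -
  define u where "u b = minv q F b d" for b
  note nz = coercive_mdet[OF c coer]
  have "(\<Sum>a<q. u a * (\<Sum>b<q. F a b * u b)) = (\<Sum>a<q. u a * (if a = d then 1 else 0))"
    unfolding u_def using ad by (intro sum.cong refl) (simp add: minv_right[OF nz])
  then have main: "c * (\<Sum>a<q. (u a)\<^sup>2) \<le> u d" using coer[of u] ad by (simp add: sum_delta_mult)
  have le: "c * (u b)\<^sup>2 \<le> u d" if "b < q" for b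
    using that c by (intro order_trans[OF mult_left_mono main] member_le_sum) auto
  have "u d \<le> 1 / c"
  proof (rule ccontr)
    assume "\<not> ?thesis"
    then have gt: "1 / c < u d" by simp
    have *: "1 < c * u d" using gt c by (simp add: pos_divide_less_eq mult.commute)
    have pos: "0 < u d" using gt c by (intro less_trans[OF _ gt]) simp
    from * pos have "1 * u d < (c * u d) * u d" by (intro mult_strict_right_mono) auto
    then show False using le[OF ad(2)] by (simp add: power2_eq_square)
  qed
  then have "c * (u a)\<^sup>2 \<le> 1 / c" using le[OF ad(1)] by simp
  then have "(u a)\<^sup>2 \<le> 1 / c / c" using c by (subst pos_le_divide_eq) (simp_all add: mult.commute)
  also have "\<dots> = (1 / c)\<^sup>2" by (simp add: power2_eq_square)
  finally have "\<bar>u a\<bar> \<le> \<bar>1 / c\<bar>" by (simp only: abs_le_square_iff)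
  then show ?thesis using c by (simp add: u_def)
qed

text \<open>The exponent may have either sign, so the determinant must be bounded from both sides:
  from above by the Leibniz sum, from below because the determinant of the inverse has such an upper
  bound too. W depends on F only through B and c, which makes the bound uniform in e later.\<close>

lemma coercive_weight_bound:
  fixes t :: real
  assumes c: "c > 0"
  shows "\<exists>W\<ge>0. \<forall>F. (\<forall>a<q. \<forall>b<q. \<bar>F a b\<bar> \<le> B) \<longrightarrow>
     (\<forall>v. c * (\<Sum>a<q. (v a)\<^sup>2) \<le> (\<Sum>a<q. v a * (\<Sum>b<q. F a b * v b))) \<longrightarrow> ((mdet q F)\<^sup>2) powr t \<le> W"
proof -
  define u where "u = (fact q * \<bar>B\<bar> ^ q :: real)\<^sup>2"
  define l where "l = (1 / (fact q * (1 / c) ^ q) :: real)\<^sup>2"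
  have l0: "l > 0" using c by (simp add: l_def)
  have "((mdet q F)\<^sup>2) powr t \<le> u powr t + l powr t"
    if F: "\<forall>a<q. \<forall>b<q. \<bar>F a b\<bar> \<le> B"
      and coer: "\<forall>v. c * (\<Sum>a<q. (v a)\<^sup>2) \<le> (\<Sum>a<q. v a * (\<Sum>b<q. F a b * v b))" for F
  proof -
    have nz: "mdet q F \<noteq> 0" using coercive_mdet[OF c] coer by blast
    have "\<bar>mdet q F\<bar> \<le> fact q * \<bar>B\<bar> ^ q"
      using F by (intro mdet_bound) (auto intro: order_trans[OF _ abs_ge_self])
    then have up: "(mdet q F)\<^sup>2 \<le> u" unfolding u_def by (intro abs_le_square_iff[THEN iffD1]) simp
    have inv: "\<bar>mdet q (minv q F)\<bar> \<le> fact q * (1 / c) ^ q"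
      using coer by (intro mdet_bound coercive_minv[OF c]) auto
    have "mdet q (\<lambda>a b. \<Sum>c<q. F a c * minv q F c b) = 1"
      by (subst mdet_one[symmetric, of q]) (intro mdet_cong minv_right nz)
    then have "\<bar>mdet q F\<bar> * \<bar>mdet q (minv q F)\<bar> = 1" by (simp add: mdet_mult abs_mult[symmetric])
    then have "1 \<le> \<bar>mdet q F\<bar> * (fact q * (1 / c) ^ q)"
      using mult_left_mono[OF inv, of "\<bar>mdet q F\<bar>"] by simp
    then have "1 / (fact q * (1 / c) ^ q) \<le> \<bar>mdet q F\<bar>"
      using c by (subst pos_divide_le_eq) auto
    then have "(1 / (fact q * (1 / c) ^ q))\<^sup>2 \<le> \<bar>mdet q F\<bar>\<^sup>2" using c by (intro power_mono) auto
    then have lo: "l \<le> (mdet q F)\<^sup>2" by (simp add: l_def)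
    show ?thesis
    proof (cases "t \<ge> 0")
      case True
      then have "((mdet q F)\<^sup>2) powr t \<le> u powr t" using up by (intro powr_mono2) auto
      then show ?thesis by (simp add: add_increasing2)
    next
      case False
      then have "((mdet q F)\<^sup>2) powr t \<le> l powr t" using lo l0 by (intro powr_mono2') auto
      then show ?thesis by (simp add: add_increasing)
    qed
  qed
  then show ?thesis by (intro exI[of _ "u powr t + l powr t"]) auto
qed

lemma L2_set_square: "(L2_set f A)\<^sup>2 = (\<Sum>a\<in>A. (f a)\<^sup>2)"
  by (simp add: L2_set_def sum_nonneg)

lemma Vmat_quad_opnorm:
  "(\<Sum>c<q. v c * (\<Sum>d<q. Vmat p e z c d * v d)) = (1 + e) * (\<Sum>c<q. (v c)\<^sup>2) - (L2_set (mat_vec q z v) {..<p})\<^sup>2"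
proof -
  have "(\<Sum>c<q. v c * (\<Sum>d<q. Vmat p e z c d * v d)) =
     (\<Sum>c<q. v c * ((1 + e) * v c - (\<Sum>d<q. (\<Sum>i<p. z (i, c) * z (i, d)) * v d)))"
    by (intro sum.cong refl arg_cong2[where f = "(*)"])
      (simp add: Vmat_def left_diff_distrib sum_subtractf sum_if_diag)
  also have "\<dots> = (1 + e) * (\<Sum>c<q. (v c)\<^sup>2) - (\<Sum>c<q. \<Sum>d<q. \<Sum>i<p. (z (i, c) * v c) * (z (i, d) * v d))"
    by (simp add: right_diff_distrib sum_subtractf sum_distrib_left sum_distrib_right power2_eq_square ac_simps)
  also have "(\<Sum>c<q. \<Sum>d<q. \<Sum>i<p. (z (i, c) * v c) * (z (i, d) * v d)) =
      (\<Sum>c<q. \<Sum>i<p. \<Sum>d<q. (z (i, c) * v c) * (z (i, d) * v d))"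
    by (rule sum.cong[OF refl], rule sum.swap)
  also have "\<dots> = (\<Sum>i<p. \<Sum>c<q. \<Sum>d<q. (z (i, c) * v c) * (z (i, d) * v d))"
    by (rule sum.swap)
  also have "\<dots> = (L2_set (mat_vec q z v) {..<p})\<^sup>2"
    unfolding L2_set_square mat_vec_def by (simp add: power2_eq_square sum_product)
  finally show ?thesis .
qed

text \<open>On a ball of radius \<rho> < 1 this is coercivity with a constant that does not depend
  on e, and e = 0 is included.\<close>

lemma Vmat_coercive:
  assumes "opnorm p q z \<le> \<rho>" "e \<ge> 0"
  shows "(1 - \<rho>\<^sup>2) * (\<Sum>c<q. (v c)\<^sup>2) \<le> (\<Sum>c<q. v c * (\<Sum>d<q. Vmat p e z c d * v d))"
proof -
  have "L2_set (mat_vec q z v) {..<p} \<le> \<rho> * L2_set v {..<q}"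
    by (rule order_trans[OF mat_vec_le_opnorm mult_right_mono]) (use assms in auto)
  then have "(L2_set (mat_vec q z v) {..<p})\<^sup>2 \<le> (\<rho> * L2_set v {..<q})\<^sup>2"
    by (intro power_mono) auto
  also have "\<dots> = \<rho>\<^sup>2 * (\<Sum>c<q. (v c)\<^sup>2)" by (simp add: power_mult_distrib L2_set_def sum_nonneg)
  finally have "(L2_set (mat_vec q z v) {..<p})\<^sup>2 \<le> \<rho>\<^sup>2 * (\<Sum>c<q. (v c)\<^sup>2)" .
  moreover have "0 \<le> e * (\<Sum>c<q. (v c)\<^sup>2)" using assms(2) by (intro mult_nonneg_nonneg sum_nonneg) auto
  ultimately show ?thesis unfolding Vmat_quad_opnorm distrib_right left_diff_distrib by linarith
qed

lemma Vmat_entry_bound: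
  assumes "\<And>i c. i < p \<Longrightarrow> c < q \<Longrightarrow> \<bar>z (i, c)\<bar> \<le> 1" "0 \<le> e" "e \<le> 1" "c < q" "d < q"
  shows "\<bar>Vmat p e z c d\<bar> \<le> 2 + real p"
proof -
  have "\<bar>\<Sum>i<p. z (i, c) * z (i, d)\<bar> \<le> (\<Sum>i<p. \<bar>z (i, c) * z (i, d)\<bar>)" by (rule sum_abs)
  also have "\<dots> \<le> (\<Sum>i<p. 1)"
    using assms by (intro sum_mono) (auto simp: abs_mult intro!: mult_le_one)
  finally show ?thesis using assms(2,3) by (auto simp: Vmat_def)
qed

lemma measurable_Vdet_borel_on[measurable]:
  "(\<lambda>x. Vdet p q e (\<lambda>ij. x ij / s)) \<in> borel_measurable (borel_on (mat_idx p q))"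
  unfolding Vdet_def Vmat_def
  by (intro borel_measurable_mdet borel_measurable_diff borel_measurable_const borel_measurable_sum
      borel_measurable_times borel_measurable_divide measurable_component_singleton) auto

context haar_block
begin

abbreviation s :: real where "s \<equiv> sqrt (real n)"

lemma s_pos: "s > 0" using q1 qp pn by simp

text \<open>
  \<open>Vdet\<close> is positive wherever this matters; the square makes the real power meaningful without a proof
  of that.
\<close>

definition weight :: "real \<Rightarrow> (nat \<times> nat \<Rightarrow> real) \<Rightarrow> real"
  where "weight e z = ((Vdet p q e z)\<^sup>2) powr (- m / 4)"

lemma nice_weight:
  assumes e: "0 < e" "e \<le> 1"
  shows "nice (weight e)"
proof -
  obtain W where W: "\<And>F. (\<forall>a<q. \<forall>b<q. \<bar>F a b\<bar> \<le> 2 + real p) \<Longrightarrow>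
     (\<forall>v. e * (\<Sum>a<q. (v a)\<^sup>2) \<le> (\<Sum>a<q. v a * (\<Sum>b<q. F a b * v b))) \<Longrightarrow> ((mdet q F)\<^sup>2) powr (- m / 4) \<le> W"
    using coercive_weight_bound[OF e(1), of q "2 + real p" "- m / 4"] by blast
  have "\<bar>weight e A\<bar> \<le> W" if A: "A \<in> orthogonal_mats n" for A
  proof -
    have "((mdet q (Vmat p e A))\<^sup>2) powr (- m / 4) \<le> W"
    proof (rule W)
      show "\<forall>a<q. \<forall>b<q. \<bar>Vmat p e A a b\<bar> \<le> 2 + real p"
        using e orthogonal_mats_entry_le[OF A] by (auto intro!: Vmat_entry_bound[where q = q] simp: p_le_n q_le_n)
      show "\<forall>v. e * (\<Sum>a<q. (v a)\<^sup>2) \<le> (\<Sum>a<q. v a * (\<Sum>b<q. Vmat p e A a b * v b))"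
        unfolding Vmat_quadratic[OF A] by (simp add: sum_nonneg)
    qed
    then show ?thesis by (simp add: weight_def Vdet_def)
  qed
  moreover have "weight e \<in> borel_measurable \<mu>" unfolding weight_def[abs_def] by measurable
  ultimately show ?thesis by (auto simp: nice_def)
qed

text \<open>The squared determinant has logarithmic derivative - 4 P, and the power - m / 4 turns
  this into m P.\<close>

lemma DERIV_weight:
  assumes "A \<in> orthogonal_mats n" "e > 0" "i < p" "k \<in> {p..<n}"
  shows "((\<lambda>t. weight e (rot_rows n i k t A)) has_real_derivative m * P e A i k * weight e A) (at 0)"
proof -
  note nz = Vdet_nonzero[OF assms(1,2)]
  have r0: "rot_rows n i k 0 A = A" using rot0[OF assms(1) less_imp_le[OF assms(2)] nz assms(3,4)] .
  let ?D = "Vdet p q e A"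
  have "((\<lambda>t. (Vdet p q e (rot_rows n i k t A))\<^sup>2) has_real_derivative
      2 * ?D * (- 2 * ?D * P e A i k)) (at 0)"
    using DERIV_power[OF DERIV_Vdet[OF assms(1) less_imp_le[OF assms(2)] nz assms(3,4)], of 2] r0
    by (simp add: ac_simps)
  then have "((\<lambda>t. ((Vdet p q e (rot_rows n i k t A))\<^sup>2) powr (- m / 4)) has_real_derivative
      (- m / 4) * (?D\<^sup>2) powr (- m / 4 - 1) * (2 * ?D * (- 2 * ?D * P e A i k))) (at 0)"
    using nz r0 by (intro DERIV_fun_powr[THEN DERIV_cong]) (auto simp: )
  moreover have "(- m / 4) * (?D\<^sup>2) powr (- m / 4 - 1) * (2 * ?D * (- 2 * ?D * P e A i k))
      = m * P e A i k * ((?D\<^sup>2) powr (- m / 4 - 1) * ?D\<^sup>2)"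
    by (simp add: power2_eq_square)
  moreover have "(?D\<^sup>2) powr (- m / 4 - 1) * ?D\<^sup>2 = (?D\<^sup>2) powr (- m / 4)"
    using nz powr_add[of "?D\<^sup>2" "- m / 4 - 1" 1] by simp
  ultimately show ?thesis unfolding weight_def by (simp only:)
qed

end

text \<open>
  Testing the rotation identity with \<open>\<phi> = weight \<cdot> \<psi> \<cdot> (K e\<^sub>j) \<cdot> y\<^sub>k\<close>, summed over the hidden rows k, gives the
  weak equation for the density in the direction of entry (i, j).
\<close>

locale haar_test = haar_block +
  fixes b b' :: "nat \<times> nat \<Rightarrow> real \<Rightarrow> real" and r :: real
  assumes r: "r < sqrt (real n)"
    and b_deriv: "(b ij has_real_derivative b' ij t) (at t)"
    and b'_cont: "continuous_on UNIV (b' ij)"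
    and b_bound: "\<exists>C. \<forall>t. \<bar>b ij t\<bar> \<le> C \<and> \<bar>b' ij t\<bar> \<le> C"
    and b_supp: "(\<And>ij. ij \<in> mat_idx p q \<Longrightarrow> b ij (x ij) \<noteq> 0 \<or> b' ij (x ij) \<noteq> 0) \<Longrightarrow> opnorm p q x \<le> r"
begin

definition \<psi> :: "(nat \<times> nat \<Rightarrow> real) \<Rightarrow> real"
  where "\<psi> A = (\<Prod>ij\<in>mat_idx p q. b ij (s * A ij))"

definition d\<psi> :: "nat \<times> nat \<Rightarrow> (nat \<times> nat \<Rightarrow> real) \<Rightarrow> real"
  where "d\<psi> ij A = b' ij (s * A ij) * (\<Prod>kl\<in>mat_idx p q - {ij}. b kl (s * A kl))"

lemma b_cont: "continuous_on UNIV (b ij)"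
  using b_deriv by (intro continuous_at_imp_continuous_on) (blast intro: DERIV_isCont)

lemma entry_idx: "ij \<in> mat_idx p q \<Longrightarrow> fst ij < n" "ij \<in> mat_idx p q \<Longrightarrow> snd ij < n"
  using qp pn by auto

lemma nice_b: "ij \<in> mat_idx p q \<Longrightarrow> nice (\<lambda>A. b ij (s * A ij))" "ij \<in> mat_idx p q \<Longrightarrow> nice (\<lambda>A. b' ij (s * A ij))"
proof -
  assume ij: "ij \<in> mat_idx p q"
  obtain C where C: "\<And>t. \<bar>b ij t\<bar> \<le> C \<and> \<bar>b' ij t\<bar> \<le> C" using b_bound by blast
  have [measurable]: "(\<lambda>A. A ij) \<in> borel_measurable \<mu>"
    using measurable_entry[OF entry_idx[OF ij]] by simp
  have [measurable]: "b ij \<in> borel_measurable borel" "b' ij \<in> borel_measurable borel"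
    by (intro borel_measurable_continuous_onI b_cont b'_cont)+
  show "nice (\<lambda>A. b ij (s * A ij))" "nice (\<lambda>A. b' ij (s * A ij))"
    unfolding nice_def using C by (auto intro!: exI[of _ C])
qed

lemma nice_\<psi>: "nice \<psi>" "ij \<in> mat_idx p q \<Longrightarrow> nice (d\<psi> ij)"
  unfolding \<psi>_def[abs_def] d\<psi>_def[abs_def] by (intro nice_prod nice_mult nice_b; simp)+

lemma DERIV_\<psi>:
  assumes A: "A \<in> orthogonal_mats n" and i: "i < p" and k: "k \<in> {p..<n}"
  shows "((\<lambda>t. \<psi> (rot_rows n i k t A)) has_real_derivative s * (\<Sum>l<q. d\<psi> (i, l) A * A (k, l))) (at 0)"
proof -
  have ik: "i \<noteq> k" "i < n" "k < n" using i k pn by auto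
  note r0 = rot_rows_0[OF ik A]
  have d1: "((\<lambda>t. b kl (s * rot_rows n i k t A kl)) has_real_derivative
     (if fst kl = i then b' kl (s * A kl) * (s * A (k, snd kl)) else 0)) (at 0)" if kl: "kl \<in> mat_idx p q" for kl
  proof -
    obtain a c where ac: "kl = (a, c)" "a < p" "c < q" using kl by auto
    have "((\<lambda>t. rot_rows n i k t A (a, c)) has_real_derivative (if a = i then A (k, c) else 0)) (at 0)"
      using DERIV_rot_rows[OF ik A, of a c] ac k by (auto simp: p_le_n q_le_n split: if_splits)
    then have "((\<lambda>t. s * rot_rows n i k t A (a, c)) has_real_derivative s * (if a = i then A (k, c) else 0)) (at 0)"
      by (rule DERIV_cmult)
    then show ?thesis
      unfolding ac by (rule DERIV_cong[OF DERIV_chain2[OF b_deriv[of "(a, c)"]]]) (simp add: r0)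
  qed
  have "((\<lambda>t. \<psi> (rot_rows n i k t A)) has_real_derivative
    (\<Sum>kl\<in>mat_idx p q. (if fst kl = i then b' kl (s * A kl) * (s * A (k, snd kl)) else 0) *
      (\<Prod>j\<in>mat_idx p q - {kl}. b j (s * rot_rows n i k 0 A j)))) (at 0)"
    unfolding \<psi>_def by (rule has_field_derivative_prod[OF d1])
  also have "(\<Sum>kl\<in>mat_idx p q. (if fst kl = i then b' kl (s * A kl) * (s * A (k, snd kl)) else 0) *
      (\<Prod>j\<in>mat_idx p q - {kl}. b j (s * rot_rows n i k 0 A j)))
     = (\<Sum>a<p. \<Sum>l<q. if a = i then s * (d\<psi> (a, l) A * A (k, l)) else 0)"
    unfolding sum.cartesian_product by (intro sum.cong refl) (auto simp: r0 d\<psi>_def)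
  also have "\<dots> = (\<Sum>l<q. s * (d\<psi> (i, l) A * A (k, l)))"
    using i by (subst sum.swap) simp
  finally show ?thesis by (simp add: sum_distrib_left)
qed

text \<open>Everything that carries a factor e in the summed identity, with that factor removed. It
  remains bounded on the support of the test function as e tends to 0.\<close>

definition test_error :: "nat \<Rightarrow> nat \<Rightarrow> real \<Rightarrow> (nat \<times> nat \<Rightarrow> real) \<Rightarrow> real"
  where "test_error i j e A = s * (\<Sum>l<q. d\<psi> (i, l) A * K e A j l) +
     \<psi> A * ((m + 1) * (\<Sum>d<q. K e A j d * Q e A d i) + Q e A j i * \<tau>1 e A)"

lemma weak_regularised:
  assumes e: "0 < e" "e \<le> 1" and i: "i < p" and j: "j < q"
  shows "(\<integral>A. weight e A * (s * d\<psi> (i, j) A - e * test_error i j e A) \<partial>\<mu>) = 0"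
proof -
  define D where "D k A = weight e A * (s * (\<Sum>l<q. d\<psi> (i, l) A * A (k, l))) * Q e A j k
     + weight e A * \<psi> A * (m * P e A i k * Q e A j k + (Q e A j i * P e A k k + Q e A j k * P e A i k - Q e A j i))" for k A
  have nd: "nice (\<lambda>A. d\<psi> (i, l) A)" if "l < q" for l using nice_\<psi>(2)[of "(i, l)"] i that by simp
  have nD: "nice (D k)" if "k \<in> {p..<n}" for k
    unfolding D_def[abs_def] using that i j e
    by (intro nice_add nice_mult nice_diff nice_const nice_sum nice_weight nice_\<psi>(1) nd nice_Q nice_P nice_entry)
      (auto simp: p_le_n q_le_n)
  have zero: "(\<integral>A. D k A \<partial>\<mu>) = 0" if k: "k \<in> {p..<n}" for k
  proof (rule integral_rotation_nice[OF _ _ _ _ nD[OF k], where \<phi> = "\<lambda>A. weight e A * \<psi> A * Q e A j k" and i = i and k = k])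
    show "nice (\<lambda>A. weight e A * \<psi> A * Q e A j k)"
      using k j e by (intro nice_mult nice_weight nice_\<psi> nice_Q) auto
    fix A assume A: "A \<in> orthogonal_mats n"
    note nz = Vdet_nonzero[OF A e(1)] and e0 = less_imp_le[OF e(1)]
    have "((\<lambda>t. weight e (rot_rows n i k t A) * \<psi> (rot_rows n i k t A) * Q e (rot_rows n i k t A) j k) has_real_derivative
      weight e (rot_rows n i k 0 A) * \<psi> (rot_rows n i k 0 A) * (Q e A j i * P e A k k + Q e A j k * P e A i k - Q e A j i) +
      (weight e (rot_rows n i k 0 A) * (s * (\<Sum>l<q. d\<psi> (i, l) A * A (k, l))) + m * P e A i k * weight e A * \<psi> (rot_rows n i k 0 A))
        * Q e (rot_rows n i k 0 A) j k) (at 0)"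
      by (intro DERIV_mult' DERIV_weight[OF A e(1) i k] DERIV_\<psi>[OF A i k] DERIV_Q_k[OF A e0 nz i k j])
    then show "((\<lambda>t. weight e (rot_rows n i k t A) * \<psi> (rot_rows n i k t A) * Q e (rot_rows n i k t A) j k)
        has_real_derivative D k A) (at 0)"
      by (rule DERIV_cong) (simp add: rot0[OF A e0 nz i k] D_def algebra_simps)
  qed (use i k pn in auto)
  have "0 = (\<integral>A. (\<Sum>k\<in>{p..<n}. D k A) \<partial>\<mu>)"
    using zero nD by (subst Bochner_Integration.integral_sum) (auto intro: nice_integrable)
  also have "\<dots> = (\<integral>A. weight e A * (s * d\<psi> (i, j) A - e * test_error i j e A) \<partial>\<mu>)"
  proof (rule integral_cong_orthogonal)
    show "nice (\<lambda>A. \<Sum>k\<in>{p..<n}. D k A)" by (intro nice_sum nD)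
    show "nice (\<lambda>A. weight e A * (s * d\<psi> (i, j) A - e * test_error i j e A))"
      unfolding test_error_def using i j e
      by (intro nice_add nice_mult nice_diff nice_const nice_sum nice_weight nice_\<psi>(1) nd nice_Q nice_K nice_traces)
        (auto simp: p_le_n q_le_n)
    fix A assume A: "A \<in> orthogonal_mats n"
    note nz = Vdet_nonzero[OF A e(1)] and e0 = less_imp_le[OF e(1)]
    let ?X = "\<Sum>d<q. K e A j d * Q e A d i"
    have QP: "(\<Sum>k\<in>{p..<n}. P e A i k * Q e A j k) = Q e A j i - e * ?X"
    proof -
      have "(\<Sum>k\<in>{p..<n}. P e A i k * Q e A j k) = (\<Sum>k\<in>{p..<n}. Q e A j k * P e A k i)"
        by (intro sum.cong refl) (use P_sym[OF A e0 nz, of i] in \<open>simp add: mult.commute\<close>)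
      then show ?thesis using sum_Q_P[OF A e0 nz j, of i] by simp
    qed
    have S1: "(\<Sum>k\<in>{p..<n}. weight e A * (s * (\<Sum>l<q. d\<psi> (i, l) A * A (k, l))) * Q e A j k)
       = weight e A * s * (d\<psi> (i, j) A - e * (\<Sum>l<q. d\<psi> (i, l) A * K e A j l))"
    proof -
      have "(\<Sum>k\<in>{p..<n}. weight e A * (s * (\<Sum>l<q. d\<psi> (i, l) A * A (k, l))) * Q e A j k)
        = weight e A * s * (\<Sum>k\<in>{p..<n}. \<Sum>l<q. d\<psi> (i, l) A * (Q e A j k * A (k, l)))"
        by (simp add: sum_distrib_left sum_distrib_right ac_simps)
      also have "(\<Sum>k\<in>{p..<n}. \<Sum>l<q. d\<psi> (i, l) A * (Q e A j k * A (k, l)))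
        = (\<Sum>l<q. d\<psi> (i, l) A * (\<Sum>k\<in>{p..<n}. Q e A j k * A (k, l)))"
        by (subst sum.swap) (simp add: sum_distrib_left)
      also have "\<dots> = (\<Sum>l<q. d\<psi> (i, l) A * ((if j = l then 1 else 0) - e * K e A j l))"
        using j by (intro sum.cong refl) (simp add: sum_Q_A[OF A e0 nz])
      also have "\<dots> = d\<psi> (i, j) A - e * (\<Sum>l<q. d\<psi> (i, l) A * K e A j l)"
        using j by (simp add: right_diff_distrib sum_subtractf sum_if_diag sum_distrib_left ac_simps)
      finally show ?thesis .
    qed
    have S2: "(\<Sum>k\<in>{p..<n}. m * P e A i k * Q e A j k + (Q e A j i * P e A k k + Q e A j k * P e A i k - Q e A j i))
       = (m + 1) * (\<Sum>k\<in>{p..<n}. P e A i k * Q e A j k) + Q e A j i * \<kappa>1 e A - (real n - real p) * Q e A j i"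
      using pn by (simp add: sum.distrib sum_subtractf sum_distrib_left \<kappa>1_def distrib_right of_nat_diff ac_simps)
    \<comment> \<open>Here the exponent of the density is determined: the terms without e have the
      total coefficient (m + 1) + q - (n - p), which is 0 exactly for this m.\<close>
    have S3: "(\<Sum>k\<in>{p..<n}. m * P e A i k * Q e A j k + (Q e A j i * P e A k k + Q e A j k * P e A i k - Q e A j i))
       = - e * ((m + 1) * ?X + Q e A j i * \<tau>1 e A)"
      unfolding S2 QP \<kappa>1_eq[OF A e0 nz] by (simp add: m_def algebra_simps)
    show "(\<Sum>k\<in>{p..<n}. D k A) = weight e A * (s * d\<psi> (i, j) A - e * test_error i j e A)"
    proof -
      have gen: "(\<Sum>k\<in>{p..<n}. X k + u * Y k) = (\<Sum>k\<in>{p..<n}. X k) + u * (\<Sum>k\<in>{p..<n}. Y k)" for X Y and u :: real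
        by (simp add: sum.distrib sum_distrib_left)
      show ?thesis unfolding D_def gen S1 S3 test_error_def by (simp add: algebra_simps)
    qed
  qed
  finally show ?thesis by simp
qed

lemma support_\<psi>:
  assumes "\<psi> A \<noteq> 0 \<or> (\<exists>ij\<in>mat_idx p q. d\<psi> ij A \<noteq> 0)"
  shows "opnorm p q A \<le> r / s"
proof -
  have "opnorm p q (\<lambda>ij. s * A ij) \<le> r"
  proof (rule b_supp)
    fix kl assume kl: "kl \<in> mat_idx p q"
    show "b kl (s * A kl) \<noteq> 0 \<or> b' kl (s * A kl) \<noteq> 0"
    proof (rule ccontr)
      assume z: "\<not> ?thesis"
      then have "\<psi> A = 0" unfolding \<psi>_def using kl by (intro prod_zero) auto
      moreover have "d\<psi> ij A = 0" if "ij \<in> mat_idx p q" for ij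
      proof (cases "ij = kl")
        case False
        then have "(\<Prod>kl\<in>mat_idx p q - {ij}. b kl (s * A kl)) = 0" using kl z by (intro prod_zero) auto
        then show ?thesis by (simp add: d\<psi>_def)
      qed (use z in \<open>simp add: d\<psi>_def\<close>)
      ultimately show False using assms by blast
    qed
  qed
  moreover have "opnorm p q (\<lambda>ij. s * A ij) = s * opnorm p q A"
    using opnorm.scale[of p q s A] by simp
  ultimately show ?thesis using s_pos by (simp only: pos_le_divide_eq mult.commute)
qed

text \<open>On the support of \<psi> the operator norm is at most some \<rho> < 1. There V is
  coercive, so K, the weight and \<open>test_error\<close> are bounded uniformly for e between 0 and
  1, and the error term disappears by dominated convergence. This works for every sign of m, and V
  may be singular elsewhere.\<close>

lemma weak_equation:
  assumes i: "i < p" and j: "j < q"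
  shows "(\<integral>A. weight 0 A * d\<psi> (i, j) A \<partial>\<mu>) = 0"
proof (cases "r < 0")
  case True
  have "d\<psi> (i, j) A = 0" for A
    using support_\<psi>[of A] i j True opnorm_nonneg[of p q A] s_pos
    by (metis SigmaI divide_neg_pos lessThan_iff not_le order_trans)
  then show ?thesis by simp
next
  case False
  define \<rho> where "\<rho> = r / s"
  have \<rho>: "0 \<le> \<rho>" "\<rho> < 1" using False r s_pos by (auto simp: \<rho>_def)
  define c where "c = 1 - \<rho>\<^sup>2"
  have c: "c > 0" using \<rho> by (simp add: c_def power_less_one_iff abs_square_less_1)
  obtain W where W0: "W \<ge> 0" and W: "\<And>F. (\<forall>a<q. \<forall>b<q. \<bar>F a b\<bar> \<le> 2 + real p) \<Longrightarrow>
     (\<forall>v. c * (\<Sum>a<q. (v a)\<^sup>2) \<le> (\<Sum>a<q. v a * (\<Sum>b<q. F a b * v b))) \<Longrightarrow> ((mdet q F)\<^sup>2) powr (- m / 4) \<le> W"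
    using coercive_weight_bound[OF c, of q "2 + real p" "- m / 4"] by blast
  obtain C where C: "\<And>A. A \<in> orthogonal_mats n \<Longrightarrow> \<bar>\<psi> A\<bar> \<le> C" using nice_\<psi>(1) by (auto simp: nice_def)
  have "\<exists>C. \<forall>ij\<in>mat_idx p q. \<forall>A\<in>orthogonal_mats n. \<bar>d\<psi> ij A\<bar> \<le> C"
  proof -
    have "\<forall>ij\<in>mat_idx p q. \<exists>C. \<forall>A\<in>orthogonal_mats n. \<bar>d\<psi> ij A\<bar> \<le> C"
      using nice_\<psi>(2) by (auto simp: nice_def)
    then obtain Cf where Cf: "\<And>ij A. ij \<in> mat_idx p q \<Longrightarrow> A \<in> orthogonal_mats n \<Longrightarrow> \<bar>d\<psi> ij A\<bar> \<le> Cf ij" by metis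
    have "\<bar>d\<psi> ij A\<bar> \<le> (\<Sum>ij\<in>mat_idx p q. \<bar>Cf ij\<bar>)" if "ij \<in> mat_idx p q" "A \<in> orthogonal_mats n" for ij A
    proof -
      have "\<bar>d\<psi> ij A\<bar> \<le> \<bar>Cf ij\<bar>" using Cf[OF that] by linarith
      also have "\<dots> \<le> (\<Sum>ij\<in>mat_idx p q. \<bar>Cf ij\<bar>)" using that by (intro member_le_sum) auto
      finally show ?thesis .
    qed
    then show ?thesis by blast
  qed
  then obtain C' where C': "\<And>ij A. ij \<in> mat_idx p q \<Longrightarrow> A \<in> orthogonal_mats n \<Longrightarrow> \<bar>d\<psi> ij A\<bar> \<le> C'" by blast
  \<comment> \<open>The bound for \<open>test_error\<close> on the ball of radius \<rho>, put
    together from |K| \<le> 1 / c entrywise and the bounds C and C' on the test function and its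
    partial derivatives.\<close>
  define E where "E = s * (real q * (C' * (1 / c))) + C * (\<bar>m + 1\<bar> * (real q * (1 / c * (real q * (1 / c)))) + real q * (1 / c) * (real q * (1 / c)))"
  define f where "f k A = weight (eps k) A * (s * d\<psi> (i, j) A - eps k * test_error i j (eps k) A)" for k A
  have supp: "opnorm p q A \<le> \<rho>" if "\<psi> A \<noteq> 0 \<or> (\<exists>ij\<in>mat_idx p q. d\<psi> ij A \<noteq> 0)" for A
    unfolding \<rho>_def by (rule support_\<psi>[OF that])
  have off: "f k A = 0 \<and> d\<psi> (i, j) A = 0" if "\<not> opnorm p q A \<le> \<rho>" for k A
  proof -
    have "\<psi> A = 0" "\<And>ij. ij \<in> mat_idx p q \<Longrightarrow> d\<psi> ij A = 0" using supp[of A] that by blast+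
    then show ?thesis using i j by (simp add: f_def test_error_def)
  qed
  have C0: "0 \<le> C" "0 \<le> C'" if "A \<in> orthogonal_mats n" for A
    using C[OF that] C'[OF _ that, of "(i, j)"] i j by (force intro: order_trans[OF abs_ge_zero])+
  have on: "\<bar>K e A a d\<bar> \<le> 1 / c" "weight e A \<le> W" "Vdet p q e A \<noteq> 0"
    if A: "A \<in> orthogonal_mats n" and N: "opnorm p q A \<le> \<rho>" and e: "0 \<le> e" "e \<le> 1" and "a < q" "d < q" for A e a d
  proof -
    have coer: "c * (\<Sum>a<q. (v a)\<^sup>2) \<le> (\<Sum>a<q. v a * (\<Sum>b<q. Vmat p e A a b * v b))" for v
      unfolding c_def by (rule Vmat_coercive[OF N e(1)])
    show "\<bar>K e A a d\<bar> \<le> 1 / c" unfolding Kmat_def by (rule coercive_minv[OF c coer that(5,6)])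
    show "weight e A \<le> W"
      unfolding weight_def Vdet_def
      using coer e orthogonal_mats_entry_le[OF A] by (intro W) (auto intro!: Vmat_entry_bound[where q = q] simp: p_le_n q_le_n)
    show "Vdet p q e A \<noteq> 0" unfolding Vdet_def by (rule coercive_mdet[OF c coer])
  qed
  have "(\<lambda>k. \<integral>A. f k A \<partial>\<mu>) \<longlonglongrightarrow> (\<integral>A. weight 0 A * (s * d\<psi> (i, j) A) \<partial>\<mu>)"
  proof (rule integral_dominated_convergence[where w = "\<lambda>_. W * (s * \<bar>C'\<bar> + \<bar>E\<bar>)"])
    have nd: "nice (\<lambda>A. d\<psi> (i, l) A)" if "l < q" for l using nice_\<psi>(2)[of "(i, l)"] i that by simp
    have md[measurable]: "d\<psi> (i, j) \<in> borel_measurable \<mu>" using nd[OF j] by (simp add: nice_def)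
    show "(\<lambda>A. weight 0 A * (s * d\<psi> (i, j) A)) \<in> borel_measurable \<mu>"
      unfolding weight_def by measurable
    show "f k \<in> borel_measurable \<mu>" for k
    proof -
      have "nice (f k)"
        unfolding f_def[abs_def] test_error_def using i j
        by (intro nice_add nice_mult nice_diff nice_const nice_sum nice_weight nice_\<psi>(1) nd nice_Q nice_K nice_traces)
          (auto simp: p_le_n q_le_n)
      then show ?thesis by (simp add: nice_def)
    qed
    show "AE A in \<mu>. (\<lambda>k. f k A) \<longlonglongrightarrow> weight 0 A * (s * d\<psi> (i, j) A)"
      using AE_orthogonal
    proof eventually_elim
      case (elim A)
      show ?case
      proof (cases "opnorm p q A \<le> \<rho>")
        case False
        then show ?thesis using off[OF False] by simp
      next
        case True
        have nz: "Vdet p q 0 A \<noteq> 0" using on(3)[OF elim True, of 0 j j] j by simp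
        have "(\<lambda>k. test_error i j (eps k) A) \<longlonglongrightarrow> test_error i j 0 A"
          unfolding test_error_def using j
          by (intro tendsto_intros K_tendsto Q_tendsto traces_tendsto nz) auto
        moreover have "(\<lambda>k. weight (eps k) A) \<longlonglongrightarrow> weight 0 A"
        proof -
          have "(\<lambda>k. Vdet p q (eps k) A) \<longlonglongrightarrow> Vdet p q 0 A"
            unfolding Vdet_def
          proof (rule tendsto_mdet)
            fix a b :: nat
            have "(\<lambda>j. 1 + eps j) \<longlonglongrightarrow> 1 + 0" by (intro tendsto_add tendsto_const eps_0)
            then have "(\<lambda>j. if a = b then 1 + eps j else 0) \<longlonglongrightarrow> (if a = b then 1 + 0 else 0)"
              by (cases "a = b") (simp_all del: of_nat_Suc)
            then show "(\<lambda>j. Vmat p (eps j) A a b) \<longlonglongrightarrow> Vmat p 0 A a b"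
              unfolding Vmat_def by (rule tendsto_diff[OF _ tendsto_const])
          qed
          then show ?thesis
            unfolding weight_def using nz by (intro tendsto_powr tendsto_power tendsto_const) auto
        qed
        ultimately have "(\<lambda>k. f k A) \<longlonglongrightarrow> weight 0 A * (s * d\<psi> (i, j) A - 0 * test_error i j 0 A)"
          unfolding f_def by (intro tendsto_mult tendsto_diff tendsto_const eps_0)
        then show ?thesis by simp
      qed
    qed
    show "AE A in \<mu>. norm (f k A) \<le> W * (s * \<bar>C'\<bar> + \<bar>E\<bar>)" for k
      using AE_orthogonal
    proof eventually_elim
      case (elim A)
      show ?case
      proof (cases "opnorm p q A \<le> \<rho>")
        case False
        then show ?thesis using off[OF False] W0 s_pos by simp
      next
        case True
        define e where "e = eps k"
        have e: "0 < e" "e \<le> 1" by (auto simp: e_def)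
        note on' = on[OF elim True less_imp_le[OF e(1)] e(2)]
        have cn: "0 \<le> 1 / c" using c by simp
        have QB: "\<bar>Q e A a i\<bar> \<le> real q * (1 / c)" if "a < q" for a
        proof -
          have "\<bar>Q e A a i\<bar> \<le> (\<Sum>d<q. \<bar>K e A a d * A (i, d)\<bar>)" unfolding Q_def by (rule sum_abs)
          also have "\<dots> \<le> (\<Sum>d<q. 1 / c)"
          proof (rule sum_mono)
            fix d assume "d \<in> {..<q}"
            then have "\<bar>K e A a d\<bar> * \<bar>A (i, d)\<bar> \<le> 1 / c * 1"
              using on'(1)[OF that, of d] orthogonal_mats_entry_le[OF elim, of i d] i cn
              by (intro mult_mono) (auto simp: p_le_n q_le_n)
            then show "\<bar>K e A a d * A (i, d)\<bar> \<le> 1 / c" by (simp add: abs_mult)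
          qed
          finally show ?thesis by simp
        qed
        have XB: "\<bar>\<Sum>d<q. K e A j d * Q e A d i\<bar> \<le> real q * (1 / c * (real q * (1 / c)))"
        proof -
          have "\<bar>\<Sum>d<q. K e A j d * Q e A d i\<bar> \<le> (\<Sum>d<q. \<bar>K e A j d * Q e A d i\<bar>)" by (rule sum_abs)
          also have "\<dots> \<le> (\<Sum>d<q. 1 / c * (real q * (1 / c)))"
            unfolding abs_mult using on'(1)[OF j] QB cn by (intro sum_mono mult_mono) auto
          finally show ?thesis by simp
        qed
        have TB: "\<bar>\<tau>1 e A\<bar> \<le> real q * (1 / c)"
        proof -
          have "\<bar>\<tau>1 e A\<bar> \<le> (\<Sum>c<q. \<bar>K e A c c\<bar>)" unfolding \<tau>1_def by (rule sum_abs)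
          also have "\<dots> \<le> (\<Sum>d<q. 1 / c)" using on'(1) by (intro sum_mono) auto
          finally show ?thesis by simp
        qed
        have DB: "\<bar>\<Sum>l<q. d\<psi> (i, l) A * K e A j l\<bar> \<le> real q * (C' * (1 / c))"
        proof -
          have "\<bar>\<Sum>l<q. d\<psi> (i, l) A * K e A j l\<bar> \<le> (\<Sum>l<q. \<bar>d\<psi> (i, l) A * K e A j l\<bar>)" by (rule sum_abs)
          also have "\<dots> \<le> (\<Sum>l<q. C' * (1 / c))"
            unfolding abs_mult using on'(1)[OF j] C'[OF _ elim] i C0[OF elim] by (intro sum_mono mult_mono) auto
          finally show ?thesis by simp
        qed
        have "\<bar>test_error i j e A\<bar> \<le> \<bar>s * (\<Sum>l<q. d\<psi> (i, l) A * K e A j l)\<bar> +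
            \<bar>\<psi> A * ((m + 1) * (\<Sum>d<q. K e A j d * Q e A d i) + Q e A j i * \<tau>1 e A)\<bar>"
          unfolding test_error_def by (rule abs_triangle_ineq)
        also have "\<dots> \<le> E"
          unfolding E_def
        proof (intro add_mono)
          show "\<bar>s * (\<Sum>l<q. d\<psi> (i, l) A * K e A j l)\<bar> \<le> s * (real q * (C' * (1 / c)))"
          proof -
            have "\<bar>s * (\<Sum>l<q. d\<psi> (i, l) A * K e A j l)\<bar> = s * \<bar>\<Sum>l<q. d\<psi> (i, l) A * K e A j l\<bar>"
              using s_pos by (simp add: abs_mult)
            then show ?thesis using mult_left_mono[OF DB less_imp_le[OF s_pos]] by (simp only:)
          qed
          have "\<bar>(m + 1) * (\<Sum>d<q. K e A j d * Q e A d i) + Q e A j i * \<tau>1 e A\<bar>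
              \<le> \<bar>(m + 1) * (\<Sum>d<q. K e A j d * Q e A d i)\<bar> + \<bar>Q e A j i * \<tau>1 e A\<bar>" by (rule abs_triangle_ineq)
          also have "\<dots> \<le> \<bar>m + 1\<bar> * (real q * (1 / c * (real q * (1 / c)))) + real q * (1 / c) * (real q * (1 / c))"
            unfolding abs_mult using XB QB[OF j] TB cn by (intro add_mono mult_mono) auto
          finally show "\<bar>\<psi> A * ((m + 1) * (\<Sum>d<q. K e A j d * Q e A d i) + Q e A j i * \<tau>1 e A)\<bar>
            \<le> C * (\<bar>m + 1\<bar> * (real q * (1 / c * (real q * (1 / c)))) + real q * (1 / c) * (real q * (1 / c)))"
            unfolding abs_mult[of "\<psi> A"] using C[OF elim] C0[OF elim] by (intro mult_mono) auto
        qed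
        finally have TE: "\<bar>test_error i j e A\<bar> \<le> \<bar>E\<bar>" by simp
        have "\<bar>e * test_error i j e A\<bar> \<le> 1 * \<bar>E\<bar>"
          unfolding abs_mult using e TE by (intro mult_mono) auto
        moreover have "\<bar>s * d\<psi> (i, j) A\<bar> \<le> s * \<bar>C'\<bar>"
          using C'[OF _ elim, of "(i, j)"] i j s_pos by (simp add: abs_mult)
        ultimately have "\<bar>s * d\<psi> (i, j) A - e * test_error i j e A\<bar> \<le> s * \<bar>C'\<bar> + \<bar>E\<bar>"
          by (intro order_trans[OF abs_triangle_ineq4]) linarith
        moreover have "\<bar>weight e A\<bar> \<le> W" using on'(2)[OF j j] by (simp add: weight_def)
        ultimately show ?thesis
          unfolding f_def e_def[symmetric] real_norm_def abs_mult using W0 by (intro mult_mono) auto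
      qed
    qed
  qed simp
  moreover have "(\<integral>A. f k A \<partial>\<mu>) = 0" for k
    unfolding f_def by (rule weak_regularised[OF _ _ i j]) auto
  ultimately have "(\<integral>A. weight 0 A * (s * d\<psi> (i, j) A) \<partial>\<mu>) = 0" by (simp add: LIMSEQ_const_iff)
  moreover have "(\<integral>A. weight 0 A * (s * d\<psi> (i, j) A) \<partial>\<mu>) = s * (\<integral>A. weight 0 A * d\<psi> (i, j) A \<partial>\<mu>)"
    by (simp add: mult.left_commute)
  ultimately show ?thesis using s_pos by simp
qed

end

subsection \<open>The density of the block\<close>

lemma Vmat_cong:
  "(\<And>i c. i < p \<Longrightarrow> c < q \<Longrightarrow> z (i, c) = z' (i, c)) \<Longrightarrow> c < q \<Longrightarrow> d < q \<Longrightarrow> Vmat p e z c d = Vmat p e z' c d"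
  unfolding Vmat_def by (intro arg_cong2[where f = "(-)"] refl sum.cong) auto

lemma Vdet_cong:
  "(\<And>i c. i < p \<Longrightarrow> c < q \<Longrightarrow> z (i, c) = z' (i, c)) \<Longrightarrow> Vdet p q e z = Vdet p q e z'"
  unfolding Vdet_def by (intro mdet_cong Vmat_cong)

lemma Kmat_cong:
  "(\<And>i c. i < p \<Longrightarrow> c < q \<Longrightarrow> z (i, c) = z' (i, c)) \<Longrightarrow> Kmat p q e z a b = Kmat p q e z' a b"
  unfolding Kmat_def by (intro minv_cong Vmat_cong)

lemma Vdet_nonzero_opnorm: "opnorm p q z < 1 \<Longrightarrow> Vdet p q 0 z \<noteq> 0"
  unfolding Vdet_def
  by (rule coercive_mdet[OF _ Vmat_coercive[OF order_refl order_refl]])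
    (simp add: opnorm_nonneg power_less_one_iff abs_square_less_1)

context haar_block
begin

abbreviation I :: "(nat \<times> nat) set" where "I \<equiv> mat_idx p q"

definition block :: "(nat \<times> nat \<Rightarrow> real) \<Rightarrow> nat \<times> nat \<Rightarrow> real"
  where "block A = (\<lambda>ij\<in>I. s * A ij)"

definition law :: "(nat \<times> nat \<Rightarrow> real) measure"
  where "law = distr \<mu> (borel_on I) block"

lemma measurable_entry': "ij \<in> I \<Longrightarrow> (\<lambda>A. A ij) \<in> borel_measurable \<mu>"
  using measurable_entry[of "fst ij" "snd ij"] qp pn by auto

lemma measurable_block[measurable]: "block \<in> measurable \<mu> (borel_on I)"
  unfolding block_def[abs_def]
  by (intro measurable_restrict borel_measurable_times borel_measurable_const measurable_entry')

lemma opnorm_block: "opnorm p q (block A) = s * opnorm p q A"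
proof -
  have "opnorm p q (block A) = opnorm p q (\<lambda>ij. s * A ij)"
    unfolding block_def by (rule opnorm.N_restrict)
  then show ?thesis using opnorm.scale[of p q s A] by simp
qed

lemma block_entry: "i < p \<Longrightarrow> c < q \<Longrightarrow> block A (i, c) / s = A (i, c)"
  using s_pos by (simp add: block_def)

text \<open>The reciprocal of the expected density on the open ball, up to a constant. It is cut off
  to 0 elsewhere, so that the weak equation concerns interior points only.\<close>

definition dens_weight :: "(nat \<times> nat \<Rightarrow> real) \<Rightarrow> real"
  where "dens_weight x = (if opnorm p q x < s then weight 0 (\<lambda>ij. x ij / s) else 0)"

lemma weight_block: "weight 0 (\<lambda>ij. block A ij / s) = weight 0 A"
  unfolding weight_def using Vdet_cong[of p q "\<lambda>ij. block A ij / s" A 0] block_entry by simp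

lemma opnorm_div_s: "opnorm p q (\<lambda>ij. x ij / s) = opnorm p q x / s"
  using opnorm.scale[of p q "1 / s" x] s_pos by (simp add: field_simps)

lemma measurable_dens_weight[measurable]: "dens_weight \<in> borel_measurable (borel_on I)"
proof -
  have [measurable]: "(\<lambda>x. Vdet p q 0 (\<lambda>ij. x ij / s)) \<in> borel_measurable (borel_on I)"
    by (rule measurable_Vdet_borel_on)
  show ?thesis
    unfolding dens_weight_def[abs_def] weight_def by measurable
qed

lemma sets_law: "sets law = sets (borel_on I)"
  by (simp add: law_def)

lemma prob_space_law: "prob_space law"
  unfolding law_def by (rule prob_space_distr) measurable

lemma weakly_constant_law: "weakly_constant I (opnorm p q) law dens_weight s"
proof (intro weakly_constant.intro weakly_constant_axioms.intro)
  show "coordinate_norm I (opnorm p q)" by (rule opnorm.coordinate_norm_axioms)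
  show "finite_measure law" using prob_space_law by (simp add: prob_space_def)
  show "sets law = sets (borel_on I)" by (rule sets_law)
  show "dens_weight \<in> borel_measurable (borel_on I)" by measurable
  show "0 \<le> dens_weight x" for x by (simp add: dens_weight_def weight_def)
  show "0 < s" by (rule s_pos)
  fix r assume r: "r < s"
  show "\<exists>B. \<forall>x. opnorm p q x \<le> r \<longrightarrow> dens_weight x \<le> B"
  proof (cases "r < 0")
    case True
    then show ?thesis using opnorm_nonneg[of p q] by (meson not_le order_trans)
  next
    case False
    define \<rho> where "\<rho> = r / s"
    have \<rho>: "0 \<le> \<rho>" "\<rho> < 1" using False r s_pos by (auto simp: \<rho>_def)
    define c where "c = 1 - \<rho>\<^sup>2"
    have c: "c > 0" using \<rho> by (simp add: c_def power_less_one_iff abs_square_less_1)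
    obtain W where W: "\<And>F. (\<forall>a<q. \<forall>b<q. \<bar>F a b\<bar> \<le> 2 + real p) \<Longrightarrow>
     (\<forall>v. c * (\<Sum>a<q. (v a)\<^sup>2) \<le> (\<Sum>a<q. v a * (\<Sum>b<q. F a b * v b))) \<Longrightarrow> ((mdet q F)\<^sup>2) powr (- m / 4) \<le> W"
      using coercive_weight_bound[OF c, of q "2 + real p" "- m / 4"] by blast
    have "dens_weight x \<le> W" if x: "opnorm p q x \<le> r" for x
    proof -
      have z: "opnorm p q (\<lambda>ij. x ij / s) \<le> \<rho>"
        unfolding opnorm_div_s \<rho>_def using x s_pos by (intro divide_right_mono) auto
      have ent: "\<bar>x (i, c) / s\<bar> \<le> 1" if "i < p" "c < q" for i c
        using opnorm.coord_le[of "(i, c)" p q "\<lambda>ij. x ij / s"] z \<rho> that by force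
      have "((mdet q (Vmat p 0 (\<lambda>ij. x ij / s)))\<^sup>2) powr (- m / 4) \<le> W"
        using ent Vmat_coercive[OF z order_refl]
        by (intro W) (auto intro!: Vmat_entry_bound[where q = q] simp: c_def)
      then show ?thesis using x r by (simp add: dens_weight_def weight_def Vdet_def)
    qed
    then show ?thesis by blast
  qed
next
  fix r and b b' :: "nat \<times> nat \<Rightarrow> real \<Rightarrow> real" and ij
  assume r: "r < s" and bd: "\<And>j t. (b j has_real_derivative b' j t) (at t)"
    and bc: "\<And>j. continuous_on UNIV (b' j)"
    and bb: "\<And>j. \<exists>C. \<forall>t. \<bar>b j t\<bar> \<le> C \<and> \<bar>b' j t\<bar> \<le> C"
    and bs: "\<And>x. (\<And>j. j \<in> I \<Longrightarrow> b j (x j) \<noteq> 0 \<or> b' j (x j) \<noteq> 0) \<Longrightarrow> opnorm p q x \<le> r"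
    and ij: "ij \<in> I"
  interpret T: haar_test n \<mu> p q b b' r
    by standard (use r bd bc bb bs in auto)
  obtain i j where ij': "ij = (i, j)" "i < p" "j < q" using ij by auto
  have cont_b: "continuous_on UNIV (b kl)" for kl by (rule T.b_cont)
  have "(\<integral>x. b' ij (x ij) * (\<Prod>j\<in>I - {ij}. b j (x j)) * dens_weight x \<partial>law)
      = (\<integral>A. b' ij (block A ij) * (\<Prod>j\<in>I - {ij}. b j (block A j)) * dens_weight (block A) \<partial>\<mu>)"
    unfolding law_def
  proof (rule integral_distr)
    show "(\<lambda>x. b' ij (x ij) * (\<Prod>j\<in>I - {ij}. b j (x j)) * dens_weight x) \<in> borel_measurable (borel_on I)"
    proof -
      have comp: "(\<lambda>x. f (x kl)) \<in> borel_measurable (borel_on I)"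
        if "continuous_on UNIV f" "kl \<in> I" for f :: "real \<Rightarrow> real" and kl
      proof -
        have "(\<lambda>x. x kl) \<in> borel_measurable (borel_on I)"
          using that(2) by (rule measurable_component_singleton)
        then show ?thesis
          by (rule measurable_compose) (rule borel_measurable_continuous_onI[OF that(1)])
      qed
      show ?thesis
        using ij by (intro borel_measurable_times borel_measurable_prod measurable_dens_weight comp bc cont_b) auto
    qed
  qed measurable
  also have "\<dots> = (\<integral>A. weight 0 A * T.d\<psi> (i, j) A \<partial>\<mu>)"
  proof (intro arg_cong[where f = "integral\<^sup>L \<mu>"] ext)
    fix A
    have prod: "b' ij (block A ij) * (\<Prod>j\<in>I - {ij}. b j (block A j)) = T.d\<psi> (i, j) A"
      unfolding T.d\<psi>_def ij'(1)[symmetric] using ij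
      by (intro arg_cong2[where f = "(*)"] prod.cong refl) (auto simp: block_def)
    show "b' ij (block A ij) * (\<Prod>j\<in>I - {ij}. b j (block A j)) * dens_weight (block A) = weight 0 A * T.d\<psi> (i, j) A"
    proof (cases "T.d\<psi> (i, j) A = 0")
      case False
      then have "opnorm p q A \<le> r / s" using ij' by (intro T.support_\<psi>) auto
      also have "\<dots> < 1" using r s_pos by simp
      finally have "dens_weight (block A) = weight 0 A"
        using s_pos by (simp add: dens_weight_def opnorm_block weight_block)
      then show ?thesis unfolding prod by simp
    qed (simp add: prod)
  qed
  also have "\<dots> = 0" by (rule T.weak_equation[OF ij'(2,3)])
  finally show "(\<integral>x. b' ij (x ij) * (\<Prod>j\<in>I - {ij}. b j (x j)) * dens_weight x \<partial>law) = 0" .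
qed

section \<open>The explicit density\<close>

definition dens :: "(nat \<times> nat \<Rightarrow> real) \<Rightarrow> real"
  where "dens x = (if opnorm p q x < s then ((Vdet p q 0 (\<lambda>ij. x ij / s))\<^sup>2) powr (m / 4) else 0)"

lemma measurable_dens[measurable]: "dens \<in> borel_measurable (borel_on I)"
proof -
  have [measurable]: "(\<lambda>x. Vdet p q 0 (\<lambda>ij. x ij / s)) \<in> borel_measurable (borel_on I)"
    by (rule measurable_Vdet_borel_on)
  show ?thesis
    unfolding dens_def[abs_def] by measurable
qed

lemma dens_nonneg: "0 \<le> dens x"
  by (simp add: dens_def)

lemma Vdet_scaled_nonzero: "opnorm p q x < s \<Longrightarrow> Vdet p q 0 (\<lambda>ij. x ij / s) \<noteq> 0"
  using s_pos by (intro Vdet_nonzero_opnorm) (simp add: opnorm_div_s)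

text \<open>The law times \<open>dens_weight\<close> is a multiple of Lebesgue measure on the open
  ball. Multiplying by the reciprocal \<open>dens\<close> recovers the law, because the ball has
  full measure by assumption; \<kappa> \<noteq> 0 since the law has total mass 1.\<close>

theorem law_density:
  assumes "AE A in \<mu>. opnorm p q A < 1"
  shows "\<exists>\<kappa>>0. law = density (lborel_on I) (\<lambda>x. ennreal (\<kappa> * dens x))"
proof -
  interpret W: weakly_constant I "opnorm p q" law dens_weight s by (rule weakly_constant_law)
  interpret L: prob_space law by (rule prob_space_law)
  obtain \<kappa> where \<kappa>: "\<kappa> \<ge> 0"
    and eq: "density law (\<lambda>x. ennreal ((if opnorm p q x < s then 1 else 0) * dens_weight x))
     = density (lborel_on I) (\<lambda>x. ennreal \<kappa> * (if opnorm p q x < s then 1 else 0))"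
    using W.density_eq by blast
  have mp: "opnorm p q \<in> borel_measurable (borel_on I)" by (rule opnorm.measurable_N)
  have m1: "(\<lambda>x. ennreal ((if opnorm p q x < s then 1 else 0) * dens_weight x)) \<in> borel_measurable law"
    unfolding measurable_cong_sets[OF sets_law refl] using mp by measurable
  have m2: "(\<lambda>x. ennreal \<kappa> * (if opnorm p q x < s then 1 else 0)) \<in> borel_measurable (lborel_on I)"
    unfolding measurable_lborel_on using mp by measurable
  have m3: "(\<lambda>x. ennreal (dens x)) \<in> borel_measurable law"
    unfolding measurable_cong_sets[OF sets_law refl] by measurable
  have m4: "(\<lambda>x. ennreal (dens x)) \<in> borel_measurable (lborel_on I)"
    unfolding measurable_lborel_on by measurable
  have ae: "AE x in law. opnorm p q x < s"
  proof -
    have "AE A in \<mu>. opnorm p q (block A) < s"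
      using assms by eventually_elim (use s_pos in \<open>simp add: opnorm_block\<close>)
    then show ?thesis
      unfolding law_def using mp by (subst AE_distr_iff) measurable
  qed
  have one: "dens_weight x * dens x = 1" if "opnorm p q x < s" for x
    using that Vdet_scaled_nonzero[OF that]
    by (simp add: dens_weight_def dens_def weight_def powr_add[symmetric])
  have "law = density law (\<lambda>x. 1)" by (rule density_1[symmetric])
  also have "\<dots> = density law (\<lambda>x. ennreal ((if opnorm p q x < s then 1 else 0) * dens_weight x) * ennreal (dens x))"
  proof (rule density_cong)
    show "AE x in law. 1 = ennreal ((if opnorm p q x < s then 1 else 0) * dens_weight x) * ennreal (dens x)"
      using ae by eventually_elim (simp add: ennreal_mult[symmetric] dens_nonneg W.w_nonneg one)
  qed (use m1 m3 in measurable)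
  also have "\<dots> = density (density law (\<lambda>x. ennreal ((if opnorm p q x < s then 1 else 0) * dens_weight x))) (\<lambda>x. ennreal (dens x))"
    by (rule density_density_eq[symmetric, OF m1 m3])
  also have "\<dots> = density (lborel_on I) (\<lambda>x. ennreal \<kappa> * (if opnorm p q x < s then 1 else 0) * ennreal (dens x))"
    unfolding eq by (rule density_density_eq[OF m2 m4])
  also have "\<dots> = density (lborel_on I) (\<lambda>x. ennreal (\<kappa> * dens x))"
    using \<kappa> by (intro arg_cong[where f = "density (lborel_on I)"] ext) (simp add: dens_def ennreal_mult)
  finally have law: "law = density (lborel_on I) (\<lambda>x. ennreal (\<kappa> * dens x))" .
  have "\<kappa> \<noteq> 0"
  proof
    assume "\<kappa> = 0"
    then have "law = density (lborel_on I) (\<lambda>x. 0)" using law by simp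
    then have "emeasure law (space law) = 0" by (simp add: emeasure_density)
    then show False using L.emeasure_space_1 by simp
  qed
  then show ?thesis using \<kappa> law by (intro exI[of _ \<kappa>]) auto
qed

text \<open>A quantitative form of invertible and positive semidefinite implies positive definite.
  As V \<le> 1, one has |V v|^2 \<le> <v, V v>, and v = K (V v) gives |v|^2 \<le> tr(K^2) |V v|^2.
  Together they bound <v, V v> = |v|^2 - |X v|^2 from below by |v|^2 / k.\<close>

lemma opnorm_less_1:
  assumes A: "A \<in> orthogonal_mats n" and nz: "Vdet p q 0 A \<noteq> 0"
  shows "opnorm p q A < 1"
proof -
  \<comment> \<open>The summand 1 ensures k \<ge> 1, so that the square root of 1 - 1 / k is defined
    and below 1.\<close>
  define k where "k = \<tau>2 0 A + 1"
  have k: "k \<ge> 1" using nonneg(6)[OF A order_refl nz] by (simp add: k_def)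
  have bil: "(\<Sum>c<q. w c * (\<Sum>d<q. Vmat p 0 A c d * v d)) =
    (\<Sum>k\<in>{p..<n}. (\<Sum>c<q. A (k, c) * w c) * (\<Sum>c<q. A (k, c) * v c))" for v w
  proof -
    have "(\<Sum>c<q. w c * (\<Sum>d<q. Vmat p 0 A c d * v d)) =
       (\<Sum>c<q. \<Sum>d<q. \<Sum>k\<in>{p..<n}. (A (k, c) * w c) * (A (k, d) * v d))"
      unfolding sum_distrib_left
      by (intro sum.cong refl) (simp add: Vmat_orthogonal[OF A] sum_distrib_left sum_distrib_right ac_simps)
    also have "\<dots> = (\<Sum>c<q. \<Sum>k\<in>{p..<n}. \<Sum>d<q. (A (k, c) * w c) * (A (k, d) * v d))"
      by (rule sum.cong[OF refl], rule sum.swap)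
    also have "\<dots> = (\<Sum>k\<in>{p..<n}. \<Sum>c<q. \<Sum>d<q. (A (k, c) * w c) * (A (k, d) * v d))"
      by (rule sum.swap)
    finally show ?thesis by (simp add: sum_product)
  qed
  have lower: "(\<Sum>c<q. (v c)\<^sup>2) \<le> k * (\<Sum>c<q. v c * (\<Sum>d<q. Vmat p 0 A c d * v d))" for v
  proof -
    define w where "w c = (\<Sum>d<q. Vmat p 0 A c d * v d)" for c
    define S where "S = (\<Sum>c<q. (w c)\<^sup>2)"
    define T where "T = (\<Sum>c<q. v c * w c)"
    have S0: "S \<ge> 0" unfolding S_def by (intro sum_nonneg) simp
    have T: "T = (\<Sum>k\<in>{p..<n}. (\<Sum>c<q. A (k, c) * v c)\<^sup>2)"
      unfolding T_def w_def bil by (simp add: power2_eq_square)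
    have ww: "(\<Sum>k\<in>{p..<n}. (\<Sum>c<q. A (k, c) * w c)\<^sup>2) \<le> S"
    proof -
      have "(\<Sum>k\<in>{p..<n}. (\<Sum>c<q. A (k, c) * w c)\<^sup>2) = (\<Sum>c<q. w c * (\<Sum>d<q. Vmat p 0 A c d * w d))"
        unfolding bil by (simp add: power2_eq_square)
      also have "\<dots> \<le> S" unfolding Vmat_quad_opnorm S_def by simp
      finally show ?thesis .
    qed
    have "S = (\<Sum>c<q. w c * (\<Sum>d<q. Vmat p 0 A c d * v d))"
      unfolding S_def w_def[symmetric] by (simp add: power2_eq_square)
    also have "\<dots> = (\<Sum>k\<in>{p..<n}. (\<Sum>c<q. A (k, c) * w c) * (\<Sum>c<q. A (k, c) * v c))" by (rule bil)
    finally have S_eq: "S = (\<Sum>k\<in>{p..<n}. (\<Sum>c<q. A (k, c) * w c) * (\<Sum>c<q. A (k, c) * v c))" .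
    have "S\<^sup>2 \<le> (\<Sum>k\<in>{p..<n}. (\<Sum>c<q. A (k, c) * w c)\<^sup>2) * T"
      unfolding T S_eq by (rule Cauchy_Schwarz_ineq_sum)
    also have "\<dots> \<le> S * T" unfolding T by (intro mult_right_mono ww sum_nonneg) simp
    finally have "S * S \<le> S * T" by (simp add: power2_eq_square)
    then have ST: "S \<le> T"
    proof (cases "S = 0")
      case True
      then show ?thesis unfolding T by (simp add: sum_nonneg)
    qed (use S0 \<open>S * S \<le> S * T\<close> in simp)
    have v: "v c = (\<Sum>d<q. K 0 A c d * w d)" if "c < q" for c
    proof -
      have "v c = (\<Sum>b<q. (\<Sum>a<q. K 0 A c a * Vmat p 0 A a b) * v b)"
        using that by (simp add: KV[OF A order_refl nz] sum_if_diag)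
      also have "\<dots> = (\<Sum>a<q. K 0 A c a * w a)"
        unfolding w_def sum_distrib_left sum_distrib_right by (subst sum.swap) (simp add: mult.assoc)
      finally show ?thesis .
    qed
    have "(\<Sum>c<q. (v c)\<^sup>2) = (\<Sum>c<q. (\<Sum>d<q. K 0 A c d * w d)\<^sup>2)"
      by (intro sum.cong refl) (simp add: v)
    also have "\<dots> \<le> (\<Sum>c<q. (\<Sum>d<q. (K 0 A c d)\<^sup>2) * S)"
      unfolding S_def by (intro sum_mono Cauchy_Schwarz_ineq_sum)
    also have "\<dots> = \<tau>2 0 A * S" by (simp add: \<tau>2_def sum_distrib_right)
    also have "\<dots> \<le> k * T"
      using ST S0 k nonneg(6)[OF A order_refl nz] by (intro mult_mono) (auto simp: k_def)
    finally show ?thesis by (simp add: T_def w_def)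
  qed
  define \<rho> where "\<rho> = sqrt (1 - 1 / k)"
  have "opnorm p q A \<le> \<rho>"
  proof (rule opnorm_leI)
    show "0 \<le> \<rho>" using k by (simp add: \<rho>_def)
    fix v
    have "(\<Sum>c<q. (v c)\<^sup>2) / k \<le> (\<Sum>c<q. v c * (\<Sum>d<q. Vmat p 0 A c d * v d))"
      using lower[of v] k by (simp add: pos_divide_le_eq mult.commute)
    then have "(L2_set (mat_vec q A v) {..<p})\<^sup>2 \<le> (1 - 1 / k) * (\<Sum>c<q. (v c)\<^sup>2)"
      unfolding Vmat_quad_opnorm by (simp add: left_diff_distrib)
    also have "\<dots> = (\<rho> * L2_set v {..<q})\<^sup>2"
      using k by (simp add: \<rho>_def power_mult_distrib L2_set_square)
    finally have sq: "(L2_set (mat_vec q A v) {..<p})\<^sup>2 \<le> (\<rho> * L2_set v {..<q})\<^sup>2" .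
    show "L2_set (mat_vec q A v) {..<p} \<le> \<rho> * L2_set v {..<q}"
      using k by (intro power2_le_imp_le[OF sq]) (simp add: \<rho>_def)
  qed
  also have "\<rho> < 1" using k by (simp add: \<rho>_def)
  finally show ?thesis .
qed

lemma opnorm_le_1: "A \<in> orthogonal_mats n \<Longrightarrow> opnorm p q A \<le> 1"
proof (rule opnorm_leI)
  fix v assume A: "A \<in> orthogonal_mats n"
  have "0 \<le> (\<Sum>c<q. v c * (\<Sum>d<q. Vmat p 0 A c d * v d))"
    unfolding Vmat_quadratic[OF A] by (simp add: sum_nonneg)
  then have "(L2_set (mat_vec q A v) {..<p})\<^sup>2 \<le> (L2_set v {..<q})\<^sup>2"
    unfolding Vmat_quad_opnorm by (simp add: L2_set_square)
  from power2_le_imp_le[OF this L2_set_nonneg]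
  show "L2_set (mat_vec q A v) {..<p} \<le> 1 * L2_set v {..<q}" by simp
qed simp

text \<open>For orthogonal A the norm is at most 1, and equality puts the scaled block on a sphere,
  a Lebesgue null set. Thus the mere existence of some density forces the block into the open ball
  almost surely, which brings the explicit density into play.\<close>

lemma AE_opnorm_of_density:
  assumes "law = density (lborel_on I) f" "f \<in> borel_measurable (lborel_on I)"
  shows "AE A in \<mu>. opnorm p q A < 1"
proof -
  have mp: "opnorm p q \<in> borel_measurable (borel_on I)" by (rule opnorm.measurable_N)
  define S where "S = {x \<in> extensional I. opnorm p q x = s}"
  have "S \<in> null_sets (lborel_on I)"
    unfolding S_def using opnorm.sphere_null[of s p q] s_pos mp
    by (intro null_setsI) (auto simp: sets_lborel_on space_borel_on(1)[symmetric])
  then have "AE x in lborel_on I. x \<notin> S" by (rule AE_not_in)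
  then have "AE x in law. x \<notin> S"
    unfolding assms(1) using assms(2) by (auto simp: AE_density)
  then have "AE x in law. opnorm p q x \<noteq> s"
    by (rule AE_mp) (rule AE_I2, auto simp: S_def sets_eq_imp_space_eq[OF sets_law] space_borel_on)
  then have "AE A in \<mu>. opnorm p q (block A) \<noteq> s"
    unfolding law_def using mp by (subst (asm) AE_distr_iff) measurable
  then show ?thesis
    using AE_orthogonal
    by eventually_elim (use s_pos opnorm_le_1 in \<open>fastforce simp: opnorm_block\<close>)
qed

end

subsection \<open>Independence of the Fisher information from the versions of the densities\<close>

text \<open>Otherwise f - g vanishes at a with nonzero slope, so it is nonzero on a whole interval
  next to a, against equality almost everywhere.\<close>

lemma deriv_eq_of_AE_eq:
  fixes f g :: "real \<Rightarrow> real"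
  assumes "f differentiable at a" "g differentiable at a" "f a = g a" "AE t in lborel. f t = g t"
  shows "deriv f a = deriv g a"
proof (rule ccontr)
  assume ne: "deriv f a \<noteq> deriv g a"
  have d: "((\<lambda>t. f t - g t) has_real_derivative deriv f a - deriv g a) (at a)"
    using assms(1,2) by (intro DERIV_diff) (auto simp: DERIV_deriv_iff_real_differentiable)
  have "((\<lambda>t. (f t - g t) / (t - a)) \<longlongrightarrow> deriv f a - deriv g a) (at a)"
    using d assms(3) by (simp add: has_field_derivative_iff)
  then have "\<forall>\<^sub>F t in at a. (f t - g t) / (t - a) \<noteq> 0"
    by (rule tendsto_imp_eventually_ne) (use ne in simp)
  then obtain e where e: "e > 0" "\<And>t. t \<noteq> a \<Longrightarrow> dist t a < e \<Longrightarrow> (f t - g t) / (t - a) \<noteq> 0"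
    unfolding eventually_at by auto
  obtain N where N: "{t. f t \<noteq> g t} \<subseteq> N" "N \<in> null_sets lborel"
    using assms(4) by (auto elim!: AE_E simp: null_sets_def)
  have "{a<..<a+e} \<subseteq> N" using e(2) N(1) by (fastforce simp: dist_real_def)
  then have "{a<..<a+e} \<in> null_sets lborel" using N(2) by (intro null_sets_subset[OF N(2)]) auto
  then show False using e(1) by (simp add: null_sets_def)
qed

text \<open>Fubini, with a conclusion about points rather than about lines. F measures the
  exceptional set on a line in direction i, and M collects the points on bad lines; almost every
  line misses M altogether, so M is null.\<close>

lemma AE_lines:
  assumes I: "finite I" "i \<in> I" and AE: "AE x in lborel_on I. P x"
  shows "AE x in lborel_on I. AE t in lborel. P (x(i := t))"
proof -
  let ?J = "I - {i}"
  have ins: "insert i ?J = I" using I by auto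
  obtain N where N: "{x \<in> space (lborel_on I). \<not> P x} \<subseteq> N" "N \<in> null_sets (lborel_on I)"
    using AE by (auto elim!: AE_E simp: null_sets_def)
  have Nm: "N \<in> sets (lborel_on I)" "emeasure (lborel_on I) N = 0" using N(2) by auto
  have upd: "(\<lambda>z. (fst z)(i := snd z)) \<in> measurable (lborel_on ?J \<Otimes>\<^sub>M lborel) (lborel_on I)"
    using measurable_add_dim[of i ?J "\<lambda>_. lborel"] unfolding ins by (simp add: split_beta')
  define F where "F y = (\<integral>\<^sup>+t. indicator N (y(i := t)) \<partial>lborel)" for y
  have indN: "(\<lambda>x. indicator N x :: ennreal) \<in> borel_measurable (lborel_on I)" using Nm by simp
  have Fm: "F \<in> borel_measurable (lborel_on ?J)"
  proof -
    have "(\<lambda>z. indicator N ((fst z)(i := snd z)) :: ennreal) \<in> borel_measurable (lborel_on ?J \<Otimes>\<^sub>M lborel)"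
      by (rule measurable_compose[OF upd indN])
    then show ?thesis
      unfolding F_def[abs_def] by (intro lborel.borel_measurable_nn_integral) (simp add: split_beta')
  qed
  have "(\<integral>\<^sup>+y. F y \<partial>lborel_on ?J) = (\<integral>\<^sup>+x. indicator N x \<partial>lborel_on I)"
    unfolding F_def using lb.product_nn_integral_insert[of ?J i "indicator N"] I indN by (simp add: insert_absorb)
  also have "\<dots> = 0" using Nm by simp
  finally have "AE y in lborel_on ?J. F y = 0"
    using Fm by (simp add: nn_integral_0_iff_AE)
  define M where "M = {x \<in> space (lborel_on I). F (restrict x ?J) \<noteq> 0}"
  have rm: "(\<lambda>x. restrict x ?J) \<in> measurable (lborel_on I) (lborel_on ?J)"
    by (intro measurable_restrict_subset) auto
  have Mm: "M \<in> sets (lborel_on I)"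
    unfolding M_def using measurable_compose[OF rm Fm] by measurable
  have "emeasure (lborel_on I) M = (\<integral>\<^sup>+x. indicator M x \<partial>lborel_on I)" using Mm by simp
  also have "\<dots> = (\<integral>\<^sup>+y. (\<integral>\<^sup>+t. indicator M (y(i := t)) \<partial>lborel) \<partial>lborel_on ?J)"
    using lb.product_nn_integral_insert[of ?J i "indicator M"] I Mm by (simp add: insert_absorb)
  also have "\<dots> = (\<integral>\<^sup>+y. 0 \<partial>lborel_on ?J)"
  proof (rule nn_integral_cong_AE)
    show "AE y in lborel_on ?J. (\<integral>\<^sup>+t. indicator M (y(i := t)) \<partial>lborel) = 0"
      using \<open>AE y in lborel_on ?J. F y = 0\<close> AE_space
    proof eventually_elim
      case (elim y)
      have "restrict (y(i := t)) ?J = y" for t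
        using elim(2) by (auto simp: space_borel_on restrict_def extensional_def fun_eq_iff)
      then show ?case using elim(1) by (simp add: M_def indicator_def)
    qed
  qed
  finally have "M \<in> null_sets (lborel_on I)" using Mm by (simp add: null_setsI)
  then have "AE x in lborel_on I. x \<notin> M" by (rule AE_not_in)
  then show ?thesis
    using AE_space
  proof eventually_elim
    case (elim x)
    have eq: "(restrict x ?J)(i := t) = x(i := t)" for t
      using elim(2) by (auto simp: space_borel_on restrict_def extensional_def fun_eq_iff)
    have "F (restrict x ?J) = 0" using elim by (simp add: M_def)
    then have "(\<integral>\<^sup>+t. indicator N (x(i := t)) \<partial>lborel) = 0"
      unfolding F_def eq .
    moreover have "(\<lambda>t. indicator N (x(i := t)) :: ennreal) \<in> borel_measurable lborel"
    proof -
      have "restrict x ?J \<in> space (lborel_on ?J)" by (simp add: space_borel_on)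
      then have "(\<lambda>t. (restrict x ?J)(i := t)) \<in> measurable lborel (lborel_on (insert i ?J))"
        by (rule measurable_component_update) simp
      then show ?thesis unfolding ins eq by (rule measurable_compose[OF _ indN])
    qed
    ultimately have "AE t in lborel. indicator N (x(i := t)) = (0 :: ennreal)"
      by (simp add: nn_integral_0_iff_AE)
    then show "AE t in lborel. P (x(i := t))"
    proof eventually_elim
      case (elim t)
      have "x(i := t) \<in> space (lborel_on I)"
        using \<open>x \<in> space (lborel_on I)\<close> I(2) by (auto simp: space_borel_on extensional_def)
      then show ?case using elim N(1) by (auto simp: indicator_def split: if_splits)
    qed
  qed
qed

lemma partial_deriv_version:
  assumes I: "finite I" and eq: "AE x in lborel_on I. u x = v x"
    and u: "AE x in lborel_on I. \<forall>i\<in>I. partial_differentiable i u x"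
    and v: "AE x in lborel_on I. \<forall>i\<in>I. partial_differentiable i v x"
  shows "AE x in lborel_on I. \<forall>i\<in>I. partial_deriv i u x = partial_deriv i v x"
proof (rule AE_finite_allI[OF I])
  fix i assume i: "i \<in> I"
  show "AE x in lborel_on I. partial_deriv i u x = partial_deriv i v x"
    using AE_lines[OF I i eq] eq u v
  proof eventually_elim
    case (elim x)
    then show ?case
      unfolding partial_deriv_def using i
      by (intro deriv_eq_of_AE_eq) (auto simp: partial_differentiable_def)
  qed
qed

lemma has_density_on_unique:
  assumes "finite I" "has_density_on \<mu> I f" "has_density_on \<mu> I g"
  shows "AE x in lborel_on I. f x = g x"
proof -
  interpret sigma_finite_measure "lborel_on I" by (rule lb.sigma_finite[OF assms(1)])
  have f: "(\<lambda>x. ennreal (f x)) \<in> borel_measurable (lborel_on I)" "\<And>x. x \<in> space (lborel_on I) \<Longrightarrow> 0 \<le> f x"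
    and g: "(\<lambda>x. ennreal (g x)) \<in> borel_measurable (lborel_on I)" "\<And>x. x \<in> space (lborel_on I) \<Longrightarrow> 0 \<le> g x"
    using assms by (auto simp: has_density_on_def)
  have "density (lborel_on I) (\<lambda>x. ennreal (f x)) = density (lborel_on I) (\<lambda>x. ennreal (g x))"
    using assms by (simp add: has_density_on_def)
  then have "AE x in lborel_on I. ennreal (f x) = ennreal (g x)"
    using density_unique_iff[OF f(1) g(1)] by simp
  then show ?thesis using AE_space by eventually_elim (simp add: f g)
qed

lemma fisher_information_eq:
  assumes I: "finite I" and f: "has_density_on \<mu> I f" and g: "has_density_on \<nu> I g"
    and diff: "AE x in lborel_on I. \<forall>i\<in>I. partial_differentiable i (\<lambda>y. sqrt (f y / g y)) x"
  shows "fisher_information I \<mu> \<nu> =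
    (\<integral>\<^sup>+x. ennreal ((grad_norm I (\<lambda>y. sqrt (f y / g y)) x)\<^sup>2 * g x) \<partial>lborel_on I)" (is "_ = ?F f g")
proof -
  have "?F f' g' = ?F f g" if f': "has_density_on \<mu> I f'" and g': "has_density_on \<nu> I g'"
    and diff': "AE x in lborel_on I. \<forall>i\<in>I. partial_differentiable i (\<lambda>y. sqrt (f' y / g' y)) x" for f' g'
  proof (rule nn_integral_cong_AE)
    note ae = has_density_on_unique[OF I f' f] has_density_on_unique[OF I g' g]
    have "AE x in lborel_on I. sqrt (f' x / g' x) = sqrt (f x / g x)"
      using ae by eventually_elim simp
    from partial_deriv_version[OF I this diff' diff]
    have "AE x in lborel_on I. \<forall>i\<in>I. partial_deriv i (\<lambda>y. sqrt (f' y / g' y)) x = partial_deriv i (\<lambda>y. sqrt (f y / g y)) x" .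
    then show "AE x in lborel_on I. ennreal ((grad_norm I (\<lambda>y. sqrt (f' y / g' y)) x)\<^sup>2 * g' x)
        = ennreal ((grad_norm I (\<lambda>y. sqrt (f y / g y)) x)\<^sup>2 * g x)"
      using ae(2) by eventually_elim (simp add: grad_norm_def cong: L2_set_cong)
  qed
  then have "{?F f' g' | f' g'. has_density_on \<mu> I f' \<and> has_density_on \<nu> I g' \<and>
      (AE x in lborel_on I. \<forall>i\<in>I. partial_differentiable i (\<lambda>y. sqrt (f' y / g' y)) x)} = {?F f g}"
    using f g diff by blast
  then show ?thesis unfolding fisher_information_def by simp
qed

lemma fisher_information_no_density:
  assumes "\<And>f. \<not> has_density_on \<mu> I f"
  shows "fisher_information I \<mu> \<nu> = \<infinity>"
proof -
  have "{(\<integral>\<^sup>+x. ennreal ((grad_norm I (\<lambda>y. sqrt (f y / g y)) x)\<^sup>2 * g x) \<partial>lborel_on I) | f g.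
           has_density_on \<mu> I f \<and> has_density_on \<nu> I g \<and>
           (AE x in lborel_on I. \<forall>i\<in>I. partial_differentiable i (\<lambda>y. sqrt (f y / g y)) x)} = {}"
    using assms by blast
  then show ?thesis by (simp only: fisher_information_def Inf_empty infinity_ennreal_def)
qed

subsection \<open>The Gaussian density\<close>

definition gauss_dens :: "'i set \<Rightarrow> ('i \<Rightarrow> real) \<Rightarrow> real"
  where "gauss_dens I x = (\<Prod>i\<in>I. std_normal_density (x i))"

lemma gauss_dens_pos: "0 < gauss_dens I x"
  unfolding gauss_dens_def by (intro prod_pos) (simp add: normal_density_pos)

lemma measurable_gauss_dens[measurable]: "gauss_dens I \<in> borel_measurable (borel_on I)"
  unfolding gauss_dens_def[abs_def]
  by (intro borel_measurable_prod measurable_compose[OF measurable_component_singleton]) auto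

lemma PiM_density:
  fixes f :: "real \<Rightarrow> ennreal"
  assumes I: "finite I" and f[measurable]: "f \<in> borel_measurable borel"
    and sf: "sigma_finite_measure (density lborel f)"
  shows "Pi\<^sub>M I (\<lambda>_. density lborel f) = density (lborel_on I) (\<lambda>x. \<Prod>i\<in>I. f (x i))"
proof -
  interpret D: product_sigma_finite "\<lambda>_. density lborel f"
    using sf by (simp add: product_sigma_finite_def)
  have "(\<lambda>x. f (x i)) \<in> borel_measurable (borel_on I)" if "i \<in> I" for i
    by (rule measurable_compose[OF _ f], rule measurable_component_singleton[OF that])
  then have m: "(\<lambda>x. \<Prod>i\<in>I. f (x i)) \<in> borel_measurable (lborel_on I)"
    unfolding measurable_lborel_on by (intro borel_measurable_prod_ennreal)
  show ?thesis
  proof (rule D.PiM_eqI[OF I, symmetric])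
    show "sets (density (lborel_on I) (\<lambda>x. \<Prod>i\<in>I. f (x i))) = sets (Pi\<^sub>M I (\<lambda>_. density lborel f))"
      by (simp, rule sets_PiM_cong) auto
    fix A :: "'a \<Rightarrow> real set" assume A: "\<And>i. i \<in> I \<Longrightarrow> A i \<in> sets (density lborel f)"
    then have A': "\<And>i. i \<in> I \<Longrightarrow> A i \<in> sets borel" by simp
    have "emeasure (density (lborel_on I) (\<lambda>x. \<Prod>i\<in>I. f (x i))) (Pi\<^sub>E I A)
      = (\<integral>\<^sup>+x. (\<Prod>i\<in>I. f (x i)) * indicator (Pi\<^sub>E I A) x \<partial>lborel_on I)"
      using A' I by (intro emeasure_density m sets_PiM_I_finite) auto
    also have "\<dots> = (\<integral>\<^sup>+x. (\<Prod>i\<in>I. f (x i) * indicator (A i) (x i)) \<partial>lborel_on I)"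
    proof (intro nn_integral_cong)
      fix x assume "x \<in> space (lborel_on I)"
      then have x: "x \<in> extensional I" by (simp add: space_borel_on)
      have "indicator (Pi\<^sub>E I A) x = (\<Prod>i\<in>I. indicator (A i) (x i) :: ennreal)"
      proof (cases "x \<in> Pi\<^sub>E I A")
        case False
        then obtain i where "i \<in> I" "x i \<notin> A i" using x by (auto simp: PiE_def Pi_def)
        then have "(\<Prod>i\<in>I. indicator (A i) (x i) :: ennreal) = 0"
            using I by (intro prod_zero bexI[of _ i]) auto
        then show ?thesis using False by simp
      qed (auto simp: PiE_def Pi_def)
      then show "(\<Prod>i\<in>I. f (x i)) * indicator (Pi\<^sub>E I A) x = (\<Prod>i\<in>I. f (x i) * indicator (A i) (x i))"
        by (simp add: prod.distrib)
    qed
    also have "\<dots> = (\<Prod>i\<in>I. \<integral>\<^sup>+t. f t * indicator (A i) t \<partial>lborel)"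
      using A' by (intro lb.product_nn_integral_prod I) auto
    also have "\<dots> = (\<Prod>i\<in>I. emeasure (density lborel f) (A i))"
      using A' by (intro prod.cong refl emeasure_density[symmetric]) auto
    finally show "emeasure (density (lborel_on I) (\<lambda>x. \<Prod>i\<in>I. f (x i))) (Pi\<^sub>E I A)
      = (\<Prod>i\<in>I. emeasure (density lborel f) (A i))" .
  qed
qed

lemma gaussian_law:
  assumes G: "std_gaussian_matrix p q N G" and ne: "mat_idx p q \<noteq> {}"
  shows "has_density_on (joint_law N (mat_idx p q) G) (mat_idx p q) (gauss_dens (mat_idx p q))"
proof -
  let ?I = "mat_idx p q"
  interpret prob_space N using G by (simp add: std_gaussian_matrix_def)
  have indep: "indep_vars (\<lambda>_. borel) (\<lambda>ij \<omega>. G \<omega> ij) ?I"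
    and dist: "\<And>ij. ij \<in> ?I \<Longrightarrow> distributed N lborel (\<lambda>\<omega>. G \<omega> ij) std_normal_density"
    using G unfolding std_gaussian_matrix_def by blast+
  have rv: "random_variable borel (\<lambda>\<omega>. G \<omega> ij)" if "ij \<in> ?I" for ij
    using distributed_measurable[OF dist[OF that]] by simp
  have "joint_law N ?I G = distr N (Pi\<^sub>M ?I (\<lambda>_. borel)) (\<lambda>\<omega>. \<lambda>ij\<in>?I. G \<omega> ij)"
    by (simp add: joint_law_def restrict_def)
  also have "\<dots> = Pi\<^sub>M ?I (\<lambda>ij. distr N borel (\<lambda>\<omega>. G \<omega> ij))"
    using iffD1[OF indep_vars_iff_distr_eq_PiM'[OF ne rv] indep] by simp
  also have "\<dots> = Pi\<^sub>M ?I (\<lambda>_. density lborel (\<lambda>x. ennreal (std_normal_density x)))"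
  proof (rule PiM_cong[OF refl])
    fix ij assume "ij \<in> ?I"
    have "distr N borel (\<lambda>\<omega>. G \<omega> ij) = distr N lborel (\<lambda>\<omega>. G \<omega> ij)"
      by (rule distr_cong) auto
    then show "distr N borel (\<lambda>\<omega>. G \<omega> ij) = density lborel (\<lambda>x. ennreal (std_normal_density x))"
      using distributed_distr_eq_density[OF dist[OF \<open>ij \<in> ?I\<close>]] by simp
  qed
  also have "\<dots> = density (lborel_on ?I) (\<lambda>x. \<Prod>i\<in>?I. ennreal (std_normal_density (x i)))"
  proof (rule PiM_density)
    interpret P: prob_space "density lborel (\<lambda>x. ennreal (std_normal_density x))"
      by (rule prob_space_normal_density) simp
    show "sigma_finite_measure (density lborel (\<lambda>x. ennreal (std_normal_density x)))" by standard
  qed auto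
  also have "\<dots> = density (lborel_on ?I) (\<lambda>x. ennreal (gauss_dens ?I x))"
    by (simp add: gauss_dens_def prod_ennreal)
  finally show ?thesis
    unfolding has_density_on_def measurable_lborel_on
    using gauss_dens_pos[of ?I] by (auto intro: less_imp_le)
qed

subsection \<open>The Fisher information as an expectation\<close>

context haar_block
begin

text \<open>The partial derivative of the logarithm of the density ratio on the open ball: x comes
  from the Gaussian density, the other term from the power of the determinant.\<close>

definition score :: "(nat \<times> nat \<Rightarrow> real) \<Rightarrow> nat \<Rightarrow> nat \<Rightarrow> real"
  where "score x i j = x (i, j) - m / real n * (\<Sum>c<q. K 0 (\<lambda>ij. x ij / s) j c * x (i, c))"

lemma DERIV_upd: "((\<lambda>t. (x(ij := t)) kl) has_real_derivative (if kl = ij then 1 else 0)) (at u)"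
  for x :: "nat \<times> nat \<Rightarrow> real"
  by (cases "kl = ij") auto

text \<open>Ensures that a small change of one entry does not cross the sphere, so that partial
  derivatives off the sphere do not see the cut-off in \<open>dens\<close>.\<close>

lemma opnorm_upd: "ij \<in> I \<Longrightarrow> \<bar>opnorm p q (x(ij := t)) - opnorm p q x\<bar> \<le> \<bar>t - x ij\<bar>"
proof -
  assume ij: "ij \<in> I"
  have "\<bar>opnorm p q (x(ij := t)) - opnorm p q x\<bar> \<le> (\<Sum>kl\<in>I. \<bar>(x(ij := t)) kl - x kl\<bar>)"
    by (rule opnorm.Lipschitz)
  also have "\<dots> = (\<Sum>kl\<in>I. if kl = ij then \<bar>t - x ij\<bar> else 0)" by (intro sum.cong) auto
  also have "\<dots> = \<bar>t - x ij\<bar>" using ij by (simp add: sum.delta)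
  finally show ?thesis .
qed

text \<open>Jacobi's formula. Entry (i, j) enters V through row j and column j, and the two
  contributions coincide by symmetry of K, which gives the factor 2.\<close>

lemma DERIV_Vdet_entry:
  assumes x: "opnorm p q x < s" and ij: "i < p" "j < q"
  shows "((\<lambda>t. Vdet p q 0 (\<lambda>kl. (x((i, j) := t)) kl / s)) has_real_derivative
    - 2 / real n * (\<Sum>c<q. K 0 (\<lambda>kl. x kl / s) j c * x (i, c)) * Vdet p q 0 (\<lambda>kl. x kl / s)) (at (x (i, j)))"
proof -
  let ?z = "\<lambda>kl. x kl / s"
  have nz: "Vdet p q 0 ?z \<noteq> 0" by (rule Vdet_scaled_nonzero[OF x])
  have upd: "x((i, j) := x (i, j)) = x" by simp
  let ?V' = "\<lambda>c d. - ((if c = j then x (i, d) else 0) + (if d = j then x (i, c) else 0)) / real n"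
  have dV: "((\<lambda>t. Vmat p 0 (\<lambda>kl. (x((i, j) := t)) kl / s) c d) has_real_derivative ?V' c d) (at (x (i, j)))"
    if cd: "c < q" "d < q" for c d
  proof -
    have d1: "((\<lambda>t. (x((i, j) := t)) kl / s) has_real_derivative (if kl = (i, j) then 1 else 0) / s) (at (x (i, j)))" for kl
      by (rule DERIV_cdivide[OF DERIV_upd])
    have "((\<lambda>t. Vmat p 0 (\<lambda>kl. (x((i, j) := t)) kl / s) c d) has_real_derivative
      0 - (\<Sum>k<p. (x((i, j) := x (i, j))) (k, c) / s * ((if (k, d) = (i, j) then 1 else 0) / s)
         + (if (k, c) = (i, j) then 1 else 0) / s * ((x((i, j) := x (i, j))) (k, d) / s))) (at (x (i, j)))"
      unfolding Vmat_def by (intro DERIV_diff DERIV_const DERIV_sum DERIV_mult' d1)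
    moreover have "(\<Sum>k<p. (x((i, j) := x (i, j))) (k, c) / s * ((if (k, d) = (i, j) then 1 else 0) / s)
         + (if (k, c) = (i, j) then 1 else 0) / s * ((x((i, j) := x (i, j))) (k, d) / s))
       = (\<Sum>k<p. if k = i then ((if d = j then x (i, c) else 0) + (if c = j then x (i, d) else 0)) / real n else 0)"
      unfolding upd by (intro sum.cong refl) (auto simp: add_divide_distrib)
    moreover have "\<dots> = - ?V' c d" using ij by (simp add: add.commute)
    ultimately show ?thesis by simp
  qed
  have "((\<lambda>t. Vdet p q 0 (\<lambda>kl. (x((i, j) := t)) kl / s)) has_real_derivative
     mdet q (Vmat p 0 (\<lambda>kl. (x((i, j) := x (i, j))) kl / s)) * (\<Sum>a<q. \<Sum>b<q. minv q (Vmat p 0 (\<lambda>kl. (x((i, j) := x (i, j))) kl / s)) a b * ?V' b a))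
     (at (x (i, j)))"
    unfolding Vdet_def using nz by (intro DERIV_mdet dV) (auto simp: Vdet_def)
  also have "(\<Sum>a<q. \<Sum>b<q. minv q (Vmat p 0 (\<lambda>kl. (x((i, j) := x (i, j))) kl / s)) a b * ?V' b a)
    = - (1 / real n) * ((\<Sum>a<q. \<Sum>b<q. (if b = j then 1 else 0) * (K 0 ?z a b * x (i, a)))
        + (\<Sum>a<q. (if a = j then 1 else 0) * (\<Sum>b<q. K 0 ?z a b * x (i, b))))"
    unfolding upd Kmat_def[symmetric] sum_distrib_left sum.distrib[symmetric]
    by (intro sum.cong refl) (auto simp: add_divide_distrib algebra_simps)
  also have "(\<Sum>a<q. \<Sum>b<q. (if b = j then 1 else 0) * (K 0 ?z a b * x (i, a))) = (\<Sum>a<q. K 0 ?z j a * x (i, a))"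
    using ij(2) Kmat_sym[OF nz] by (intro sum.cong refl) (simp add: sum_delta_mult)
  also have "(\<Sum>a<q. (if a = j then 1 else 0) * (\<Sum>b<q. K 0 ?z a b * x (i, b))) = (\<Sum>b<q. K 0 ?z j b * x (i, b))"
    using ij(2) by (simp add: sum_delta_mult)
  finally show ?thesis by (simp add: upd Vdet_def mult.commute)
qed

lemma DERIV_dens:
  assumes x: "opnorm p q x < s" and ij: "i < p" "j < q"
  shows "((\<lambda>t. dens (x((i, j) := t))) has_real_derivative
    - m / real n * (\<Sum>c<q. K 0 (\<lambda>kl. x kl / s) j c * x (i, c)) * dens x) (at (x (i, j)))"
proof -
  let ?D = "\<lambda>t. Vdet p q 0 (\<lambda>kl. (x((i, j) := t)) kl / s)"
  let ?y = "\<Sum>c<q. K 0 (\<lambda>kl. x kl / s) j c * x (i, c)"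
  have nz: "?D (x (i, j)) \<noteq> 0" using Vdet_scaled_nonzero[OF x] by simp
  have eqD: "?D (x (i, j)) = Vdet p q 0 (\<lambda>kl. x kl / s)" by simp
  let ?d = "?D (x (i, j))"
  have "((\<lambda>t. (?D t)\<^sup>2) has_real_derivative 2 * ?d * (- 2 / real n * ?y * ?d)) (at (x (i, j)))"
    using DERIV_power[OF DERIV_Vdet_entry[OF x ij], of 2] by (simp add: ac_simps)
  then have "((\<lambda>t. ((?D t)\<^sup>2) powr (m / 4)) has_real_derivative
      (m / 4) * (?d\<^sup>2) powr (m / 4 - 1) * (2 * ?d * (- 2 / real n * ?y * ?d))) (at (x (i, j)))"
    using nz by (intro DERIV_fun_powr[THEN DERIV_cong]) auto
  moreover have "(m / 4) * (?d\<^sup>2) powr (m / 4 - 1) * (2 * ?d * (- 2 / real n * ?y * ?d))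
      = - m / real n * ?y * ((?d\<^sup>2) powr (m / 4 - 1) * ?d\<^sup>2)"
    by (simp add: power2_eq_square)
  moreover have "(?d\<^sup>2) powr (m / 4 - 1) * ?d\<^sup>2 = (?d\<^sup>2) powr (m / 4)"
    using nz powr_add[of "?d\<^sup>2" "m / 4 - 1" 1] by simp
  moreover have "(?d\<^sup>2) powr (m / 4) = dens x"
    unfolding eqD using x by (simp add: dens_def)
  ultimately have "((\<lambda>t. ((?D t)\<^sup>2) powr (m / 4)) has_real_derivative - m / real n * ?y * dens x) (at (x (i, j)))"
    by (simp only:)
  then show ?thesis
  proof (rule has_field_derivative_transform_within[where d = "s - opnorm p q x"])
    fix t assume "dist t (x (i, j)) < s - opnorm p q x"
    then have "opnorm p q (x((i, j) := t)) < s"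
      using opnorm_upd[of "(i, j)" x t] ij by (auto simp: dist_real_def abs_le_iff)
    then show "((?D t)\<^sup>2) powr (m / 4) = dens (x((i, j) := t))" by (simp add: dens_def)
  qed (use x in auto)
qed

lemma DERIV_gauss_dens:
  assumes ij: "ij \<in> I"
  shows "((\<lambda>t. gauss_dens I (x(ij := t))) has_real_derivative - x ij * gauss_dens I x) (at (x ij))"
proof -
  have split: "gauss_dens I (x(ij := t)) = std_normal_density t * (\<Prod>kl\<in>I - {ij}. std_normal_density (x kl))" for t
    unfolding gauss_dens_def using ij
    by (subst prod.remove[of I ij]) (auto intro!: arg_cong2[where f = "(*)"] prod.cong)
  have "(std_normal_density has_real_derivative - t * std_normal_density t) (at t)" for t
  proof -
    have "((\<lambda>t. exp (- t\<^sup>2 / 2)) has_real_derivative - t * exp (- t\<^sup>2 / 2)) (at t)"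
      by (auto intro!: derivative_eq_intros)
    from DERIV_cmult[OF this, of "1 / sqrt (2 * pi)"] show ?thesis
      unfolding std_normal_density_def[abs_def] by (simp add: mult.left_commute)
  qed
  then have "((\<lambda>t. gauss_dens I (x(ij := t))) has_real_derivative
     - x ij * std_normal_density (x ij) * (\<Prod>kl\<in>I - {ij}. std_normal_density (x kl))) (at (x ij))"
    unfolding split by (rule DERIV_cmult_right)
  then show ?thesis using split[of "x ij"] by (simp add: mult.assoc)
qed

lemma DERIV_ratio:
  assumes \<kappa>: "\<kappa> > 0" and x: "opnorm p q x < s" and ij: "i < p" "j < q"
  shows "((\<lambda>t. sqrt (\<kappa> * dens (x((i, j) := t)) / gauss_dens I (x((i, j) := t)))) has_real_derivative
    sqrt (\<kappa> * dens x / gauss_dens I x) * (score x i j / 2)) (at (x (i, j)))"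
proof -
  let ?g = "gauss_dens I x"
  let ?y = "\<Sum>c<q. K 0 (\<lambda>kl. x kl / s) j c * x (i, c)"
  let ?r = "\<kappa> * dens x / ?g"
  have g: "?g > 0" by (rule gauss_dens_pos)
  have d: "dens x > 0" using x Vdet_scaled_nonzero[OF x] by (simp add: dens_def)
  have r: "?r > 0" using \<kappa> d g by simp
  have "((\<lambda>t. \<kappa> * dens (x((i, j) := t)) / gauss_dens I (x((i, j) := t))) has_real_derivative
    (\<kappa> * (- m / real n * ?y * dens x) * gauss_dens I (x((i, j) := x (i, j))) -
      \<kappa> * dens (x((i, j) := x (i, j))) * (- x (i, j) * ?g)) /
      (gauss_dens I (x((i, j) := x (i, j))) * gauss_dens I (x((i, j) := x (i, j))))) (at (x (i, j)))"
    using g ij by (intro DERIV_divide DERIV_cmult DERIV_dens[OF x] DERIV_gauss_dens) auto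
  also have "(\<kappa> * (- m / real n * ?y * dens x) * gauss_dens I (x((i, j) := x (i, j))) -
      \<kappa> * dens (x((i, j) := x (i, j))) * (- x (i, j) * ?g)) /
      (gauss_dens I (x((i, j) := x (i, j))) * gauss_dens I (x((i, j) := x (i, j)))) = ?r * score x i j"
    using g by (simp add: score_def field_simps)
  finally have dr: "((\<lambda>t. \<kappa> * dens (x((i, j) := t)) / gauss_dens I (x((i, j) := t))) has_real_derivative
    ?r * score x i j) (at (x (i, j)))" .
  have "inverse (sqrt u) / 2 * (u * c) = sqrt u * (c / 2)" if "u > 0" for u c :: real
  proof -
    have "inverse (sqrt u) / 2 * (u * c) = u / sqrt u * (c / 2)"
      by (simp only: divide_inverse mult.assoc mult.commute mult.left_commute)
    also have "u / sqrt u = sqrt u" using that by (intro real_div_sqrt) simp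
    finally show ?thesis .
  qed
  note eq = this[OF r, of "score x i j"]
  define F where "F t = \<kappa> * dens (x((i, j) := t)) / gauss_dens I (x((i, j) := t))" for t
  have F: "F (x (i, j)) = ?r" unfolding F_def fun_upd_triv ..
  have "(F has_real_derivative ?r * score x i j) (at (x (i, j)))"
    unfolding F_def[abs_def] by (rule dr)
  moreover have "(sqrt has_real_derivative inverse (sqrt ?r) / 2) (at (F (x (i, j))))"
    unfolding F by (rule DERIV_real_sqrt[OF r])
  ultimately have "((\<lambda>t. sqrt (F t)) has_real_derivative inverse (sqrt ?r) / 2 * (?r * score x i j)) (at (x (i, j)))"
    using DERIV_chain2[of sqrt "inverse (sqrt ?r) / 2" F "x (i, j)" "?r * score x i j" UNIV] by blast
  then show ?thesis unfolding eq F_def .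
qed

lemma DERIV_ratio_outside:
  assumes x: "opnorm p q x > s" and ij: "i < p" "j < q"
  shows "((\<lambda>t. sqrt (\<kappa> * dens (x((i, j) := t)) / gauss_dens I (x((i, j) := t)))) has_real_derivative 0) (at (x (i, j)))"
proof -
  have "((\<lambda>t. 0) has_real_derivative 0) (at (x (i, j)))" by simp
  then show ?thesis
  proof (rule has_field_derivative_transform_within[where d = "opnorm p q x - s"])
    fix t assume "dist t (x (i, j)) < opnorm p q x - s"
    then have "\<not> opnorm p q (x((i, j) := t)) < s"
      using opnorm_upd[of "(i, j)" x t] ij by (auto simp: dist_real_def abs_le_iff)
    then show "0 = sqrt (\<kappa> * dens (x((i, j) := t)) / gauss_dens I (x((i, j) := t)))" by (simp add: dens_def)
  qed (use x in auto)
qed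

text \<open>A quarter of the squared norm of the score at the scaled block, in terms of A; the
  factor n comes from the scaling by s.\<close>

definition info_integrand :: "(nat \<times> nat \<Rightarrow> real) \<Rightarrow> real"
  where "info_integrand A = real n / 4 * (\<Sum>i<p. \<Sum>j<q. (A (i, j) - m / real n * Q 0 A j i)\<^sup>2)"

lemma measurable_score: "i < p \<Longrightarrow> j < q \<Longrightarrow> (\<lambda>x. score x i j) \<in> borel_measurable (borel_on I)"
  unfolding score_def Kmat_def Vmat_def
  by (intro borel_measurable_diff borel_measurable_times borel_measurable_sum borel_measurable_const
      borel_measurable_minv borel_measurable_divide measurable_component_singleton) auto

lemma score_block:
  assumes "i < p" "j < q"
  shows "score (block A) i j = s * (A (i, j) - m / real n * Q 0 A j i)"
proof -
  have "Kmat p q 0 (\<lambda>ij. block A ij / s) a b = Kmat p q 0 A a b" for a b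
    by (rule Kmat_cong) (simp add: block_entry)
  then show ?thesis
    using assms by (simp add: score_def Q_def block_def right_diff_distrib sum_distrib_left ac_simps)
qed

text \<open>With f and g the two densities, the gradient of sqrt (f / g) is sqrt (f / g) times half
  the score. Its squared norm times g is f |score|^2 / 4, so g cancels, the unknown constant stays
  inside f, and the integral is an expectation under the law.\<close>

theorem fisher_information_law:
  assumes ae: "AE A in \<mu>. opnorm p q A < 1" and \<nu>: "has_density_on \<nu> I (gauss_dens I)"
  shows "fisher_information I law \<nu> = (\<integral>\<^sup>+A. ennreal (info_integrand A) \<partial>\<mu>)"
proof -
  obtain \<kappa> where \<kappa>: "\<kappa> > 0" and law: "law = density (lborel_on I) (\<lambda>x. ennreal (\<kappa> * dens x))"
    using law_density[OF ae] by blast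
  have m\<kappa>: "(\<lambda>x. \<kappa> * dens x) \<in> borel_measurable (lborel_on I)"
    unfolding measurable_lborel_on by measurable
  have f: "has_density_on law I (\<lambda>x. \<kappa> * dens x)"
    unfolding has_density_on_def using law m\<kappa> \<kappa> dens_nonneg by (auto intro!: mult_nonneg_nonneg)
  let ?h = "\<lambda>y. sqrt (\<kappa> * dens y / gauss_dens I y)"
  have aes: "AE x in lborel_on I. opnorm p q x \<noteq> s"
  proof -
    have "{x \<in> extensional I. opnorm p q x = s} \<in> null_sets (lborel_on I)"
      using opnorm.sphere_null[of s p q] s_pos opnorm.measurable_N[of p q]
      by (intro null_setsI) (auto simp: sets_lborel_on space_borel_on(1)[symmetric])
    from AE_not_in[OF this] AE_space show ?thesis
      by eventually_elim (auto simp: space_borel_on)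
  qed
  have pd_in: "partial_deriv (i, j) ?h x = ?h x * (score x i j / 2)" "partial_differentiable (i, j) ?h x"
    if "opnorm p q x < s" "i < p" "j < q" for i j x
    using DERIV_ratio[OF \<kappa> that]
    by (auto simp: partial_deriv_def partial_differentiable_def DERIV_imp_deriv real_differentiable_def)
  have pd_out: "partial_deriv (i, j) ?h x = 0" "partial_differentiable (i, j) ?h x"
    if "opnorm p q x > s" "i < p" "j < q" for i j x
    using DERIV_ratio_outside[OF that, of \<kappa>]
    by (auto simp: partial_deriv_def partial_differentiable_def DERIV_imp_deriv real_differentiable_def)
  have diff: "AE x in lborel_on I. \<forall>ij\<in>I. partial_differentiable ij ?h x"
    using aes
  proof eventually_elim
    case (elim x)
    show ?case
    proof
      fix ij assume "ij \<in> I"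
      then obtain i j where "ij = (i, j)" "i < p" "j < q" by auto
      then show "partial_differentiable ij ?h x"
        using elim pd_in(2) pd_out(2) by (cases "opnorm p q x < s") auto
    qed
  qed
  let ?T = "\<lambda>x. (\<Sum>i<p. \<Sum>j<q. (score x i j)\<^sup>2) / 4"
  have mT: "?T \<in> borel_measurable (borel_on I)"
    by (intro borel_measurable_divide borel_measurable_sum borel_measurable_power measurable_score
        borel_measurable_const) auto
  have "fisher_information I law \<nu> = (\<integral>\<^sup>+x. ennreal ((grad_norm I ?h x)\<^sup>2 * gauss_dens I x) \<partial>lborel_on I)"
    by (rule fisher_information_eq[OF _ f \<nu> diff]) simp
  also have "\<dots> = (\<integral>\<^sup>+x. ennreal (\<kappa> * dens x) * ennreal (?T x) \<partial>lborel_on I)"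
  proof (rule nn_integral_cong_AE)
    show "AE x in lborel_on I. ennreal ((grad_norm I ?h x)\<^sup>2 * gauss_dens I x) = ennreal (\<kappa> * dens x) * ennreal (?T x)"
      using aes
    proof eventually_elim
      case (elim x)
      have T0: "0 \<le> ?T x" by (simp add: sum_nonneg)
      have g: "gauss_dens I x > 0" by (rule gauss_dens_pos)
      have gn: "(grad_norm I ?h x)\<^sup>2 = (\<Sum>i<p. \<Sum>j<q. (partial_deriv (i, j) ?h x)\<^sup>2)"
        unfolding grad_norm_def L2_set_square by (simp add: sum.cartesian_product)
      show ?case
      proof (cases "opnorm p q x < s")
        case True
        have h2: "(?h x)\<^sup>2 = \<kappa> * dens x / gauss_dens I x"
          using \<kappa> g dens_nonneg[of x] by simp
        have "(grad_norm I ?h x)\<^sup>2 = (\<Sum>i<p. \<Sum>j<q. (?h x)\<^sup>2 * ((score x i j)\<^sup>2 / 4))"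
          unfolding gn using True
          by (intro sum.cong refl) (simp only: pd_in lessThan_iff power_mult_distrib power_divide, simp)
        also have "\<dots> = \<kappa> * dens x / gauss_dens I x * ?T x"
          unfolding h2 by (simp add: sum_distrib_left sum_divide_distrib)
        finally have "(grad_norm I ?h x)\<^sup>2 * gauss_dens I x = \<kappa> * dens x * ?T x" using g by simp
        then show ?thesis using T0 \<kappa> dens_nonneg[of x] by (simp only: ennreal_mult mult_nonneg_nonneg less_imp_le)
      next
        case False
        then have "(grad_norm I ?h x)\<^sup>2 = 0"
          unfolding gn using elim by (intro sum.neutral ballI) (simp add: pd_out)
        then show ?thesis using False by (simp add: dens_def)
      qed
    qed
  qed
  also have "\<dots> = (\<integral>\<^sup>+x. ennreal (?T x) \<partial>law)"
    unfolding law using m\<kappa> mT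
    by (intro nn_integral_density[symmetric]) (auto simp: measurable_lborel_on)
  also have "\<dots> = (\<integral>\<^sup>+A. ennreal (?T (block A)) \<partial>\<mu>)"
    unfolding law_def using mT by (intro nn_integral_distr) auto
  also have "\<dots> = (\<integral>\<^sup>+A. ennreal (info_integrand A) \<partial>\<mu>)"
  proof (intro nn_integral_cong arg_cong[where f = ennreal])
    fix A
    have "(\<Sum>i<p. \<Sum>j<q. (score (block A) i j)\<^sup>2) = (\<Sum>i<p. \<Sum>j<q. real n * (A (i, j) - m / real n * Q 0 A j i)\<^sup>2)"
      by (intro sum.cong refl) (simp add: score_block power_mult_distrib)
    then show "?T (block A) = info_integrand A"
      by (simp add: info_integrand_def sum_distrib_left[symmetric])
  qed
  finally show ?thesis .
qed

end

subsection \<open>The value of the Fisher information\<close>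

text \<open>With m = n - p - q - 1 the denominator is n (m - 2) (m + 1) and the numerator is m (m +
  p) (m + q) minus that denominator, rewritten as a sum of terms that are visibly nonnegative for m
  > 0.\<close>

definition info_value :: "real \<Rightarrow> real \<Rightarrow> real \<Rightarrow> real"
  where "info_value n p q = p * q / 4 *
    (((n - p - q - 1) * p * q + 2 * (n - p - q - 1) + (p + q + 1) * (n - p - q + 1)) /
     (n * (n - p - q - 3) * (n - p - q)))"

context haar_block
begin

lemma n_pos: "real n > 0"
  using q1 qp pn by simp

lemma pq_ge_1: "1 \<le> real p * real q"
proof -
  have "1 * 1 \<le> p * q" using q1 qp by (intro mult_mono) auto
  then show ?thesis by (metis of_nat_1 of_nat_le_iff of_nat_mult mult_1)
qed

lemma info_integrand_nonneg: "0 \<le> info_integrand A"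
  unfolding info_integrand_def by (intro mult_nonneg_nonneg sum_nonneg) auto

lemma info_integrand_expand:
  "info_integrand A = real n / 4 * ((\<Sum>i<p. \<Sum>j<q. (A (i, j))\<^sup>2) - 2 * (m / real n) * \<alpha>1 0 A
    + (m / real n)\<^sup>2 * \<alpha>2 0 A)"
proof -
  define r where "r = m / real n"
  have "(\<Sum>i<p. \<Sum>j<q. (A (i, j) - r * Q 0 A j i)\<^sup>2)
    = (\<Sum>i<p. \<Sum>j<q. (A (i, j))\<^sup>2 - 2 * r * (A (i, j) * Q 0 A j i) + r\<^sup>2 * (Q 0 A j i * Q 0 A j i))"
    by (intro sum.cong refl) (simp add: power2_eq_square algebra_simps)
  also have "\<dots> = (\<Sum>i<p. \<Sum>j<q. (A (i, j))\<^sup>2) - 2 * r * \<alpha>1 0 A + r\<^sup>2 * \<alpha>2 0 A"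
    by (simp only: sum.distrib sum_subtractf sum_distrib_left[symmetric] \<alpha>1_def \<alpha>2_def P_def P2_def)
  finally show ?thesis unfolding info_integrand_def r_def by (simp only:)
qed

lemma measurable_sum_sq[measurable]: "(\<lambda>A. \<Sum>i<p. \<Sum>j<q. (A (i, j))\<^sup>2) \<in> borel_measurable \<mu>"
  by (intro borel_measurable_sum borel_measurable_power measurable_entry') auto

lemma measurable_info_integrand[measurable]: "info_integrand \<in> borel_measurable \<mu>"
  unfolding info_integrand_expand[abs_def] by measurable

text \<open>A function that is not integrable would have integral 0, but the computed expectation is
  positive.\<close>

lemma integrable_sum_sq: "integrable \<mu> (\<lambda>A. \<Sum>i<p. \<Sum>j<q. (A (i, j))\<^sup>2)"
proof (rule ccontr)
  assume "\<not> ?thesis"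
  then have "(\<integral>A. (\<Sum>i<p. \<Sum>j<q. (A (i, j))\<^sup>2) \<partial>\<mu>) = 0" by (rule not_integrable_integral_eq)
  moreover have "0 < real p * real q / real n" using pq_ge_1 n_pos by (intro divide_pos_pos) auto
  ultimately show False using expectation_sum_sq by linarith
qed

text \<open>From r Q = A - (A - r Q) entrywise, with r = m / n. For m > 0, finite information thus
  makes \<alpha>2 integrable; the contrapositive yields infinite information.\<close>

lemma \<alpha>2_le_info_integrand:
  "(m / real n)\<^sup>2 * \<alpha>2 0 A \<le> 8 / real n * info_integrand A + 2 * (\<Sum>i<p. \<Sum>j<q. (A (i, j))\<^sup>2)"
proof -
  define r where "r = m / real n"
  have "r\<^sup>2 * \<alpha>2 0 A = (\<Sum>i<p. \<Sum>j<q. r\<^sup>2 * (Q 0 A j i)\<^sup>2)"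
    by (simp add: \<alpha>2_def P2_def power2_eq_square sum_distrib_left)
  also have "\<dots> \<le> (\<Sum>i<p. \<Sum>j<q. 2 * (A (i, j) - r * Q 0 A j i)\<^sup>2 + 2 * (A (i, j))\<^sup>2)"
  proof (intro sum_mono)
    fix i j
    have "0 \<le> (2 * A (i, j) - r * Q 0 A j i)\<^sup>2" by simp
    then show "r\<^sup>2 * (Q 0 A j i)\<^sup>2 \<le> 2 * (A (i, j) - r * Q 0 A j i)\<^sup>2 + 2 * (A (i, j))\<^sup>2"
      by (simp add: power2_eq_square algebra_simps)
  qed
  also have "\<dots> = 2 * (\<Sum>i<p. \<Sum>j<q. (A (i, j) - r * Q 0 A j i)\<^sup>2) + 2 * (\<Sum>i<p. \<Sum>j<q. (A (i, j))\<^sup>2)"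
    by (simp only: sum.distrib sum_distrib_left)
  also have "2 * (\<Sum>i<p. \<Sum>j<q. (A (i, j) - r * Q 0 A j i)\<^sup>2) = 8 / real n * info_integrand A"
    using n_pos by (simp add: info_integrand_def r_def)
  finally show ?thesis by (simp only: r_def)
qed

lemma nn_integral_info:
  assumes ns: "AE A in \<mu>. Vdet p q 0 A \<noteq> 0" and int: "integrable \<mu> (\<alpha>2 0)" and m2: "m > 2"
  shows "(\<integral>\<^sup>+A. ennreal (info_integrand A) \<partial>\<mu>) = ennreal (info_value n p q)"
proof -
  define a1 where "a1 = (\<integral>A. \<alpha>1 0 A \<partial>\<mu>)"
  define a2 where "a2 = (\<integral>A. \<alpha>2 0 A \<partial>\<mu>)"
  note ints = integrable_sum_sq integrable_traces_0(1)[OF ns int] int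
  have "integrable \<mu> info_integrand"
    unfolding info_integrand_expand[abs_def]
    by (intro integrable_mult_right Bochner_Integration.integrable_add Bochner_Integration.integrable_diff ints)
  then have "(\<integral>\<^sup>+A. ennreal (info_integrand A) \<partial>\<mu>) = ennreal (\<integral>A. info_integrand A \<partial>\<mu>)"
    by (intro nn_integral_eq_integral AE_I2 info_integrand_nonneg)
  also have "(\<integral>A. info_integrand A \<partial>\<mu>)
    = real n / 4 * (real p * real q / real n - 2 * (m / real n) * a1 + (m / real n)\<^sup>2 * a2)"
    unfolding info_integrand_expand expectation_sum_sq[symmetric] a1_def a2_def
    using ints by (simp only: integral_mult_right_zero Bochner_Integration.integral_add
        Bochner_Integration.integral_diff integrable_mult_right Bochner_Integration.integrable_diff)
  also have "\<dots> = info_value n p q"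
  proof -
    define P Q' N where "P = real p" "Q' = real q" "N = real n"
    have N: "N = m + P + Q' + 1" by (simp add: P_Q'_N_def m_def)
    have N0: "N > 0" using n_pos by (simp add: P_Q'_N_def)
    have nz: "m \<noteq> 0" "m - 2 \<noteq> 0" "m + 1 \<noteq> 0" "N \<noteq> 0" using m2 N0 by auto
    have a1: "m * a1 = P * Q'" and a2: "m * (m - 2) * (m + 1) * a2 = P * Q' * (m + P) * (m + Q')"
      using moments[OF ns int] by (simp_all add: a1_def a2_def P_Q'_N_def)
    have a2': "m * a2 = P * Q' * (m + P) * (m + Q') / ((m - 2) * (m + 1))"
      using a2 nz by (simp add: eq_divide_eq ac_simps)
    have "N / 4 * (P * Q' / N - 2 * (m / N) * a1 + (m / N)\<^sup>2 * a2) = (P * Q' - 2 * (m * a1) + m * (m * a2) / N) / 4"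
      using nz by (simp add: field_simps power2_eq_square)
    also have "\<dots> = P * Q' / 4 * (m * (m + P) * (m + Q') / (N * ((m - 2) * (m + 1))) - 1)"
      unfolding a1 a2' using nz by (simp add: diff_divide_distrib right_diff_distrib ac_simps)
    also have "m * (m + P) * (m + Q') / (N * ((m - 2) * (m + 1))) - 1
      = (m * (m + P) * (m + Q') - N * ((m - 2) * (m + 1))) / (N * ((m - 2) * (m + 1)))"
      using nz by (simp add: diff_divide_distrib)
    also have "m * (m + P) * (m + Q') - N * ((m - 2) * (m + 1)) = m * P * Q' + 2 * m + (P + Q' + 1) * (m + 2)"
      unfolding N by (simp add: algebra_simps)
    finally have e: "N / 4 * (P * Q' / N - 2 * (m / N) * a1 + (m / N)\<^sup>2 * a2)
      = P * Q' / 4 * ((m * P * Q' + 2 * m + (P + Q' + 1) * (m + 2)) / (N * ((m - 2) * (m + 1))))" .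
    have "N - P - Q' - 1 = m" "N - P - Q' + 1 = m + 2" "N - P - Q' - 3 = m - 2" "N - P - Q' = m + 1"
      using N by auto
    then show ?thesis using e by (simp only: info_value_def P_Q'_N_def[symmetric] mult.assoc)
  qed
  finally show ?thesis .
qed

text \<open>Keeps only the term m p q of the numerator and uses (m - 2) (m + 1) \<le> m n.\<close>

lemma info_value_lower:
  assumes m2: "m > 2"
  shows "(real p * real q / real n)\<^sup>2 / 4 \<le> info_value n p q"
proof -
  define P Q' N where "P = real p" "Q' = real q" "N = real n"
  have pos: "P > 0" "Q' > 0" "N > 0" using q1 qp pn by (auto simp: P_Q'_N_def)
  have N: "N = m + P + Q' + 1" by (simp add: P_Q'_N_def m_def)
  have e: "N - P - Q' = m + 1" "m + 1 - 1 = m" "m + 1 + 1 = m + 2" "m + 1 - 3 = m - 2"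
    using N by auto
  have D: "N * (m - 2) * (m + 1) > 0" using m2 pos by simp
  have "(m - 2) * (m + 1) \<le> m * N"
    using m2 mult_left_mono[of m N m] N pos by (simp add: algebra_simps)
  then have "N * (m - 2) * (m + 1) * (P * Q') \<le> N * (m * N) * (P * Q')"
    using pos by (simp only: mult.assoc mult_le_cancel_left_pos mult_le_cancel_right_pos mult_pos_pos)
      (metis mult.assoc mult_le_cancel_right_pos mult_pos_pos)
  then have "P * Q' / N\<^sup>2 \<le> m * P * Q' / (N * (m - 2) * (m + 1))"
    using D pos by (simp add: divide_le_eq le_divide_eq power2_eq_square ac_simps)
  also have "\<dots> \<le> (m * P * Q' + 2 * m + (P + Q' + 1) * (m + 2)) / (N * (m - 2) * (m + 1))"
    using D m2 pos by (intro divide_right_mono) auto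
  finally have "P * Q' / 4 * (P * Q' / N\<^sup>2) \<le> info_value N P Q'"
    unfolding info_value_def e using pos by (intro mult_left_mono) auto
  then show ?thesis by (simp add: P_Q'_N_def power2_eq_square)
qed

lemma nn_integral_info_lower:
  assumes ns: "AE A in \<mu>. Vdet p q 0 A \<noteq> 0"
  shows "ennreal (min (1 / 4) ((real p * real q / real n)\<^sup>2 / 4)) \<le> (\<integral>\<^sup>+A. ennreal (info_integrand A) \<partial>\<mu>)"
proof (cases "m \<le> 0")
  case True
  \<comment> \<open>The bound obtained for m \<le> 0 is pq / 4; since pq \<ge> 1, it can be replaced
    by a constant that is uniform in n.\<close>
  have "ennreal (1 / 4) \<le> ennreal (real n / 4 * (real p * real q / real n))"
    using n_pos pq_ge_1 by (intro ennreal_leI) simp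
  also have "\<dots> = ennreal (\<integral>A. real n / 4 * (\<Sum>i<p. \<Sum>j<q. (A (i, j))\<^sup>2) \<partial>\<mu>)"
    by (simp add: expectation_sum_sq)
  also have "\<dots> = (\<integral>\<^sup>+A. ennreal (real n / 4 * (\<Sum>i<p. \<Sum>j<q. (A (i, j))\<^sup>2)) \<partial>\<mu>)"
    by (intro nn_integral_eq_integral[symmetric] integrable_mult_right integrable_sum_sq AE_I2
        mult_nonneg_nonneg sum_nonneg) auto
  also have "\<dots> \<le> (\<integral>\<^sup>+A. ennreal (info_integrand A) \<partial>\<mu>)"
  proof (rule nn_integral_mono_AE)
    show "AE A in \<mu>. ennreal (real n / 4 * (\<Sum>i<p. \<Sum>j<q. (A (i, j))\<^sup>2)) \<le> ennreal (info_integrand A)"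
      using AE_orthogonal ns
    proof eventually_elim
      case (elim A)
      note nn = nonneg(1,2)[OF elim(1) order_refl elim(2)]
      have "m / real n * \<alpha>1 0 A \<le> 0"
        using True n_pos nn by (intro mult_nonpos_nonneg divide_nonpos_pos)
      moreover have "0 \<le> (m / real n)\<^sup>2 * \<alpha>2 0 A" using nn by simp
      ultimately show ?case
        unfolding info_integrand_expand using n_pos by (intro ennreal_leI mult_left_mono) auto
    qed
  qed
  finally show ?thesis by (rule order_trans[OF ennreal_leI, rotated]) simp
next
  case False
  then have m0: "m > 0" by simp
  show ?thesis
  proof (cases "integrable \<mu> (\<alpha>2 0)")
    case int: True
    have "0 \<le> (\<integral>A. \<alpha>2 0 A \<partial>\<mu>)"
    proof (rule integral_nonneg_AE)
      show "AE A in \<mu>. 0 \<le> \<alpha>2 0 A"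
        using AE_orthogonal ns by eventually_elim (rule nonneg(2)[OF _ order_refl])
    qed
    \<comment> \<open>The other side of the second moment identity is positive for m > 0, so the
      factor m - 2 has to be positive too.\<close>
    moreover have "0 < m * (m - 2) * (m + 1) * (\<integral>A. \<alpha>2 0 A \<partial>\<mu>)"
      unfolding moments(2)[OF ns int] using m0 q1 qp by simp
    ultimately have "0 < m * (m - 2) * (m + 1)"
      by (metis less_eq_real_def mult_zero_right order_less_irrefl zero_less_mult_pos2)
    then have m2: "m > 2" using m0 by (simp add: zero_less_mult_iff)
    show ?thesis
      unfolding nn_integral_info[OF ns int m2] using info_value_lower[OF m2]
      by (intro ennreal_leI) simp
  next
    case nint: False
    have "(\<integral>\<^sup>+A. ennreal (info_integrand A) \<partial>\<mu>) = \<infinity>"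
    proof (rule ccontr)
      assume "(\<integral>\<^sup>+A. ennreal (info_integrand A) \<partial>\<mu>) \<noteq> \<infinity>"
      then have int: "integrable \<mu> info_integrand"
        by (intro integrableI_nonneg) (auto simp: info_integrand_nonneg top.not_eq_extremum)
      have "integrable \<mu> (\<alpha>2 0)"
      proof (rule Bochner_Integration.integrable_bound)
        let ?b = "\<lambda>A. (real n / m)\<^sup>2 * (8 / real n * info_integrand A + 2 * (\<Sum>i<p. \<Sum>j<q. (A (i, j))\<^sup>2))"
        show "integrable \<mu> ?b"
          by (intro integrable_mult_right Bochner_Integration.integrable_add int integrable_sum_sq)
        show "AE A in \<mu>. norm (\<alpha>2 0 A) \<le> norm (?b A)"
          using AE_orthogonal ns
        proof eventually_elim
          case (elim A)
          have "\<alpha>2 0 A = (real n / m)\<^sup>2 * ((m / real n)\<^sup>2 * \<alpha>2 0 A)"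
            using m0 n_pos by (simp add: power_divide)
          also have "\<dots> \<le> ?b A"
            by (intro mult_left_mono \<alpha>2_le_info_integrand) simp
          finally show ?case using nonneg(2)[OF elim(1) order_refl elim(2)] by simp
        qed
      qed simp
      with nint show False by simp
    qed
    then show ?thesis by simp
  qed
qed

lemma fisher_information_lower:
  assumes \<nu>: "has_density_on \<nu> I (gauss_dens I)"
  shows "ennreal (min (1 / 4) ((real p * real q / real n)\<^sup>2 / 4)) \<le> fisher_information I law \<nu>"
proof (cases "\<exists>f. has_density_on law I f")
  case True
  then obtain f where "f \<in> borel_measurable (lborel_on I)" "law = density (lborel_on I) (\<lambda>x. ennreal (f x))"
    by (auto simp: has_density_on_def)
  then have ae: "AE A in \<mu>. opnorm p q A < 1" by (intro AE_opnorm_of_density) auto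
  then have ns: "AE A in \<mu>. Vdet p q 0 A \<noteq> 0" by eventually_elim (rule Vdet_nonzero_opnorm)
  show ?thesis unfolding fisher_information_law[OF ae \<nu>] by (rule nn_integral_info_lower[OF ns])
next
  case False
  then show ?thesis using fisher_information_no_density[of law I \<nu>] by simp
qed

lemma fisher_information_value:
  assumes \<nu>: "has_density_on \<nu> I (gauss_dens I)" and m2: "m > 2"
  shows "fisher_information I law \<nu> = ennreal (info_value n p q)"
proof -
  have ns: "AE A in \<mu>. Vdet p q 0 A \<noteq> 0" using m2 by (intro AE_nonsingular) simp
  have ae: "AE A in \<mu>. opnorm p q A < 1"
    using AE_orthogonal ns by eventually_elim (rule opnorm_less_1)
  show ?thesis
    unfolding fisher_information_law[OF ae \<nu>] by (rule nn_integral_info[OF ns integrable_\<alpha>2[OF m2] m2])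
qed

end

section \<open>Transfer to the random matrices U and G\<close>

lemma
  assumes haar: "haar_orthogonal_matrix n M U" and gauss: "std_gaussian_matrix p q N G"
    and dims: "1 \<le> q" "q \<le> p" "p \<le> n"
  defines "F \<equiv> fisher_information (mat_idx p q)
      (joint_law M (mat_idx p q) (\<lambda>\<omega> ij. sqrt (real n) * U \<omega> ij)) (joint_law N (mat_idx p q) G)"
  shows fisher_information_block_lower: "ennreal (min (1 / 4) ((real p * real q / real n)\<^sup>2 / 4)) \<le> F"
    and fisher_information_block: "real n - real p - real q > 3 \<Longrightarrow> F = ennreal (info_value n p q)"
proof -
  have mU: "(\<lambda>\<omega>. restrict (U \<omega>) (mat_idx n n)) \<in> measurable M (borel_on (mat_idx n n))"
  proof (rule measurable_restrict)
    show "(\<lambda>\<omega>. U \<omega> ij) \<in> borel_measurable M" if "ij \<in> mat_idx n n" for ij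
      using haar that unfolding haar_orthogonal_matrix_def by blast
  qed
  let ?\<mu> = "joint_law M (mat_idx n n) U"
  interpret haar_block n ?\<mu> p q
    using haar dims by unfold_locales (simp_all add: haar_orthogonal_matrix_def)
  have ne: "mat_idx p q \<noteq> {}" using dims by (auto simp: ex_in_conv[symmetric] intro!: exI[of _ 0])
  have mb: "block \<in> measurable (borel_on (mat_idx n n)) (borel_on I)"
    using measurable_block measurable_cong_sets[OF sets_mu refl] by blast
  have "law = distr M (borel_on I) (block \<circ> (\<lambda>\<omega>. restrict (U \<omega>) (mat_idx n n)))"
    unfolding law_def unfolding joint_law_def by (rule distr_distr[OF mb mU])
  also have "block \<circ> (\<lambda>\<omega>. restrict (U \<omega>) (mat_idx n n)) = (\<lambda>\<omega>. restrict (\<lambda>ij. sqrt (real n) * U \<omega> ij) I)"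
    using dims by (auto simp: block_def fun_eq_iff)
  finally have law: "joint_law M I (\<lambda>\<omega> ij. sqrt (real n) * U \<omega> ij) = law"
    unfolding joint_law_def[of M I] by (rule sym)
  note \<nu> = gaussian_law[OF gauss ne]
  show "ennreal (min (1 / 4) ((real p * real q / real n)\<^sup>2 / 4)) \<le> F"
    unfolding F_def law by (rule fisher_information_lower[OF \<nu>])
  show "F = ennreal (info_value n p q)" if "real n - real p - real q > 3"
    unfolding F_def law using that by (intro fisher_information_value[OF \<nu>]) (simp add: m_def)
qed

subsection \<open>Asymptotics\<close>

text \<open>The numerator is at most 9 n p q and the denominator at least n^3 / 8. Their quotient is
  at most 72 p q / n^2, and the prefactor p q / 4 makes it 18.\<close>

lemma info_value_upper:
  fixes n p q :: real
  assumes "p \<ge> 1" "q \<ge> 1" "n \<ge> 8" "p + q + 1 \<le> n / 2"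
  shows "0 \<le> info_value n p q" "info_value n p q \<le> 18 * (p * q / n)\<^sup>2"
proof -
  define m where "m = n - p - q - 1"
  have m: "n / 2 \<le> m" "n / 4 \<le> m - 2" "m \<le> n" "0 < m" using assms by (auto simp: m_def)
  have e: "n - p - q = m + 1" "m + 1 - 1 = m" "m + 1 + 1 = m + 2" "m + 1 - 3 = m - 2"
    by (auto simp: m_def)
  have D: "0 < n * (m - 2) * (m + 1)" using m assms by simp
  have x1: "1 * 1 \<le> p * q" using assms by (intro mult_mono) auto
  have "p * 1 \<le> p * q" "1 * q \<le> p * q" using assms by (intro mult_left_mono mult_right_mono; simp)+
  with x1 have px: "p + q + 1 \<le> 3 * (p * q)" by linarith
  have num0: "0 \<le> m * p * q + 2 * m + (p + q + 1) * (m + 2)" using m assms by simp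
  show "0 \<le> info_value n p q"
    unfolding info_value_def e using num0 D assms
    by (intro mult_nonneg_nonneg divide_nonneg_pos) auto
  have "(p + q + 1) * (m + 2) \<le> (3 * (p * q)) * (2 * n)"
    using px x1 m assms by (intro mult_mono) auto
  moreover have "m * (p * q) \<le> n * (p * q)" using m x1 by (intro mult_right_mono) auto
  moreover have "2 * m \<le> 2 * (n * (p * q))"
    using m x1 assms mult_mono[of m n 1 "p * q"] by simp
  ultimately have num: "m * p * q + 2 * m + (p + q + 1) * (m + 2) \<le> 9 * (n * (p * q))"
    by (simp add: ac_simps)
  have "n * (n / 4) * (n / 2) \<le> n * (m - 2) * (m + 1)"
    using m assms by (intro mult_mono) auto
  then have "(m * p * q + 2 * m + (p + q + 1) * (m + 2)) / (n * (m - 2) * (m + 1))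
    \<le> (9 * (n * (p * q))) / (n * (n / 4) * (n / 2))"
    using num num0 assms x1 by (intro frac_le) auto
  also have "\<dots> = 72 * (p * q) / n\<^sup>2" using assms by (simp add: power2_eq_square)
  finally have "info_value n p q \<le> p * q / 4 * (72 * (p * q) / n\<^sup>2)"
    unfolding info_value_def e using x1 by (intro mult_left_mono) auto
  then show "info_value n p q \<le> 18 * (p * q / n)\<^sup>2" by (simp add: power2_eq_square ac_simps)
qed

text \<open>Separates the leading term of (iii). For p = o(n) the quotient of the three factors 1 -
  .../n tends to 1, but in the last factor the terms 1 / p and 2 / (p (q + 1)) vanish only as p
  grows.\<close>

lemma info_value_ratio:
  fixes n p q :: real
  assumes p: "p \<ge> 1" and q: "q \<ge> 1" and n: "n > 0" and m: "n - p - q - 1 > 2"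
  shows "info_value n p q = p\<^sup>2 * q * (q + 1) / (4 * n\<^sup>2) *
    ((1 - (p + q + 1) / n) / ((1 - (p + q + 3) / n) * (1 - (p + q) / n)) *
     (1 + 1 / p + 2 / (p * (q + 1)) + 2 * (p + q + 1) / ((n - p - q - 1) * (p * (q + 1)))))"
proof -
  define m where "m = n - p - q - 1"
  have e: "n - p - q = m + 1" "m + 1 - 1 = m" "m + 1 + 1 = m + 2" "m + 1 - 3 = m - 2"
    by (auto simp: m_def)
  have nz: "m \<noteq> 0" "m - 2 \<noteq> 0" "m + 1 \<noteq> 0" "p \<noteq> 0" "q + 1 \<noteq> 0" "n \<noteq> 0"
    using assms by (auto simp: m_def)
  have f: "1 - (p + q + 1) / n = m / n" "1 - (p + q + 3) / n = (m - 2) / n" "1 - (p + q) / n = (m + 1) / n"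
    using nz by (auto simp: m_def field_simps)
  define D where "D = (m - 2) * (m + 1)"
  have D: "D \<noteq> 0" using nz by (simp add: D_def)
  have "m / n / ((m - 2) / n * ((m + 1) / n)) = m * n / D"
    using nz by (simp add: D_def field_simps)
  moreover have "1 + 1 / p + 2 / (p * (q + 1)) + 2 * (p + q + 1) / (m * (p * (q + 1)))
    = (m * p * q + 2 * m + (p + q + 1) * (m + 2)) / (m * (p * (q + 1)))"
    using nz by (simp add: divide_simps) (simp add: algebra_simps)
  moreover have "p\<^sup>2 * q * E / (4 * n\<^sup>2) * (m * n / D * (X / (m * (p * E)))) = p * q / 4 * (X / (n * D))"
    if "E \<noteq> 0" for X E
    using nz D that by (simp add: field_simps power2_eq_square)
  moreover have "info_value n p q = p * q / 4 * ((m * p * q + 2 * m + (p + q + 1) * (m + 2)) / (n * D))"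
    by (simp only: info_value_def e D_def mult.assoc)
  ultimately show ?thesis
    unfolding f m_def[symmetric] using nz(5) by (simp only: not_False_eq_True)
qed

theorem theorem1:
  fixes p q :: "nat \<Rightarrow> nat"
    and M :: "nat \<Rightarrow> 'a measure" and U :: "nat \<Rightarrow> 'a \<Rightarrow> nat \<times> nat \<Rightarrow> real"
    and N :: "nat \<Rightarrow> 'b measure" and G :: "nat \<Rightarrow> 'b \<Rightarrow> nat \<times> nat \<Rightarrow> real"
    and Info :: "nat \<Rightarrow> ennreal"
  assumes dims: "\<And>n. n \<ge> 1 \<Longrightarrow> 1 \<le> q n \<and> q n \<le> p n \<and> p n \<le> n"
    and haar: "\<And>n. n \<ge> 1 \<Longrightarrow> haar_orthogonal_matrix n (M n) (U n)"
    and gauss: "\<And>n. n \<ge> 1 \<Longrightarrow> std_gaussian_matrix (p n) (q n) (N n) (G n)"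
  defines "Info \<equiv> \<lambda>n. fisher_information (mat_idx (p n) (q n))
      (joint_law (M n) (mat_idx (p n) (q n)) (\<lambda>\<omega> ij. sqrt (real n) * U n \<omega> ij))
      (joint_law (N n) (mat_idx (p n) (q n)) (G n))"
  shows "((\<lambda>n. real (p n * q n)) \<in> o(\<lambda>n. real n) \<longrightarrow> Info \<longlonglongrightarrow> 0)
    \<and> ((\<exists>c1 c2 :: real. 0 < c1 \<and> c1 < c2 \<and>
          (\<forall>n\<ge>1. c1 * real n < real (p n * q n) \<and> real (p n * q n) < c2 * real n))
        \<longrightarrow> \<not> Info \<longlonglongrightarrow> 0)
    \<and> ((\<lambda>n. real (p n)) \<in> o(\<lambda>n. real n) \<and> filterlim p at_top sequentially
        \<longrightarrow> (\<exists>r :: nat \<Rightarrow> real. r \<in> o(\<lambda>_. 1) \<and>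
              (\<forall>\<^sub>F n in sequentially. Info n =
                 ennreal (real (p n)^2 * real (q n) * (real (q n) + 1) / (4 * real n ^ 2) * (1 + r n)))))"
proof -
  have lower: "ennreal (min (1 / 4) ((real (p n) * real (q n) / real n)\<^sup>2 / 4)) \<le> Info n" if "n \<ge> 1" for n
    using fisher_information_block_lower[OF haar[OF that] gauss[OF that]] dims[OF that] unfolding Info_def by blast
  have val: "Info n = ennreal (info_value n (p n) (q n))" if "n \<ge> 1" "real n - real (p n) - real (q n) > 3" for n
    using fisher_information_block[OF haar[OF that(1)] gauss[OF that(1)]] dims[OF that(1)] that(2)
    unfolding Info_def by blast
  have inv0: "(\<lambda>n. c / real n) \<longlonglongrightarrow> 0" for c :: real by (rule lim_const_over_n)
  have dims': "\<forall>\<^sub>F n in sequentially. n \<ge> 1 \<and> real (q n) \<ge> 1 \<and> real (q n) \<le> real (p n) \<and> real (p n) \<ge> 1"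
    using eventually_ge_at_top[of 1]
  proof eventually_elim
    case (elim n)
    show ?case using dims[OF elim] elim by auto
  qed
  have sum0: "(\<lambda>n. (real (p n) + real (q n) + c) / real n) \<longlonglongrightarrow> 0"
    if p0: "(\<lambda>n. real (p n) / real n) \<longlonglongrightarrow> 0" for c
  proof -
    have q0: "(\<lambda>n. real (q n) / real n) \<longlonglongrightarrow> 0"
    proof (rule tendsto_sandwich[OF _ _ tendsto_const p0])
      show "\<forall>\<^sub>F n in sequentially. real (q n) / real n \<le> real (p n) / real n"
        using dims' by eventually_elim (auto intro: divide_right_mono)
    qed simp
    from tendsto_add[OF tendsto_add[OF p0 q0] inv0[of c]] show ?thesis
      by (simp add: add_divide_distrib)
  qed
  have small: "\<forall>\<^sub>F n in sequentially. n \<ge> 8 \<and> real (p n) + real (q n) + 1 \<le> real n / 2"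
    if p0: "(\<lambda>n. real (p n) / real n) \<longlonglongrightarrow> 0"
    using order_tendstoD(2)[OF sum0[OF p0, of 1], of "1/2"] eventually_ge_at_top[of 8]
    by (auto elim!: eventually_elim2 simp: divide_less_eq)
  have 1: "Info \<longlonglongrightarrow> 0" if "(\<lambda>n. real (p n * q n)) \<in> o(\<lambda>n. real n)"
  proof -
    have x0: "(\<lambda>n. real (p n) * real (q n) / real n) \<longlonglongrightarrow> 0"
      using smalloD_tendsto[OF that] by simp
    \<comment> \<open>As q \<ge> 1, pq = o(n) forces p = o(n), so that eventually p + q + 1 \<le> n
      / 2 and the exact formula applies.\<close>
    have p0: "(\<lambda>n. real (p n) / real n) \<longlonglongrightarrow> 0"
    proof (rule tendsto_sandwich[OF _ _ tendsto_const x0])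
      show "\<forall>\<^sub>F n in sequentially. real (p n) / real n \<le> real (p n) * real (q n) / real n"
        using dims' by eventually_elim (auto intro!: divide_right_mono)
    qed simp
    have ub: "(\<lambda>n. ennreal (18 * (real (p n) * real (q n) / real n)\<^sup>2)) \<longlonglongrightarrow> 0"
      using tendsto_ennrealI[OF tendsto_mult_right_zero[OF tendsto_null_power[OF x0, of 2]], of 18] by simp
    show ?thesis
    proof (rule tendsto_sandwich[OF _ _ tendsto_const ub])
      show "\<forall>\<^sub>F n in sequentially. Info n \<le> ennreal (18 * (real (p n) * real (q n) / real n)\<^sup>2)"
        using dims' small[OF p0]
      proof eventually_elim
        case (elim n)
        then have "Info n = ennreal (info_value n (p n) (q n))" by (intro val) auto
        then show ?case using elim by (auto intro!: ennreal_leI info_value_upper(2))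
      qed
    qed simp
  qed
  have 2: "\<not> Info \<longlonglongrightarrow> 0"
    if c: "0 < c1" "\<forall>n\<ge>1. c1 * real n < real (p n * q n) \<and> real (p n * q n) < c2 * real n" for c1 c2 :: real
  proof
    assume "Info \<longlonglongrightarrow> 0"
    then have "\<forall>\<^sub>F n in sequentially. Info n < ennreal (min (1 / 4) (c1\<^sup>2 / 4))"
      using c(1) by (intro order_tendstoD(2)) (auto simp: ennreal_less_zero_iff)
    \<comment> \<open>A single n contradicts convergence to 0, because the lower bound for the
      information depends on c1 alone.\<close>
    then obtain n where n: "n \<ge> 1" "Info n < ennreal (min (1 / 4) (c1\<^sup>2 / 4))"
      using eventually_happens[OF eventually_conj[OF eventually_ge_at_top[of 1]]] by force
    have "c1 \<le> real (p n) * real (q n) / real n"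
      using c(2) n(1) by (auto simp: le_divide_eq dest!: spec[of _ n])
    then have "c1\<^sup>2 \<le> (real (p n) * real (q n) / real n)\<^sup>2" using c(1) by (intro power_mono) auto
    then have "ennreal (min (1 / 4) (c1\<^sup>2 / 4)) \<le> ennreal (min (1 / 4) ((real (p n) * real (q n) / real n)\<^sup>2 / 4))"
      by (intro ennreal_leI) auto
    with lower[OF n(1)] n(2) show False by (meson leD order_trans)
  qed
  have 3: "\<exists>r. r \<in> o(\<lambda>_. 1) \<and> (\<forall>\<^sub>F n in sequentially. Info n =
      ennreal (real (p n)^2 * real (q n) * (real (q n) + 1) / (4 * real n ^ 2) * (1 + r n)))"
    if po: "(\<lambda>n. real (p n)) \<in> o(\<lambda>n. real n)" and pinf: "filterlim p at_top sequentially"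
  proof -
    define P where "P n = real (p n)" for n
    define Q where "Q n = real (q n)" for n
    define T where "T n = (1 - (P n + Q n + 1) / n) / ((1 - (P n + Q n + 3) / n) * (1 - (P n + Q n) / n)) *
      (1 + 1 / P n + 2 / (P n * (Q n + 1)) + 2 * (P n + Q n + 1) / ((n - P n - Q n - 1) * (P n * (Q n + 1))))" for n :: nat
    have p0: "(\<lambda>n. real (p n) / real n) \<longlonglongrightarrow> 0" by (rule smalloD_tendsto[OF po])
    note s0 = sum0[OF p0, folded P_def Q_def]
    have ev: "\<forall>\<^sub>F n in sequentially. 1 \<le> n \<and> 1 \<le> Q n \<and> Q n \<le> P n \<and> 1 \<le> P n \<and> 8 \<le> n \<and> P n + Q n + 1 \<le> n / 2"
      using dims' small[OF p0] by eventually_elim (auto simp: P_def Q_def)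
    have "filterlim P at_top sequentially"
      unfolding P_def[abs_def] by (rule filterlim_compose[OF filterlim_real_sequentially pinf])
    \<comment> \<open>This is where p tending to infinity enters; for p = q = 1 the last factor of T
      would tend to 3 instead of 1.\<close>
    then have i1: "(\<lambda>n. c / P n) \<longlonglongrightarrow> 0" for c
      by (rule tendsto_divide_0[OF tendsto_const filterlim_at_top_imp_at_infinity])
    have i2: "(\<lambda>n. 2 / (P n * (Q n + 1))) \<longlonglongrightarrow> 0"
    proof (rule tendsto_sandwich[OF _ _ tendsto_const i1[of 2]])
      show "\<forall>\<^sub>F n in sequentially. 0 \<le> 2 / (P n * (Q n + 1))"
        using ev by eventually_elim auto
      show "\<forall>\<^sub>F n in sequentially. 2 / (P n * (Q n + 1)) \<le> 2 / P n"
        using ev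
      proof eventually_elim
        case (elim n)
        then show ?case by (intro divide_left_mono) auto
      qed
    qed
    have i3: "(\<lambda>n. 2 * (P n + Q n + 1) / ((n - P n - Q n - 1) * (P n * (Q n + 1)))) \<longlonglongrightarrow> 0"
    proof (rule tendsto_sandwich[OF _ _ tendsto_const inv0[of 12]])
      show "\<forall>\<^sub>F n in sequentially. 0 \<le> 2 * (P n + Q n + 1) / ((n - P n - Q n - 1) * (P n * (Q n + 1)))"
        using ev by eventually_elim (auto intro!: divide_nonneg_nonneg mult_nonneg_nonneg)
      show "\<forall>\<^sub>F n in sequentially. 2 * (P n + Q n + 1) / ((n - P n - Q n - 1) * (P n * (Q n + 1))) \<le> 12 / real n"
        using ev
      proof eventually_elim
        case (elim n)
        \<comment> \<open>P + Q + 1 \<le> 3 P because 1 \<le> P and Q \<le> P, and n - P - Q - 1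
          \<ge> n / 2; hence the constant 12.\<close>
        have "2 * (P n + Q n + 1) / ((n - P n - Q n - 1) * (P n * (Q n + 1))) \<le> 6 * P n / (n / 2 * (P n * 1))"
        proof (rule frac_le)
          show "real n / 2 * (P n * 1) \<le> (n - P n - Q n - 1) * (P n * (Q n + 1))"
            using elim by (intro mult_mono) auto
        qed (use elim in auto)
        also have "\<dots> = 12 / real n" using elim by simp
        finally show ?case .
      qed
    qed
    have "T \<longlonglongrightarrow> (1 - 0) / ((1 - 0) * (1 - 0)) * (1 + 0 + 0 + 0)"
      unfolding T_def[abs_def]
      by (intro tendsto_mult tendsto_divide tendsto_diff tendsto_add tendsto_const s0 i1 i2 i3
          s0[of 0, simplified]) auto
    then have "(\<lambda>n. T n - 1) \<longlonglongrightarrow> 0"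
      using LIM_zero[of T 1 sequentially] by simp
    then have r: "(\<lambda>n. T n - 1) \<in> o(\<lambda>_. 1)" by (intro smalloI_tendsto) auto
    have "\<forall>\<^sub>F n in sequentially. Info n = ennreal (P n ^ 2 * Q n * (Q n + 1) / (4 * real n ^ 2) * (1 + (T n - 1)))"
      using ev
    proof eventually_elim
      case (elim n)
      then have "Info n = ennreal (info_value n (P n) (Q n))"
        unfolding P_def Q_def by (intro val) auto
      also have "info_value n (P n) (Q n) = P n ^ 2 * Q n * (Q n + 1) / (4 * real n ^ 2) * T n"
        unfolding T_def using elim by (intro info_value_ratio) auto
      finally show ?case by simp
    qed
    with r show ?thesis unfolding P_def Q_def by (intro exI[of _ "\<lambda>n. T n - 1"]) simp
  qed
  show ?thesis using 1 2 3 by blast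
qed

end
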